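(* Let $w_0>0$, $\ell>1$, $(\phi_0,a_0)\in\mathcal{H}_{w_0}^{\ell+2}\times\mathcal{H}_{w_0}^{\ell+1}$, and let $(\phi_0^\varepsilon,a_0^\varepsilon)_{\varepsilon\in(0,1]}$ be bounded in $\mathcal{H}_{w_0}^{\ell+1}\times\mathcal{H}_{w_0}^{\ell}$, with $\phi_0,\phi_0^\varepsilon$ real-valued and $a_0,a_0^\varepsilon$ complex-valued, such that $$\|\phi_0^\varepsilon-\phi_0\|_{\mathcal{H}_{w_0}^{\ell+1}}+\|a_0^\varepsilon-a_0\|_{\mathcal{H}_{w_0}^{\ell}}\longrightarrow0\quad\text{as }\varepsilon\to0.$$ Let $M=M(\ell+1)>0$ be sufficiently large (i.e. $M\ge M_0$ for some $M_0>0$ independent of $\varepsilon$), $w(t)=w_0-Mt$ and $0<T<w_0/M$. Let $(\phi^\varepsilon,a^\varepsilon)\in X_{w,T}^\ell$ be the solution, for $\varepsilon\in(0,1]$, of $$ (\mathrm{S}_\varepsilon)\quad\begin{cases} \partial_t \phi^\varepsilon + \frac12(\partial_x\phi^\varepsilon)^2+\frac12 g(|a^\varepsilon|^2)\partial_x\phi^\varepsilon+f(|a^\varepsilon|^2)=0, & \phi^\varepsilon_{|t=0}=\phi_0^\varepsilon,\\ \partial_t a^\varepsilon+\partial_x\phi^\varepsilon\,\partial_x a^\varepsilon+\frac12 a^\varepsilon\partial_x^2\phi^\varepsilon+\frac12\partial_x\big(g(|a^\varepsilon|^2)a^\varepsilon\big)=\frac{i\varepsilon}{2}\partial_x^2a^\varepsilon,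 & a^\varepsilon_{|t=0}=a_0^\varepsilon, \end{cases} $$ let $(\phi,a)\in X_{w,T}^{\ell+1}$ be the solution of $$ (\mathrm{S}_0)\quad\begin{cases} \partial_t \phi + \frac12(\partial_x\phi)^2+\frac12 g(|a|^2)\partial_x\phi+f(|a|^2)=0, & \phi_{|t=0}=\phi_0,\\ \partial_t a+\partial_x\phi\,\partial_x a+\frac12 a\,\partial_x^2\phi+\frac12\partial_x\big(g(|a|^2)a\big)=0, & a_{|t=0}=a_0, \end{cases} $$ and let $u^\varepsilon=a^\varepsilon e^{i\phi^\varepsilon/\varepsilon}$. Then, as $\varepsilon\to0$, $$|u^\varepsilon|^2\longrightarrow|a|^2\quad\text{and}\quad \operatorname{Im}\big(\varepsilon\,\overline{u^\varepsilon}\,\partial_xu^\varepsilon\big)\longrightarrow|a|^2\,\partial_x\phi\qquad\text{in }L^\infty\big([0,T];L^1\cap L^\infty(\mathbb{R})\big).$$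
   Context: Nonlinearities: $g(s)=\alpha s^\gamma$ and $f(s)=\lambda s^\sigma$, where $\alpha,\lambda\in\mathbb{R}$ and $\gamma,\sigma$ are positive integers, fixed throughout. All systems are posed for $(t,x)\in[0,T]\times\mathbb{R}$. The function $u^\varepsilon=a^\varepsilon e^{i\phi^\varepsilon/\varepsilon}$ solves $i\varepsilon\partial_tu^\varepsilon+\frac{\varepsilon^2}{2}\partial_x^2u^\varepsilon+\frac{i\varepsilon}{2}\partial_x\big(g(|u^\varepsilon|^2)u^\varepsilon\big)-f(|u^\varepsilon|^2)u^\varepsilon=0$ with $u^\varepsilon(0,x)=a_0^\varepsilon(x)e^{i\phi_0^\varepsilon(x)/\varepsilon}$. Fourier transform: $\hat\psi(\xi)=\mathcal{F}\psi(\xi)=\frac{1}{\sqrt{2\pi}}\int_{\mathbb{R}}e^{-ix\xi}\psi(x)\,dx$, and $\langle\xi\rangle=\sqrt{1+\xi^2}$. For $w\ge0$ and $\ell\ge0$, $\mathcal{H}_w^\ell=\{\psi\in L^2(\mathbb{R}):\|\psi\|_{\mathcal{H}_w^\ell}<\infty\}$ with $\|\psi\|_{\mathcal{H}_w^\ell}^2=\int_{\mathbb{R}}\langle\xi\rangle^{2\ell}e^{2w\langle\xi\rangle}|\hat\psi(\xi)|^2\,d\xi$. For a time-dependent weight $w(t)=w_0-Mt$ with $w_0,M>0$ and $0<T<w_0/M$: $C([0,T],\mathcal{H}_w^\ell)$ is the set of $\psi$ such that $\mathcal{F}^{-1}\big(e^{w(t)\langle\xi\rangle}\hat\psi\big)\in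 C([0,T],H^\ell(\mathbb{R}))$ (Fourier transform in $x$); $L^2_T\mathcal{H}_w^\ell$ is the set of $\psi$ such that $\int_0^T\|\psi(t)\|_{\mathcal{H}_{w(t)}^\ell}^2dt<\infty$. Set $Y_{w,T}^\ell=C([0,T],\mathcal{H}_w^\ell)\cap L^2_T\mathcal{H}_w^{\ell+1/2}$ and $X_{w,T}^\ell=Y_{w,T}^{\ell+1}\times Y_{w,T}^\ell$. The constant $M(\ell+1)$ is the (sufficiently large) constant furnished by the local well-posedness theory at regularity $\ell+1$: for $k>1$ and a family of initial data bounded in $\mathcal{H}_{w_0}^{k+1}\times\mathcal{H}_{w_0}^{k}$, the systems $(\mathrm{S}_\varepsilon)$, $\varepsilon\in[0,1]$, have unique solutions in $X_{w,T}^k$ when $w(t)=w_0-Mt$, $M=M(k)$ is sufficiently large and $T=T(k)<w_0/M$; $k\mapsto M(k)$ is taken to be increasing. In particular, for $M$ sufficiently large the solutions $(\phi^\varepsilon,a^\varepsilon)\in X_{w,T}^\ell$ and $(\phi,a)\in X_{w,T}^{\ell+1}$ of the claim exist and are unique. *)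

theory Defs
  imports "HOL-Probability.Probability"
begin

definition square_integrable :: "(real \<Rightarrow> complex) \<Rightarrow> bool" where
  "square_integrable \<psi> \<longleftrightarrow>
     \<psi> \<in> borel_measurable lborel \<and> integrable lborel (\<lambda>x. (cmod (\<psi> x))\<^sup>2)"

(* The unitary Fourier transform on L^2: the L^2-limit of the integrals over {-R..R} as R tends
   to infinity. By Plancherel the limit exists for every square integrable function, and it is
   unique up to null sets, so that fourier and inv_fourier select one representative of it; all
   notions below are insensitive to the choice. On integrable and square integrable functions
   they agree almost everywhere with the usual integrals. *)
definition fourier :: "(real \<Rightarrow> complex) \<Rightarrow> real \<Rightarrow> complex" where
  "fourier \<psi> = (SOME h. square_integrable h \<and>
     ((\<lambda>R. \<integral>\<^sup>+\<xi>. ennreal ((cmod (complex_of_real (1 / sqrt (2 * pi)) *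
           (LINT x:{-R..R}|lborel. exp (- \<i> * complex_of_real (x * \<xi>)) * \<psi> x) - h \<xi>))\<^sup>2) \<partial>lborel)
       \<longlongrightarrow> 0) at_top)"

definition inv_fourier :: "(real \<Rightarrow> complex) \<Rightarrow> real \<Rightarrow> complex" where
  "inv_fourier \<psi> = (SOME h. square_integrable h \<and>
     ((\<lambda>R. \<integral>\<^sup>+x. ennreal ((cmod (complex_of_real (1 / sqrt (2 * pi)) *
           (LINT \<xi>:{-R..R}|lborel. exp (\<i> * complex_of_real (x * \<xi>)) * \<psi> \<xi>) - h x))\<^sup>2) \<partial>lborel)
       \<longlongrightarrow> 0) at_top)"

definition bracket :: "real \<Rightarrow> real" where
  "bracket \<xi> = sqrt (1 + \<xi>\<^sup>2)"

(* Squared norm of H_w^l, with value infinity allowed. *)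
definition hnorm2 :: "real \<Rightarrow> real \<Rightarrow> (real \<Rightarrow> complex) \<Rightarrow> ennreal" where
  "hnorm2 w l \<psi> = (\<integral>\<^sup>+\<xi>. ennreal (bracket \<xi> powr (2 * l) * exp (2 * w * bracket \<xi>) *
      (cmod (fourier \<psi> \<xi>))\<^sup>2) \<partial>lborel)"

definition hspace :: "real \<Rightarrow> real \<Rightarrow> (real \<Rightarrow> complex) set" where
  "hspace w l = {\<psi>. square_integrable \<psi> \<and> hnorm2 w l \<psi> < \<infinity>}"

(* Only meaningful on hspace w l, since enn2real maps infinity to 0. *)
definition hnorm :: "real \<Rightarrow> real \<Rightarrow> (real \<Rightarrow> complex) \<Rightarrow> real" where
  "hnorm w l \<psi> = sqrt (enn2real (hnorm2 w l \<psi>))"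

(* C([0,T], H^l(R)); the Sobolev space H^l is hspace 0 l. In this and the following spaces a
   function of (t,x) is a curried function, whose values for t outside {0..T} are irrelevant. *)
definition C_sobolev :: "real \<Rightarrow> real \<Rightarrow> (real \<Rightarrow> real \<Rightarrow> complex) set" where
  "C_sobolev T l = {\<psi>.
     (\<forall>t\<in>{0..T}. \<psi> t \<in> hspace 0 l) \<and>
     (\<forall>t\<in>{0..T}. ((\<lambda>s. hnorm 0 l (\<lambda>x. \<psi> s x - \<psi> t x)) \<longlongrightarrow> 0) (at t within {0..T}))}"

(* The first condition ensures that the function to which inv_fourier is applied is square
   integrable (for l \<ge> 0). *)
definition C_hspace :: "(real \<Rightarrow> real) \<Rightarrow> real \<Rightarrow> real \<Rightarrow> (real \<Rightarrow> real \<Rightarrow> complex) set" where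
  "C_hspace w T l = {\<psi>.
     (\<forall>t\<in>{0..T}. \<psi> t \<in> hspace (w t) l) \<and>
     (\<lambda>t. inv_fourier (\<lambda>\<xi>. complex_of_real (exp (w t * bracket \<xi>)) * fourier (\<psi> t) \<xi>))
        \<in> C_sobolev T l}"

definition L2_hspace :: "(real \<Rightarrow> real) \<Rightarrow> real \<Rightarrow> real \<Rightarrow> (real \<Rightarrow> real \<Rightarrow> complex) set" where
  "L2_hspace w T l = {\<psi>.
     (AE t\<in>{0..T} in lborel. square_integrable (\<psi> t)) \<and>
     (\<lambda>t. hnorm2 (w t) l (\<psi> t)) \<in> borel_measurable (restrict_space lborel {0..T}) \<and>
     (\<integral>\<^sup>+t\<in>{0..T}. hnorm2 (w t) l (\<psi> t) \<partial>lborel) < \<infinity>}"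

definition Yspace :: "(real \<Rightarrow> real) \<Rightarrow> real \<Rightarrow> real \<Rightarrow> (real \<Rightarrow> real \<Rightarrow> complex) set" where
  "Yspace w T l = C_hspace w T l \<inter> L2_hspace w T (l + 1 / 2)"

definition Xspace ::
  "(real \<Rightarrow> real) \<Rightarrow> real \<Rightarrow> real \<Rightarrow> ((real \<Rightarrow> real \<Rightarrow> real) \<times> (real \<Rightarrow> real \<Rightarrow> complex)) set" where
  "Xspace w T l = {(\<phi>, a).
     (\<lambda>t x. complex_of_real (\<phi> t x)) \<in> Yspace w T (l + 1) \<and> a \<in> Yspace w T l}"

abbreviation dx :: "(real \<Rightarrow> 'a::real_normed_vector) \<Rightarrow> real \<Rightarrow> 'a" where
  "dx f x \<equiv> vector_derivative f (at x)"

(* The system (S_eps); eps = 0 gives (S_0). Elements of hspace w l are determined only up to null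
   sets; for w > 0 such a class contains exactly one continuous function, and that function is
   real analytic. Solutions are given by these continuous representatives, so that all
   x-derivatives exist and the equations can be read pointwise (with one-sided t-derivatives
   at 0 and T). The initial data remain L^2 classes, hence the AE in the initial conditions. *)
definition solves_S ::
  "(real \<Rightarrow> real) \<Rightarrow> (real \<Rightarrow> real) \<Rightarrow> real \<Rightarrow> real \<Rightarrow> (real \<Rightarrow> real) \<Rightarrow> (real \<Rightarrow> complex) \<Rightarrow>
   (real \<Rightarrow> real \<Rightarrow> real) \<Rightarrow> (real \<Rightarrow> real \<Rightarrow> complex) \<Rightarrow> bool" where
  "solves_S g f \<epsilon> T \<phi>0 a0 \<phi> a \<longleftrightarrow>
     (\<forall>t\<in>{0..T}. continuous_on UNIV (\<phi> t) \<and> continuous_on UNIV (a t)) \<and>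
     (\<forall>t\<in>{0..T}. \<forall>x.
        \<exists>\<phi>' a'.
          ((\<lambda>s. \<phi> s x) has_vector_derivative \<phi>') (at t within {0..T}) \<and>
          ((\<lambda>s. a s x) has_vector_derivative a') (at t within {0..T}) \<and>
          \<phi>' + 1 / 2 * (dx (\<phi> t) x)\<^sup>2 + 1 / 2 * g ((cmod (a t x))\<^sup>2) * dx (\<phi> t) x
             + f ((cmod (a t x))\<^sup>2) = 0 \<and>
          a' + complex_of_real (dx (\<phi> t) x) * dx (a t) x
             + 1 / 2 * a t x * complex_of_real (dx (dx (\<phi> t)) x)
             + 1 / 2 * dx (\<lambda>y. complex_of_real (g ((cmod (a t y))\<^sup>2)) * a t y) x
           = \<i> * complex_of_real \<epsilon> / 2 * dx (dx (a t)) x) \<and>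
     (AE x in lborel. \<phi> 0 x = \<phi>0 x) \<and>
     (AE x in lborel. a 0 x = a0 x)"

(* Norm of L^1 \<inter> L^\<infinity>(R); it is infinite outside this space, because esssup of a
   non-measurable function is top. *)
definition L1_Linf_norm :: "(real \<Rightarrow> real) \<Rightarrow> ennreal" where
  "L1_Linf_norm f = (\<integral>\<^sup>+x. ennreal \<bar>f x\<bar> \<partial>lborel) + esssup lborel (\<lambda>x. ennreal \<bar>f x\<bar>)"

definition Linf_L1_Linf_norm :: "real \<Rightarrow> (real \<Rightarrow> real \<Rightarrow> real) \<Rightarrow> ennreal" where
  "Linf_L1_Linf_norm T F = esssup (restrict_space lborel {0..T}) (\<lambda>t. L1_Linf_norm (F t))"

definition converges_Linf_L1_Linf ::
  "real \<Rightarrow> (real \<Rightarrow> real \<Rightarrow> real \<Rightarrow> real) \<Rightarrow> (real \<Rightarrow> real \<Rightarrow> real) \<Rightarrow> bool" where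
  "converges_Linf_L1_Linf T F G \<longleftrightarrow>
     (\<forall>\<epsilon>\<in>{0<..1}. Linf_L1_Linf_norm T (F \<epsilon>) < \<infinity>) \<and>
     Linf_L1_Linf_norm T G < \<infinity> \<and>
     ((\<lambda>\<epsilon>. Linf_L1_Linf_norm T (\<lambda>t x. F \<epsilon> t x - G t x)) \<longlongrightarrow> 0) (at_right 0)"

definition wkb :: "real \<Rightarrow> (real \<Rightarrow> real \<Rightarrow> real) \<Rightarrow> (real \<Rightarrow> real \<Rightarrow> complex) \<Rightarrow> real \<Rightarrow> real \<Rightarrow> complex"
  where "wkb \<epsilon> \<phi> a t x = a t x * exp (\<i> * complex_of_real (\<phi> t x / \<epsilon>))"

end

theory Submission
  imports Defs
begin

text \<open>Since the weight \<open>w0 - M * t\<close> decays, the time derivative of a squared weighted norm contains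
  \<open>- 2 * M\<close> times the squared norm with half a derivative more. For large \<open>M\<close> this term absorbs the derivative
  that the nonlinear terms lose, while the dispersive term is skew-adjoint and drops out, uniformly in \<open>\<epsilon>\<close>.
  The solutions are smooth at a quarter of the weight, so it suffices to estimate there, at the fixed
  regularities 5/2 and 3/2 for phase and amplitude. Comparing a solution with the zero solution, a continuity
  argument shows that its energy never grows, which bounds all solutions uniformly in \<open>\<epsilon>\<close>. Comparing it
  with the solution for \<open>\<epsilon> = 0\<close>, Gronwall's inequality bounds the energy of the difference by
  that of the initial data plus a term of order \<open>\<epsilon>\<close>. Both observables are sums of products of at least two
  functions that are small or bounded in $H^1$, hence in $L^2$ and in $L^\infty$, and so they converge in
  $L^1$ and in $L^\infty$.\<close>

section \<open>Square integrable functions\<close>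

text \<open>The order of quantifiers shapes the proof: \<open>M0\<close> is chosen from the data,
  before \<open>M\<close>, \<open>T\<close> and the solutions are given. So the decay may absorb
  only terms whose constants depend on the initial size \<open>\<rho>\<close>. Higher norms of the
  limit solution depend on \<open>M\<close> and \<open>T\<close>; they are kept apart, multiply only
  the energy of the difference or \<open>\<epsilon>\<close>, and enter Gronwall's constants, never
  the condition on \<open>M\<close>. For the uniform bound the second solution is zero and they
  vanish. The orders balance as follows: the energy of orders 5/2 and 3/2 dissipates the norms of
  orders 3 and 2, and an uneven split of the pairing leaves orders 2 and 1 for the nonlinear terms,
  so the Banach algebra of order 1 suffices. A quarter of the weight is used because differentiating
  the energy puts the squared weight on one factor, and half of the weight still leaves exponential
  decay to spare. As the Fourier transform is a chosen L^2 limit and the equations hold pointwise,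
  Plancherel's identity, inversion and the passage from pointwise to L^2 derivatives in time are
  established on the way.\<close>

definition l2 :: "(real \<Rightarrow> complex) \<Rightarrow> real" where
  "l2 f = sqrt (LINT x|lborel. (cmod (f x))\<^sup>2)"

definition ip :: "(real \<Rightarrow> complex) \<Rightarrow> (real \<Rightarrow> complex) \<Rightarrow> complex" where
  "ip f g = (LINT x|lborel. f x * cnj (g x))"

lemma sqint_measurable [measurable_dest]:
  "square_integrable f \<Longrightarrow> f \<in> borel_measurable borel"
  by (simp add: square_integrable_def)

lemma sqint_integrable: "square_integrable f \<Longrightarrow> integrable lborel (\<lambda>x. (cmod (f x))\<^sup>2)"
  by (simp add: square_integrable_def)

lemma sqintI_bound:
  assumes "f \<in> borel_measurable borel" "integrable lborel h" "AE x in lborel. (cmod (f x))\<^sup>2 \<le> h x"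
  shows "square_integrable f"
  unfolding square_integrable_def
proof
  show "integrable lborel (\<lambda>x. (cmod (f x))\<^sup>2)"
    using assms(1) by (intro Bochner_Integration.integrable_bound[OF assms(2)])
      (use assms(3) in \<open>auto elim!: AE_mp\<close>)
qed (use assms(1) in simp)

lemma sqint_iff_nn:
  "square_integrable f \<longleftrightarrow> f \<in> borel_measurable borel \<and> (\<integral>\<^sup>+x. ennreal ((cmod (f x))\<^sup>2) \<partial>lborel) < \<infinity>"
  unfolding square_integrable_def by (auto simp: integrable_iff_bounded)

lemma l2_nonneg [simp]: "0 \<le> l2 f"
  by (simp add: l2_def)

lemma l2_sq: "(l2 f)\<^sup>2 = (LINT x|lborel. (cmod (f x))\<^sup>2)"
  by (simp add: l2_def)

lemma nn_l2: "square_integrable f \<Longrightarrow> (\<integral>\<^sup>+x. ennreal ((cmod (f x))\<^sup>2) \<partial>lborel) = ennreal ((l2 f)\<^sup>2)"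
  unfolding l2_sq by (intro nn_integral_eq_integral sqint_integrable) auto

lemma l2_cong_AE:
  assumes "AE x in lborel. f x = g x" "f \<in> borel_measurable borel" "g \<in> borel_measurable borel"
  shows "l2 f = l2 g"
  unfolding l2_def using assms by (intro arg_cong[where f=sqrt] integral_cong_AE) auto

lemma sqint_cong_AE:
  assumes "square_integrable f" "AE x in lborel. f x = g x" "g \<in> borel_measurable borel"
  shows "square_integrable g"
  by (rule sqintI_bound[OF assms(3) sqint_integrable[OF assms(1)]]) (use assms(2) in auto)

lemma sqint_mult_bounded:
  assumes "square_integrable f" and [measurable]: "b \<in> borel_measurable borel" and "\<And>x. cmod (b x) \<le> B"
  shows "square_integrable (\<lambda>x. b x * f x)"
proof (rule sqintI_bound[where h="\<lambda>x. B\<^sup>2 * (cmod (f x))\<^sup>2"])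
  show "AE x in lborel. (cmod (b x * f x))\<^sup>2 \<le> B\<^sup>2 * (cmod (f x))\<^sup>2"
    by (auto simp: norm_mult power_mult_distrib intro!: mult_right_mono power_mono assms(3))
qed (use assms(1) sqint_integrable[OF assms(1)] in \<open>auto simp: square_integrable_def\<close>)

lemma l2_mult_bounded:
  assumes f: "square_integrable f" and [measurable]: "b \<in> borel_measurable borel" and "\<And>x. cmod (b x) \<le> B"
  shows "l2 (\<lambda>x. b x * f x) \<le> B * l2 f"
proof -
  have B: "0 \<le> B" using assms(3)[of 0] norm_ge_zero order_trans by blast
  have "(l2 (\<lambda>x. b x * f x))\<^sup>2 \<le> (LINT x|lborel. B\<^sup>2 * (cmod (f x))\<^sup>2)"
    unfolding l2_sq
    by (intro integral_mono sqint_integrable sqint_mult_bounded[OF f _ assms(3)])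
       (auto simp: norm_mult power_mult_distrib intro!: mult_right_mono power_mono assms(3) sqint_integrable[OF f])
  also have "\<dots> = (B * l2 f)\<^sup>2" by (simp add: l2_sq power_mult_distrib)
  finally show ?thesis using B by (auto intro: power2_le_imp_le)
qed

lemma sqint_scale: "square_integrable f \<Longrightarrow> square_integrable (\<lambda>x. c * f x)"
  by (rule sqint_mult_bounded[where B="cmod c"]) auto

lemma l2_scale: "l2 (\<lambda>x. c * f x) = cmod c * l2 f"
  by (simp add: l2_def norm_mult power_mult_distrib real_sqrt_mult)

lemma l2_minus_commute: "l2 (\<lambda>x. f x - g x) = l2 (\<lambda>x. g x - f x)"
  by (simp add: l2_def norm_minus_commute)

lemma borel_measurable_cnj [measurable]: "cnj \<in> borel_measurable borel"
  by (intro borel_measurable_continuous_onI continuous_intros)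

lemma sqint_cnj: "square_integrable f \<Longrightarrow> square_integrable (\<lambda>x. cnj (f x))"
  by (auto simp: square_integrable_def)

lemma sqint_zero: "square_integrable (\<lambda>x. 0)"
  by (simp add: square_integrable_def)

lemma l2_zero [simp]: "l2 (\<lambda>x. 0) = 0"
  by (simp add: l2_def)

lemma sqint_add:
  assumes f: "square_integrable f" and g: "square_integrable g"
  shows "square_integrable (\<lambda>x. f x + g x)"
proof (rule sqintI_bound[where h="\<lambda>x. 2 * (cmod (f x))\<^sup>2 + 2 * (cmod (g x))\<^sup>2"])
  have "(cmod (u + v))\<^sup>2 \<le> 2 * (cmod u)\<^sup>2 + 2 * (cmod v)\<^sup>2" for u v
  proof -
    have "(cmod (u + v))\<^sup>2 \<le> (cmod u + cmod v)\<^sup>2" by (intro power_mono norm_triangle_ineq) auto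
    also have "\<dots> \<le> 2 * (cmod u)\<^sup>2 + 2 * (cmod v)\<^sup>2"
      using zero_le_power2[of "cmod u - cmod v"] by (simp add: power2_eq_square algebra_simps)
    finally show ?thesis .
  qed
  then show "AE x in lborel. (cmod (f x + g x))\<^sup>2 \<le> 2 * (cmod (f x))\<^sup>2 + 2 * (cmod (g x))\<^sup>2" by simp
qed (use f g in \<open>auto simp: square_integrable_def\<close>)

lemma sqint_diff:
  assumes f: "square_integrable f" and g: "square_integrable g"
  shows "square_integrable (\<lambda>x. f x - g x)"
  using sqint_add[OF f sqint_scale[OF g, of "-1"]] by simp

lemma sqint_prod_integrable:
  assumes f: "square_integrable f" and g: "square_integrable g"
  shows "integrable lborel (\<lambda>x. f x * g x)"
proof (rule Bochner_Integration.integrable_bound)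
  show "integrable lborel (\<lambda>x. (cmod (f x))\<^sup>2 + (cmod (g x))\<^sup>2)"
    using f g by (auto simp: square_integrable_def)
  have "cmod u * cmod v \<le> (cmod u)\<^sup>2 + (cmod v)\<^sup>2" for u v
  proof -
    have "0 \<le> cmod u * cmod v" by simp
    then show ?thesis using sum_squares_bound[of "cmod u" "cmod v"] unfolding mult.assoc by linarith
  qed
  then show "AE x in lborel. norm (f x * g x) \<le> norm ((cmod (f x))\<^sup>2 + (cmod (g x))\<^sup>2)"
    by (simp add: norm_mult)
qed (use f g in \<open>auto simp: square_integrable_def\<close>)

lemma ip_integrable:
  "square_integrable f \<Longrightarrow> square_integrable g \<Longrightarrow> integrable lborel (\<lambda>x. f x * cnj (g x))"
  by (rule sqint_prod_integrable) (auto intro: sqint_cnj)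

text \<open>Integrate 2uv <= (B/A)u^2 + (A/B)v^2, where \<open>A\<close> and \<open>B\<close> are
  the two norms enlarged by \<open>e\<close>. The enlargement keeps the ratios finite when a norm
  vanishes; the limit \<open>e\<close> to 0 then gives the bound.\<close>

lemma l2_cauchy_schwarz_abs:
  assumes f: "square_integrable f" and g: "square_integrable g"
  shows "(LINT x|lborel. cmod (f x) * cmod (g x)) \<le> l2 f * l2 g"
proof -
  define I where "I = (LINT x|lborel. cmod (f x) * cmod (g x))"
  have fgi: "integrable lborel (\<lambda>x. cmod (f x) * cmod (g x))"
    using integrable_norm[OF sqint_prod_integrable[OF f g]] by (simp add: norm_mult)
  have *: "I \<le> (l2 f + e) * (l2 g + e)" if e: "e > 0" for e
  proof -
    define A B where "A = l2 f + e" and "B = l2 g + e"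
    have A: "A > 0" "B > 0" "l2 f \<le> A" "l2 g \<le> B" using e by (auto simp: A_def B_def add_nonneg_pos)
    have pt: "2 * (cmod u * cmod v) \<le> (B / A) * (cmod u)\<^sup>2 + (A / B) * (cmod v)\<^sup>2" for u v
    proof -
      have "0 \<le> (B * cmod u - A * cmod v)\<^sup>2 / (A * B)" using A by simp
      also have "\<dots> = (B / A) * (cmod u)\<^sup>2 + (A / B) * (cmod v)\<^sup>2 - 2 * (cmod u * cmod v)"
        using A by (simp add: field_simps power2_eq_square)
      finally show ?thesis by simp
    qed
    have "2 * I = (LINT x|lborel. 2 * (cmod (f x) * cmod (g x)))" by (simp add: I_def)
    also have "\<dots> \<le> (LINT x|lborel. (B / A) * (cmod (f x))\<^sup>2 + (A / B) * (cmod (g x))\<^sup>2)"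
      using f g fgi by (intro integral_mono pt) (auto simp: square_integrable_def)
    also have "\<dots> = (B / A) * (l2 f)\<^sup>2 + (A / B) * (l2 g)\<^sup>2"
      using f g by (simp add: square_integrable_def l2_sq)
    also have "\<dots> \<le> (B / A) * A\<^sup>2 + (A / B) * B\<^sup>2"
      using A by (intro add_mono mult_left_mono power_mono) auto
    also have "\<dots> = 2 * (A * B)" using A by (simp add: field_simps power2_eq_square)
    finally show ?thesis by (simp add: A_def B_def)
  qed
  have "((\<lambda>e. (l2 f + e) * (l2 g + e)) \<longlongrightarrow> (l2 f + 0) * (l2 g + 0)) (at_right 0)"
    by (intro tendsto_intros)
  moreover have "\<forall>\<^sub>F e in at_right 0. I \<le> (l2 f + e) * (l2 g + e)"
    using * by (auto simp: eventually_at_right_field intro!: exI[of _ 1])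
  ultimately have "I \<le> (l2 f + 0) * (l2 g + 0)"
    by (intro tendsto_lowerbound[of _ _ "at_right 0"]) auto
  then show ?thesis by (simp add: I_def)
qed

lemma ip_cauchy_schwarz:
  assumes f: "square_integrable f" and g: "square_integrable g"
  shows "cmod (ip f g) \<le> l2 f * l2 g"
proof -
  have "cmod (ip f g) \<le> (LINT x|lborel. cmod (f x * cnj (g x)))"
    unfolding ip_def by (rule integral_norm_bound)
  also have "\<dots> \<le> l2 f * l2 g" using l2_cauchy_schwarz_abs[OF f g] by (simp add: norm_mult)
  finally show ?thesis .
qed

lemma ip_self: "ip f f = complex_of_real ((l2 f)\<^sup>2)"
proof -
  have "ip f f = (LINT x|lborel. complex_of_real ((cmod (f x))\<^sup>2))"
    unfolding ip_def by (intro Bochner_Integration.integral_cong refl complex_norm_square[symmetric])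
  also have "\<dots> = complex_of_real ((l2 f)\<^sup>2)" by (simp only: integral_complex_of_real l2_sq)
  finally show ?thesis .
qed

lemma ip_add_left:
  "square_integrable f \<Longrightarrow> square_integrable g \<Longrightarrow> square_integrable h \<Longrightarrow>
    ip (\<lambda>x. f x + g x) h = ip f h + ip g h"
  by (simp add: ip_def distrib_right ip_integrable)

lemma ip_diff_left:
  "square_integrable f \<Longrightarrow> square_integrable g \<Longrightarrow> square_integrable h \<Longrightarrow>
    ip (\<lambda>x. f x - g x) h = ip f h - ip g h"
  by (simp add: ip_def left_diff_distrib ip_integrable)

lemma ip_diff_right:
  "square_integrable f \<Longrightarrow> square_integrable g \<Longrightarrow> square_integrable h \<Longrightarrow>
    ip h (\<lambda>x. f x - g x) = ip h f - ip h g"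
  by (simp add: ip_def right_diff_distrib ip_integrable)

lemma ip_add_right:
  "square_integrable f \<Longrightarrow> square_integrable g \<Longrightarrow> square_integrable h \<Longrightarrow>
    ip h (\<lambda>x. f x + g x) = ip h f + ip h g"
  by (simp add: ip_def distrib_left ip_integrable)

lemma ip_scale_right: "ip f (\<lambda>x. c * g x) = cnj c * ip f g"
  unfolding ip_def by (simp add: mult.left_commute)

lemma l2_triangle:
  assumes f: "square_integrable f" and g: "square_integrable g"
  shows "l2 (\<lambda>x. f x + g x) \<le> l2 f + l2 g"
proof -
  have fg: "square_integrable (\<lambda>x. f x + g x)" by (rule sqint_add[OF f g])
  have "complex_of_real ((l2 (\<lambda>x. f x + g x))\<^sup>2) = ip f (\<lambda>x. f x + g x) + ip g (\<lambda>x. f x + g x)"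
    using ip_self[of "\<lambda>x. f x + g x"] ip_add_left[OF f g fg] by simp
  then have "(l2 (\<lambda>x. f x + g x))\<^sup>2 = cmod (ip f (\<lambda>x. f x + g x) + ip g (\<lambda>x. f x + g x))"
    by (metis norm_of_real abs_of_nonneg zero_le_power2)
  also have "\<dots> \<le> l2 f * l2 (\<lambda>x. f x + g x) + l2 g * l2 (\<lambda>x. f x + g x)"
    by (rule order_trans[OF norm_triangle_ineq add_mono[OF ip_cauchy_schwarz[OF f fg] ip_cauchy_schwarz[OF g fg]]])
  finally have "l2 (\<lambda>x. f x + g x) * l2 (\<lambda>x. f x + g x) \<le> (l2 f + l2 g) * l2 (\<lambda>x. f x + g x)"
    by (simp add: power2_eq_square algebra_simps)
  then show ?thesis
    using l2_nonneg[of "\<lambda>x. f x + g x"] l2_nonneg[of f] l2_nonneg[of g]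
    by (cases "l2 (\<lambda>x. f x + g x) = 0") (auto simp: mult_le_cancel_right)
qed

lemma l2_triangle_diff:
  assumes f: "square_integrable f" and g: "square_integrable g"
  shows "l2 (\<lambda>x. f x - g x) \<le> l2 f + l2 g"
  using l2_triangle[OF f sqint_scale[OF g, of "-1"]] l2_scale[of "-1" g] by simp

lemma l2_triangle3:
  assumes f: "square_integrable f" and g: "square_integrable g" and h: "square_integrable h"
  shows "l2 (\<lambda>x. f x - h x) \<le> l2 (\<lambda>x. f x - g x) + l2 (\<lambda>x. g x - h x)"
  using l2_triangle[OF sqint_diff[OF f g] sqint_diff[OF g h]] by simp

lemma l2_rev_triangle:
  assumes f: "square_integrable f" and g: "square_integrable g"
  shows "\<bar>l2 f - l2 g\<bar> \<le> l2 (\<lambda>x. f x - g x)"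
  using l2_triangle[OF sqint_diff[OF f g] g] l2_triangle[OF sqint_diff[OF g f] f]
  by (simp add: l2_minus_commute[of f g])

lemma l2_mono:
  assumes "square_integrable g" "f \<in> borel_measurable borel" "AE x in lborel. cmod (f x) \<le> cmod (g x)"
  shows "l2 f \<le> l2 g" "square_integrable f"
proof -
  have *: "AE x in lborel. (cmod (f x))\<^sup>2 \<le> (cmod (g x))\<^sup>2" using assms(3) by (auto elim!: AE_mp intro: power_mono)
  show f: "square_integrable f" by (rule sqintI_bound[OF assms(2) sqint_integrable[OF assms(1)] *])
  show "l2 f \<le> l2 g"
    unfolding l2_def by (intro real_sqrt_le_mono integral_mono_AE sqint_integrable f assms(1) *)
qed

lemma l2_eq_0_AE:
  assumes "square_integrable f" "l2 f = 0"
  shows "AE x in lborel. f x = 0"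
proof -
  have "(LINT x|lborel. (cmod (f x))\<^sup>2) = 0" using assms(2) l2_sq[of f] by simp
  then show ?thesis using integral_nonneg_eq_0_iff_AE[OF sqint_integrable[OF assms(1)]] by simp
qed

text \<open>The distances to both limits bound the distance between them. This makes the function
  chosen by \<open>SOME\<close> in the Fourier transform unique up to null sets.\<close>

lemma l2_lim_unique:
  assumes "\<And>i. square_integrable (f i)" "square_integrable g" "square_integrable h"
    and F: "F \<noteq> bot" and "((\<lambda>i. l2 (\<lambda>x. f i x - g x)) \<longlongrightarrow> 0) F" "((\<lambda>i. l2 (\<lambda>x. f i x - h x)) \<longlongrightarrow> 0) F"
  shows "AE x in lborel. g x = h x"
proof -
  have "((\<lambda>i. l2 (\<lambda>x. f i x - g x) + l2 (\<lambda>x. f i x - h x)) \<longlongrightarrow> 0 + 0) F"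
    using assms by (intro tendsto_add) auto
  moreover have "l2 (\<lambda>x. g x - h x) \<le> l2 (\<lambda>x. f i x - g x) + l2 (\<lambda>x. f i x - h x)" for i
    using l2_triangle3[OF assms(2) assms(1)[of i] assms(3)] by (simp add: l2_minus_commute)
  ultimately have "l2 (\<lambda>x. g x - h x) \<le> 0 + 0"
    using F by (intro tendsto_lowerbound[where F=F]) auto
  then have "AE x in lborel. g x - h x = 0"
    using assms(2,3) by (intro l2_eq_0_AE sqint_diff) (auto intro: antisym)
  then show ?thesis by simp
qed

lemma ip_lim:
  assumes "\<And>i. square_integrable (f i)" "square_integrable f'" "square_integrable g"
    and "((\<lambda>i. l2 (\<lambda>x. f i x - f' x)) \<longlongrightarrow> 0) F"
  shows "((\<lambda>i. ip (f i) g) \<longlongrightarrow> ip f' g) F"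
proof -
  have "((\<lambda>i. ip (f i) g - ip f' g) \<longlongrightarrow> 0) F"
  proof (rule Lim_null_comparison)
    show "((\<lambda>i. l2 (\<lambda>x. f i x - f' x) * l2 g) \<longlongrightarrow> 0) F"
      using tendsto_mult_right[OF assms(4), of "l2 g"] by simp
    show "\<forall>\<^sub>F i in F. norm (ip (f i) g - ip f' g) \<le> l2 (\<lambda>x. f i x - f' x) * l2 g"
      using ip_cauchy_schwarz[OF sqint_diff[OF assms(1,2)] assms(3)] ip_diff_left[OF assms(1,2,3)]
      by simp
  qed
  then show ?thesis by (rule LIM_zero_cancel)
qed

text \<open>Squares converge along with the functions, so Fatou's lemma applies. It serves whenever
  a limit is known only pointwise: in the completeness proof and when a Gaussian cut-off is
  removed.\<close>

lemma l2_fatou: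
  assumes [measurable]: "\<And>n::nat. f n \<in> borel_measurable borel" "g \<in> borel_measurable borel"
    and lim: "AE x in lborel. (\<lambda>n. f n x) \<longlonglongrightarrow> g x"
    and sq: "\<And>n. square_integrable (f n)" and b: "\<forall>\<^sub>F n in sequentially. l2 (f n) \<le> B" and B: "0 \<le> B"
  shows "square_integrable g" "l2 g \<le> B"
proof -
  have "(\<integral>\<^sup>+x. ennreal ((cmod (g x))\<^sup>2) \<partial>lborel) = (\<integral>\<^sup>+x. liminf (\<lambda>n. ennreal ((cmod (f n x))\<^sup>2)) \<partial>lborel)"
  proof (rule nn_integral_cong_AE)
    show "AE x in lborel. ennreal ((cmod (g x))\<^sup>2) = liminf (\<lambda>n. ennreal ((cmod (f n x))\<^sup>2))"
      using lim
    proof (rule AE_mp, intro AE_I2 impI)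
      fix x assume "(\<lambda>n. f n x) \<longlonglongrightarrow> g x"
      then have "(\<lambda>n. ennreal ((cmod (f n x))\<^sup>2)) \<longlonglongrightarrow> ennreal ((cmod (g x))\<^sup>2)"
        by (intro tendsto_intros)
      from lim_imp_Liminf[OF _ this]
      show "ennreal ((cmod (g x))\<^sup>2) = liminf (\<lambda>n. ennreal ((cmod (f n x))\<^sup>2))" by simp
    qed
  qed
  also have "\<dots> \<le> liminf (\<lambda>n. \<integral>\<^sup>+x. ennreal ((cmod (f n x))\<^sup>2) \<partial>lborel)"
    by (rule nn_integral_liminf) simp
  also have "\<dots> \<le> limsup (\<lambda>n. \<integral>\<^sup>+x. ennreal ((cmod (f n x))\<^sup>2) \<partial>lborel)"
    by (rule Liminf_le_Limsup) simp
  also have "\<dots> \<le> ennreal (B\<^sup>2)"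
  proof (rule Limsup_bounded)
    show "\<forall>\<^sub>F n in sequentially. (\<integral>\<^sup>+x. ennreal ((cmod (f n x))\<^sup>2) \<partial>lborel) \<le> ennreal (B\<^sup>2)"
      using b by eventually_elim (auto simp: nn_l2[OF sq] intro!: ennreal_leI power_mono)
  qed
  finally have le: "(\<integral>\<^sup>+x. ennreal ((cmod (g x))\<^sup>2) \<partial>lborel) \<le> ennreal (B\<^sup>2)" .
  then show g: "square_integrable g"
    unfolding sqint_iff_nn using le_less_trans[OF le ennreal_less_top] by simp
  from le have "(l2 g)\<^sup>2 \<le> B\<^sup>2" unfolding nn_l2[OF g] by simp
  then show "l2 g \<le> B" using B by (rule power2_le_imp_le)
qed

text \<open>The factors \<open>4 ^ n\<close> are small enough for the weighted sum of the squared
  norms to converge. Hence almost everywhere the weighted squares tend to 0, and the terms are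
  eventually below \<open>(1/2) ^ n\<close>.\<close>

lemma sqint_AE_bounded_sum:
  fixes u :: "nat \<Rightarrow> real \<Rightarrow> complex"
  assumes sq: "\<And>n. square_integrable (u n)" and le: "\<And>n. l2 (u n) \<le> (1/4) ^ n"
  shows "AE x in lborel. summable (\<lambda>n. u n x)"
proof -
  have [measurable]: "u n \<in> borel_measurable borel" for n using sq by measurable
  have "(\<integral>\<^sup>+x. (\<Sum>n. ennreal (4 ^ n * (cmod (u n x))\<^sup>2)) \<partial>lborel)
      = (\<Sum>n. \<integral>\<^sup>+x. ennreal (4 ^ n * (cmod (u n x))\<^sup>2) \<partial>lborel)"
    by (rule nn_integral_suminf) simp
  also have "\<dots> = (\<Sum>n. ennreal (4 ^ n) * ennreal ((l2 (u n))\<^sup>2))"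
    by (simp add: ennreal_mult nn_integral_cmult nn_l2[OF sq])
  also have "\<dots> = (\<Sum>n. ennreal (4 ^ n * (l2 (u n))\<^sup>2))" by (simp add: ennreal_mult)
  also have "\<dots> \<le> (\<Sum>n. ennreal ((1/4) ^ n))"
  proof (rule suminf_le)
    fix n
    have "4 ^ n * (l2 (u n))\<^sup>2 \<le> 4 ^ n * ((1/4) ^ n)\<^sup>2"
      by (intro mult_left_mono power_mono le) auto
    also have "\<dots> = (4 * (1/4) * (1/4)) ^ n" by (simp only: power2_eq_square power_mult_distrib mult.assoc)
    finally show "ennreal (4 ^ n * (l2 (u n))\<^sup>2) \<le> ennreal ((1/4) ^ n)" by (intro ennreal_leI) simp
  qed auto
  also have "\<dots> < \<infinity>" by (subst suminf_ennreal2) auto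
  finally have "AE x in lborel. (\<Sum>n. ennreal (4 ^ n * (cmod (u n x))\<^sup>2)) \<noteq> \<infinity>"
    by (intro nn_integral_noteq_infinite) auto
  then show ?thesis
  proof (rule AE_mp, intro AE_I2 impI)
    fix x assume "(\<Sum>n. ennreal (4 ^ n * (cmod (u n x))\<^sup>2)) \<noteq> \<infinity>"
    then have s: "summable (\<lambda>n. 4 ^ n * (cmod (u n x))\<^sup>2)"
      by (intro summable_suminf_not_top) auto
    then have "(\<lambda>n. 4 ^ n * (cmod (u n x))\<^sup>2) \<longlonglongrightarrow> 0" by (rule summable_LIMSEQ_zero)
    then have ev: "\<forall>\<^sub>F n in sequentially. 4 ^ n * (cmod (u n x))\<^sup>2 < 1" by (auto intro: order_tendstoD)
    have "\<forall>\<^sub>F n in sequentially. norm (u n x) \<le> (1/2) ^ n"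
      using ev
    proof eventually_elim
      case (elim n)
      have "(2 ^ n * cmod (u n x))\<^sup>2 = 4 ^ n * (cmod (u n x))\<^sup>2"
        by (simp add: power_mult_distrib power2_eq_square flip: power_mult_distrib[of 2 2 n])
      then have "2 ^ n * cmod (u n x) < 1"
        using elim power_less_imp_less_base[of "2 ^ n * cmod (u n x)" 2 1] by simp
      then show ?case by (simp add: field_simps power_one_over)
    qed
    moreover have "summable (\<lambda>n. (1/2 :: real) ^ n)" by (rule summable_geometric) simp
    ultimately show "summable (\<lambda>n. u n x)" by (rule summable_comparison_test_ev)
  qed
qed

text \<open>The Riesz-Fischer argument: a fast subsequence converges almost everywhere, and Fatou's
  lemma along it measures the distance to the limit.\<close>

lemma l2_complete:
  fixes f :: "nat \<Rightarrow> real \<Rightarrow> complex"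
  assumes sq: "\<And>n. square_integrable (f n)"
    and cauchy: "\<And>e. e > 0 \<Longrightarrow> \<exists>N. \<forall>m\<ge>N. \<forall>n\<ge>N. l2 (\<lambda>x. f m x - f n x) < e"
  obtains h where "square_integrable h" "(\<lambda>n. l2 (\<lambda>x. f n x - h x)) \<longlonglongrightarrow> 0"
proof -
  have "\<forall>j. \<exists>N. \<forall>m\<ge>N. \<forall>n\<ge>N. l2 (\<lambda>x. f m x - f n x) < (1/4) ^ j" using cauchy by simp
  then obtain N where N: "\<And>j m n. m \<ge> N j \<Longrightarrow> n \<ge> N j \<Longrightarrow> l2 (\<lambda>x. f m x - f n x) < (1/4) ^ j" by metis
  \<comment> \<open>The partial sum exceeds every \<open>N i\<close> with \<open>i \<le> j\<close>,
    so that \<open>k j\<close> and \<open>k (Suc j)\<close> both lie beyond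
    \<open>N j\<close>.\<close>
  define k where "k j = (\<Sum>i\<le>j. N i) + j" for j
  have kN: "N j \<le> k i" if "j \<le> i" for i j
    using member_le_sum[of j "{..i}" N] that by (auto simp: k_def)
  have kj: "j \<le> k j" for j by (simp add: k_def)
  have "AE x in lborel. summable (\<lambda>j. f (k (Suc j)) x - f (k j) x)"
    by (rule sqint_AE_bounded_sum) (auto intro!: sqint_diff sq less_imp_le N kN)
  moreover have "\<exists>L. (\<lambda>j. f (k j) x) \<longlonglongrightarrow> L" if "summable (\<lambda>j. f (k (Suc j)) x - f (k j) x)" for x
  proof -
    have "(\<lambda>n. \<Sum>j<n. f (k (Suc j)) x - f (k j) x) = (\<lambda>n. f (k n) x - f (k 0) x)"
      by (intro ext sum_lessThan_telescope[of "\<lambda>j. f (k j) x"])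
    with summable_LIMSEQ[OF that] have "(\<lambda>n. f (k n) x - f (k 0) x) \<longlonglongrightarrow> (\<Sum>j. f (k (Suc j)) x - f (k j) x)"
      by simp
    from tendsto_add[OF this tendsto_const[of "f (k 0) x"]] show ?thesis by auto
  qed
  ultimately have ae: "AE x in lborel. convergent (\<lambda>j. f (k j) x)"
    by (auto simp: convergent_def elim!: AE_mp)
  have [measurable]: "f n \<in> borel_measurable borel" for n using sq by measurable
  \<comment> \<open>With the default 0 off the convergence set \<open>h\<close> is Borel, since
    convergence is the Cauchy property and therefore a measurable condition.\<close>
  define h where "h x = (if convergent (\<lambda>j. f (k j) x) then lim (\<lambda>j. f (k j) x) else 0)" for x
  have "(\<lambda>x. convergent (\<lambda>j. f (k j) x)) = (\<lambda>x. Cauchy (\<lambda>j. f (k j) x))"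
    by (simp add: Cauchy_convergent_iff)
  then have [measurable]: "Measurable.pred borel (\<lambda>x. convergent (\<lambda>j. f (k j) x))"
    by simp
  have [measurable]: "h \<in> borel_measurable borel" unfolding h_def by measurable
  have lim: "AE x in lborel. (\<lambda>j. f (k j) x) \<longlonglongrightarrow> h x"
    using ae by (auto elim!: AE_mp simp: h_def convergent_LIMSEQ_iff)
  \<comment> \<open>With \<open>m\<close> fixed, Fatou's lemma is applied to
    \<open>f m - f (k i)\<close> as \<open>i\<close> grows.\<close>
  have bnd: "square_integrable (\<lambda>x. f m x - h x) \<and> l2 (\<lambda>x. f m x - h x) \<le> (1/4) ^ j" if "m \<ge> N j" for m j
  proof -
    have ev: "\<forall>\<^sub>F i in sequentially. l2 (\<lambda>x. f m x - f (k i) x) \<le> (1/4) ^ j"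
      using eventually_ge_at_top[of j] by eventually_elim (auto intro!: less_imp_le N kN that)
    have li: "AE x in lborel. (\<lambda>i. f m x - f (k i) x) \<longlonglongrightarrow> f m x - h x"
      using lim by (auto elim!: AE_mp intro!: tendsto_intros)
    show ?thesis
      using l2_fatou[OF _ _ li sqint_diff[OF sq sq] ev] by simp
  qed
  show ?thesis
  proof
    show "square_integrable h"
      using sqint_diff[OF sq[of "N 0"] conjunct1[OF bnd[of 0 "N 0"]]] by simp
    show "(\<lambda>n. l2 (\<lambda>x. f n x - h x)) \<longlonglongrightarrow> 0"
    proof (rule LIMSEQ_I)
      fix e :: real assume "e > 0"
      then obtain j where "(1/4 :: real) ^ j < e" using real_arch_pow_inv[of e "1/4"] by auto
      then show "\<exists>no. \<forall>n\<ge>no. norm (l2 (\<lambda>x. f n x - h x) - 0) < e"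
        using bnd[of j] by (intro exI[of _ "N j"]) (auto intro: le_less_trans)
    qed
  qed
qed

section \<open>The Fourier transform on $L^2$\<close>

text \<open>The sign \<open>s\<close> treats both transforms at once: -1 for the forward transform,
  1 for the inverse one. Later facts assume only \<open>\<bar>s\<bar> = 1\<close>.\<close>

definition ft :: "real \<Rightarrow> (real \<Rightarrow> complex) \<Rightarrow> real \<Rightarrow> complex" where
  "ft s f \<xi> = complex_of_real (1 / sqrt (2 * pi)) * (LINT x|lborel. iexp (s * (x * \<xi>)) * f x)"

definition trunc :: "real \<Rightarrow> (real \<Rightarrow> complex) \<Rightarrow> real \<Rightarrow> complex" where
  "trunc R f x = indicator {-R..R} x *\<^sub>R f x"

definition FT :: "real \<Rightarrow> (real \<Rightarrow> complex) \<Rightarrow> real \<Rightarrow> complex" where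
  "FT s f = (SOME h. square_integrable h \<and>
     ((\<lambda>R. \<integral>\<^sup>+\<xi>. ennreal ((cmod (ft s (trunc R f) \<xi> - h \<xi>))\<^sup>2) \<partial>lborel) \<longlongrightarrow> 0) at_top)"

lemma fourier_eq_FT: "fourier f = FT (-1) f"
proof -
  have "complex_of_real (1 / sqrt (2 * pi)) * (LINT x:{-R..R}|lborel. exp (- \<i> * complex_of_real (x * \<xi>)) * f x)
      = ft (-1) (trunc R f) \<xi>" for R \<xi>
    unfolding ft_def trunc_def set_lebesgue_integral_def
    by (intro arg_cong2[where f="(*)"] refl Bochner_Integration.integral_cong) (simp_all add: algebra_simps)
  then show ?thesis by (simp only: fourier_def FT_def)
qed

lemma inv_fourier_eq_FT: "inv_fourier f = FT 1 f"
proof -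
  have "complex_of_real (1 / sqrt (2 * pi)) * (LINT \<xi>:{-R..R}|lborel. exp (\<i> * complex_of_real (x * \<xi>)) * f \<xi>)
      = ft 1 (trunc R f) x" for R x
    unfolding ft_def trunc_def set_lebesgue_integral_def
    by (intro arg_cong2[where f="(*)"] refl Bochner_Integration.integral_cong) (simp_all add: algebra_simps)
  then show ?thesis by (simp only: inv_fourier_def FT_def)
qed

section \<open>The Fourier integral of integrable functions\<close>

lemma ft_measurable [measurable]:
  assumes [measurable]: "f \<in> borel_measurable borel"
  shows "ft s f \<in> borel_measurable borel"
  unfolding ft_def by measurable

lemma iexp_integrable:
  assumes "integrable lborel f"
  shows "integrable lborel (\<lambda>x. iexp (s * (x * \<xi>)) * f x)"
proof (rule Bochner_Integration.integrable_bound[OF assms])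
  show "(\<lambda>x. iexp (s * (x * \<xi>)) * f x) \<in> borel_measurable lborel"
    using borel_measurable_integrable[OF assms] by measurable
qed (simp add: norm_mult)

lemma ft_bound: "cmod (ft s f \<xi>) \<le> (LINT x|lborel. cmod (f x)) / sqrt (2 * pi)"
proof -
  have "cmod (LINT x|lborel. iexp (s * (x * \<xi>)) * f x) \<le> (LINT x|lborel. cmod (iexp (s * (x * \<xi>)) * f x))"
    by (rule integral_norm_bound)
  then have "cmod (LINT x|lborel. iexp (s * (x * \<xi>)) * f x) \<le> (LINT x|lborel. cmod (f x))"
    by (simp add: norm_mult)
  then show ?thesis by (simp add: ft_def norm_mult norm_divide divide_right_mono)
qed

lemma ft_diff:
  assumes "integrable lborel f" "integrable lborel g"
  shows "ft s (\<lambda>x. f x - g x) \<xi> = ft s f \<xi> - ft s g \<xi>"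
  using iexp_integrable[OF assms(1)] iexp_integrable[OF assms(2)]
  by (simp add: ft_def right_diff_distrib)

lemma cnj_ft: "cnj (ft s f \<xi>) = ft (- s) (\<lambda>x. cnj (f x)) \<xi>"
proof -
  have "cnj (LINT x|lborel. iexp (s * (x * \<xi>)) * f x) = (LINT x|lborel. cnj (iexp (s * (x * \<xi>)) * f x))"
    by (rule Bochner_Integration.integral_cnj[symmetric])
  then show ?thesis by (simp add: ft_def exp_cnj)
qed

lemma integrable_pair_bounded:
  fixes f g :: "real \<Rightarrow> complex"
  assumes f: "integrable lborel f" and g: "integrable lborel g"
    and [measurable]: "(\<lambda>(x, y). k x y) \<in> borel_measurable (borel \<Otimes>\<^sub>M borel)"
    and b: "\<And>x y. cmod (k x y) \<le> 1"
  shows "integrable (lborel \<Otimes>\<^sub>M lborel) (\<lambda>(x, y). k x y * (f x * g y))"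
proof -
  have [measurable]: "f \<in> borel_measurable borel" "g \<in> borel_measurable borel"
    using f g by auto
  have "integrable (lborel \<Otimes>\<^sub>M lborel) (\<lambda>(x, y). f x * g y)"
  proof (rule lborel_pair.Fubini_integrable)
    show "integrable lborel (\<lambda>x. LINT y|lborel. norm (case (x, y) of (x, y) \<Rightarrow> f x * g y))"
      using f by (simp add: norm_mult integrable_mult_left integrable_norm)
    show "AE x in lborel. integrable lborel (\<lambda>y. case (x, y) of (x, y) \<Rightarrow> f x * g y)"
      using g by simp
  qed measurable
  then show ?thesis
    by (rule Bochner_Integration.integrable_bound)
       (auto simp: norm_mult split_beta intro!: AE_I2 mult_left_le_one_le b)
qed

text \<open>The kernel is bounded and symmetric in its two variables, so Fubini's theorem moves the
  transform from one factor to the other.\<close>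

lemma ft_mult:
  assumes f: "integrable lborel f" and g: "integrable lborel g"
  shows "(LINT \<xi>|lborel. ft s f \<xi> * g \<xi>) = (LINT x|lborel. f x * ft s g x)"
proof -
  let ?c = "complex_of_real (1 / sqrt (2 * pi))"
  have "integrable (lborel \<Otimes>\<^sub>M lborel) (\<lambda>(x, y). iexp (s * (x * y)) * (f x * g y))"
  proof (rule integrable_pair_bounded[OF f g])
    show "(\<lambda>(x, y). iexp (s * (x * y))) \<in> borel_measurable (borel \<Otimes>\<^sub>M borel)" by measurable
  qed simp
  then have "(LINT \<xi>|lborel. LINT x|lborel. iexp (s * (x * \<xi>)) * (f x * g \<xi>))
      = (LINT x|lborel. LINT \<xi>|lborel. iexp (s * (x * \<xi>)) * (f x * g \<xi>))"
    by (rule lborel_pair.Fubini_integral)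
  moreover have "(LINT x|lborel. iexp (s * (x * \<xi>)) * (f x * g \<xi>)) = (LINT x|lborel. iexp (s * (x * \<xi>)) * f x) * g \<xi>" for \<xi>
    by (simp add: mult.assoc[symmetric])
  moreover have "(LINT \<xi>|lborel. iexp (s * (x * \<xi>)) * (f x * g \<xi>)) = f x * (LINT \<xi>|lborel. iexp (s * (\<xi> * x)) * g \<xi>)" for x
    by (simp add: ac_simps)
  ultimately have "(LINT \<xi>|lborel. (LINT x|lborel. iexp (s * (x * \<xi>)) * f x) * g \<xi>)
      = (LINT x|lborel. f x * (LINT \<xi>|lborel. iexp (s * (\<xi> * x)) * g \<xi>))" by simp
  then have "?c * (LINT \<xi>|lborel. (LINT x|lborel. iexp (s * (x * \<xi>)) * f x) * g \<xi>)
      = ?c * (LINT x|lborel. f x * (LINT \<xi>|lborel. iexp (s * (\<xi> * x)) * g \<xi>))" by simp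
  then show ?thesis
    by (simp add: ft_def mult.assoc mult.left_commute)
qed

section \<open>Gaussian regularisation and Bessel's inequality\<close>

definition gauss :: "real \<Rightarrow> real \<Rightarrow> real" where
  "gauss d \<xi> = exp (- ((d * \<xi>)\<^sup>2) / 2)"

lemma gauss_measurable [measurable]: "gauss d \<in> borel_measurable borel"
  unfolding gauss_def by measurable

lemma gauss_bounds: "0 \<le> gauss d \<xi>" "gauss d \<xi> \<le> 1"
  by (auto simp: gauss_def)

lemma gauss_std: "gauss 1 x = sqrt (2 * pi) * std_normal_density x"
  by (simp add: gauss_def std_normal_density_def)

lemma gauss_integrable: "d > 0 \<Longrightarrow> integrable lborel (gauss d)"
proof -
  assume d: "d > 0"
  have "integrable lborel (gauss 1)" unfolding gauss_std[abs_def] by (intro integrable_mult_right) simp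
  from lborel_integrable_real_affine[OF this, of d 0] d
  show ?thesis by (simp add: gauss_def[abs_def])
qed

text \<open>Rescaling to \<open>d = 1\<close> turns the integral into the characteristic function of
  the standard normal distribution.\<close>

lemma gauss_fourier:
  assumes d: "d > 0"
  shows "(LINT \<xi>|lborel. iexp (t * \<xi>) * complex_of_real (gauss d \<xi>)) = complex_of_real (2 * pi * normal_density 0 d t)"
proof -
  have "(LINT x|lborel. iexp ((t / d) * x) * complex_of_real (gauss 1 x))
      = (LINT x|lborel. complex_of_real (sqrt (2 * pi)) * (std_normal_density x *\<^sub>R iexp ((t / d) * x)))"
    unfolding gauss_std by (intro Bochner_Integration.integral_cong refl) (simp add: scaleR_conv_of_real ac_simps)
  also have "\<dots> = complex_of_real (sqrt (2 * pi)) * char std_normal_distribution (t / d)"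
    unfolding char_def integral_mult_right_zero by (subst integral_density) auto
  also have "\<dots> = complex_of_real (sqrt (2 * pi) * exp (- (t / d)\<^sup>2 / 2))"
    unfolding char_std_normal_distribution by (simp add: scaleR_conv_of_real)
  finally have 1: "(LINT x|lborel. iexp ((t / d) * x) * complex_of_real (gauss 1 x))
      = complex_of_real (sqrt (2 * pi) * exp (- (t / d)\<^sup>2 / 2))" .
  have "(LINT x|lborel. iexp ((t / d) * x) * complex_of_real (gauss 1 x))
      = d *\<^sub>R (LINT \<xi>|lborel. iexp (t * \<xi>) * complex_of_real (gauss d \<xi>))"
    using d by (subst lborel_integral_real_affine[where c=d and t=0]) (auto simp: gauss_def)
  with 1 have "(LINT \<xi>|lborel. iexp (t * \<xi>) * complex_of_real (gauss d \<xi>))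
      = complex_of_real (sqrt (2 * pi) * exp (- (t / d)\<^sup>2 / 2) / d)"
    using d by (simp add: scaleR_conv_of_real field_simps)
  also have "sqrt (2 * pi) * exp (- (t / d)\<^sup>2 / 2) / d = 2 * pi * normal_density 0 d t"
    using d by (simp add: normal_density_def real_sqrt_mult field_simps power_divide)
  finally show ?thesis .
qed

lemma normal_density_commute: "normal_density x d y = normal_density y d x"
  by (simp add: normal_density_def power2_commute)

lemma normal_density_sign: "\<bar>s\<bar> = 1 \<Longrightarrow> normal_density 0 d (s * (x - y)) = normal_density x d y"
  by (simp add: normal_density_def power_mult_distrib power2_commute)
     (metis abs_square_eq_1 mult_1 power2_abs power_one)

lemma normal_density_nn: "d > 0 \<Longrightarrow> (\<integral>\<^sup>+y. ennreal (normal_density x d y) \<partial>lborel) = 1"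
  by (subst nn_integral_eq_integral) auto

lemma normal_density_measurable2 [measurable]:
  "(\<lambda>p. normal_density (fst p) d (snd p)) \<in> borel_measurable (borel \<Otimes>\<^sub>M borel)"
  unfolding normal_density_def by measurable

text \<open>Schur's test: the product of the moduli is at most half the sum of their squares, and
  the normal density has integral 1 in either variable.\<close>

lemma nn_schur:
  assumes [measurable]: "f \<in> borel_measurable borel" and d: "d > 0"
  shows "(\<integral>\<^sup>+x. \<integral>\<^sup>+y. ennreal (cmod (f x) * (cmod (f y) * normal_density x d y)) \<partial>lborel \<partial>lborel)
    \<le> (\<integral>\<^sup>+x. ennreal ((cmod (f x))\<^sup>2) \<partial>lborel)"
proof -
  define A where "A = (\<integral>\<^sup>+x. ennreal ((cmod (f x))\<^sup>2 / 2) \<partial>lborel)"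
  have [measurable]: "(\<lambda>p. normal_density (fst p) d (snd p)) \<in> borel_measurable (lborel \<Otimes>\<^sub>M lborel)"
    using normal_density_measurable2 by simp
  have pt: "u * (v * n) \<le> u\<^sup>2 * n / 2 + v\<^sup>2 * n / 2" if "0 \<le> n" for u v n :: real
  proof -
    have "u * v \<le> u\<^sup>2 / 2 + v\<^sup>2 / 2" using sum_squares_bound[of u v] by simp
    from mult_right_mono[OF this that] show ?thesis by (simp add: distrib_right mult.assoc)
  qed
  have "(\<integral>\<^sup>+x. \<integral>\<^sup>+y. ennreal (cmod (f x) * (cmod (f y) * normal_density x d y)) \<partial>lborel \<partial>lborel)
      \<le> (\<integral>\<^sup>+x. \<integral>\<^sup>+y. (ennreal ((cmod (f x))\<^sup>2 / 2) * ennreal (normal_density x d y)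
            + ennreal ((cmod (f y))\<^sup>2 / 2) * ennreal (normal_density x d y)) \<partial>lborel \<partial>lborel)"
    by (intro nn_integral_mono) (auto simp: ennreal_plus[symmetric] ennreal_mult[symmetric] simp del: ennreal_plus intro!: ennreal_leI pt)
  also have "\<dots> = (\<integral>\<^sup>+x. (\<integral>\<^sup>+y. ennreal ((cmod (f x))\<^sup>2 / 2) * ennreal (normal_density x d y) \<partial>lborel)
            + (\<integral>\<^sup>+y. ennreal ((cmod (f y))\<^sup>2 / 2) * ennreal (normal_density x d y) \<partial>lborel) \<partial>lborel)"
    by (subst nn_integral_add) auto
  also have "\<dots> = (\<integral>\<^sup>+x. (\<integral>\<^sup>+y. ennreal ((cmod (f x))\<^sup>2 / 2) * ennreal (normal_density x d y) \<partial>lborel) \<partial>lborel)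
            + (\<integral>\<^sup>+x. (\<integral>\<^sup>+y. ennreal ((cmod (f y))\<^sup>2 / 2) * ennreal (normal_density x d y) \<partial>lborel) \<partial>lborel)"
    by (subst nn_integral_add) auto
  also have "(\<integral>\<^sup>+x. (\<integral>\<^sup>+y. ennreal ((cmod (f y))\<^sup>2 / 2) * ennreal (normal_density x d y) \<partial>lborel) \<partial>lborel)
      = (\<integral>\<^sup>+y. (\<integral>\<^sup>+x. ennreal ((cmod (f y))\<^sup>2 / 2) * ennreal (normal_density x d y) \<partial>lborel) \<partial>lborel)"
    by (subst lborel_pair.Fubini') auto
  also have "\<dots> = A"
  proof -
    have "(\<integral>\<^sup>+x. ennreal (normal_density x d y) \<partial>lborel) = (\<integral>\<^sup>+x. ennreal (normal_density y d x) \<partial>lborel)" for y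
      by (intro nn_integral_cong arg_cong[where f=ennreal] normal_density_commute)
    moreover have "(\<lambda>x. normal_density x d y) \<in> borel_measurable borel" for y
      unfolding normal_density_def by measurable
    ultimately show ?thesis
      unfolding A_def by (simp add: nn_integral_cmult normal_density_nn[OF d])
  qed
  also have "(\<integral>\<^sup>+x. (\<integral>\<^sup>+y. ennreal ((cmod (f x))\<^sup>2 / 2) * ennreal (normal_density x d y) \<partial>lborel) \<partial>lborel) = A"
    unfolding A_def by (simp add: nn_integral_cmult normal_density_nn[OF d])
  also have "A + A = (\<integral>\<^sup>+x. ennreal ((cmod (f x))\<^sup>2) \<partial>lborel)"
    unfolding A_def by (subst nn_integral_add[symmetric]) (auto simp: ennreal_plus[symmetric] simp del: ennreal_plus)
  finally show ?thesis .
qed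

lemma norm_integral_le_nn: "ennreal (norm (integral\<^sup>L M f)) \<le> (\<integral>\<^sup>+x. ennreal (norm (f x)) \<partial>M)"
  for f :: "_ \<Rightarrow> complex"
  by (cases "integrable M f") (auto intro: integral_norm_bound_ennreal simp: not_integrable_integral_eq)

lemma gauss_ft_kernel:
  assumes s: "\<bar>s\<bar> = 1" and d: "d > 0"
  shows "ft (- s) (\<lambda>y. complex_of_real (gauss d y) * iexp (s * (y * x))) z
    = complex_of_real (sqrt (2 * pi) * normal_density x d z)"
proof -
  have "(LINT y|lborel. iexp (- s * (y * z)) * (complex_of_real (gauss d y) * iexp (s * (y * x))))
      = (LINT y|lborel. iexp ((s * (x - z)) * y) * complex_of_real (gauss d y))"
    by (intro Bochner_Integration.integral_cong refl)
       (simp add: exp_minus exp_diff right_diff_distrib left_diff_distrib field_simps)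
  also have "\<dots> = complex_of_real (2 * pi * normal_density x d z)"
    by (simp only: gauss_fourier[OF d] normal_density_sign[OF s])
  finally have *: "(LINT y|lborel. iexp (- s * (y * z)) * (complex_of_real (gauss d y) * iexp (s * (y * x))))
    = complex_of_real (2 * pi * normal_density x d z)" .
  have "1 / sqrt (2 * pi) * (2 * pi * n) = sqrt (2 * pi) * n" for n
    using real_sqrt_mult_self[of "2 * pi"] by (simp add: field_simps)
  then show ?thesis unfolding ft_def * by (simp only: of_real_mult[symmetric])
qed

lemma gauss_iexp_integrable:
  assumes d: "d > 0"
  shows "integrable lborel (\<lambda>y. complex_of_real (gauss d y) * iexp (s * (y * x)))"
  by (rule Bochner_Integration.integrable_bound[OF gauss_integrable[OF d]]) (auto simp: norm_mult)

text \<open>The Gaussian factor makes the frequency integral absolutely convergent. The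
  multiplication formula then rewrites the left side as \<open>f\<close> paired with a Gaussian
  average of its conjugate, which \<open>nn_schur\<close> bounds independently of
  \<open>d\<close>.\<close>

lemma bessel_gauss:
  assumes f: "integrable lborel f" and f2: "square_integrable f" and s: "\<bar>s\<bar> = 1" and d: "d > 0"
  shows "(\<integral>\<^sup>+\<xi>. ennreal (gauss d \<xi> * (cmod (ft s f \<xi>))\<^sup>2) \<partial>lborel) \<le> ennreal ((l2 f)\<^sup>2)"
proof -
  note [measurable] = borel_measurable_integrable[OF f]
  have [measurable]: "f \<in> borel_measurable borel" using f2 by measurable
  have [measurable]: "(\<lambda>p. normal_density (fst p) d (snd p)) \<in> borel_measurable (lborel \<Otimes>\<^sub>M lborel)"
    using normal_density_measurable2 by simp
  define L where "L = (LINT x|lborel. cmod (f x)) / sqrt (2 * pi)"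
  \<comment> \<open>Chosen so that \<open>ft s f \<xi> * g \<xi>\<close> is the weighted squared
    modulus. By \<open>cnj_ft\<close> it is again a Gaussian times a transform, which is why its own
    transform can be computed in \<open>inner\<close>.\<close>
  define g where "g \<xi> = complex_of_real (gauss d \<xi>) * cnj (ft s f \<xi>)" for \<xi>
  have g: "integrable lborel g"
  proof (rule Bochner_Integration.integrable_bound)
    show "integrable lborel (\<lambda>\<xi>. L * gauss d \<xi>)" by (intro integrable_mult_right gauss_integrable d)
    show "AE \<xi> in lborel. norm (g \<xi>) \<le> norm (L * gauss d \<xi>)"
    proof (rule AE_I2)
      fix \<xi>
      have "norm (g \<xi>) = gauss d \<xi> * cmod (ft s f \<xi>)" by (simp add: g_def norm_mult gauss_bounds)
      also have "\<dots> \<le> gauss d \<xi> * L" unfolding L_def by (intro mult_left_mono ft_bound gauss_bounds)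
      also have "\<dots> \<le> norm (L * gauss d \<xi>)" by (simp add: mult.commute)
      finally show "norm (g \<xi>) \<le> norm (L * gauss d \<xi>)" .
    qed
  qed (unfold g_def, measurable)
  have gg: "ft s f \<xi> * g \<xi> = complex_of_real (gauss d \<xi> * (cmod (ft s f \<xi>))\<^sup>2)" for \<xi>
    by (simp add: g_def complex_norm_square[symmetric] mult.left_commute del: of_real_power)
  have fi: "integrable lborel (\<lambda>x. cnj (f x))" using f by simp
  have inner: "ft s g x = (LINT z|lborel. cnj (f z) * complex_of_real (normal_density x d z))" for x
  proof -
    have "ft s g x = complex_of_real (1 / sqrt (2 * pi)) *
        (LINT y|lborel. ft (- s) (\<lambda>x. cnj (f x)) y * (complex_of_real (gauss d y) * iexp (s * (y * x))))"
    proof -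
      have "iexp (s * (y * x)) * g y = ft (- s) (\<lambda>x. cnj (f x)) y * (complex_of_real (gauss d y) * iexp (s * (y * x)))" for y
        unfolding g_def cnj_ft by (simp only: mult_ac)
      then show ?thesis by (simp only: ft_def[of s g])
    qed
    also have "\<dots> = complex_of_real (1 / sqrt (2 * pi)) *
        (LINT z|lborel. cnj (f z) * ft (- s) (\<lambda>y. complex_of_real (gauss d y) * iexp (s * (y * x))) z)"
      by (simp only: ft_mult[OF fi gauss_iexp_integrable[OF d]])
    also have "\<dots> = (LINT z|lborel. complex_of_real (1 / sqrt (2 * pi)) * (cnj (f z) * complex_of_real (sqrt (2 * pi) * normal_density x d z)))"
      by (simp only: gauss_ft_kernel[OF s d] integral_mult_right_zero)
    also have "\<dots> = (LINT z|lborel. cnj (f z) * complex_of_real (normal_density x d z))"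
      by (intro Bochner_Integration.integral_cong refl) simp
    finally show ?thesis .
  qed
  have int: "integrable lborel (\<lambda>\<xi>. gauss d \<xi> * (cmod (ft s f \<xi>))\<^sup>2)"
  proof (rule Bochner_Integration.integrable_bound)
    show "integrable lborel (\<lambda>\<xi>. L\<^sup>2 * gauss d \<xi>)" by (intro integrable_mult_right gauss_integrable d)
    have "gauss d \<xi> * (cmod (ft s f \<xi>))\<^sup>2 \<le> gauss d \<xi> * L\<^sup>2" for \<xi>
      unfolding L_def by (intro mult_left_mono power_mono ft_bound gauss_bounds norm_ge_zero)
    then show "AE \<xi> in lborel. norm (gauss d \<xi> * (cmod (ft s f \<xi>))\<^sup>2) \<le> norm (L\<^sup>2 * gauss d \<xi>)"
      by (simp add: gauss_bounds mult.commute)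
  qed simp
  have "complex_of_real (LINT \<xi>|lborel. gauss d \<xi> * (cmod (ft s f \<xi>))\<^sup>2) = (LINT \<xi>|lborel. ft s f \<xi> * g \<xi>)"
    by (simp only: gg integral_complex_of_real)
  also have "\<dots> = (LINT x|lborel. f x * ft s g x)" by (rule ft_mult[OF f g])
  finally have eq: "complex_of_real (LINT \<xi>|lborel. gauss d \<xi> * (cmod (ft s f \<xi>))\<^sup>2) = (LINT x|lborel. f x * ft s g x)" .
  have "(\<integral>\<^sup>+\<xi>. ennreal (gauss d \<xi> * (cmod (ft s f \<xi>))\<^sup>2) \<partial>lborel)
      = ennreal (LINT \<xi>|lborel. gauss d \<xi> * (cmod (ft s f \<xi>))\<^sup>2)"
    by (intro nn_integral_eq_integral int) (simp add: gauss_bounds)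
  also have "\<dots> \<le> ennreal (cmod (LINT x|lborel. f x * ft s g x))"
    unfolding eq[symmetric] norm_of_real by (intro ennreal_leI) simp
  also have "\<dots> \<le> (\<integral>\<^sup>+x. ennreal (cmod (f x * ft s g x)) \<partial>lborel)"
    by (rule norm_integral_le_nn)
  also have "\<dots> \<le> (\<integral>\<^sup>+x. \<integral>\<^sup>+y. ennreal (cmod (f x) * (cmod (f y) * normal_density x d y)) \<partial>lborel \<partial>lborel)"
  proof (rule nn_integral_mono)
    fix x
    have "ennreal (cmod (f x * ft s g x)) = ennreal (cmod (f x)) * ennreal (cmod (ft s g x))"
      by (simp add: norm_mult ennreal_mult)
    also have "\<dots> \<le> ennreal (cmod (f x)) * (\<integral>\<^sup>+y. ennreal (cmod (cnj (f y) * complex_of_real (normal_density x d y))) \<partial>lborel)"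
      unfolding inner by (intro mult_left_mono norm_integral_le_nn) simp
    also have "\<dots> = (\<integral>\<^sup>+y. ennreal (cmod (f x) * (cmod (f y) * normal_density x d y)) \<partial>lborel)"
      by (subst nn_integral_cmult[symmetric]) (auto simp: norm_mult ennreal_mult)
    finally show "ennreal (cmod (f x * ft s g x)) \<le> (\<integral>\<^sup>+y. ennreal (cmod (f x) * (cmod (f y) * normal_density x d y)) \<partial>lborel)" .
  qed
  also have "\<dots> \<le> (\<integral>\<^sup>+x. ennreal ((cmod (f x))\<^sup>2) \<partial>lborel)" by (rule nn_schur[OF _ d]) simp
  also have "\<dots> = ennreal ((l2 f)\<^sup>2)" by (rule nn_l2[OF f2])
  finally show ?thesis .
qed

text \<open>The Gaussian is removed by letting its parameter tend to 0; Fatou's lemma keeps the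
  bound.\<close>

lemma bessel:
  assumes f: "integrable lborel f" and f2: "square_integrable f" and s: "\<bar>s\<bar> = 1"
  shows "square_integrable (ft s f)" "l2 (ft s f) \<le> l2 f"
proof -
  have [measurable]: "f \<in> borel_measurable borel" using f2 by measurable
  define d where "d n = 1 / real (Suc n)" for n
  have d: "d n > 0" for n by (simp add: d_def)
  \<comment> \<open>Dividing by \<open>sqrt 2\<close> makes the square of this factor the Gaussian
    of parameter \<open>d n\<close>.\<close>
  define u where "u n \<xi> = complex_of_real (gauss (d n / sqrt 2) \<xi>) * ft s f \<xi>" for n \<xi>
  have um [measurable]: "u n \<in> borel_measurable borel" for n unfolding u_def by measurable
  have usq: "(cmod (u n \<xi>))\<^sup>2 = gauss (d n) \<xi> * (cmod (ft s f \<xi>))\<^sup>2" for n \<xi>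
  proof -
    have "(gauss (d n / sqrt 2) \<xi>)\<^sup>2 = gauss (d n) \<xi>"
      by (simp add: gauss_def exp_double[symmetric] power_mult_distrib power_divide)
    then show ?thesis by (simp add: u_def norm_mult power_mult_distrib gauss_bounds)
  qed
  have le: "(\<integral>\<^sup>+\<xi>. ennreal ((cmod (u n \<xi>))\<^sup>2) \<partial>lborel) \<le> ennreal ((l2 f)\<^sup>2)" for n
    unfolding usq by (rule bessel_gauss[OF f f2 s d])
  then have sq: "square_integrable (u n)" for n
    unfolding sqint_iff_nn using le_less_trans[OF le ennreal_less_top] by simp
  have le2: "l2 (u n) \<le> l2 f" for n
  proof (rule power2_le_imp_le)
    show "(l2 (u n))\<^sup>2 \<le> (l2 f)\<^sup>2" using le[of n] unfolding nn_l2[OF sq] by simp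
  qed simp
  have lim: "(\<lambda>n. u n \<xi>) \<longlonglongrightarrow> ft s f \<xi>" for \<xi>
  proof -
    have "d \<longlonglongrightarrow> 0" unfolding d_def using LIMSEQ_inverse_real_of_nat by (simp add: inverse_eq_divide)
    then have "(\<lambda>n. gauss (d n / sqrt 2) \<xi>) \<longlonglongrightarrow> exp (- ((0 / sqrt 2 * \<xi>)\<^sup>2) / 2)"
      unfolding gauss_def by (intro tendsto_intros) auto
    then have "(\<lambda>n. complex_of_real (gauss (d n / sqrt 2) \<xi>) * ft s f \<xi>) \<longlonglongrightarrow> complex_of_real 1 * ft s f \<xi>"
      by (intro tendsto_intros) auto
    then show ?thesis by (simp add: u_def)
  qed
  show "square_integrable (ft s f)" "l2 (ft s f) \<le> l2 f"
    using l2_fatou[OF um _ AE_I2[OF lim] sq, of "l2 f"] le2 by auto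
qed

section \<open>Extension to L^2 by truncation\<close>

lemma trunc_measurable [measurable]:
  "f \<in> borel_measurable borel \<Longrightarrow> trunc R f \<in> borel_measurable borel"
  unfolding trunc_def by measurable

lemma sqint_trunc:
  assumes "square_integrable f" shows "square_integrable (trunc R f)"
proof -
  have "trunc R f = (\<lambda>x. complex_of_real (indicator {-R..R} x) * f x)"
    by (auto simp: trunc_def scaleR_conv_of_real)
  then show ?thesis
    using sqint_mult_bounded[OF assms, of "\<lambda>x. complex_of_real (indicator {-R..R} x)" 1]
    by (auto simp: indicator_def)
qed

lemma sqint_indicator: "square_integrable (\<lambda>x. complex_of_real (indicator {a..b::real} x))"
proof -
  have "(\<lambda>x. (cmod (complex_of_real (indicator {a..b::real} x)))\<^sup>2) = indicator {a..b}"
    by (auto simp: indicator_def)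
  moreover have "integrable lborel (indicator {a..b} :: real \<Rightarrow> real)"
    by (rule integrable_real_indicator) (auto simp: emeasure_lborel_Icc_eq)
  ultimately show ?thesis by (simp add: square_integrable_def)
qed

lemma integrable_trunc:
  assumes "square_integrable f" shows "integrable lborel (trunc R f)"
proof -
  have "trunc R f = (\<lambda>x. complex_of_real (indicator {-R..R} x) * f x)"
    by (auto simp: trunc_def scaleR_conv_of_real)
  then show ?thesis using sqint_prod_integrable[OF sqint_indicator assms] by simp
qed

lemma l2_trunc:
  assumes f: "square_integrable f"
  shows "((\<lambda>R. l2 (\<lambda>x. trunc R f x - f x)) \<longlongrightarrow> 0) at_top"
proof -
  have [measurable]: "f \<in> borel_measurable borel" using f by measurable
  have "((\<lambda>R. LINT x|lborel. (cmod (trunc R f x - f x))\<^sup>2) \<longlongrightarrow> (LINT x|(lborel::real measure). 0)) at_top"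
  proof (rule integral_dominated_convergence_at_top)
    show "integrable lborel (\<lambda>x. (cmod (f x))\<^sup>2)" by (rule sqint_integrable[OF f])
    show "\<forall>\<^sub>F R in at_top. AE x in lborel. norm ((cmod (trunc R f x - f x))\<^sup>2) \<le> (cmod (f x))\<^sup>2"
      by (intro always_eventually allI AE_I2) (auto simp: trunc_def indicator_def)
    show "AE x in lborel. ((\<lambda>R. (cmod (trunc R f x - f x))\<^sup>2) \<longlongrightarrow> 0) at_top"
    proof (rule AE_I2)
      fix x
      have "\<forall>\<^sub>F R in at_top. (cmod (trunc R f x - f x))\<^sup>2 = 0"
        using eventually_ge_at_top[of "\<bar>x\<bar>"]
        by eventually_elim (auto simp: trunc_def indicator_def abs_le_iff)
      then show "((\<lambda>R. (cmod (trunc R f x - f x))\<^sup>2) \<longlongrightarrow> 0) at_top"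
        by (rule tendsto_eventually)
    qed
  qed measurable
  then have "((\<lambda>R. sqrt (LINT x|lborel. (cmod (trunc R f x - f x))\<^sup>2)) \<longlongrightarrow> sqrt 0) at_top"
    by (intro tendsto_intros) simp
  then show ?thesis by (simp add: l2_def)
qed

lemma trunc_diff: "trunc R (\<lambda>x. f x - g x) = (\<lambda>x. trunc R f x - trunc R g x)"
  by (auto simp: trunc_def algebra_simps)

lemma trunc_scale: "trunc R (\<lambda>x. c * f x) = (\<lambda>x. c * trunc R f x)"
  by (auto simp: trunc_def)

lemma bessel_diff:
  assumes "integrable lborel f" "square_integrable f" "integrable lborel g" "square_integrable g" "\<bar>s\<bar> = 1"
  shows "l2 (\<lambda>\<xi>. ft s f \<xi> - ft s g \<xi>) \<le> l2 (\<lambda>x. f x - g x)"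
proof -
  have "ft s (\<lambda>x. f x - g x) = (\<lambda>\<xi>. ft s f \<xi> - ft s g \<xi>)"
    by (rule ext) (rule ft_diff[OF assms(1,3)])
  then show ?thesis
    using bessel(2)[OF Bochner_Integration.integrable_diff[OF assms(1,3)] sqint_diff[OF assms(2,4)] assms(5)] by simp
qed

text \<open>By Bessel's inequality the transforms of the truncations form a Cauchy family in
  L^2.\<close>

lemma FT_exists:
  assumes f: "square_integrable f" and s: "\<bar>s\<bar> = 1"
  obtains h where "square_integrable h" "((\<lambda>R. l2 (\<lambda>\<xi>. ft s (trunc R f) \<xi> - h \<xi>)) \<longlongrightarrow> 0) at_top"
proof -
  note fi = integrable_trunc[OF f] and f2 = sqint_trunc[OF f]
  note sq = bessel(1)[OF fi f2 s]
  have le: "l2 (\<lambda>\<xi>. ft s (trunc R f) \<xi> - ft s (trunc R' f) \<xi>)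
      \<le> l2 (\<lambda>x. trunc R f x - f x) + l2 (\<lambda>x. trunc R' f x - f x)" for R R'
    using bessel_diff[OF fi f2 fi f2 s] l2_triangle3[OF f2 f f2] by (rule order_trans[THEN order_trans])
      (simp add: l2_minus_commute[of f])
  have lim: "(\<lambda>n. l2 (\<lambda>x. trunc (real n) f x - f x)) \<longlonglongrightarrow> 0"
    using l2_trunc[OF f] filterlim_real_sequentially by (rule filterlim_compose)
  obtain h where h: "square_integrable h" "(\<lambda>n. l2 (\<lambda>\<xi>. ft s (trunc (real n) f) \<xi> - h \<xi>)) \<longlonglongrightarrow> 0"
  proof (rule l2_complete[where f="\<lambda>n. ft s (trunc (real n) f)"])
    fix e :: real assume "e > 0"
    with lim have "\<forall>\<^sub>F n in sequentially. l2 (\<lambda>x. trunc (real n) f x - f x) < e / 2"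
      by (intro order_tendstoD) auto
    then obtain N where N: "\<And>n. n \<ge> N \<Longrightarrow> l2 (\<lambda>x. trunc (real n) f x - f x) < e / 2"
      by (auto simp: eventually_sequentially)
    show "\<exists>N. \<forall>m\<ge>N. \<forall>n\<ge>N. l2 (\<lambda>x. ft s (trunc (real m) f) x - ft s (trunc (real n) f) x) < e"
    proof (intro exI[of _ N] allI impI)
      fix m n assume "N \<le> m" "N \<le> n"
      then show "l2 (\<lambda>x. ft s (trunc (real m) f) x - ft s (trunc (real n) f) x) < e"
        using le[of "real m" "real n"] N[of m] N[of n] by simp
    qed
  qed (use sq in auto)
  \<comment> \<open>Integer radii produced \<open>h\<close>. Letting \<open>n\<close> tend to
    infinity in the triangle inequality extends the estimate to every real \<open>R\<close>.\<close>
  have bnd: "l2 (\<lambda>\<xi>. ft s (trunc R f) \<xi> - h \<xi>) \<le> l2 (\<lambda>x. trunc R f x - f x)" for R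
  proof -
    have "(\<lambda>n. (l2 (\<lambda>x. trunc R f x - f x) + l2 (\<lambda>x. trunc (real n) f x - f x))
        + l2 (\<lambda>\<xi>. ft s (trunc (real n) f) \<xi> - h \<xi>)) \<longlonglongrightarrow> (l2 (\<lambda>x. trunc R f x - f x) + 0) + 0"
      by (intro tendsto_intros lim h)
    moreover have "l2 (\<lambda>\<xi>. ft s (trunc R f) \<xi> - h \<xi>) \<le> (l2 (\<lambda>x. trunc R f x - f x) + l2 (\<lambda>x. trunc (real n) f x - f x))
        + l2 (\<lambda>\<xi>. ft s (trunc (real n) f) \<xi> - h \<xi>)" for n
      using l2_triangle3[OF sq sq h(1), of R "real n"] le[of R "real n"] by linarith
    ultimately show ?thesis by (intro LIMSEQ_le_const) auto
  qed
  show ?thesis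
  proof (rule that[OF h(1)])
    show "((\<lambda>R. l2 (\<lambda>\<xi>. ft s (trunc R f) \<xi> - h \<xi>)) \<longlongrightarrow> 0) at_top"
      by (rule tendsto_sandwich[OF _ _ tendsto_const l2_trunc[OF f]]) (use bnd in auto)
  qed
qed

lemma nn_l2_tendsto:
  assumes "\<And>i. square_integrable (f i)"
  shows "((\<lambda>i. \<integral>\<^sup>+x. ennreal ((cmod (f i x))\<^sup>2) \<partial>lborel) \<longlongrightarrow> 0) F \<longleftrightarrow> ((\<lambda>i. l2 (f i)) \<longlongrightarrow> 0) F"
proof -
  have "((\<lambda>i. \<integral>\<^sup>+x. ennreal ((cmod (f i x))\<^sup>2) \<partial>lborel) \<longlongrightarrow> 0) F \<longleftrightarrow> ((\<lambda>i. ennreal ((l2 (f i))\<^sup>2)) \<longlongrightarrow> ennreal 0) F"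
    by (simp add: nn_l2[OF assms])
  also have "\<dots> \<longleftrightarrow> ((\<lambda>i. (l2 (f i))\<^sup>2) \<longlongrightarrow> 0) F"
    by (intro tendsto_ennreal_iff) auto
  also have "\<dots> \<longleftrightarrow> ((\<lambda>i. l2 (f i)) \<longlongrightarrow> 0) F"
  proof
    assume "((\<lambda>i. (l2 (f i))\<^sup>2) \<longlongrightarrow> 0) F"
    then have "((\<lambda>i. sqrt ((l2 (f i))\<^sup>2)) \<longlongrightarrow> sqrt 0) F" by (intro tendsto_intros)
    then show "((\<lambda>i. l2 (f i)) \<longlongrightarrow> 0) F" by simp
  next
    assume "((\<lambda>i. l2 (f i)) \<longlongrightarrow> 0) F"
    then have "((\<lambda>i. (l2 (f i))\<^sup>2) \<longlongrightarrow> 0\<^sup>2) F" by (intro tendsto_intros)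
    then show "((\<lambda>i. (l2 (f i))\<^sup>2) \<longlongrightarrow> 0) F" by simp
  qed
  finally show ?thesis .
qed

lemma sqint_ft_trunc: "square_integrable f \<Longrightarrow> \<bar>s\<bar> = 1 \<Longrightarrow> square_integrable (ft s (trunc R f))"
  by (intro bessel(1) integrable_trunc sqint_trunc)

lemma FT_limit:
  assumes f: "square_integrable f" and s: "\<bar>s\<bar> = 1"
  shows sqint_FT: "square_integrable (FT s f)"
    and "((\<lambda>R. l2 (\<lambda>\<xi>. ft s (trunc R f) \<xi> - FT s f \<xi>)) \<longlongrightarrow> 0) at_top"
proof -
  let ?P = "\<lambda>h. square_integrable h \<and>
     ((\<lambda>R. \<integral>\<^sup>+\<xi>. ennreal ((cmod (ft s (trunc R f) \<xi> - h \<xi>))\<^sup>2) \<partial>lborel) \<longlongrightarrow> 0) at_top"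
  have eq: "?P h \<longleftrightarrow> square_integrable h \<and> ((\<lambda>R. l2 (\<lambda>\<xi>. ft s (trunc R f) \<xi> - h \<xi>)) \<longlongrightarrow> 0) at_top" for h
    using nn_l2_tendsto[of "\<lambda>R \<xi>. ft s (trunc R f) \<xi> - h \<xi>" at_top] sqint_diff[OF sqint_ft_trunc[OF f s]] by blast
  have "\<exists>h. ?P h" unfolding eq by (rule FT_exists[OF f s]) blast
  then have "?P (FT s f)" unfolding FT_def by (rule someI_ex)
  then show "square_integrable (FT s f)" "((\<lambda>R. l2 (\<lambda>\<xi>. ft s (trunc R f) \<xi> - FT s f \<xi>)) \<longlongrightarrow> 0) at_top"
    unfolding eq by auto
qed

lemma FT_eqI:
  assumes f: "square_integrable f" and s: "\<bar>s\<bar> = 1" and h: "square_integrable h"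
    and "((\<lambda>R. l2 (\<lambda>\<xi>. ft s (trunc R f) \<xi> - h \<xi>)) \<longlongrightarrow> 0) at_top"
  shows "AE \<xi> in lborel. FT s f \<xi> = h \<xi>"
  by (rule l2_lim_unique[OF sqint_ft_trunc[OF f s] FT_limit(1)[OF f s] h _ FT_limit(2)[OF f s] assms(4)]) simp

lemma FT_cong_AE:
  assumes "AE x in lborel. f x = g x" "f \<in> borel_measurable borel" "g \<in> borel_measurable borel"
  shows "FT s f = FT s g"
proof -
  have [measurable]: "f \<in> borel_measurable borel" "g \<in> borel_measurable borel" by fact+
  have "ft s (trunc R f) \<xi> = ft s (trunc R g) \<xi>" for R \<xi>
    unfolding ft_def using assms(1)
    by (intro arg_cong2[where f="(*)"] refl integral_cong_AE) (auto simp: trunc_def elim!: AE_mp)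
  then show ?thesis by (simp add: FT_def)
qed

lemma FT_diff:
  assumes f: "square_integrable f" and g: "square_integrable g" and s: "\<bar>s\<bar> = 1"
  shows "AE \<xi> in lborel. FT s (\<lambda>x. f x - g x) \<xi> = FT s f \<xi> - FT s g \<xi>"
proof (rule FT_eqI[OF sqint_diff[OF f g] s sqint_diff[OF FT_limit(1)[OF f s] FT_limit(1)[OF g s]]])
  have eq: "ft s (trunc R (\<lambda>x. f x - g x)) \<xi> - (FT s f \<xi> - FT s g \<xi>)
      = (ft s (trunc R f) \<xi> - FT s f \<xi>) - (ft s (trunc R g) \<xi> - FT s g \<xi>)" for R \<xi>
    unfolding trunc_diff ft_diff[OF integrable_trunc[OF f] integrable_trunc[OF g]] by simp
  have lim: "((\<lambda>R. l2 (\<lambda>\<xi>. ft s (trunc R f) \<xi> - FT s f \<xi>) + l2 (\<lambda>\<xi>. ft s (trunc R g) \<xi> - FT s g \<xi>)) \<longlongrightarrow> 0) at_top"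
    using tendsto_add[OF FT_limit(2)[OF f s] FT_limit(2)[OF g s]] by simp
  have le: "norm (l2 (\<lambda>\<xi>. (ft s (trunc R f) \<xi> - FT s f \<xi>) - (ft s (trunc R g) \<xi> - FT s g \<xi>)))
        \<le> l2 (\<lambda>\<xi>. ft s (trunc R f) \<xi> - FT s f \<xi>) + l2 (\<lambda>\<xi>. ft s (trunc R g) \<xi> - FT s g \<xi>)" for R
    unfolding real_norm_def abs_of_nonneg[OF l2_nonneg]
    by (intro l2_triangle_diff sqint_diff sqint_ft_trunc FT_limit(1) f g s)
  show "((\<lambda>R. l2 (\<lambda>\<xi>. ft s (trunc R (\<lambda>x. f x - g x)) \<xi> - (FT s f \<xi> - FT s g \<xi>))) \<longlongrightarrow> 0) at_top"
    unfolding eq using le by (intro Lim_null_comparison[OF always_eventually lim]) simp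
qed

lemma ft_scale: "ft s (\<lambda>x. c * f x) \<xi> = c * ft s f \<xi>"
proof -
  have "(LINT x|lborel. iexp (s * (x * \<xi>)) * (c * f x)) = (LINT x|lborel. c * (iexp (s * (x * \<xi>)) * f x))"
    by (simp only: mult.left_commute)
  also have "\<dots> = c * (LINT x|lborel. iexp (s * (x * \<xi>)) * f x)" by (rule integral_mult_right_zero)
  finally show ?thesis by (simp add: ft_def)
qed

lemma FT_scale:
  assumes f: "square_integrable f" and s: "\<bar>s\<bar> = 1"
  shows "AE \<xi> in lborel. FT s (\<lambda>x. c * f x) \<xi> = c * FT s f \<xi>"
proof (rule FT_eqI[OF sqint_scale[OF f] s sqint_scale[OF FT_limit(1)[OF f s]]])
  have eq: "l2 (\<lambda>\<xi>. ft s (trunc R (\<lambda>x. c * f x)) \<xi> - c * FT s f \<xi>)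
      = cmod c * l2 (\<lambda>\<xi>. ft s (trunc R f) \<xi> - FT s f \<xi>)" for R
    unfolding trunc_scale ft_scale by (simp add: right_diff_distrib[symmetric] l2_scale)
  have "((\<lambda>R. cmod c * l2 (\<lambda>\<xi>. ft s (trunc R f) \<xi> - FT s f \<xi>)) \<longlongrightarrow> cmod c * 0) at_top"
    by (intro tendsto_mult tendsto_const FT_limit f s)
  then show "((\<lambda>R. l2 (\<lambda>\<xi>. ft s (trunc R (\<lambda>x. c * f x)) \<xi> - c * FT s f \<xi>)) \<longlongrightarrow> 0) at_top"
    unfolding eq by simp
qed

lemma FT_add:
  assumes f: "square_integrable f" and g: "square_integrable g" and s: "\<bar>s\<bar> = 1"
  shows "AE \<xi> in lborel. FT s (\<lambda>x. f x + g x) \<xi> = FT s f \<xi> + FT s g \<xi>"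
  using FT_diff[OF f sqint_scale[OF g, of "-1"] s] FT_scale[OF g s, of "-1"] by (auto elim!: AE_mp)

lemma l2_tendsto:
  assumes "\<And>i. square_integrable (f i)" "square_integrable g"
    and "((\<lambda>i. l2 (\<lambda>x. f i x - g x)) \<longlongrightarrow> 0) F"
  shows "((\<lambda>i. l2 (f i)) \<longlongrightarrow> l2 g) F"
proof -
  have "((\<lambda>i. l2 (f i) - l2 g) \<longlongrightarrow> 0) F"
    by (rule Lim_null_comparison[OF _ assms(3)])
       (use l2_rev_triangle[OF assms(1,2)] in auto)
  then show ?thesis by (rule LIM_zero_cancel)
qed

lemma FT_le:
  assumes f: "square_integrable f" and s: "\<bar>s\<bar> = 1"
  shows "l2 (FT s f) \<le> l2 f"
proof (rule tendsto_le)
  show "((\<lambda>R. l2 (trunc R f)) \<longlongrightarrow> l2 f) at_top"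
    by (intro l2_tendsto sqint_trunc f l2_trunc)
  show "((\<lambda>R. l2 (ft s (trunc R f))) \<longlongrightarrow> l2 (FT s f)) at_top"
    by (intro l2_tendsto sqint_ft_trunc FT_limit f s)
  show "\<forall>\<^sub>F R in at_top. l2 (ft s (trunc R f)) \<le> l2 (trunc R f)"
    by (intro always_eventually allI bessel(2) integrable_trunc sqint_trunc f s)
qed simp

text \<open>By Bessel's inequality the transforms of the truncations also approach the plain
  integral, and the L^2 limit is unique.\<close>

lemma FT_integrable:
  assumes fi: "integrable lborel f" and f: "square_integrable f" and s: "\<bar>s\<bar> = 1"
  shows "AE \<xi> in lborel. FT s f \<xi> = ft s f \<xi>"
proof (rule FT_eqI[OF f s bessel(1)[OF fi f s]])
  show "((\<lambda>R. l2 (\<lambda>\<xi>. ft s (trunc R f) \<xi> - ft s f \<xi>)) \<longlongrightarrow> 0) at_top"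
    by (rule tendsto_sandwich[OF _ _ tendsto_const l2_trunc[OF f]])
       (auto intro!: always_eventually bessel_diff integrable_trunc sqint_trunc fi f s)
qed

section \<open>Inversion and Plancherel's identity\<close>

lemma ip_ft:
  assumes f: "integrable lborel f" and g: "integrable lborel g"
  shows "ip (ft s f) g = ip f (ft (- s) g)"
proof -
  have "integrable lborel (\<lambda>x. cnj (g x))" using g by simp
  from ft_mult[OF f this, of s] show ?thesis by (simp add: ip_def cnj_ft)
qed

text \<open>Testing against translated Gaussians, whose inverse transform is explicit, is enough to invert
  the transform on all of $L^2$.\<close>

lemma gauss_test:
  fixes y d s :: real
  assumes s: "\<bar>s\<bar> = 1" and d: "d > 0"
  defines "\<theta> \<equiv> (\<lambda>x. complex_of_real (normal_density y d x))"
  shows "integrable lborel \<theta>" "square_integrable \<theta>" "integrable lborel (ft s \<theta>)" "ft (- s) (ft s \<theta>) = \<theta>"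
proof -
  \<comment> \<open>Up to the factor \<open>1 / sqrt (2 * pi)\<close> this will turn out to be
    \<open>ft s \<theta>\<close>: a wave times an integrable Gaussian, whose transform back is known
    from \<open>gauss_ft_kernel\<close>.\<close>
  define u where "u = (\<lambda>\<xi>. complex_of_real (gauss d \<xi>) * iexp (s * (\<xi> * y)))"
  have nd: "integrable lborel (normal_density y d)" using d by (rule integrable_normal_density)
  then show i: "integrable lborel \<theta>" unfolding \<theta>_def by (rule integrable_of_real)
  show sq: "square_integrable \<theta>"
  proof (rule sqintI_bound[where h="\<lambda>x. 1 / sqrt (2 * pi * d\<^sup>2) * normal_density y d x"])
    have "normal_density y d x \<le> 1 / sqrt (2 * pi * d\<^sup>2)" for x
      unfolding normal_density_def by (rule mult_left_le) auto
    from mult_right_mono[OF this normal_density_nonneg[of y d]]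
    show "AE x in lborel. (cmod (\<theta> x))\<^sup>2 \<le> 1 / sqrt (2 * pi * d\<^sup>2) * normal_density y d x"
      unfolding \<theta>_def norm_of_real power2_abs by (intro AE_I2) (simp only: power2_eq_square)
  qed (use nd in \<open>auto simp: \<theta>_def\<close>)
  have u_eq: "ft (- s) u z = complex_of_real (sqrt (2 * pi)) * \<theta> z" for z
    unfolding u_def \<theta>_def gauss_ft_kernel[OF s d] by simp
  have "ft s \<theta> \<xi> = complex_of_real (1 / sqrt (2 * pi)) * u \<xi>" for \<xi>
  proof -
    have "(LINT x|lborel. iexp (s * (x * \<xi>)) * \<theta> x)
        = (LINT x|lborel. iexp (s * (y * \<xi>)) * (iexp ((s * d * \<xi>) * x) * complex_of_real (std_normal_density x)))"
    proof -
      have "(LINT x|lborel. iexp (s * (x * \<xi>)) * \<theta> x) = d *\<^sub>R (LINT x|lborel. iexp (s * ((y + d * x) * \<xi>)) * \<theta> (y + d * x))"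
        using d by (subst lborel_integral_real_affine[where c=d and t=y]) auto
      also have "\<dots> = (LINT x|lborel. complex_of_real d * (iexp (s * ((y + d * x) * \<xi>)) * \<theta> (y + d * x)))"
        by (simp only: scaleR_conv_of_real integral_mult_right_zero)
      also have "\<dots> = (LINT x|lborel. iexp (s * (y * \<xi>)) * (iexp ((s * d * \<xi>) * x) * complex_of_real (std_normal_density x)))"
      proof (intro Bochner_Integration.integral_cong refl)
        fix x
        have 1: "d * normal_density y d (y + d * x) = std_normal_density x"
          using d by (simp add: normal_density_def power_mult_distrib real_sqrt_mult)
        have 2: "iexp (s * ((y + d * x) * \<xi>)) = iexp (s * (y * \<xi>)) * iexp ((s * d * \<xi>) * x)"
          by (simp add: exp_add[symmetric] algebra_simps)
        show "complex_of_real d * (iexp (s * ((y + d * x) * \<xi>)) * \<theta> (y + d * x))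
            = iexp (s * (y * \<xi>)) * (iexp ((s * d * \<xi>) * x) * complex_of_real (std_normal_density x))"
          unfolding 1[symmetric] 2 \<theta>_def by (simp only: of_real_mult mult_ac)
      qed
      finally show ?thesis .
    qed
    also have "\<dots> = iexp (s * (y * \<xi>)) * (LINT x|lborel. iexp ((s * d * \<xi>) * x) * complex_of_real (std_normal_density x))"
      by (rule integral_mult_right_zero)
    also have "(LINT x|lborel. iexp ((s * d * \<xi>) * x) * complex_of_real (std_normal_density x)) = char std_normal_distribution (s * d * \<xi>)"
      unfolding char_def by (subst integral_density) (auto simp: scaleR_conv_of_real mult.commute)
    also have "\<dots> = complex_of_real (gauss d \<xi>)"
    proof -
      have "(s * d * \<xi>)\<^sup>2 = (d * \<xi>)\<^sup>2"
        using s by (metis abs_mult mult.assoc mult_1 power2_abs)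
      then show ?thesis unfolding char_std_normal_distribution gauss_def by simp
    qed
    finally have "(LINT x|lborel. iexp (s * (x * \<xi>)) * \<theta> x) = u \<xi>"
      by (simp add: u_def mult_ac)
    then show ?thesis by (simp add: ft_def)
  qed
  then have fe: "ft s \<theta> = (\<lambda>\<xi>. complex_of_real (1 / sqrt (2 * pi)) * u \<xi>)" by auto
  show "integrable lborel (ft s \<theta>)"
    unfolding fe u_def by (intro integrable_mult_right gauss_iexp_integrable d)
  show "ft (- s) (ft s \<theta>) = \<theta>"
  proof
    fix z
    show "ft (- s) (ft s \<theta>) z = \<theta> z" unfolding fe ft_scale u_eq by simp
  qed
qed

text \<open>Compact intervals are stable under intersection and generate the Borel sets, so the
  vanishing of the integrals spreads to all of these; \<open>tot\<close> takes care of
  complements.\<close>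

lemma interval_integrals_zero_AE:
  fixes h :: "real \<Rightarrow> complex"
  assumes h: "integrable lborel h" and z: "\<And>a b. (LINT x:{a..b}|lborel. h x) = 0" and tot: "(LINT x|lborel. h x) = 0"
  shows "AE x in lborel. h x = 0"
proof (rule sigma_finite_measure.density_zero[OF lborel.sigma_finite_measure_axioms h])
  fix A :: "real set" assume "A \<in> sets lborel"
  then have A: "A \<in> sigma_sets UNIV (range (\<lambda>(a::real, b). {a..b}))"
    by (simp add: borel_eq_atLeastAtMost)
  have si: "set_integrable lborel B h" if "B \<in> sets borel" for B
    using h that unfolding set_integrable_def by (intro integrable_mult_indicator) auto
  have sb: "B \<in> sets borel" if "B \<in> sigma_sets UNIV (range (\<lambda>(a::real, b). {a..b}))" for B
    using that by (simp add: borel_eq_atLeastAtMost)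
  have "Int_stable (range (\<lambda>(a::real, b). {a..b}))" "range (\<lambda>(a::real, b). {a..b}) \<subseteq> Pow UNIV"
    by (auto simp: Int_stable_def)
  from this A show "set_lebesgue_integral lborel A h = 0"
  proof (induction rule: sigma_sets_induct_disjoint)
    case (basic B) then show ?case using z by auto
  next
    case empty show ?case by (simp add: set_lebesgue_integral_def)
  next
    case (compl B)
    note B = sb[OF compl(1)]
    have "(LINT x:UNIV|lborel. h x) = (LINT x:B|lborel. h x) + (LINT x:(UNIV - B)|lborel. h x)"
      using set_integral_Un[of B "UNIV - B" lborel h] si B by (auto simp: Un_absorb1)
    then show ?case using compl(2) tot by (simp add: set_lebesgue_integral_def)
  next
    case (union B)
    have B: "B i \<in> sets borel" for i using union(2) sb by blast
    have "(LINT x:(\<Union>i. B i)|lborel. h x) = (\<Sum>i. LINT x:B i|lborel. h x)"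
      using union(1) B by (intro lebesgue_integral_countable_add si) (auto simp: disjoint_family_on_def)
    then show ?case using union(3) by simp
  qed
qed

lemma sqint_translate:
  assumes "square_integrable g"
  shows "square_integrable (\<lambda>y. g (y + t))" "l2 (\<lambda>y. g (y + t)) = l2 g"
proof -
  have [measurable]: "g \<in> borel_measurable borel" using assms by measurable
  show "square_integrable (\<lambda>y. g (y + t))"
    using lborel_integrable_real_affine[OF sqint_integrable[OF assms], of 1 t]
    by (simp add: square_integrable_def add.commute)
  show "l2 (\<lambda>y. g (y + t)) = l2 g"
    unfolding l2_def
    by (subst (2) lborel_integral_real_affine[where c=1 and t=t]) (auto simp: add.commute)
qed

text \<open>Averaging the test integrals over \<open>y\<close> in an interval replaces pointwise
  approximation. Fubini's theorem turns them into Gaussian means of \<open>\<Gamma>\<close>, where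
  \<open>\<Gamma> t\<close> is the integral of \<open>g\<close> over the interval shifted by
  \<open>t\<close>. As \<open>\<Gamma>\<close> is continuous at 0, letting \<open>d\<close> tend to
  0 yields the integral over the interval itself.\<close>

lemma gauss_test_zero:
  assumes g: "square_integrable g"
    and z: "\<And>y d. d > 0 \<Longrightarrow> (LINT x|lborel. g x * complex_of_real (normal_density y d x)) = 0"
  shows "AE x in lborel. g x = 0"
proof -
  have [measurable]: "g \<in> borel_measurable borel" using g by measurable
  have key: "(LINT x:{a..b}|lborel. g x) = 0" for a b
  proof -
    define I where "I y = complex_of_real (indicator {a..b::real} y)" for y
    have [measurable]: "I \<in> borel_measurable borel" unfolding I_def by measurable
    have I: "square_integrable I" unfolding I_def[abs_def] by (rule sqint_indicator)
    define \<Gamma> where "\<Gamma> t = (LINT y|lborel. I y * g (y + t))" for t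
    define B where "B = l2 I * l2 g"
    have nint: "integrable lborel (\<lambda>y. I y * g (y + t))" for t
      by (intro sqint_prod_integrable I sqint_translate g)
    have Bnd: "(LINT y|lborel. cmod (I y * g (y + t))) \<le> B" for t
      using l2_cauchy_schwarz_abs[OF I sqint_translate(1)[OF g, of t]]
      by (simp add: B_def sqint_translate(2)[OF g] norm_mult)
    have \<Gamma>B: "cmod (\<Gamma> t) \<le> B" for t
      unfolding \<Gamma>_def by (rule order_trans[OF integral_norm_bound Bnd])
    have [measurable]: "\<Gamma> \<in> borel_measurable borel"
      unfolding \<Gamma>_def by measurable
    have sn: "integrable lborel std_normal_density" by simp
    have \<Gamma>0: "(LINT z|lborel. complex_of_real (std_normal_density z) * \<Gamma> (d * z)) = 0" if d: "d > 0" for d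
    proof -
      have inner: "(LINT z|lborel. complex_of_real (std_normal_density z) * g (y + d * z)) = 0" for y
      proof -
        have "(LINT x|lborel. g x * complex_of_real (normal_density y d x))
            = d *\<^sub>R (LINT z|lborel. g (y + d * z) * complex_of_real (normal_density y d (y + d * z)))"
          using d by (subst lborel_integral_real_affine[where c=d and t=y]) auto
        also have "\<dots> = (LINT z|lborel. complex_of_real d * (g (y + d * z) * complex_of_real (normal_density y d (y + d * z))))"
          by (simp only: scaleR_conv_of_real integral_mult_right_zero)
        also have "\<dots> = (LINT z|lborel. complex_of_real (std_normal_density z) * g (y + d * z))"
        proof (intro Bochner_Integration.integral_cong refl)
          fix z
          have nd: "d * normal_density y d (y + d * z) = std_normal_density z"
            using d by (simp add: normal_density_def power_mult_distrib real_sqrt_mult)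
          show "complex_of_real d * (g (y + d * z) * complex_of_real (normal_density y d (y + d * z)))
              = complex_of_real (std_normal_density z) * g (y + d * z)"
            unfolding nd[symmetric] of_real_mult by (simp only: mult_ac)
        qed
        finally show ?thesis using z[OF d, of y] by simp
      qed
      have int: "integrable (lborel \<Otimes>\<^sub>M lborel) (\<lambda>(z, y). complex_of_real (std_normal_density z) * (I y * g (y + d * z)))"
      proof (rule lborel_pair.Fubini_integrable)
        show "AE z in lborel. integrable lborel (\<lambda>y. case (z, y) of (z, y) \<Rightarrow> complex_of_real (std_normal_density z) * (I y * g (y + d * z)))"
          using nint by simp
        have m: "(\<lambda>z. LINT y|lborel. cmod (I y * g (y + d * z))) \<in> borel_measurable borel" by measurable
        have "integrable lborel (\<lambda>z. std_normal_density z * (LINT y|lborel. cmod (I y * g (y + d * z))))"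
        proof (rule Bochner_Integration.integrable_bound)
          show "integrable lborel (\<lambda>z. B * std_normal_density z)" using sn by (rule integrable_mult_right)
          show "AE z in lborel. norm (std_normal_density z * (LINT y|lborel. cmod (I y * g (y + d * z)))) \<le> norm (B * std_normal_density z)"
          proof (intro AE_I2)
            fix z
            have "0 \<le> (LINT y|lborel. cmod (I y * g (y + d * z)))" "(LINT y|lborel. cmod (I y * g (y + d * z))) \<le> \<bar>B\<bar>"
              using Bnd[of "d * z"] by (auto intro: order_trans)
            then show "norm (std_normal_density z * (LINT y|lborel. cmod (I y * g (y + d * z)))) \<le> norm (B * std_normal_density z)"
              by (simp add: abs_mult mult.commute[of "\<bar>B\<bar>"] mult_left_mono)
          qed
        qed (use m in simp)
        then show "integrable lborel (\<lambda>z. LINT y|lborel. norm (case (z, y) of (z, y) \<Rightarrow> complex_of_real (std_normal_density z) * (I y * g (y + d * z))))"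
          by (simp add: norm_mult)
      qed measurable
      have "(LINT z|lborel. complex_of_real (std_normal_density z) * \<Gamma> (d * z))
          = (LINT z|lborel. LINT y|lborel. complex_of_real (std_normal_density z) * (I y * g (y + d * z)))"
        unfolding \<Gamma>_def by simp
      also have "\<dots> = (LINT y|lborel. LINT z|lborel. complex_of_real (std_normal_density z) * (I y * g (y + d * z)))"
        using lborel_pair.Fubini_integral[OF int] by simp
      also have "\<dots> = (LINT y|lborel. I y * (LINT z|lborel. complex_of_real (std_normal_density z) * g (y + d * z)))"
        by (simp add: mult.left_commute)
      also have "\<dots> = 0" unfolding inner by simp
      finally show ?thesis .
    qed
    have cont: "(\<lambda>n. \<Gamma> (t n)) \<longlonglongrightarrow> \<Gamma> 0" if t: "t \<longlonglongrightarrow> 0" for t :: "nat \<Rightarrow> real"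
    proof -
      have eq: "\<Gamma> s = (LINT x|lborel. complex_of_real (indicator {a + s..b + s} x) * g x)" for s
        unfolding \<Gamma>_def I_def
        by (subst lborel_integral_real_affine[where c=1 and t="-s"])
           (auto simp: indicator_def intro!: Bochner_Integration.integral_cong)
      have ev: "\<forall>\<^sub>F n in sequentially. \<bar>t n\<bar> < 1" using t by (intro order_tendstoD) (auto intro: tendsto_rabs_zero)
      then obtain N where N: "\<And>n. n \<ge> N \<Longrightarrow> \<bar>t n\<bar> < 1" by (auto simp: eventually_sequentially)
      have "(\<lambda>n. LINT x|lborel. complex_of_real (indicator {a + t (n + N)..b + t (n + N)} x) * g x)
          \<longlonglongrightarrow> (LINT x|lborel. complex_of_real (indicator {a + 0..b + 0} x) * g x)"
      proof (rule integral_dominated_convergence)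
        show "integrable lborel (\<lambda>x. cmod (complex_of_real (indicator {a - 1..b + 1} x) * g x))"
          by (intro integrable_norm sqint_prod_integrable sqint_indicator g)
        show "AE x in lborel. cmod (complex_of_real (indicator {a + t (n + N)..b + t (n + N)} x) * g x)
            \<le> cmod (complex_of_real (indicator {a - 1..b + 1} x) * g x)" for n
        proof (rule AE_I2)
          fix x show "cmod (complex_of_real (indicator {a + t (n + N)..b + t (n + N)} x) * g x)
            \<le> cmod (complex_of_real (indicator {a - 1..b + 1} x) * g x)"
            using N[of "n + N"] by (auto simp: indicator_def)
        qed
        \<comment> \<open>Away from the two end points the indicator of the shifted interval is
          eventually constant.\<close>
        have "AE x in lborel. x \<noteq> a" "AE x in lborel. x \<noteq> b" by (rule AE_lborel_singleton)+
        then show "AE x in lborel. (\<lambda>n. complex_of_real (indicator {a + t (n + N)..b + t (n + N)} x) * g x)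
            \<longlonglongrightarrow> complex_of_real (indicator {a + 0..b + 0} x) * g x"
        proof eventually_elim
          case (elim x)
          define e where "e = min \<bar>x - a\<bar> \<bar>x - b\<bar>"
          have "e > 0" using elim by (simp add: e_def)
          moreover have "(\<lambda>n. \<bar>t (n + N)\<bar>) \<longlonglongrightarrow> 0" using LIMSEQ_ignore_initial_segment[OF t] by (rule tendsto_rabs_zero)
          ultimately have "\<forall>\<^sub>F n in sequentially. \<bar>t (n + N)\<bar> < e" by (intro order_tendstoD)
          then have "\<forall>\<^sub>F n in sequentially. complex_of_real (indicator {a + t (n + N)..b + t (n + N)} x) * g x
              = complex_of_real (indicator {a + 0..b + 0} x) * g x"
            by eventually_elim (auto simp: indicator_def e_def abs_real_def split: if_splits)
          then show ?case by (rule tendsto_eventually)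
        qed
      qed measurable
      then have "(\<lambda>n. \<Gamma> (t (n + N))) \<longlonglongrightarrow> \<Gamma> 0" unfolding eq .
      then show ?thesis by (rule LIMSEQ_offset)
    qed
    have "(\<lambda>n. LINT z|lborel. complex_of_real (std_normal_density z) * \<Gamma> (1 / real (Suc n) * z))
        \<longlonglongrightarrow> (LINT z|lborel. complex_of_real (std_normal_density z) * \<Gamma> 0)"
    proof (rule integral_dominated_convergence)
      show "integrable lborel (\<lambda>z. B * std_normal_density z)" using sn by (rule integrable_mult_right)
      show "AE z in lborel. cmod (complex_of_real (std_normal_density z) * \<Gamma> (1 / real (Suc n) * z)) \<le> B * std_normal_density z" for n
        using \<Gamma>B by (intro AE_I2) (simp add: norm_mult mult.commute[of B] mult_left_mono)
      show "AE z in lborel. (\<lambda>n. complex_of_real (std_normal_density z) * \<Gamma> (1 / real (Suc n) * z)) \<longlonglongrightarrow> complex_of_real (std_normal_density z) * \<Gamma> 0"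
      proof (intro AE_I2 tendsto_intros cont)
        fix z :: real
        have "(\<lambda>n. 1 / real (Suc n)) \<longlonglongrightarrow> 0" using LIMSEQ_inverse_real_of_nat by (simp add: inverse_eq_divide)
        from tendsto_mult_left[OF this, of z] show "(\<lambda>n. 1 / real (Suc n) * z) \<longlonglongrightarrow> 0" by (simp add: mult.commute)
      qed
    qed measurable
    moreover have "(LINT z|lborel. complex_of_real (std_normal_density z) * \<Gamma> (1 / real (Suc n) * z)) = 0" for n
      by (rule \<Gamma>0) simp
    moreover have "(LINT z|lborel. complex_of_real (std_normal_density z) * \<Gamma> 0) = \<Gamma> 0"
      by (simp only: integral_mult_left_zero integral_complex_of_real) simp
    ultimately have "\<Gamma> 0 = 0" by (simp add: LIMSEQ_const_iff)
    then show ?thesis by (simp add: \<Gamma>_def I_def set_lebesgue_integral_def scaleR_conv_of_real)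
  qed
  \<comment> \<open>\<open>g\<close> is only square integrable, so the criterion for integrable
    functions is applied to its truncations.\<close>
  have "AE x in lborel. trunc (real n) g x = 0" for n
  proof (rule interval_integrals_zero_AE[OF integrable_trunc[OF g]])
    fix a b
    have "(LINT x:{a..b}|lborel. trunc (real n) g x) = (LINT x:{max a (- real n)..min b (real n)}|lborel. g x)"
      unfolding set_lebesgue_integral_def trunc_def
      by (intro Bochner_Integration.integral_cong refl) (auto simp: indicator_def)
    then show "(LINT x:{a..b}|lborel. trunc (real n) g x) = 0" using key by simp
  next
    show "(LINT x|lborel. trunc (real n) g x) = 0"
      using key[of "- real n" "real n"] by (simp add: trunc_def[abs_def] set_lebesgue_integral_def)
  qed
  then have "AE x in lborel. \<forall>n. trunc (real n) g x = 0" by (simp add: AE_all_countable)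
  then show ?thesis
  proof eventually_elim
    case (elim x)
    obtain n where "\<bar>x\<bar> \<le> real n" using real_arch_simple by blast
    then show ?case using elim[rule_format, of n] by (auto simp: trunc_def indicator_def abs_le_iff split: if_splits)
  qed
qed

text \<open>By duality both transforms are moved onto a Gaussian test function, where inversion is
  explicit. Hence the difference of the two sides is orthogonal to all such test functions.\<close>

lemma FT_inverse:
  assumes f: "square_integrable f" and s: "\<bar>s\<bar> = 1"
  shows "AE x in lborel. FT (- s) (FT s f) x = f x"
proof -
  have ms: "\<bar>- s\<bar> = 1" using s by simp
  note sqf = sqint_FT[OF f s] and sqff = sqint_FT[OF sqint_FT[OF f s] ms]
  have "AE x in lborel. FT (- s) (FT s f) x - f x = 0"
  proof (rule gauss_test_zero)
    show "square_integrable (\<lambda>x. FT (- s) (FT s f) x - f x)" by (rule sqint_diff[OF sqff f])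
    fix y d :: real assume d: "d > 0"
    define \<theta> where "\<theta> = (\<lambda>x. complex_of_real (normal_density y d x))"
    note t = gauss_test[OF s d, of y, folded \<theta>_def]
    have ft2: "square_integrable (ft s \<theta>)" by (rule bessel(1)[OF t(1,2) s])
    have "ip (FT (- s) (FT s f)) \<theta> = ip (FT s f) (ft s \<theta>)"
    proof (rule tendsto_unique)
      show "((\<lambda>R. ip (ft (- s) (trunc R (FT s f))) \<theta>) \<longlongrightarrow> ip (FT (- s) (FT s f)) \<theta>) at_top"
        by (intro ip_lim sqint_ft_trunc sqf sqff ms t FT_limit(2))
      have "((\<lambda>R. ip (trunc R (FT s f)) (ft s \<theta>)) \<longlongrightarrow> ip (FT s f) (ft s \<theta>)) at_top"
        by (intro ip_lim sqint_trunc sqf ft2 l2_trunc)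
      then show "((\<lambda>R. ip (ft (- s) (trunc R (FT s f))) \<theta>) \<longlongrightarrow> ip (FT s f) (ft s \<theta>)) at_top"
        by (simp add: ip_ft[OF integrable_trunc[OF sqf] t(1)])
    qed simp
    also have "ip (FT s f) (ft s \<theta>) = ip f \<theta>"
    proof (rule tendsto_unique)
      show "((\<lambda>R. ip (ft s (trunc R f)) (ft s \<theta>)) \<longlongrightarrow> ip (FT s f) (ft s \<theta>)) at_top"
        by (intro ip_lim sqint_ft_trunc f sqf s ft2 FT_limit(2))
      have "((\<lambda>R. ip (trunc R f) \<theta>) \<longlongrightarrow> ip f \<theta>) at_top"
        by (intro ip_lim sqint_trunc f t l2_trunc)
      then show "((\<lambda>R. ip (ft s (trunc R f)) (ft s \<theta>)) \<longlongrightarrow> ip f \<theta>) at_top"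
        by (simp add: ip_ft[OF integrable_trunc[OF f] t(3)] t(4))
    qed simp
    finally have "ip (\<lambda>x. FT (- s) (FT s f) x - f x) \<theta> = 0"
      using ip_diff_left[OF sqff f t(2)] by simp
    then show "(LINT x|lborel. (FT (- s) (FT s f) x - f x) * complex_of_real (normal_density y d x)) = 0"
      by (simp add: ip_def \<theta>_def)
  qed
  then show ?thesis by simp
qed

text \<open>One inequality is Bessel's; the other is Bessel's for the opposite sign, applied to the
  transform, together with inversion.\<close>

lemma plancherel:
  assumes f: "square_integrable f" and s: "\<bar>s\<bar> = 1"
  shows "l2 (FT s f) = l2 f"
proof (rule antisym[OF FT_le[OF f s]])
  have ms: "\<bar>- s\<bar> = 1" using s by simp
  note sqf = sqint_FT[OF f s] and sqff = sqint_FT[OF sqint_FT[OF f s] ms]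
  have "l2 f = l2 (FT (- s) (FT s f))"
    using FT_inverse[OF f s] sqff f by (intro l2_cong_AE) auto
  also have "\<dots> \<le> l2 (FT s f)" by (rule FT_le[OF sqf ms])
  finally show "l2 f \<le> l2 (FT s f)" .
qed

section \<open>Weighted spaces\<close>

lemma bracket_ge_1: "1 \<le> bracket \<xi>"
  by (simp add: bracket_def)

lemma bracket_pos: "0 < bracket \<xi>"
  using bracket_ge_1[of \<xi>] by linarith

lemma bracket_measurable [measurable]: "bracket \<in> borel_measurable borel"
  unfolding bracket_def[abs_def] by measurable

lemma bracket_sq: "(bracket \<xi>)\<^sup>2 = 1 + \<xi>\<^sup>2"
  by (simp add: bracket_def)

lemma abs_le_bracket: "\<bar>\<xi>\<bar> \<le> bracket \<xi>"
  unfolding bracket_def by (rule real_le_rsqrt) simp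

lemma bracket_minus: "bracket (- \<xi>) = bracket \<xi>"
  by (simp add: bracket_def)

text \<open>This makes the exponential weight submultiplicative, on which the algebra property
  rests.\<close>

lemma bracket_add: "bracket (a + b) \<le> bracket a + bracket b"
proof (rule power2_le_imp_le)
  have "a * b \<le> bracket a * bracket b"
    using mult_mono[OF abs_le_bracket[of a] abs_le_bracket[of b]] bracket_pos[of a]
    by (simp add: abs_mult[symmetric])
  then show "(bracket (a + b))\<^sup>2 \<le> (bracket a + bracket b)\<^sup>2"
    by (simp add: power2_sum bracket_sq)
qed (use bracket_pos[of a] bracket_pos[of b] in simp)

text \<open>The square root of the density in \<open>hnorm2\<close>, so that
  \<open>hnorm w k\<close> becomes the L^2 norm of the transform multiplied by it.\<close>

definition wt :: "real \<Rightarrow> real \<Rightarrow> real \<Rightarrow> real" where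
  "wt w k \<xi> = bracket \<xi> powr k * exp (w * bracket \<xi>)"

definition wmul :: "real \<Rightarrow> real \<Rightarrow> (real \<Rightarrow> complex) \<Rightarrow> real \<Rightarrow> complex" where
  "wmul w k \<Psi> \<xi> = complex_of_real (wt w k \<xi>) * \<Psi> \<xi>"

lemma wt_pos: "0 < wt w k \<xi>"
  using bracket_pos[of \<xi>] by (simp add: wt_def)

lemma wt_measurable [measurable]: "wt w k \<in> borel_measurable borel"
  unfolding wt_def[abs_def] by measurable

lemma wmul_measurable [measurable]:
  "\<Psi> \<in> borel_measurable borel \<Longrightarrow> wmul w k \<Psi> \<in> borel_measurable borel"
  unfolding wmul_def[abs_def] by measurable

lemma wt_mono: "w \<le> w' \<Longrightarrow> k \<le> k' \<Longrightarrow> wt w k \<xi> \<le> wt w' k' \<xi>"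
  unfolding wt_def using bracket_ge_1[of \<xi>] bracket_pos[of \<xi>]
  by (intro mult_mono powr_mono) auto

lemma wt_ge_1: "0 \<le> w \<Longrightarrow> 0 \<le> k \<Longrightarrow> 1 \<le> wt w k \<xi>"
  using wt_mono[of 0 w 0 k \<xi>] bracket_pos[of \<xi>] by (simp add: wt_def)

lemma wt_mult: "wt w k \<xi> * wt w' k' \<xi> = wt (w + w') (k + k') \<xi>"
  unfolding wt_def powr_add distrib_right exp_add by (simp only: mult_ac)

lemma wt_even: "wt w k (- \<xi>) = wt w k \<xi>"
  by (simp add: wt_def bracket_minus)

lemma cmod_wmul: "cmod (wmul w k \<Psi> \<xi>) = wt w k \<xi> * cmod (\<Psi> \<xi>)"
  using wt_pos[of w k \<xi>] by (simp add: wmul_def norm_mult)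

section \<open>Linear structure and monotonicity of the weighted spaces\<close>

lemma sqint_fourier: "square_integrable \<psi> \<Longrightarrow> square_integrable (fourier \<psi>)"
  unfolding fourier_eq_FT by (rule sqint_FT) auto

lemma l2_fourier: "square_integrable \<psi> \<Longrightarrow> l2 (fourier \<psi>) = l2 \<psi>"
  unfolding fourier_eq_FT by (rule plancherel) auto

lemma fourier_diff: "square_integrable f \<Longrightarrow> square_integrable g \<Longrightarrow>
    AE \<xi> in lborel. fourier (\<lambda>x. f x - g x) \<xi> = fourier f \<xi> - fourier g \<xi>"
  unfolding fourier_eq_FT by (rule FT_diff) auto

lemma fourier_add: "square_integrable f \<Longrightarrow> square_integrable g \<Longrightarrow>
    AE \<xi> in lborel. fourier (\<lambda>x. f x + g x) \<xi> = fourier f \<xi> + fourier g \<xi>"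
  unfolding fourier_eq_FT by (rule FT_add) auto

lemma fourier_scale: "square_integrable f \<Longrightarrow>
    AE \<xi> in lborel. fourier (\<lambda>x. c * f x) \<xi> = c * fourier f \<xi>"
  unfolding fourier_eq_FT by (rule FT_scale) auto

lemma fourier_inv_fourier: "square_integrable f \<Longrightarrow> AE \<xi> in lborel. fourier (inv_fourier f) \<xi> = f \<xi>"
  unfolding fourier_eq_FT inv_fourier_eq_FT using FT_inverse[of f 1] by simp

lemma inv_fourier_fourier: "square_integrable f \<Longrightarrow> AE \<xi> in lborel. inv_fourier (fourier f) \<xi> = f \<xi>"
  unfolding fourier_eq_FT inv_fourier_eq_FT using FT_inverse[of f "-1"] by simp

lemma hnorm2_wmul:
  "hnorm2 w k \<psi> = (\<integral>\<^sup>+\<xi>. ennreal ((cmod (wmul w k (fourier \<psi>) \<xi>))\<^sup>2) \<partial>lborel)"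
proof -
  have "bracket \<xi> powr (2 * k) * exp (2 * w * bracket \<xi>) = (wt w k \<xi>)\<^sup>2" for \<xi>
    using wt_mult[of w k \<xi> w k] by (simp add: power2_eq_square wt_def)
  then show ?thesis by (simp add: hnorm2_def cmod_wmul power_mult_distrib)
qed

lemma hspace_iff: "\<psi> \<in> hspace w k \<longleftrightarrow> square_integrable \<psi> \<and> square_integrable (wmul w k (fourier \<psi>))"
proof (cases "square_integrable \<psi>")
  case True
  then have [measurable]: "fourier \<psi> \<in> borel_measurable borel" by (intro sqint_measurable sqint_fourier)
  show ?thesis using True by (simp add: hspace_def hnorm2_wmul sqint_iff_nn[of "wmul w k (fourier \<psi>)"])
qed (simp add: hspace_def)

lemma hspaceD:
  assumes "\<psi> \<in> hspace w k"
  shows "square_integrable \<psi>" "square_integrable (wmul w k (fourier \<psi>))" "fourier \<psi> \<in> borel_measurable borel"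
  using assms sqint_measurable[OF sqint_fourier[of \<psi>]] by (auto simp: hspace_iff)

lemma hnorm_eq:
  assumes "\<psi> \<in> hspace w k"
  shows "hnorm w k \<psi> = l2 (wmul w k (fourier \<psi>))"
  using hspaceD(2)[OF assms] by (simp add: hnorm_def hnorm2_wmul nn_l2)

lemma hnorm_nonneg [simp]: "0 \<le> hnorm w k \<psi>"
  by (simp add: hnorm_def)

lemma hspace_cong_AE:
  assumes "AE x in lborel. f x = g x" "f \<in> borel_measurable borel" "g \<in> borel_measurable borel"
  shows "fourier f = fourier g" "hnorm w k f = hnorm w k g" "f \<in> hspace w k \<Longrightarrow> g \<in> hspace w k"
proof -
  show 1: "fourier f = fourier g" unfolding fourier_eq_FT by (rule FT_cong_AE[OF assms])
  show "hnorm w k f = hnorm w k g" unfolding hnorm_def hnorm2_def 1 ..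
  show "f \<in> hspace w k \<Longrightarrow> g \<in> hspace w k"
    using sqint_cong_AE[OF _ assms(1,3)] by (auto simp: hspace_iff 1)
qed

lemma hspace_mono:
  assumes "\<psi> \<in> hspace w' k'" "w \<le> w'" "k \<le> k'"
  shows "\<psi> \<in> hspace w k" "hnorm w k \<psi> \<le> hnorm w' k' \<psi>"
proof -
  note D = hspaceD[OF assms(1)]
  note [measurable] = D(3)
  have le: "AE \<xi> in lborel. cmod (wmul w k (fourier \<psi>) \<xi>) \<le> cmod (wmul w' k' (fourier \<psi>) \<xi>)"
    unfolding cmod_wmul by (intro AE_I2 mult_right_mono wt_mono assms) auto
  show h: "\<psi> \<in> hspace w k"
    using D(1) l2_mono(2)[OF D(2) _ le] by (simp add: hspace_iff)
  show "hnorm w k \<psi> \<le> hnorm w' k' \<psi>"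
    unfolding hnorm_eq[OF h] hnorm_eq[OF assms(1)] by (rule l2_mono(1)[OF D(2) _ le]) simp
qed

lemma wmul_AE_add:
  assumes "AE \<xi> in lborel. F \<xi> = G \<xi> + H \<xi>"
  shows "AE \<xi> in lborel. wmul w k F \<xi> = wmul w k G \<xi> + wmul w k H \<xi>"
  using assms by (auto elim!: AE_mp simp: wmul_def distrib_left)

lemma wmul_AE_diff:
  assumes "AE \<xi> in lborel. F \<xi> = G \<xi> - H \<xi>"
  shows "AE \<xi> in lborel. wmul w k F \<xi> = wmul w k G \<xi> - wmul w k H \<xi>"
  using assms by (auto elim!: AE_mp simp: wmul_def right_diff_distrib)

lemma wmul_AE_scale:
  assumes "AE \<xi> in lborel. F \<xi> = c * G \<xi>"
  shows "AE \<xi> in lborel. wmul w k F \<xi> = c * wmul w k G \<xi>"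
  using assms by (auto elim!: AE_mp simp: wmul_def)

lemma hspace_add:
  assumes f: "f \<in> hspace w k" and g: "g \<in> hspace w k"
  shows "(\<lambda>x. f x + g x) \<in> hspace w k" "hnorm w k (\<lambda>x. f x + g x) \<le> hnorm w k f + hnorm w k g"
proof -
  note F = hspaceD[OF f] and G = hspaceD[OF g]
  have s: "square_integrable (\<lambda>x. f x + g x)" by (rule sqint_add[OF F(1) G(1)])
  have [measurable]: "fourier (\<lambda>x. f x + g x) \<in> borel_measurable borel"
    by (intro sqint_measurable sqint_fourier s)
  have ae: "AE \<xi> in lborel. wmul w k (fourier (\<lambda>x. f x + g x)) \<xi> = wmul w k (fourier f) \<xi> + wmul w k (fourier g) \<xi>"
    by (intro wmul_AE_add fourier_add F(1) G(1))
  have s2: "square_integrable (\<lambda>\<xi>. wmul w k (fourier f) \<xi> + wmul w k (fourier g) \<xi>)" by (rule sqint_add[OF F(2) G(2)])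
  have "square_integrable (wmul w k (fourier (\<lambda>x. f x + g x)))"
    by (rule sqint_cong_AE[OF s2]) (use ae in auto)
  then show h: "(\<lambda>x. f x + g x) \<in> hspace w k" using s by (simp add: hspace_iff)
  have "hnorm w k (\<lambda>x. f x + g x) = l2 (\<lambda>\<xi>. wmul w k (fourier f) \<xi> + wmul w k (fourier g) \<xi>)"
    unfolding hnorm_eq[OF h] by (intro l2_cong_AE ae sqint_measurable[OF s2]) simp
  then show "hnorm w k (\<lambda>x. f x + g x) \<le> hnorm w k f + hnorm w k g"
    unfolding hnorm_eq[OF f] hnorm_eq[OF g] using l2_triangle[OF F(2) G(2)] by simp
qed

lemma hspace_scale:
  assumes f: "f \<in> hspace w k"
  shows "(\<lambda>x. c * f x) \<in> hspace w k" "hnorm w k (\<lambda>x. c * f x) = cmod c * hnorm w k f"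
proof -
  note F = hspaceD[OF f]
  have s: "square_integrable (\<lambda>x. c * f x)" by (rule sqint_scale[OF F(1)])
  have [measurable]: "fourier (\<lambda>x. c * f x) \<in> borel_measurable borel"
    by (intro sqint_measurable sqint_fourier s)
  have ae: "AE \<xi> in lborel. wmul w k (fourier (\<lambda>x. c * f x)) \<xi> = c * wmul w k (fourier f) \<xi>"
    by (intro wmul_AE_scale fourier_scale F(1))
  have s2: "square_integrable (\<lambda>\<xi>. c * wmul w k (fourier f) \<xi>)" by (rule sqint_scale[OF F(2)])
  have "square_integrable (wmul w k (fourier (\<lambda>x. c * f x)))"
    by (rule sqint_cong_AE[OF s2]) (use ae in auto)
  then show h: "(\<lambda>x. c * f x) \<in> hspace w k" using s by (simp add: hspace_iff)
  have "hnorm w k (\<lambda>x. c * f x) = l2 (\<lambda>\<xi>. c * wmul w k (fourier f) \<xi>)"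
    unfolding hnorm_eq[OF h] by (intro l2_cong_AE ae sqint_measurable[OF s2]) simp
  then show "hnorm w k (\<lambda>x. c * f x) = cmod c * hnorm w k f"
    unfolding hnorm_eq[OF f] l2_scale .
qed

lemma hspace_diff:
  assumes f: "f \<in> hspace w k" and g: "g \<in> hspace w k"
  shows "(\<lambda>x. f x - g x) \<in> hspace w k" "hnorm w k (\<lambda>x. f x - g x) \<le> hnorm w k f + hnorm w k g"
  using hspace_add[OF f hspace_scale(1)[OF g, of "-1"]] hspace_scale(2)[OF g, of "-1"] by simp_all

lemma hspace_zero: "(\<lambda>x. 0) \<in> hspace w k" "hnorm w k (\<lambda>x. 0) = 0"
proof -
  have ae: "AE \<xi> in lborel. wmul w k (fourier (\<lambda>x. 0)) \<xi> = 0"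
    using wmul_AE_scale[OF fourier_scale[OF sqint_zero, of 0]] by simp
  have [measurable]: "fourier (\<lambda>x. 0) \<in> borel_measurable borel"
    by (intro sqint_measurable sqint_fourier sqint_zero)
  have "square_integrable (wmul w k (fourier (\<lambda>x. 0)))"
    by (rule sqint_cong_AE[OF sqint_zero]) (use ae in auto)
  then show h: "(\<lambda>x. 0) \<in> hspace w k" using sqint_zero by (simp add: hspace_iff)
  show "hnorm w k (\<lambda>x. 0) = 0"
    unfolding hnorm_eq[OF h] using l2_cong_AE[OF ae] by simp
qed

section \<open>Integrable transforms and continuous representatives\<close>

lemma sqint_inverse_bracket: "square_integrable (\<lambda>\<xi>. complex_of_real (1 / bracket \<xi>))"
proof -
  have "(cmod (complex_of_real (1 / bracket \<xi>)))\<^sup>2 = inverse (1 + \<xi>\<^sup>2)" for \<xi>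
    by (simp only: norm_of_real power2_abs power_divide bracket_sq power_one inverse_eq_divide)
  then show ?thesis
    using integrable_inverse_1_plus_square by (simp add: square_integrable_def set_integrable_def)
qed

definition Cb :: real where "Cb = l2 (\<lambda>\<xi>. complex_of_real (1 / bracket \<xi>))"

lemma Cb_nonneg: "0 \<le> Cb" by (simp add: Cb_def)

text \<open>Cauchy-Schwarz against the square integrable function \<open>1 / bracket\<close>: giving
  up one order makes the weighted transform integrable, at the cost of \<open>Cb\<close>.\<close>

lemma weighted_L1:
  assumes sq: "square_integrable (wmul w k \<Psi>)" and k: "1 \<le> k" and [measurable]: "\<Psi> \<in> borel_measurable borel"
  shows "integrable lborel (\<lambda>\<xi>. wt w (k - 1) \<xi> * cmod (\<Psi> \<xi>))"
    "(LINT \<xi>|lborel. wt w (k - 1) \<xi> * cmod (\<Psi> \<xi>)) \<le> Cb * l2 (wmul w k \<Psi>)"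
proof -
  have eq: "cmod (complex_of_real (1 / bracket \<xi>)) * cmod (wmul w k \<Psi> \<xi>) = wt w (k - 1) \<xi> * cmod (\<Psi> \<xi>)" for \<xi>
  proof -
    have "bracket \<xi> powr k = bracket \<xi> * bracket \<xi> powr (k - 1)"
      using powr_add[of "bracket \<xi>" 1 "k - 1"] bracket_pos[of \<xi>] by simp
    then have "wt w k \<xi> = bracket \<xi> * wt w (k - 1) \<xi>" by (simp add: wt_def)
    then show ?thesis using bracket_pos[of \<xi>] by (simp add: cmod_wmul norm_divide)
  qed
  show "integrable lborel (\<lambda>\<xi>. wt w (k - 1) \<xi> * cmod (\<Psi> \<xi>))"
    using integrable_norm[OF sqint_prod_integrable[OF sqint_inverse_bracket sq]]
    unfolding norm_mult eq .
  show "(LINT \<xi>|lborel. wt w (k - 1) \<xi> * cmod (\<Psi> \<xi>)) \<le> Cb * l2 (wmul w k \<Psi>)"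
    using l2_cauchy_schwarz_abs[OF sqint_inverse_bracket sq] unfolding eq Cb_def .
qed

lemma wmul_L1:
  assumes sq: "square_integrable (wmul w k \<Psi>)" and k: "1 \<le> k" and w: "0 \<le> w" and [measurable]: "\<Psi> \<in> borel_measurable borel"
  shows "integrable lborel \<Psi>" "(LINT \<xi>|lborel. cmod (\<Psi> \<xi>)) \<le> Cb * l2 (wmul w k \<Psi>)" "square_integrable \<Psi>" "l2 \<Psi> \<le> l2 (wmul w k \<Psi>)"
proof -
  note W = weighted_L1[OF sq k]
  have le: "cmod (\<Psi> \<xi>) \<le> wt w (k - 1) \<xi> * cmod (\<Psi> \<xi>)" for \<xi>
    using mult_right_mono[OF wt_ge_1[of w "k - 1" \<xi>], of "cmod (\<Psi> \<xi>)"] w k by simp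
  show i: "integrable lborel \<Psi>"
    by (rule Bochner_Integration.integrable_bound[OF W(1)]) (use le in \<open>auto intro!: AE_I2 intro: order_trans[OF _ abs_ge_self]\<close>)
  have "(LINT \<xi>|lborel. cmod (\<Psi> \<xi>)) \<le> (LINT \<xi>|lborel. wt w (k - 1) \<xi> * cmod (\<Psi> \<xi>))"
    by (intro integral_mono integrable_norm i W(1) le) simp
  also have "\<dots> \<le> Cb * l2 (wmul w k \<Psi>)" by (rule W(2)) simp
  finally show "(LINT \<xi>|lborel. cmod (\<Psi> \<xi>)) \<le> Cb * l2 (wmul w k \<Psi>)" .
  have le2: "AE \<xi> in lborel. cmod (\<Psi> \<xi>) \<le> cmod (wmul w k \<Psi> \<xi>)"
  proof (rule AE_I2)
    fix \<xi> show "cmod (\<Psi> \<xi>) \<le> cmod (wmul w k \<Psi> \<xi>)"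
      using mult_right_mono[OF wt_ge_1[of w k \<xi>], of "cmod (\<Psi> \<xi>)"] w k by (simp add: cmod_wmul)
  qed
  show "square_integrable \<Psi>" by (rule l2_mono(2)[OF sq _ le2]) simp
  show "l2 \<Psi> \<le> l2 (wmul w k \<Psi>)" by (rule l2_mono(1)[OF sq _ le2]) simp
qed

lemma continuous_AE_eq:
  fixes f g :: "real \<Rightarrow> 'a::t2_space"
  assumes "continuous_on UNIV f" "continuous_on UNIV g" and ae: "AE x in lborel. f x = g x"
  shows "f = g"
proof
  fix x0 show "f x0 = g x0"
  proof (rule ccontr)
    assume ne: "f x0 \<noteq> g x0"
    have "open {x. f x \<noteq> g x}" using assms(1,2) by (intro open_Collect_neq)
    then obtain e where e: "e > 0" "\<And>y. dist y x0 < e \<Longrightarrow> f y \<noteq> g y"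
      using ne unfolding open_dist by blast
    have "AE x in lborel. x \<notin> {x0 - e<..<x0 + e}"
      using ae
    proof eventually_elim
      case (elim x)
      then show ?case using e(2)[of x] by (auto simp: dist_real_def abs_less_iff)
    qed
    then have "emeasure lborel {x0 - e<..<x0 + e} = 0"
      by (subst (asm) AE_iff_measurable[where N="{x0 - e<..<x0 + e}"]) auto
    then show False using e(1) by simp
  qed
qed

lemma ft_continuous:
  assumes f: "integrable lborel f"
  shows "continuous_on UNIV (ft s f)"
proof -
  have [measurable]: "f \<in> borel_measurable borel" using f by auto
  show ?thesis
    unfolding continuous_on_sequentially
  proof (intro allI ballI impI)
    fix u :: "nat \<Rightarrow> real" and a
    assume "(\<forall>n. u n \<in> UNIV) \<and> u \<longlonglongrightarrow> a"
    then have u: "u \<longlonglongrightarrow> a" by simp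
    have "(\<lambda>n. LINT x|lborel. iexp (s * (x * u n)) * f x) \<longlonglongrightarrow> (LINT x|lborel. iexp (s * (x * a)) * f x)"
    proof (rule integral_dominated_convergence)
      show "integrable lborel (\<lambda>x. cmod (f x))" using f by simp
      show "AE x in lborel. (\<lambda>n. iexp (s * (x * u n)) * f x) \<longlonglongrightarrow> iexp (s * (x * a)) * f x"
        by (intro AE_I2 tendsto_intros u)
    qed (simp_all add: norm_mult)
    then show "(ft s f \<circ> u) \<longlonglongrightarrow> ft s f a"
      unfolding o_def ft_def by (intro tendsto_intros)
  qed
qed

lemma ft_rep:
  assumes "integrable lborel \<Psi>" "square_integrable \<Psi>"
  shows "continuous_on UNIV (ft 1 \<Psi>)" "square_integrable (ft 1 \<Psi>)"
    "AE \<xi> in lborel. fourier (ft 1 \<Psi>) \<xi> = \<Psi> \<xi>"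
proof -
  show "continuous_on UNIV (ft 1 \<Psi>)" by (rule ft_continuous[OF assms(1)])
  show sq: "square_integrable (ft 1 \<Psi>)" by (rule bessel(1)[OF assms]) simp
  have "AE \<xi> in lborel. FT 1 \<Psi> \<xi> = ft 1 \<Psi> \<xi>" by (rule FT_integrable[OF assms]) simp
  then have "FT (-1) (FT 1 \<Psi>) = FT (-1) (ft 1 \<Psi>)"
    using sq sqint_FT[OF assms(2), of 1] by (intro FT_cong_AE) auto
  moreover have "AE \<xi> in lborel. FT (-1) (FT 1 \<Psi>) \<xi> = \<Psi> \<xi>"
    using FT_inverse[OF assms(2), of 1] by simp
  ultimately show "AE \<xi> in lborel. fourier (ft 1 \<Psi>) \<xi> = \<Psi> \<xi>"
    by (simp add: fourier_eq_FT)
qed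

text \<open>Inversion holds everywhere, and not only almost everywhere, because both sides are
  continuous. Pointwise statements about members of the spaces can thus be proved through their
  transforms.\<close>

lemma ft_rep_unique:
  assumes \<psi>: "square_integrable \<psi>" "continuous_on UNIV \<psi>" and i: "integrable lborel (fourier \<psi>)"
  shows "\<psi> = ft 1 (fourier \<psi>)"
proof (rule continuous_AE_eq[OF \<psi>(2) ft_continuous[OF i]])
  have sq: "square_integrable (fourier \<psi>)" by (rule sqint_fourier[OF \<psi>(1)])
  show "AE x in lborel. \<psi> x = ft 1 (fourier \<psi>) x"
    using FT_integrable[OF i sq, of 1] inv_fourier_fourier[OF \<psi>(1)]
    by (auto simp: inv_fourier_eq_FT)
qed

text \<open>Members of \<open>hspace\<close> matter only up to null sets, whereas derivatives,
  products and the equations are pointwise; they call for the continuous representative.\<close>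

definition hc :: "real \<Rightarrow> real \<Rightarrow> (real \<Rightarrow> complex) set" where
  "hc w k = {\<psi> \<in> hspace w k. continuous_on UNIV \<psi>}"

lemma hc_rep:
  assumes "\<psi> \<in> hc w k" "1 \<le> k" "0 \<le> w"
  shows "\<psi> = ft 1 (fourier \<psi>)" "integrable lborel (fourier \<psi>)" "square_integrable (fourier \<psi>)"
    "(LINT \<xi>|lborel. cmod (fourier \<psi> \<xi>)) \<le> Cb * hnorm w k \<psi>" "l2 \<psi> \<le> hnorm w k \<psi>"
proof -
  have h: "\<psi> \<in> hspace w k" and c: "continuous_on UNIV \<psi>" using assms by (auto simp: hc_def)
  note D = hspaceD[OF h]
  note L = wmul_L1[OF D(2) assms(2,3) D(3)]
  show "integrable lborel (fourier \<psi>)" "square_integrable (fourier \<psi>)" by fact+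
  show "\<psi> = ft 1 (fourier \<psi>)" by (rule ft_rep_unique[OF D(1) c L(1)])
  show "(LINT \<xi>|lborel. cmod (fourier \<psi> \<xi>)) \<le> Cb * hnorm w k \<psi>" using L(2) by (simp add: hnorm_eq[OF h])
  show "l2 \<psi> \<le> hnorm w k \<psi>" using L(4) by (simp add: hnorm_eq[OF h] l2_fourier[OF D(1)])
qed

lemma hcI:
  assumes [measurable]: "\<Psi> \<in> borel_measurable borel" and sq: "square_integrable (wmul w k \<Psi>)" and "1 \<le> k" "0 \<le> w"
  shows "ft 1 \<Psi> \<in> hc w k" "hnorm w k (ft 1 \<Psi>) = l2 (wmul w k \<Psi>)" "AE \<xi> in lborel. fourier (ft 1 \<Psi>) \<xi> = \<Psi> \<xi>"
proof -
  note L = wmul_L1[OF sq assms(3,4,1)]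
  note R = ft_rep[OF L(1,3)]
  show ae: "AE \<xi> in lborel. fourier (ft 1 \<Psi>) \<xi> = \<Psi> \<xi>" by (rule R(3))
  have [measurable]: "fourier (ft 1 \<Psi>) \<in> borel_measurable borel"
    by (intro sqint_measurable sqint_fourier R(2))
  have ae2: "AE \<xi> in lborel. wmul w k \<Psi> \<xi> = wmul w k (fourier (ft 1 \<Psi>)) \<xi>"
    using ae by (auto simp: wmul_def elim!: AE_mp)
  have h: "ft 1 \<Psi> \<in> hspace w k"
    using R(2) sqint_cong_AE[OF sq ae2] by (simp add: hspace_iff)
  then show "ft 1 \<Psi> \<in> hc w k" using R(1) by (simp add: hc_def)
  show "hnorm w k (ft 1 \<Psi>) = l2 (wmul w k \<Psi>)"
    unfolding hnorm_eq[OF h] using ae2 by (intro l2_cong_AE[symmetric]) auto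
qed

text \<open>Sobolev embedding: the supremum is controlled by the L^1 norm of the transform. The
  factor \<open>1 / sqrt (2 * pi)\<close> is below 1 and is dropped.\<close>

lemma hc_sup:
  assumes "\<psi> \<in> hc w k" "1 \<le> k" "0 \<le> w"
  shows "cmod (\<psi> x) \<le> Cb * hnorm w k \<psi>"
proof -
  have "cmod (\<psi> x) \<le> (LINT \<xi>|lborel. cmod (fourier \<psi> \<xi>)) / sqrt (2 * pi)"
    using ft_bound[of 1 "fourier \<psi>" x] hc_rep(1)[OF assms] by metis
  also have "\<dots> \<le> (LINT \<xi>|lborel. cmod (fourier \<psi> \<xi>)) / 1"
    using pi_gt3 by (intro divide_left_mono) (auto intro!: integral_nonneg_AE)
  also have "\<dots> \<le> Cb * hnorm w k \<psi>" using hc_rep(4)[OF assms] by simp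
  finally show ?thesis .
qed

lemma hc_add: "f \<in> hc w k \<Longrightarrow> g \<in> hc w k \<Longrightarrow> (\<lambda>x. f x + g x) \<in> hc w k"
  by (auto simp: hc_def hspace_add intro!: continuous_intros)

lemma hc_diff: "f \<in> hc w k \<Longrightarrow> g \<in> hc w k \<Longrightarrow> (\<lambda>x. f x - g x) \<in> hc w k"
  by (auto simp: hc_def hspace_diff intro!: continuous_intros)

lemma hc_scale: "f \<in> hc w k \<Longrightarrow> (\<lambda>x. c * f x) \<in> hc w k"
  by (auto simp: hc_def hspace_scale intro!: continuous_intros)

lemma hc_mono: "f \<in> hc w' k' \<Longrightarrow> w \<le> w' \<Longrightarrow> k \<le> k' \<Longrightarrow> f \<in> hc w k"
  by (auto simp: hc_def intro: hspace_mono)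

section \<open>Conjugation and differentiation\<close>

lemma ft_reflect: "ft s (\<lambda>\<xi>. F (- \<xi>)) x = ft (- s) F x"
proof -
  have "(LINT \<xi>|lborel. iexp (s * (\<xi> * x)) * F (- \<xi>)) = (LINT \<xi>|lborel. iexp (- s * (\<xi> * x)) * F \<xi>)"
    by (subst lborel_integral_real_affine[where c="-1" and t=0]) auto
  then show ?thesis by (simp add: ft_def)
qed

lemma sqint_reflect:
  assumes "square_integrable f"
  shows "square_integrable (\<lambda>x. f (- x))" "l2 (\<lambda>x. f (- x)) = l2 f"
proof -
  have [measurable]: "f \<in> borel_measurable borel" using assms by measurable
  show "square_integrable (\<lambda>x. f (- x))"
    using lborel_integrable_real_affine[OF sqint_integrable[OF assms], of "-1" 0]
    by (simp add: square_integrable_def)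
  show "l2 (\<lambda>x. f (- x)) = l2 f"
    unfolding l2_def by (subst (2) lborel_integral_real_affine[where c="-1" and t=0]) auto
qed

text \<open>Conjugation reflects and conjugates the transform, and the weights are even.\<close>

lemma hc_cnj:
  assumes f: "f \<in> hc w k" and kw: "1 \<le> k" "0 \<le> w"
  shows "(\<lambda>x. cnj (f x)) \<in> hc w k" "hnorm w k (\<lambda>x. cnj (f x)) = hnorm w k f"
proof -
  have h: "f \<in> hspace w k" using f by (simp add: hc_def)
  note D = hspaceD[OF h]
  note [measurable] = D(3)
  define \<Psi> where "\<Psi> = (\<lambda>\<xi>. cnj (fourier f (- \<xi>)))"
  have [measurable]: "\<Psi> \<in> borel_measurable borel" unfolding \<Psi>_def by measurable
  have eq: "(\<lambda>x. cnj (f x)) = ft 1 \<Psi>"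
  proof
    fix x
    have "cnj (f x) = ft (- 1) (\<lambda>\<xi>. cnj (fourier f \<xi>)) x"
      using cnj_ft[of 1 "fourier f" x] hc_rep(1)[OF f kw] by metis
    also have "\<dots> = ft 1 \<Psi> x" unfolding \<Psi>_def using ft_reflect[of 1 "\<lambda>\<xi>. cnj (fourier f \<xi>)" x] by simp
    finally show "cnj (f x) = ft 1 \<Psi> x" .
  qed
  have wfe: "wmul w k \<Psi> = (\<lambda>\<xi>. cnj (wmul w k (fourier f) (- \<xi>)))"
    by (auto simp: wmul_def \<Psi>_def wt_even)
  have s: "square_integrable (wmul w k \<Psi>)"
    unfolding wfe by (intro sqint_cnj sqint_reflect D)
  show "(\<lambda>x. cnj (f x)) \<in> hc w k" unfolding eq by (rule hcI[OF _ s kw]) simp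
  have "l2 (wmul w k \<Psi>) = l2 (\<lambda>\<xi>. wmul w k (fourier f) (- \<xi>))"
    unfolding wfe l2_def by simp
  then show "hnorm w k (\<lambda>x. cnj (f x)) = hnorm w k f"
    unfolding eq hnorm_eq[OF h] using hcI(2)[OF _ s kw] sqint_reflect(2)[OF D(2)] by simp
qed

lemma wt_nonneg: "0 \<le> wt w k \<xi>"
  using wt_pos[of w k \<xi>] by simp

lemma has_vector_derivative_quotient:
  fixes f :: "real \<Rightarrow> complex"
  shows "(f has_vector_derivative D) (at x within S) \<longleftrightarrow>
    ((\<lambda>y. (f y - f x) / complex_of_real (y - x)) \<longlongrightarrow> D) (at x within S)"
proof -
  have "(f has_vector_derivative D) (at x within S) \<longleftrightarrow>
      ((\<lambda>y. (1 / norm (y - x)) *\<^sub>R (f y - (f x + (y - x) *\<^sub>R D))) \<longlongrightarrow> 0) (at x within S)"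
    unfolding has_vector_derivative_def has_derivative_within
    using bounded_linear_scaleR_left[of D] by simp
  also have "\<dots> \<longleftrightarrow> ((\<lambda>y. norm ((1 / norm (y - x)) *\<^sub>R (f y - (f x + (y - x) *\<^sub>R D)))) \<longlongrightarrow> 0) (at x within S)"
    by (rule tendsto_norm_zero_iff[symmetric])
  also have "\<dots> \<longleftrightarrow> ((\<lambda>y. norm ((f y - f x) / complex_of_real (y - x) - D)) \<longlongrightarrow> 0) (at x within S)"
  proof (rule tendsto_cong)
    have "norm ((1 / norm (y - x)) *\<^sub>R (f y - (f x + (y - x) *\<^sub>R D))) = norm ((f y - f x) / complex_of_real (y - x) - D)" if "y \<noteq> x" for y
    proof -
      have ne: "complex_of_real (y - x) \<noteq> 0" using that by simp
      have "(f y - f x) / complex_of_real (y - x) - D = (f y - (f x + (y - x) *\<^sub>R D)) / complex_of_real (y - x)"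
        using ne by (simp add: diff_divide_distrib add_divide_distrib scaleR_conv_of_real)
      then show ?thesis by (simp add: norm_divide del: of_real_diff)
    qed
    then show "\<forall>\<^sub>F y in at x within S. norm ((1 / norm (y - x)) *\<^sub>R (f y - (f x + (y - x) *\<^sub>R D))) = norm ((f y - f x) / complex_of_real (y - x) - D)"
      by (auto simp: eventually_at_filter)
  qed
  also have "\<dots> \<longleftrightarrow> ((\<lambda>y. (f y - f x) / complex_of_real (y - x) - D) \<longlongrightarrow> 0) (at x within S)"
    by (rule tendsto_norm_zero_iff)
  also have "\<dots> \<longleftrightarrow> ((\<lambda>y. (f y - f x) / complex_of_real (y - x)) \<longlongrightarrow> D) (at x within S)"
    by (rule LIM_zero_iff)
  finally show ?thesis .
qed

lemma iexp_diff_bound: "cmod (iexp a - iexp b) \<le> \<bar>a - b\<bar>"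
proof -
  have "iexp a - iexp b = iexp b * (iexp (a - b) - 1)"
    by (simp add: right_diff_distrib exp_add[symmetric] algebra_simps)
  then have "cmod (iexp a - iexp b) = cmod (iexp (a - b) - 1)" by (simp add: norm_mult)
  also have "\<dots> \<le> \<bar>a - b\<bar>" using iexp_approx1[of "a - b" 0] by simp
  finally show ?thesis .
qed

text \<open>Dominated convergence: the difference quotients of the exponential are bounded by
  \<open>\<bar>s * \<xi>\<bar>\<close>.\<close>

lemma ft_has_derivative:
  assumes f: "integrable lborel f" and xf: "integrable lborel (\<lambda>\<xi>. complex_of_real \<xi> * f \<xi>)"
  shows "(ft s f has_vector_derivative ft s (\<lambda>\<xi>. \<i> * complex_of_real (s * \<xi>) * f \<xi>) x) (at x)"
  unfolding has_vector_derivative_quotient tendsto_at_iff_sequentially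
proof (intro allI impI)
  fix X :: "nat \<Rightarrow> real"
  assume X: "\<forall>i. X i \<in> UNIV - {x}" and lim: "X \<longlonglongrightarrow> x"
  have [measurable]: "f \<in> borel_measurable borel" using f by auto
  have lim2: "(\<lambda>n. LINT \<xi>|lborel. (iexp (s * (\<xi> * X n)) - iexp (s * (\<xi> * x))) / complex_of_real (X n - x) * f \<xi>)
      \<longlonglongrightarrow> (LINT \<xi>|lborel. iexp (s * (\<xi> * x)) * (\<i> * complex_of_real (s * \<xi>) * f \<xi>))"
  proof (rule integral_dominated_convergence)
    show "integrable lborel (\<lambda>\<xi>. \<bar>s\<bar> * cmod (complex_of_real \<xi> * f \<xi>))"
      using xf by (intro integrable_mult_right integrable_norm)
    show "AE \<xi> in lborel. cmod ((iexp (s * (\<xi> * X n)) - iexp (s * (\<xi> * x))) / complex_of_real (X n - x) * f \<xi>)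
        \<le> \<bar>s\<bar> * cmod (complex_of_real \<xi> * f \<xi>)" for n
    proof (rule AE_I2)
      fix \<xi>
      have ne: "X n - x \<noteq> 0" using X by auto
      have "cmod (iexp (s * (\<xi> * X n)) - iexp (s * (\<xi> * x))) \<le> \<bar>s * \<xi> * (X n - x)\<bar>"
        using iexp_diff_bound[of "s * (\<xi> * X n)" "s * (\<xi> * x)"] by (simp add: algebra_simps)
      then have "cmod (iexp (s * (\<xi> * X n)) - iexp (s * (\<xi> * x))) / \<bar>X n - x\<bar> \<le> \<bar>s * \<xi>\<bar>"
        using ne by (simp add: divide_le_eq abs_mult)
      from mult_right_mono[OF this norm_ge_zero[of "f \<xi>"]]
      show "cmod ((iexp (s * (\<xi> * X n)) - iexp (s * (\<xi> * x))) / complex_of_real (X n - x) * f \<xi>)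
        \<le> \<bar>s\<bar> * cmod (complex_of_real \<xi> * f \<xi>)"
        by (simp only: norm_mult norm_divide norm_of_real abs_mult mult.assoc)
    qed
    show "AE \<xi> in lborel. (\<lambda>n. (iexp (s * (\<xi> * X n)) - iexp (s * (\<xi> * x))) / complex_of_real (X n - x) * f \<xi>)
        \<longlonglongrightarrow> iexp (s * (\<xi> * x)) * (\<i> * complex_of_real (s * \<xi>) * f \<xi>)"
    proof (rule AE_I2)
      fix \<xi>
      have "((\<lambda>y. iexp (s * (\<xi> * y))) has_vector_derivative iexp (s * (\<xi> * x)) * (\<i> * complex_of_real (s * \<xi>))) (at x)"
        by (auto intro!: derivative_eq_intros has_vector_derivative_real_field simp: mult_ac)
      then have "((\<lambda>y. (iexp (s * (\<xi> * y)) - iexp (s * (\<xi> * x))) / complex_of_real (y - x))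
          \<longlongrightarrow> iexp (s * (\<xi> * x)) * (\<i> * complex_of_real (s * \<xi>))) (at x)"
        unfolding has_vector_derivative_quotient .
      then have "(\<lambda>n. (iexp (s * (\<xi> * X n)) - iexp (s * (\<xi> * x))) / complex_of_real (X n - x))
          \<longlonglongrightarrow> iexp (s * (\<xi> * x)) * (\<i> * complex_of_real (s * \<xi>))"
        unfolding tendsto_at_iff_sequentially using X lim by (auto simp: o_def)
      from tendsto_mult_right[OF this, of "f \<xi>"]
      show "(\<lambda>n. (iexp (s * (\<xi> * X n)) - iexp (s * (\<xi> * x))) / complex_of_real (X n - x) * f \<xi>)
        \<longlonglongrightarrow> iexp (s * (\<xi> * x)) * (\<i> * complex_of_real (s * \<xi>) * f \<xi>)" by (simp only: mult.assoc)
    qed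
  qed measurable
  have eq: "(LINT \<xi>|lborel. (iexp (s * (\<xi> * X n)) - iexp (s * (\<xi> * x))) / complex_of_real (X n - x) * f \<xi>)
      = ((LINT \<xi>|lborel. iexp (s * (\<xi> * X n)) * f \<xi>) - (LINT \<xi>|lborel. iexp (s * (\<xi> * x)) * f \<xi>)) / complex_of_real (X n - x)" for n
  proof -
    have "(LINT \<xi>|lborel. (iexp (s * (\<xi> * X n)) - iexp (s * (\<xi> * x))) / complex_of_real (X n - x) * f \<xi>)
        = (LINT \<xi>|lborel. (iexp (s * (\<xi> * X n)) * f \<xi> - iexp (s * (\<xi> * x)) * f \<xi>) / complex_of_real (X n - x))"
      by (intro Bochner_Integration.integral_cong refl) (simp add: left_diff_distrib diff_divide_distrib)
    also have "\<dots> = (LINT \<xi>|lborel. (iexp (s * (\<xi> * X n)) * f \<xi> - iexp (s * (\<xi> * x)) * f \<xi>)) / complex_of_real (X n - x)"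
      by (rule integral_divide_zero)
    finally show ?thesis
      using iexp_integrable[OF f] by (simp only: Bochner_Integration.integral_diff)
  qed
  from tendsto_mult_left[OF lim2[unfolded eq], of "complex_of_real (1 / sqrt (2 * pi))"]
  show "((\<lambda>y. (ft s f y - ft s f x) / complex_of_real (y - x)) \<circ> X) \<longlonglongrightarrow> ft s (\<lambda>\<xi>. \<i> * complex_of_real (s * \<xi>) * f \<xi>) x"
    unfolding ft_def o_def by (simp only: right_diff_distrib times_divide_eq_right)
qed

lemma wt_Suc: "wt w (k + 1) \<xi> = bracket \<xi> * wt w k \<xi>"
  using bracket_pos[of \<xi>] by (simp add: wt_def powr_add)

text \<open>Differentiation multiplies the transform by \<open>\<i> * \<xi>\<close>, and
  \<open>\<bar>\<xi>\<bar>\<close> is at most \<open>bracket \<xi>\<close>, the extra factor in the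
  weight of order \<open>k + 1\<close>.\<close>

lemma hc_deriv:
  assumes f: "f \<in> hc w (k + 1)" and kw: "1 \<le> k" "0 \<le> w"
  shows "\<And>x. (f has_vector_derivative dx f x) (at x)" "dx f \<in> hc w k" "hnorm w k (dx f) \<le> hnorm w (k + 1) f"
    "AE \<xi> in lborel. fourier (dx f) \<xi> = \<i> * complex_of_real \<xi> * fourier f \<xi>"
proof -
  have h: "f \<in> hspace w (k + 1)" using f by (simp add: hc_def)
  note D = hspaceD[OF h]
  note [measurable] = D(3)
  have k1: "1 \<le> k + 1" using kw by simp
  note R = hc_rep[OF f k1 kw(2)]
  define G where "G = (\<lambda>\<xi>. \<i> * complex_of_real (1 * \<xi>) * fourier f \<xi>)"
  have [measurable]: "G \<in> borel_measurable borel" unfolding G_def by measurable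
  have le: "cmod (wmul w k G \<xi>) \<le> cmod (wmul w (k + 1) (fourier f) \<xi>)" for \<xi>
  proof -
    have "wt w k \<xi> * (\<bar>\<xi>\<bar> * cmod (fourier f \<xi>)) \<le> wt w k \<xi> * (bracket \<xi> * cmod (fourier f \<xi>))"
      using wt_pos[of w k \<xi>] by (intro mult_left_mono mult_right_mono abs_le_bracket) auto
    then show ?thesis unfolding cmod_wmul wt_Suc by (simp add: G_def norm_mult mult_ac)
  qed
  have sG: "square_integrable (wmul w k G)" "l2 (wmul w k G) \<le> l2 (wmul w (k + 1) (fourier f))"
    using le by (auto intro!: l2_mono[OF D(2)])
  note L = wmul_L1[OF sG(1) kw]
  have iG: "integrable lborel G" by (rule L(1)) simp
  then have "integrable lborel (\<lambda>\<xi>. complex_of_real \<xi> * fourier f \<xi>)"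
    using integrable_mult_right[OF iG, of "- \<i>"] by (simp add: G_def mult.assoc[symmetric])
  from ft_has_derivative[OF R(2) this, of 1]
  have der: "(f has_vector_derivative ft 1 G x) (at x)" for x
    unfolding G_def using R(1) by simp
  then have eq: "dx f = ft 1 G" by (auto simp: vector_derivative_at)
  show "\<And>x. (f has_vector_derivative dx f x) (at x)" using der by (simp only: vector_derivative_at[OF der])
  show "dx f \<in> hc w k" unfolding eq by (rule hcI(1)[OF _ sG(1) kw]) simp
  show "hnorm w k (dx f) \<le> hnorm w (k + 1) f"
    unfolding eq hnorm_eq[OF h] using hcI(2)[OF _ sG(1) kw] sG(2) by simp
  show "AE \<xi> in lborel. fourier (dx f) \<xi> = \<i> * complex_of_real \<xi> * fourier f \<xi>"
    using hcI(3)[OF _ sG(1) kw] unfolding eq by (simp add: G_def)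
qed

text \<open>A converse of \<open>hc_deriv\<close>, from
  \<open>bracket \<xi> \<le> 1 + \<bar>\<xi>\<bar>\<close>. It reduces the order 2 norm of a
  nonlinear term to order 1 norms of the term and of its derivative.\<close>

lemma hnorm_Suc_le:
  assumes f: "f \<in> hc w (k + 1)" and kw: "1 \<le> k" "0 \<le> w"
  shows "hnorm w (k + 1) f \<le> hnorm w k f + hnorm w k (dx f)"
proof -
  have h: "f \<in> hspace w (k + 1)" using f by (simp add: hc_def)
  have h0: "f \<in> hspace w k" by (rule hspace_mono(1)[OF h]) auto
  note D = hspaceD[OF h] and D0 = hspaceD[OF h0]
  note [measurable] = D(3)
  note R = hc_deriv[OF f kw]
  have hd: "dx f \<in> hspace w k" using R(2) by (simp add: hc_def)
  note D1 = hspaceD[OF hd]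
  note [measurable] = D1(3)
  define A where "A = (\<lambda>\<xi>. complex_of_real (cmod (wmul w k (fourier f) \<xi>)))"
  define B where "B = (\<lambda>\<xi>. complex_of_real (cmod (wmul w k (fourier (dx f)) \<xi>)))"
  have A: "square_integrable A" "l2 A = hnorm w k f"
    using D0(2) unfolding A_def by (auto simp: square_integrable_def l2_def hnorm_eq[OF h0])
  have B: "square_integrable B" "l2 B = hnorm w k (dx f)"
    using D1(2) unfolding B_def by (auto simp: square_integrable_def l2_def hnorm_eq[OF hd])
  have "AE \<xi> in lborel. cmod (wmul w (k + 1) (fourier f) \<xi>) \<le> cmod (A \<xi> + B \<xi>)"
    using R(4)
  proof eventually_elim
    case (elim \<xi>)
    have "bracket \<xi> \<le> 1 + \<bar>\<xi>\<bar>"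
      by (rule power2_le_imp_le) (auto simp: bracket_sq power2_sum)
    then have "bracket \<xi> * (wt w k \<xi> * cmod (fourier f \<xi>)) \<le> (1 + \<bar>\<xi>\<bar>) * (wt w k \<xi> * cmod (fourier f \<xi>))"
      using wt_pos[of w k \<xi>] by (intro mult_right_mono) auto
    also have "\<dots> = cmod (A \<xi> + B \<xi>)"
      unfolding A_def B_def cmod_wmul elim of_real_add[symmetric] norm_of_real
      using wt_pos[of w k \<xi>] by (simp add: norm_mult algebra_simps)
    finally show ?case unfolding cmod_wmul wt_Suc by (simp add: mult.assoc)
  qed
  from l2_mono(1)[OF sqint_add[OF A(1) B(1)] _ this]
  have "hnorm w (k + 1) f \<le> l2 (\<lambda>\<xi>. A \<xi> + B \<xi>)" by (simp add: hnorm_eq[OF h])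
  also have "\<dots> \<le> hnorm w k f + hnorm w k (dx f)"
    using l2_triangle[OF A(1) B(1)] by (simp add: A(2) B(2))
  finally show ?thesis .
qed

section \<open>The algebra property\<close>

definition convolution :: "(real \<Rightarrow> complex) \<Rightarrow> (real \<Rightarrow> complex) \<Rightarrow> real \<Rightarrow> complex" where
  "convolution F G \<xi> = (LINT \<eta>|lborel. F (\<xi> - \<eta>) * G \<eta>)"

lemma convolution_measurable [measurable]:
  assumes [measurable]: "F \<in> borel_measurable borel" "G \<in> borel_measurable borel"
  shows "convolution F G \<in> borel_measurable borel"
  unfolding convolution_def[abs_def] by measurable

lemma ft_product:
  assumes F: "integrable lborel F" and G: "integrable lborel G"
  shows "ft s F x * ft s G x = ft s (\<lambda>\<xi>. complex_of_real (1 / sqrt (2 * pi)) * convolution F G \<xi>) x"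
proof -
  have [measurable]: "F \<in> borel_measurable borel" "G \<in> borel_measurable borel" using F G by auto
  have Ft: "integrable lborel (\<lambda>\<xi>. F (\<xi> - \<eta>))" for \<eta>
    using lborel_integrable_real_affine[OF F, of 1 "- \<eta>"] by simp
  have Fn: "(LINT \<xi>|lborel. cmod (F (\<xi> - \<eta>))) = (LINT \<xi>|lborel. cmod (F \<xi>))" for \<eta>
    by (subst (2) lborel_integral_real_affine[where c=1 and t="- \<eta>"]) auto
  have int: "integrable (lborel \<Otimes>\<^sub>M lborel) (\<lambda>(\<eta>, \<xi>). iexp (s * (\<xi> * x)) * (F (\<xi> - \<eta>) * G \<eta>))"
  proof (rule lborel_pair.Fubini_integrable)
    show "integrable lborel (\<lambda>\<eta>. LINT \<xi>|lborel. norm (case (\<eta>, \<xi>) of (\<eta>, \<xi>) \<Rightarrow> iexp (s * (\<xi> * x)) * (F (\<xi> - \<eta>) * G \<eta>)))"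
      using G by (simp add: norm_mult Fn)
    show "AE \<eta> in lborel. integrable lborel (\<lambda>\<xi>. case (\<eta>, \<xi>) of (\<eta>, \<xi>) \<Rightarrow> iexp (s * (\<xi> * x)) * (F (\<xi> - \<eta>) * G \<eta>))"
      using iexp_integrable[OF integrable_mult_left[OF Ft]] by simp
  qed measurable
  have shift: "(LINT \<xi>|lborel. iexp (s * (\<xi> * x)) * F (\<xi> - \<eta>)) = iexp (s * (\<eta> * x)) * (LINT \<xi>|lborel. iexp (s * (\<xi> * x)) * F \<xi>)" for \<eta>
  proof -
    have "(LINT \<xi>|lborel. iexp (s * (\<xi> * x)) * F (\<xi> - \<eta>)) = (LINT \<xi>|lborel. iexp (s * ((\<eta> + \<xi>) * x)) * F \<xi>)"
      by (subst lborel_integral_real_affine[where c=1 and t="\<eta>"]) auto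
    also have "\<dots> = (LINT \<xi>|lborel. iexp (s * (\<eta> * x)) * (iexp (s * (\<xi> * x)) * F \<xi>))"
      by (intro Bochner_Integration.integral_cong refl) (simp add: exp_add[symmetric] algebra_simps)
    also have "\<dots> = iexp (s * (\<eta> * x)) * (LINT \<xi>|lborel. iexp (s * (\<xi> * x)) * F \<xi>)"
      by (rule integral_mult_right_zero)
    finally show ?thesis .
  qed
  have "(LINT \<xi>|lborel. iexp (s * (\<xi> * x)) * convolution F G \<xi>)
      = (LINT \<xi>|lborel. LINT \<eta>|lborel. iexp (s * (\<xi> * x)) * (F (\<xi> - \<eta>) * G \<eta>))"
    by (simp only: convolution_def integral_mult_right_zero)
  also have "\<dots> = (LINT \<eta>|lborel. LINT \<xi>|lborel. iexp (s * (\<xi> * x)) * (F (\<xi> - \<eta>) * G \<eta>))"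
    using lborel_pair.Fubini_integral[OF int] by simp
  also have "\<dots> = (LINT \<eta>|lborel. (LINT \<xi>|lborel. iexp (s * (\<xi> * x)) * F \<xi>) * (iexp (s * (\<eta> * x)) * G \<eta>))"
  proof (intro Bochner_Integration.integral_cong refl)
    fix \<eta>
    have "(LINT \<xi>|lborel. iexp (s * (\<xi> * x)) * (F (\<xi> - \<eta>) * G \<eta>)) = (LINT \<xi>|lborel. iexp (s * (\<xi> * x)) * F (\<xi> - \<eta>)) * G \<eta>"
      by (simp only: mult.assoc[symmetric] integral_mult_left_zero)
    then show "(LINT \<xi>|lborel. iexp (s * (\<xi> * x)) * (F (\<xi> - \<eta>) * G \<eta>)) = (LINT \<xi>|lborel. iexp (s * (\<xi> * x)) * F \<xi>) * (iexp (s * (\<eta> * x)) * G \<eta>)"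
      unfolding shift by (simp only: mult_ac)
  qed
  also have "\<dots> = (LINT \<xi>|lborel. iexp (s * (\<xi> * x)) * F \<xi>) * (LINT \<eta>|lborel. iexp (s * (\<eta> * x)) * G \<eta>)"
    by (rule integral_mult_right_zero)
  finally have "(LINT \<xi>|lborel. iexp (s * (\<xi> * x)) * convolution F G \<xi>)
      = (LINT \<xi>|lborel. iexp (s * (\<xi> * x)) * F \<xi>) * (LINT \<eta>|lborel. iexp (s * (\<eta> * x)) * G \<eta>)" .
  then show ?thesis unfolding ft_scale by (simp only: ft_def mult_ac)
qed

text \<open>Split \<open>u * v\<close> into \<open>sqrt u\<close> and \<open>sqrt u * v\<close>.
  This serves both Young's inequality and the time integral in \<open>L2_mean_value\<close>.\<close>

lemma nn_cauchy_schwarz_weighted: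
  fixes u v :: "real \<Rightarrow> real"
  assumes [measurable]: "u \<in> borel_measurable borel" "v \<in> borel_measurable borel"
    and pos: "\<And>x. 0 \<le> u x" "\<And>x. 0 \<le> v x" and K: "(\<integral>\<^sup>+x. ennreal (u x) \<partial>lborel) \<le> ennreal K" "0 < K"
  shows "(\<integral>\<^sup>+x. ennreal (u x * v x) \<partial>lborel)\<^sup>2 \<le> ennreal K * (\<integral>\<^sup>+x. ennreal (u x * (v x)\<^sup>2) \<partial>lborel)"
proof (cases "(\<integral>\<^sup>+x. ennreal (u x * (v x)\<^sup>2) \<partial>lborel) = \<infinity>")
  case True
  then show ?thesis using K(2) by (simp add: ennreal_mult_top)
next
  case False
  define f where "f = (\<lambda>x. complex_of_real (sqrt (u x)))"
  define g where "g = (\<lambda>x. complex_of_real (sqrt (u x) * v x))"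
  have [measurable]: "f \<in> borel_measurable borel" "g \<in> borel_measurable borel" unfolding f_def g_def by measurable
  have f2: "(cmod (f x))\<^sup>2 = u x" and g2: "(cmod (g x))\<^sup>2 = u x * (v x)\<^sup>2" and fg: "cmod (f x) * cmod (g x) = u x * v x" for x
    using pos[of x] by (auto simp: f_def g_def norm_mult power_mult_distrib)
  have sf: "square_integrable f"
    unfolding sqint_iff_nn f2 using le_less_trans[OF K(1) ennreal_less_top] by simp
  have sg: "square_integrable g"
    unfolding sqint_iff_nn g2 using False by (simp add: top.not_eq_extremum)
  have "integrable lborel (\<lambda>x. u x * v x)"
    using integrable_norm[OF sqint_prod_integrable[OF sf sg]] by (simp add: norm_mult fg)
  then have "(\<integral>\<^sup>+x. ennreal (u x * v x) \<partial>lborel) = ennreal (LINT x|lborel. u x * v x)"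
    using pos by (intro nn_integral_eq_integral) auto
  also have "\<dots> \<le> ennreal (l2 f * l2 g)"
    using l2_cauchy_schwarz_abs[OF sf sg] unfolding fg by (rule ennreal_leI)
  finally have "(\<integral>\<^sup>+x. ennreal (u x * v x) \<partial>lborel)\<^sup>2 \<le> (ennreal (l2 f * l2 g))\<^sup>2"
    by (intro power_mono) auto
  also have "\<dots> = ennreal ((l2 f)\<^sup>2) * ennreal ((l2 g)\<^sup>2)"
    by (simp add: ennreal_power ennreal_mult[symmetric] power_mult_distrib)
  also have "\<dots> \<le> ennreal K * (\<integral>\<^sup>+x. ennreal (u x * (v x)\<^sup>2) \<partial>lborel)"
    unfolding nn_l2[OF sf, symmetric] nn_l2[OF sg, symmetric] f2 g2 by (intro mult_right_mono K(1)) simp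
  finally show ?thesis .
qed

text \<open>Weighted Cauchy-Schwarz in the inner integral, then an exchange of integrals:
  convolution with a function of L^1 norm at most \<open>K\<close> acts on L^2.\<close>

lemma nn_young:
  fixes u v :: "real \<Rightarrow> real"
  assumes [measurable]: "u \<in> borel_measurable borel" "v \<in> borel_measurable borel"
    and pos: "\<And>x. 0 \<le> u x" "\<And>x. 0 \<le> v x" and K: "(\<integral>\<^sup>+x. ennreal (u x) \<partial>lborel) \<le> ennreal K" "0 < K"
  shows "(\<integral>\<^sup>+\<xi>. (\<integral>\<^sup>+\<eta>. ennreal (u (\<xi> - \<eta>) * v \<eta>) \<partial>lborel)\<^sup>2 \<partial>lborel)
    \<le> ennreal (K\<^sup>2) * (\<integral>\<^sup>+x. ennreal ((v x)\<^sup>2) \<partial>lborel)"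
proof -
  have tr: "(\<integral>\<^sup>+\<eta>. ennreal (u (\<xi> - \<eta>)) \<partial>lborel) \<le> ennreal K" for \<xi>
    using K(1) by (subst (asm) nn_integral_real_affine[where c="-1" and t=\<xi>]) (auto simp: minus_mult_left)
  have tr2: "(\<integral>\<^sup>+\<xi>. ennreal (u (\<xi> - \<eta>)) \<partial>lborel) \<le> ennreal K" for \<eta>
    using K(1) by (subst (asm) nn_integral_real_affine[where c="1" and t="-\<eta>"]) auto
  have "(\<integral>\<^sup>+\<xi>. (\<integral>\<^sup>+\<eta>. ennreal (u (\<xi> - \<eta>) * v \<eta>) \<partial>lborel)\<^sup>2 \<partial>lborel)
      \<le> (\<integral>\<^sup>+\<xi>. ennreal K * (\<integral>\<^sup>+\<eta>. ennreal (u (\<xi> - \<eta>) * (v \<eta>)\<^sup>2) \<partial>lborel) \<partial>lborel)"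
    by (intro nn_integral_mono nn_cauchy_schwarz_weighted pos K(2) tr) measurable
  also have "\<dots> = ennreal K * (\<integral>\<^sup>+\<xi>. (\<integral>\<^sup>+\<eta>. ennreal (u (\<xi> - \<eta>) * (v \<eta>)\<^sup>2) \<partial>lborel) \<partial>lborel)"
    by (rule nn_integral_cmult) measurable
  also have "\<dots> \<le> ennreal K * (ennreal K * (\<integral>\<^sup>+x. ennreal ((v x)\<^sup>2) \<partial>lborel))"
  proof (rule mult_left_mono)
    have "(\<integral>\<^sup>+\<xi>. (\<integral>\<^sup>+\<eta>. ennreal (u (\<xi> - \<eta>) * (v \<eta>)\<^sup>2) \<partial>lborel) \<partial>lborel)
        = (\<integral>\<^sup>+\<eta>. (\<integral>\<^sup>+\<xi>. ennreal (u (\<xi> - \<eta>) * (v \<eta>)\<^sup>2) \<partial>lborel) \<partial>lborel)"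
      by (rule lborel_pair.Fubini'[symmetric]) measurable
    also have "\<dots> = (\<integral>\<^sup>+\<eta>. (\<integral>\<^sup>+\<xi>. ennreal (u (\<xi> - \<eta>)) \<partial>lborel) * ennreal ((v \<eta>)\<^sup>2) \<partial>lborel)"
      by (intro nn_integral_cong) (subst nn_integral_multc[symmetric], auto simp: ennreal_mult pos)
    also have "\<dots> \<le> (\<integral>\<^sup>+\<eta>. ennreal K * ennreal ((v \<eta>)\<^sup>2) \<partial>lborel)"
      by (intro nn_integral_mono mult_right_mono tr2) simp
    also have "\<dots> = ennreal K * (\<integral>\<^sup>+\<eta>. ennreal ((v \<eta>)\<^sup>2) \<partial>lborel)" by (rule nn_integral_cmult) measurable
    finally show "(\<integral>\<^sup>+\<xi>. (\<integral>\<^sup>+\<eta>. ennreal (u (\<xi> - \<eta>) * (v \<eta>)\<^sup>2) \<partial>lborel) \<partial>lborel)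
      \<le> ennreal K * (\<integral>\<^sup>+x. ennreal ((v x)\<^sup>2) \<partial>lborel)" .
  qed simp
  finally show ?thesis using K(2) by (simp add: power2_eq_square ennreal_mult mult.assoc)
qed

text \<open>The bracket of a sum is at most twice the larger bracket, so the power goes to one of
  the two factors while the exponential factorises.\<close>

lemma wt_subadditive:
  assumes "0 \<le> w" "0 \<le> k"
  shows "wt w k (a + b) \<le> 2 powr k * (wt w k a * wt w 0 b + wt w 0 a * wt w k b)"
proof -
  have pos: "0 < bracket a" "0 < bracket b" "0 < bracket (a + b)" by (rule bracket_pos)+
  have "bracket (a + b) powr k \<le> (2 * max (bracket a) (bracket b)) powr k"
    using bracket_add[of a b] pos assms by (intro powr_mono2) auto
  also have "\<dots> = 2 powr k * max (bracket a) (bracket b) powr k" by (rule powr_mult)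
  also have "\<dots> \<le> 2 powr k * (bracket a powr k + bracket b powr k)"
    by (intro mult_left_mono) (auto simp: max_def)
  finally have 1: "bracket (a + b) powr k \<le> 2 powr k * (bracket a powr k + bracket b powr k)" .
  have 2: "exp (w * bracket (a + b)) \<le> exp (w * bracket a) * exp (w * bracket b)"
    unfolding exp_add[symmetric] using bracket_add[of a b] assms by (simp add: distrib_left[symmetric] mult_left_mono)
  have "wt w k (a + b) \<le> (2 powr k * (bracket a powr k + bracket b powr k)) * (exp (w * bracket a) * exp (w * bracket b))"
    unfolding wt_def by (intro mult_mono 1 2) auto
  also have "\<dots> = 2 powr k * (wt w k a * wt w 0 b + wt w 0 a * wt w k b)"
    using pos by (simp add: wt_def algebra_simps)
  finally show ?thesis .
qed

text \<open>The proof of \<open>hc_product\<close> yields \<open>2 * 2 powr k * Cb\<close>. This is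
  rounded up to be at least 1, so that \<open>anorm\<close> below dominates the order 1
  norm.\<close>

definition Calg :: "real \<Rightarrow> real" where "Calg k = 1 + 4 * 2 powr k * (1 + Cb)"

text \<open>The transform of a product is a convolution. By \<open>wt_subadditive\<close> the full
  weight falls on one factor and only the exponential on the other, which is then integrable by
  \<open>weighted_L1\<close>; Young's inequality bounds both halves.\<close>

lemma hc_product:
  assumes f: "f \<in> hc w k" and g: "g \<in> hc w k" and kw: "1 \<le> k" "0 \<le> w"
  shows "(\<lambda>x. f x * g x) \<in> hc w k" "hnorm w k (\<lambda>x. f x * g x) \<le> Calg k * (hnorm w k f * hnorm w k g)"
proof -
  have hf: "f \<in> hspace w k" and hg: "g \<in> hspace w k" using f g by (auto simp: hc_def)
  note F = hspaceD[OF hf] and G = hspaceD[OF hg]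
  note [measurable] = F(3) G(3)
  define c where "c = 1 / sqrt (2 * pi)"
  have c: "0 \<le> c" "c \<le> 1" using pi_gt3 by (auto simp: c_def)
  define C where "C = (\<lambda>\<xi>. complex_of_real c * convolution (fourier f) (fourier g) \<xi>)"
  have [measurable]: "C \<in> borel_measurable borel" unfolding C_def by measurable
  have eq: "(\<lambda>x. f x * g x) = ft 1 C"
  proof
    fix x
    have "f x * g x = ft 1 (fourier f) x * ft 1 (fourier g) x"
      using hc_rep(1)[OF f kw] hc_rep(1)[OF g kw] by metis
    also have "\<dots> = ft 1 C x"
      unfolding C_def c_def by (rule ft_product[OF hc_rep(2)[OF f kw] hc_rep(2)[OF g kw]])
    finally show "f x * g x = ft 1 C x" .
  qed
  define uf where "uf \<xi> = wt w 0 \<xi> * cmod (fourier f \<xi>)" for \<xi>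
  define ug where "ug \<xi> = wt w 0 \<xi> * cmod (fourier g \<xi>)" for \<xi>
  define vf where "vf \<xi> = wt w k \<xi> * cmod (fourier f \<xi>)" for \<xi>
  define vg where "vg \<xi> = wt w k \<xi> * cmod (fourier g \<xi>)" for \<xi>
  have [measurable]: "uf \<in> borel_measurable borel" "ug \<in> borel_measurable borel"
    "vf \<in> borel_measurable borel" "vg \<in> borel_measurable borel"
    unfolding uf_def ug_def vf_def vg_def by measurable
  have pos: "0 \<le> uf \<xi>" "0 \<le> ug \<xi>" "0 \<le> vf \<xi>" "0 \<le> vg \<xi>" for \<xi>
    by (simp_all add: uf_def ug_def vf_def vg_def wt_nonneg)
  have L1: "(\<integral>\<^sup>+\<xi>. ennreal (wt w 0 \<xi> * cmod (fourier h \<xi>)) \<partial>lborel) \<le> ennreal (Cb * hnorm w k h)" if h: "h \<in> hspace w k" for h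
  proof -
    have h1: "h \<in> hspace w 1" using kw by (intro hspace_mono(1)[OF h]) auto
    note W = weighted_L1[OF hspaceD(2)[OF h1] order_refl hspaceD(3)[OF h1]]
    have "(\<integral>\<^sup>+\<xi>. ennreal (wt w 0 \<xi> * cmod (fourier h \<xi>)) \<partial>lborel) = ennreal (LINT \<xi>|lborel. wt w 0 \<xi> * cmod (fourier h \<xi>))"
      using W(1) by (intro nn_integral_eq_integral) (auto simp: wt_nonneg)
    also have "\<dots> \<le> ennreal (Cb * hnorm w 1 h)"
      using W(2) by (intro ennreal_leI) (simp add: hnorm_eq[OF h1])
    also have "\<dots> \<le> ennreal (Cb * hnorm w k h)"
      using hspace_mono(2)[OF h, of w 1] kw Cb_nonneg by (intro ennreal_leI mult_left_mono) auto
    finally show ?thesis .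
  qed
  have pw: "wt w k \<xi> * (cmod (fourier f (\<xi> - \<eta>)) * cmod (fourier g \<eta>))
      \<le> 2 powr k * (vf (\<xi> - \<eta>) * ug \<eta> + uf (\<xi> - \<eta>) * vg \<eta>)" for \<xi> \<eta>
    using mult_right_mono[OF wt_subadditive[of w k "\<xi> - \<eta>" \<eta>], of "cmod (fourier f (\<xi> - \<eta>)) * cmod (fourier g \<eta>)"] kw
    by (simp add: vf_def ug_def uf_def vg_def algebra_simps)
  define N1 where "N1 \<xi> = (\<integral>\<^sup>+\<eta>. ennreal (ug (\<xi> - \<eta>) * vf \<eta>) \<partial>lborel)" for \<xi>
  define N2 where "N2 \<xi> = (\<integral>\<^sup>+\<eta>. ennreal (uf (\<xi> - \<eta>) * vg \<eta>) \<partial>lborel)" for \<xi>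
  have [measurable]: "N1 \<in> borel_measurable borel" "N2 \<in> borel_measurable borel"
    unfolding N1_def N2_def by measurable
  have N1_swap: "(\<integral>\<^sup>+\<eta>. ennreal (vf (\<xi> - \<eta>) * ug \<eta>) \<partial>lborel) = N1 \<xi>" for \<xi>
    unfolding N1_def by (subst nn_integral_real_affine[where c="-1" and t=\<xi>]) (auto simp: mult.commute)
  define q where "q = 2 powr k"
  have q: "0 \<le> q" by (simp add: q_def)
  have bnd: "ennreal (cmod (wmul w k C \<xi>)) \<le> ennreal q * (N1 \<xi> + N2 \<xi>)" for \<xi>
  proof -
    have "cmod (wmul w k C \<xi>) \<le> wt w k \<xi> * cmod (convolution (fourier f) (fourier g) \<xi>)"
      unfolding cmod_wmul C_def norm_mult norm_of_real using c wt_pos[of w k \<xi>]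
      by (intro mult_left_mono) (auto intro: mult_left_le_one_le)
    then have "ennreal (cmod (wmul w k C \<xi>)) \<le> ennreal (wt w k \<xi>) * ennreal (cmod (convolution (fourier f) (fourier g) \<xi>))"
      using wt_pos[of w k \<xi>] by (simp add: ennreal_mult[symmetric] ennreal_leI)
    also have "\<dots> \<le> ennreal (wt w k \<xi>) * (\<integral>\<^sup>+\<eta>. ennreal (cmod (fourier f (\<xi> - \<eta>) * fourier g \<eta>)) \<partial>lborel)"
      unfolding convolution_def by (intro mult_left_mono norm_integral_le_nn) simp
    also have "\<dots> = (\<integral>\<^sup>+\<eta>. ennreal (wt w k \<xi> * (cmod (fourier f (\<xi> - \<eta>)) * cmod (fourier g \<eta>))) \<partial>lborel)"
      using wt_pos[of w k \<xi>] by (subst nn_integral_cmult[symmetric]) (auto simp: norm_mult ennreal_mult)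
    also have "\<dots> \<le> (\<integral>\<^sup>+\<eta>. ennreal (2 powr k * (vf (\<xi> - \<eta>) * ug \<eta> + uf (\<xi> - \<eta>) * vg \<eta>)) \<partial>lborel)"
      by (intro nn_integral_mono ennreal_leI pw)
    also have "\<dots> = (\<integral>\<^sup>+\<eta>. ennreal q * (ennreal (vf (\<xi> - \<eta>) * ug \<eta>) + ennreal (uf (\<xi> - \<eta>) * vg \<eta>)) \<partial>lborel)"
      by (intro nn_integral_cong) (simp add: q_def ennreal_mult ennreal_plus pos)
    also have "\<dots> = ennreal q * (N1 \<xi> + N2 \<xi>)"
      by (subst nn_integral_cmult, measurable, subst nn_integral_add, measurable) (simp add: N1_swap N2_def)
    finally show ?thesis .
  qed
  have vint: "(\<integral>\<^sup>+x. ennreal ((wt w k x * cmod (fourier h x))\<^sup>2) \<partial>lborel) = ennreal ((hnorm w k h)\<^sup>2)" if h: "h \<in> hspace w k" for h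
    using nn_l2[OF hspaceD(2)[OF h]] unfolding cmod_wmul hnorm_eq[OF h] .
  \<comment> \<open>\<open>nn_young\<close> asks for a positive constant, but
    \<open>Cb * hnorm w k h\<close> may vanish. Hence \<open>e\<close> is added here and sent to 0
    at the end.\<close>
  have sq: "(\<integral>\<^sup>+\<xi>. (ennreal (cmod (wmul w k C \<xi>)))\<^sup>2 \<partial>lborel)
      \<le> ennreal (2 * q\<^sup>2 * (((Cb * hnorm w k g + e) * hnorm w k f)\<^sup>2 + ((Cb * hnorm w k f + e) * hnorm w k g)\<^sup>2))"
    if e: "e > 0" for e
  proof -
    have K: "0 < Cb * hnorm w k h + e" for h using e Cb_nonneg by (intro add_nonneg_pos mult_nonneg_nonneg) auto
    have N1: "(\<integral>\<^sup>+\<xi>. (N1 \<xi>)\<^sup>2 \<partial>lborel) \<le> ennreal (((Cb * hnorm w k g + e) * hnorm w k f)\<^sup>2)"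
    proof -
      have "(\<integral>\<^sup>+\<xi>. (N1 \<xi>)\<^sup>2 \<partial>lborel) \<le> ennreal ((Cb * hnorm w k g + e)\<^sup>2) * (\<integral>\<^sup>+x. ennreal ((vf x)\<^sup>2) \<partial>lborel)"
        unfolding N1_def
      proof (rule nn_young)
        show "(\<integral>\<^sup>+x. ennreal (ug x) \<partial>lborel) \<le> ennreal (Cb * hnorm w k g + e)"
          using L1[OF hg] e unfolding ug_def by (elim order_trans) (auto intro: ennreal_leI)
      qed (use pos K in auto)
      also have "\<dots> = ennreal (((Cb * hnorm w k g + e) * hnorm w k f)\<^sup>2)"
        unfolding vf_def vint[OF hf] by (simp add: ennreal_mult[symmetric] power_mult_distrib)
      finally show ?thesis .
    qed
    have N2: "(\<integral>\<^sup>+\<xi>. (N2 \<xi>)\<^sup>2 \<partial>lborel) \<le> ennreal (((Cb * hnorm w k f + e) * hnorm w k g)\<^sup>2)"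
    proof -
      have "(\<integral>\<^sup>+\<xi>. (N2 \<xi>)\<^sup>2 \<partial>lborel) \<le> ennreal ((Cb * hnorm w k f + e)\<^sup>2) * (\<integral>\<^sup>+x. ennreal ((vg x)\<^sup>2) \<partial>lborel)"
        unfolding N2_def
      proof (rule nn_young)
        show "(\<integral>\<^sup>+x. ennreal (uf x) \<partial>lborel) \<le> ennreal (Cb * hnorm w k f + e)"
          using L1[OF hf] e unfolding uf_def by (elim order_trans) (auto intro: ennreal_leI)
      qed (use pos K in auto)
      also have "\<dots> = ennreal (((Cb * hnorm w k f + e) * hnorm w k g)\<^sup>2)"
        unfolding vg_def vint[OF hg] by (simp add: ennreal_mult[symmetric] power_mult_distrib)
      finally show ?thesis .
    qed
    have two: "(a + b)\<^sup>2 \<le> 2 * (a\<^sup>2 + b\<^sup>2)" for a b :: ennreal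
    proof (cases a; cases b)
      fix r s :: real assume "a = ennreal r" "0 \<le> r" "b = ennreal s" "0 \<le> s"
      then have "(a + b)\<^sup>2 = ennreal ((r + s)\<^sup>2)" "a\<^sup>2 + b\<^sup>2 = ennreal (r\<^sup>2 + s\<^sup>2)"
        by (simp_all add: ennreal_power ennreal_plus[symmetric] del: ennreal_plus)
      moreover have "2 * ennreal (r\<^sup>2 + s\<^sup>2) = ennreal (2 * (r\<^sup>2 + s\<^sup>2))"
        using ennreal_mult[of 2 "r\<^sup>2 + s\<^sup>2"] by simp
      moreover have "(r + s)\<^sup>2 \<le> 2 * (r\<^sup>2 + s\<^sup>2)"
        using sum_squares_bound[of r s] by (simp add: power2_sum)
      ultimately show ?thesis by (simp only: ennreal_leI)
    qed (auto simp: power2_eq_square ennreal_mult_top top_unique)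
    have "(\<integral>\<^sup>+\<xi>. (ennreal (cmod (wmul w k C \<xi>)))\<^sup>2 \<partial>lborel) \<le> (\<integral>\<^sup>+\<xi>. ennreal (q\<^sup>2) * (2 * ((N1 \<xi>)\<^sup>2 + (N2 \<xi>)\<^sup>2)) \<partial>lborel)"
    proof (rule nn_integral_mono)
      fix \<xi>
      have "(ennreal (cmod (wmul w k C \<xi>)))\<^sup>2 \<le> (ennreal q * (N1 \<xi> + N2 \<xi>))\<^sup>2" by (intro power_mono bnd) simp
      also have "\<dots> = ennreal (q\<^sup>2) * (N1 \<xi> + N2 \<xi>)\<^sup>2" using q by (simp add: power_mult_distrib ennreal_power)
      also have "\<dots> \<le> ennreal (q\<^sup>2) * (2 * ((N1 \<xi>)\<^sup>2 + (N2 \<xi>)\<^sup>2))" by (intro mult_left_mono two) simp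
      finally show "(ennreal (cmod (wmul w k C \<xi>)))\<^sup>2 \<le> ennreal (q\<^sup>2) * (2 * ((N1 \<xi>)\<^sup>2 + (N2 \<xi>)\<^sup>2))" .
    qed
    also have "\<dots> = ennreal (q\<^sup>2) * (2 * ((\<integral>\<^sup>+\<xi>. (N1 \<xi>)\<^sup>2 \<partial>lborel) + (\<integral>\<^sup>+\<xi>. (N2 \<xi>)\<^sup>2 \<partial>lborel)))"
      by (simp add: nn_integral_cmult nn_integral_add)
    also have "\<dots> \<le> ennreal (q\<^sup>2) * (2 * (ennreal (((Cb * hnorm w k g + e) * hnorm w k f)\<^sup>2) + ennreal (((Cb * hnorm w k f + e) * hnorm w k g)\<^sup>2)))"
      by (intro mult_left_mono add_mono N1 N2) auto
    also have "\<dots> = ennreal (2 * q\<^sup>2 * (((Cb * hnorm w k g + e) * hnorm w k f)\<^sup>2 + ((Cb * hnorm w k f + e) * hnorm w k g)\<^sup>2))"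
      by (simp add: ennreal_plus[symmetric] ennreal_mult mult_ac del: ennreal_plus)
    finally show ?thesis .
  qed
  have sqC: "square_integrable (wmul w k C)"
    unfolding sqint_iff_nn using le_less_trans[OF sq[of 1] ennreal_less_top] by (simp add: ennreal_power)
  define P where "P = hnorm w k f * hnorm w k g"
  have P: "0 \<le> P" by (simp add: P_def)
  have l2C: "(l2 (wmul w k C))\<^sup>2 \<le> 2 * q\<^sup>2 * (((Cb * hnorm w k g + e) * hnorm w k f)\<^sup>2 + ((Cb * hnorm w k f + e) * hnorm w k g)\<^sup>2)"
    if e: "e > 0" for e
    using sq[OF e] by (simp add: ennreal_power nn_l2[OF sqC])
  have "((\<lambda>e. 2 * q\<^sup>2 * (((Cb * hnorm w k g + e) * hnorm w k f)\<^sup>2 + ((Cb * hnorm w k f + e) * hnorm w k g)\<^sup>2))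
      \<longlongrightarrow> 2 * q\<^sup>2 * (((Cb * hnorm w k g + 0) * hnorm w k f)\<^sup>2 + ((Cb * hnorm w k f + 0) * hnorm w k g)\<^sup>2)) (at_right 0)"
    by (intro tendsto_intros)
  then have "(l2 (wmul w k C))\<^sup>2 \<le> 2 * q\<^sup>2 * (((Cb * hnorm w k g + 0) * hnorm w k f)\<^sup>2 + ((Cb * hnorm w k f + 0) * hnorm w k g)\<^sup>2)"
    by (rule tendsto_lowerbound) (auto simp: eventually_at_right_field intro!: exI[of _ 1] l2C)
  also have "\<dots> = (2 * q * Cb * P)\<^sup>2" by (simp add: P_def power2_eq_square algebra_simps)
  also have "\<dots> \<le> (Calg k * P)\<^sup>2"
    using q P Cb_nonneg unfolding Calg_def q_def[symmetric]
    by (intro power_mono mult_right_mono) (auto simp: algebra_simps intro: add_nonneg_nonneg)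
  finally have "l2 (wmul w k C) \<le> Calg k * P"
    by (rule power2_le_imp_le) (use P Cb_nonneg in \<open>simp add: Calg_def\<close>)
  then show "hnorm w k (\<lambda>x. f x * g x) \<le> Calg k * (hnorm w k f * hnorm w k g)"
    unfolding eq using hcI(2)[OF _ sqC kw] by (simp add: P_def)
  show "(\<lambda>x. f x * g x) \<in> hc w k" unfolding eq by (rule hcI(1)[OF _ sqC kw]) simp
qed

lemma Calg_ge_1: "1 \<le> Calg k"
  using Cb_nonneg by (simp add: Calg_def)

section \<open>Paths of functions and the derivative of the energy\<close>

definition L2cont :: "real \<Rightarrow> (real \<Rightarrow> real \<Rightarrow> complex) \<Rightarrow> bool" where
  "L2cont T F \<longleftrightarrow> (\<forall>t\<in>{0..T}. square_integrable (F t) \<and>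
     ((\<lambda>s. l2 (\<lambda>x. F s x - F t x)) \<longlongrightarrow> 0) (at t within {0..T}))"

lemma L2cont_sqint: "L2cont T F \<Longrightarrow> t \<in> {0..T} \<Longrightarrow> square_integrable (F t)"
  by (simp add: L2cont_def)

lemma L2cont_lim:
  "L2cont T F \<Longrightarrow> t \<in> {0..T} \<Longrightarrow> ((\<lambda>s. l2 (\<lambda>x. F s x - F t x)) \<longlongrightarrow> 0) (at t within {0..T})"
  by (simp add: L2cont_def)

lemma eventually_at_within_mem: "(\<And>s. s \<in> S \<Longrightarrow> P s) \<Longrightarrow> \<forall>\<^sub>F s in at t within S. P s"
  by (auto simp: eventually_at_filter)

lemma L2cont_bounded_by:
  assumes sq: "\<And>t. t \<in> {0..T} \<Longrightarrow> square_integrable (F t)"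
    and lim: "\<And>t. t \<in> {0..T} \<Longrightarrow> ((\<lambda>s. r s t) \<longlongrightarrow> 0) (at t within {0..T})"
    and le: "\<And>s t. s \<in> {0..T} \<Longrightarrow> t \<in> {0..T} \<Longrightarrow> l2 (\<lambda>x. F s x - F t x) \<le> r s t"
  shows "L2cont T F"
  unfolding L2cont_def
proof (intro ballI conjI sq)
  fix t assume t: "t \<in> {0..T}"
  show "((\<lambda>s. l2 (\<lambda>x. F s x - F t x)) \<longlongrightarrow> 0) (at t within {0..T})"
    by (rule Lim_null_comparison[OF eventually_at_within_mem lim[OF t]]) (use le t in auto)
qed

lemma L2cont_diff:
  assumes F: "L2cont T F" and G: "L2cont T G"
  shows "L2cont T (\<lambda>t x. F t x - G t x)"
proof (rule L2cont_bounded_by[where r="\<lambda>s t. l2 (\<lambda>x. F s x - F t x) + l2 (\<lambda>x. G s x - G t x)"])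
  note sq = L2cont_sqint[OF F] L2cont_sqint[OF G]
  show "square_integrable (\<lambda>x. F t x - G t x)" if "t \<in> {0..T}" for t
    using that by (intro sqint_diff sq)
  show "((\<lambda>s. l2 (\<lambda>x. F s x - F t x) + l2 (\<lambda>x. G s x - G t x)) \<longlongrightarrow> 0) (at t within {0..T})" if "t \<in> {0..T}" for t
    using tendsto_add[OF L2cont_lim[OF F that] L2cont_lim[OF G that]] by simp
  show "l2 (\<lambda>x. F s x - G s x - (F t x - G t x)) \<le> l2 (\<lambda>x. F s x - F t x) + l2 (\<lambda>x. G s x - G t x)"
    if "s \<in> {0..T}" "t \<in> {0..T}" for s t
  proof -
    have "l2 (\<lambda>x. (F s x - F t x) - (G s x - G t x)) \<le> l2 (\<lambda>x. F s x - F t x) + l2 (\<lambda>x. G s x - G t x)"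
      using that by (intro l2_triangle_diff sqint_diff sq)
    moreover have "(\<lambda>x. F s x - G s x - (F t x - G t x)) = (\<lambda>x. (F s x - F t x) - (G s x - G t x))"
      by (rule ext) simp
    ultimately show ?thesis by simp
  qed
qed

lemma L2cont_mult:
  assumes F: "L2cont T F" and [measurable]: "b \<in> borel_measurable borel" and b: "\<And>x. cmod (b x) \<le> B"
  shows "L2cont T (\<lambda>t x. b x * F t x)"
proof (rule L2cont_bounded_by[where r="\<lambda>s t. B * l2 (\<lambda>x. F s x - F t x)"])
  note sq = L2cont_sqint[OF F]
  show "square_integrable (\<lambda>x. b x * F t x)" if "t \<in> {0..T}" for t
    using that by (intro sqint_mult_bounded[OF sq _ b]) auto
  show "((\<lambda>s. B * l2 (\<lambda>x. F s x - F t x)) \<longlongrightarrow> 0) (at t within {0..T})" if "t \<in> {0..T}" for t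
    using tendsto_mult_left[OF L2cont_lim[OF F that], of B] by simp
  show "l2 (\<lambda>x. b x * F s x - b x * F t x) \<le> B * l2 (\<lambda>x. F s x - F t x)"
    if "s \<in> {0..T}" "t \<in> {0..T}" for s t
    unfolding right_diff_distrib[symmetric] using that by (intro l2_mult_bounded[OF _ _ b] sqint_diff sq) auto
qed

lemma L2cont_cong_AE:
  assumes F: "L2cont T F" and ae: "\<And>t. t \<in> {0..T} \<Longrightarrow> AE x in lborel. F t x = G t x"
    and m: "\<And>t. t \<in> {0..T} \<Longrightarrow> G t \<in> borel_measurable borel"
  shows "L2cont T G"
proof (rule L2cont_bounded_by[where r="\<lambda>s t. l2 (\<lambda>x. F s x - F t x)"])
  note sq = L2cont_sqint[OF F]
  show "square_integrable (G t)" if "t \<in> {0..T}" for t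
    using sqint_cong_AE[OF sq ae m] that by auto
  show "((\<lambda>s. l2 (\<lambda>x. F s x - F t x)) \<longlongrightarrow> 0) (at t within {0..T})" if "t \<in> {0..T}" for t
    by (rule L2cont_lim[OF F that])
  show "l2 (\<lambda>x. G s x - G t x) \<le> l2 (\<lambda>x. F s x - F t x)" if st: "s \<in> {0..T}" "t \<in> {0..T}" for s t
  proof -
    have [measurable]: "G s \<in> borel_measurable borel" "G t \<in> borel_measurable borel"
      "F s \<in> borel_measurable borel" "F t \<in> borel_measurable borel" using m sq st by auto
    have "AE x in lborel. F s x - F t x = G s x - G t x" using ae[OF st(1)] ae[OF st(2)] by eventually_elim simp
    then show ?thesis by (subst l2_cong_AE) auto
  qed
qed

lemma L2cont_norm:
  assumes F: "L2cont T F"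
  shows "continuous_on {0..T} (\<lambda>t. l2 (F t))"
  unfolding continuous_on_def
proof
  fix t assume t: "t \<in> {0..T}"
  have "((\<lambda>s. l2 (F s) - l2 (F t)) \<longlongrightarrow> 0) (at t within {0..T})"
    by (rule Lim_null_comparison[OF eventually_at_within_mem L2cont_lim[OF F t]])
       (use l2_rev_triangle[OF L2cont_sqint[OF F] L2cont_sqint[OF F t]] in auto)
  then show "((\<lambda>s. l2 (F s)) \<longlongrightarrow> l2 (F t)) (at t within {0..T})" by (rule LIM_zero_cancel)
qed

section \<open>Solutions at a reduced weight\<close>

lemma powr_exp_bounded:
  fixes k \<kappa> :: real
  assumes "\<kappa> > 0"
  obtains B where "0 \<le> B" "\<And>b. 1 \<le> b \<Longrightarrow> b powr k * exp (- \<kappa> * b) \<le> B"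
proof (cases "k \<le> 0")
  case True
  have "b powr k * exp (- \<kappa> * b) \<le> 1" if b: "1 \<le> b" for b
  proof -
    have "b powr k \<le> 1" using powr_mono[OF True b] b by simp
    moreover have "exp (- \<kappa> * b) \<le> 1" using assms b by simp
    ultimately show ?thesis by (intro mult_le_one) auto
  qed
  then show ?thesis using that[of 1] by auto
next
  case False
  then have k: "k > 0" by simp
  \<comment> \<open>The bound is the maximum over positive \<open>b\<close>, attained at
    \<open>b = k / \<kappa>\<close>; it comes from \<open>ln x \<le> x - 1\<close> at
    \<open>x = b * (\<kappa> / k)\<close>.\<close>
  have "b powr k * exp (- \<kappa> * b) \<le> exp (k * (ln (k / \<kappa>) - 1))" if b: "1 \<le> b" for b
  proof -
    have "ln (b * (\<kappa> / k)) \<le> b * (\<kappa> / k) - 1" using b assms k by (intro ln_le_minus_one) auto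
    moreover have "ln (b * (\<kappa> / k)) = ln b - ln (k / \<kappa>)" using b assms k by (simp add: ln_mult ln_div)
    ultimately have "ln b \<le> ln (k / \<kappa>) - 1 + b * (\<kappa> / k)" by linarith
    from mult_left_mono[OF this, of k] have "k * ln b - \<kappa> * b \<le> k * (ln (k / \<kappa>) - 1)"
      using k by (simp add: algebra_simps)
    then have "exp (k * ln b - \<kappa> * b) \<le> exp (k * (ln (k / \<kappa>) - 1))" by simp
    then show ?thesis using b by (simp add: powr_def exp_diff exp_minus field_simps)
  qed
  then show ?thesis using that[of "exp (k * (ln (k / \<kappa>) - 1))"] by auto
qed

text \<open>A Lipschitz bound that retains an exponential factor; that factor later absorbs the
  bracket produced by differencing the weight in time.\<close>

lemma exp_diff_le: "\<bar>exp (- x) - exp (- y)\<bar> \<le> \<bar>x - y\<bar> * exp (- min x y)" for x y :: real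
proof -
  have *: "\<bar>exp (- x) - exp (- y)\<bar> \<le> \<bar>x - y\<bar> * exp (- min x y)" if "x \<le> y" for x y :: real
  proof -
    have "exp (- x) - exp (- y) = exp (- x) * (1 - exp (x - y))" by (simp add: right_diff_distrib exp_add[symmetric])
    also have "\<dots> \<le> exp (- x) * (y - x)"
    proof (rule mult_left_mono)
      show "1 - exp (x - y) \<le> y - x" using exp_ge_add_one_self[of "x - y"] by linarith
    qed simp
    finally show ?thesis using that by (simp add: min_def mult.commute)
  qed
  show ?thesis
    using *[of x y] *[of y x] by (cases "x \<le> y") (auto simp: abs_minus_commute min.commute)
qed

text \<open>\<open>WT_pos\<close> keeps the weight above a positive constant on the whole time
  interval. This margin is what is spent on derivatives.\<close>

locale weight_decay =
  fixes w0 M T :: real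
  assumes T_pos: "0 < T" and M_nonneg: "0 \<le> M" and WT_pos: "0 < w0 - M * T"
begin

definition W :: "real \<Rightarrow> real" where "W t = w0 - M * t"

lemma W_ge: "t \<in> {0..T} \<Longrightarrow> w0 - M * T \<le> W t"
  using M_nonneg by (auto simp: W_def intro: mult_left_mono)

lemma W_pos: "t \<in> {0..T} \<Longrightarrow> 0 < W t"
  using W_ge[of t] WT_pos by simp

text \<open>Lowering the weight from \<open>W\<close> to \<open>c * W\<close> buys any number of derivatives, so that solutions of every
  regularity satisfy this. The energies use \<open>c = 1 / 4\<close>; their time derivative involves the weight \<open>2 * c\<close>.\<close>

definition apath :: "(real \<Rightarrow> real \<Rightarrow> complex) \<Rightarrow> bool" where
  "apath \<psi> \<longleftrightarrow> (\<forall>t\<in>{0..T}. square_integrable (\<psi> t) \<and> continuous_on UNIV (\<psi> t)) \<and>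
     (\<forall>k c. 0 \<le> c \<and> c \<le> 1 / 2 \<longrightarrow> L2cont T (\<lambda>t. wmul (c * W t) k (fourier (\<psi> t))))"

lemma apathD:
  assumes "apath \<psi>"
  shows "t \<in> {0..T} \<Longrightarrow> square_integrable (\<psi> t)" "t \<in> {0..T} \<Longrightarrow> continuous_on UNIV (\<psi> t)"
    "0 \<le> c \<Longrightarrow> c \<le> 1 / 2 \<Longrightarrow> L2cont T (\<lambda>t. wmul (c * W t) k (fourier (\<psi> t)))"
  using assms by (auto simp: apath_def)

lemma apath_hc:
  assumes "apath \<psi>" "t \<in> {0..T}" "0 \<le> c" "c \<le> 1 / 2"
  shows "\<psi> t \<in> hc (c * W t) k"
  using L2cont_sqint[OF apathD(3)[OF assms(1,3,4)] assms(2)] apathD(1,2)[OF assms(1,2)]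
  by (auto simp: hc_def hspace_iff)

text \<open>Relative to \<open>\<Phi>\<close>, the transform at full weight, the lower weight is a
  multiplier \<open>\<rho> t\<close>. The exponential left over makes it bounded and Lipschitz in
  time, uniformly in the frequency, so L^2 continuity passes from \<open>\<Phi>\<close> to every
  order \<open>k\<close>.\<close>

lemma apath_C_hspace:
  assumes C: "\<psi> \<in> C_hspace W T l" and l: "0 \<le> l" and cont: "\<And>t. t \<in> {0..T} \<Longrightarrow> continuous_on UNIV (\<psi> t)"
  shows "apath \<psi>"
proof -
  define \<Psi> where "\<Psi> = (\<lambda>t. fourier (\<psi> t))"
  define \<Phi> where "\<Phi> = (\<lambda>t \<xi>. complex_of_real (exp (W t * bracket \<xi>)) * \<Psi> t \<xi>)"
  have \<Phi>_wmul: "\<Phi> t = wmul (W t) 0 (\<Psi> t)" for t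
    using bracket_pos by (auto simp: \<Phi>_def wmul_def wt_def less_imp_neq[THEN not_sym])
  have hsp: "\<psi> t \<in> hspace (W t) l" if "t \<in> {0..T}" for t
    using C that by (simp add: C_hspace_def)
  have hsp0: "\<psi> t \<in> hspace (W t) 0" if "t \<in> {0..T}" for t
    using hspace_mono(1)[OF hsp[OF that], of "W t" 0] l by simp
  have \<Psi>m: "\<Psi> t \<in> borel_measurable borel" if "t \<in> {0..T}" for t
    using hspaceD(3)[OF hsp0[OF that]] by (simp add: \<Psi>_def)
  have \<Phi>sq: "square_integrable (\<Phi> t)" if "t \<in> {0..T}" for t
    using hspaceD(2)[OF hsp0[OF that]] by (simp add: \<Phi>_wmul \<Psi>_def)
  define \<zeta> where "\<zeta> = (\<lambda>t. inv_fourier (\<Phi> t))"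
  have S: "\<zeta> \<in> C_sobolev T l"
    using C by (simp add: C_hspace_def \<zeta>_def \<Phi>_def \<Psi>_def)
  have \<zeta>h: "\<zeta> t \<in> hspace 0 l" if "t \<in> {0..T}" for t
    using S that by (simp add: C_sobolev_def)
  \<comment> \<open>\<open>C_hspace\<close> states continuity for
    \<open>inv_fourier (\<Phi> t)\<close>. Applying \<open>fourier\<close> returns
    \<open>\<Phi> t\<close> almost everywhere, and the norm of order \<open>l\<close> dominates the
    L^2 norm.\<close>
  have \<Phi>cont: "L2cont T \<Phi>"
  proof (rule L2cont_bounded_by[where r="\<lambda>s t. hnorm 0 l (\<lambda>x. \<zeta> s x - \<zeta> t x)", OF \<Phi>sq])
    show "((\<lambda>s. hnorm 0 l (\<lambda>x. \<zeta> s x - \<zeta> t x)) \<longlongrightarrow> 0) (at t within {0..T})" if "t \<in> {0..T}" for t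
      using S that by (simp add: C_sobolev_def)
    fix s t assume st: "s \<in> {0..T}" "t \<in> {0..T}"
    note D = hspace_diff(1)[OF \<zeta>h[OF st(1)] \<zeta>h[OF st(2)]]
    have D0: "(\<lambda>x. \<zeta> s x - \<zeta> t x) \<in> hspace 0 0" by (rule hspace_mono(1)[OF D]) (use l in auto)
    note sqs = hspaceD(1)[OF \<zeta>h[OF st(1)]] and sqt = hspaceD(1)[OF \<zeta>h[OF st(2)]]
    have wf0: "wmul 0 0 F = F" for F using bracket_pos by (auto simp: wmul_def wt_def less_imp_neq[THEN not_sym])
    have "AE \<xi> in lborel. \<Phi> s \<xi> - \<Phi> t \<xi> = fourier (\<lambda>x. \<zeta> s x - \<zeta> t x) \<xi>"
      using fourier_diff[OF sqs sqt] fourier_inv_fourier[OF \<Phi>sq[OF st(1)]] fourier_inv_fourier[OF \<Phi>sq[OF st(2)]]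
      unfolding \<zeta>_def by eventually_elim simp
    then have "l2 (\<lambda>\<xi>. \<Phi> s \<xi> - \<Phi> t \<xi>) = l2 (fourier (\<lambda>x. \<zeta> s x - \<zeta> t x))"
      using hspaceD(3)[OF D] sqint_measurable[OF sqint_diff[OF \<Phi>sq[OF st(1)] \<Phi>sq[OF st(2)]]]
      by (intro l2_cong_AE)
    also have "\<dots> = hnorm 0 0 (\<lambda>x. \<zeta> s x - \<zeta> t x)" by (simp add: hnorm_eq[OF D0] wf0)
    also have "\<dots> \<le> hnorm 0 l (\<lambda>x. \<zeta> s x - \<zeta> t x)" by (rule hspace_mono(2)[OF D]) (use l in auto)
    finally show "l2 (\<lambda>\<xi>. \<Phi> s \<xi> - \<Phi> t \<xi>) \<le> hnorm 0 l (\<lambda>x. \<zeta> s x - \<zeta> t x)" .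
  qed
  have "L2cont T (\<lambda>t. wmul (c * W t) k (\<Psi> t))" if c: "0 \<le> c" "c \<le> 1 / 2" for k c
  proof -
    \<comment> \<open>As \<open>c \<le> 1 / 2\<close>, at least half of the weight is left over;
      \<open>\<kappa>\<close> bounds \<open>(1 - c) * W t\<close> from below uniformly in
      time.\<close>
    define \<kappa> where "\<kappa> = (w0 - M * T) / 2"
    have \<kappa>: "\<kappa> > 0" using WT_pos by (simp add: \<kappa>_def)
    have \<kappa>W: "\<kappa> \<le> (1 - c) * W t" if "t \<in> {0..T}" for t
      using mult_mono[of "1/2" "1 - c" "w0 - M * T" "W t"] W_ge[OF that] W_pos[OF that] WT_pos c by (simp add: \<kappa>_def)
    obtain B where B: "0 \<le> B" "\<And>b. 1 \<le> b \<Longrightarrow> b powr k * exp (- \<kappa> * b) \<le> B"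
      using powr_exp_bounded[OF \<kappa>, of k] by blast
    \<comment> \<open>The order \<open>k + 1\<close> appears because differencing the weight in time
      brings down one factor \<open>bracket \<xi>\<close>.\<close>
    obtain B' where B': "0 \<le> B'" "\<And>b. 1 \<le> b \<Longrightarrow> b powr (k + 1) * exp (- \<kappa> * b) \<le> B'"
      using powr_exp_bounded[OF \<kappa>, of "k + 1"] by blast
    define \<rho> where "\<rho> t \<xi> = bracket \<xi> powr k * exp (- ((1 - c) * W t * bracket \<xi>))" for t \<xi>
    have [measurable]: "\<rho> t \<in> borel_measurable borel" for t unfolding \<rho>_def by measurable
    have eq: "wmul (c * W t) k (\<Psi> t) = (\<lambda>\<xi>. complex_of_real (\<rho> t \<xi>) * \<Phi> t \<xi>)" for t
    proof
      fix \<xi>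
      have "wt (c * W t) k \<xi> = \<rho> t \<xi> * exp (W t * bracket \<xi>)"
        unfolding wt_def \<rho>_def mult.assoc exp_add[symmetric] by (simp add: algebra_simps)
      then show "wmul (c * W t) k (\<Psi> t) \<xi> = complex_of_real (\<rho> t \<xi>) * \<Phi> t \<xi>"
        by (simp add: wmul_def \<Phi>_def)
    qed
    have \<rho>B: "cmod (complex_of_real (\<rho> t \<xi>)) \<le> B" if t: "t \<in> {0..T}" for t \<xi>
    proof -
      have "\<kappa> * bracket \<xi> \<le> (1 - c) * W t * bracket \<xi>" using \<kappa>W[OF t] bracket_pos[of \<xi>] by (simp add: mult_right_mono)
      then have "\<rho> t \<xi> \<le> bracket \<xi> powr k * exp (- \<kappa> * bracket \<xi>)" unfolding \<rho>_def by (intro mult_left_mono) auto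
      also have "\<dots> \<le> B" by (rule B(2)[OF bracket_ge_1])
      finally show ?thesis unfolding norm_of_real by (simp add: \<rho>_def)
    qed
    have \<rho>L: "cmod (complex_of_real (\<rho> s \<xi> - \<rho> t \<xi>)) \<le> M * \<bar>s - t\<bar> * B'" if st: "s \<in> {0..T}" "t \<in> {0..T}" for s t \<xi>
    proof -
      define x y where "x = (1 - c) * W s * bracket \<xi>" and "y = (1 - c) * W t * bracket \<xi>"
      have m: "\<kappa> * bracket \<xi> \<le> min x y"
        unfolding x_def y_def using \<kappa>W[OF st(1)] \<kappa>W[OF st(2)] bracket_pos[of \<xi>] by (simp add: mult_right_mono)
      have xy: "\<bar>x - y\<bar> \<le> M * \<bar>s - t\<bar> * bracket \<xi>"
      proof -
        have "x - y = (1 - c) * (M * (t - s) * bracket \<xi>)" by (simp add: x_def y_def W_def algebra_simps)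
        then have "\<bar>x - y\<bar> = (1 - c) * (M * \<bar>s - t\<bar> * bracket \<xi>)"
          using c M_nonneg bracket_pos[of \<xi>] by (simp add: abs_mult abs_minus_commute)
        also have "\<dots> \<le> 1 * (M * \<bar>s - t\<bar> * bracket \<xi>)"
          using c M_nonneg bracket_pos[of \<xi>] by (intro mult_right_mono) auto
        finally show ?thesis by simp
      qed
      have "\<bar>\<rho> s \<xi> - \<rho> t \<xi>\<bar> = bracket \<xi> powr k * \<bar>exp (- x) - exp (- y)\<bar>"
        unfolding \<rho>_def x_def y_def right_diff_distrib[symmetric] by (simp add: abs_mult)
      also have "\<dots> \<le> bracket \<xi> powr k * ((M * \<bar>s - t\<bar> * bracket \<xi>) * exp (- \<kappa> * bracket \<xi>))"
        using m xy by (intro mult_left_mono order_trans[OF exp_diff_le] mult_mono) auto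
      also have "\<dots> = M * \<bar>s - t\<bar> * (bracket \<xi> powr (k + 1) * exp (- \<kappa> * bracket \<xi>))"
        using bracket_pos[of \<xi>] by (simp add: powr_add)
      also have "\<dots> \<le> M * \<bar>s - t\<bar> * B'"
        using M_nonneg by (intro mult_left_mono B'(2) bracket_ge_1) auto
      finally show ?thesis unfolding norm_of_real .
    qed
    show ?thesis
      unfolding eq
    proof (rule L2cont_bounded_by[where r="\<lambda>s t. B * l2 (\<lambda>\<xi>. \<Phi> s \<xi> - \<Phi> t \<xi>) + M * \<bar>s - t\<bar> * B' * l2 (\<Phi> t)"])
      show "square_integrable (\<lambda>\<xi>. complex_of_real (\<rho> t \<xi>) * \<Phi> t \<xi>)" if "t \<in> {0..T}" for t
        by (rule sqint_mult_bounded[OF \<Phi>sq[OF that] _ \<rho>B[OF that]]) simp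
      show "((\<lambda>s. B * l2 (\<lambda>\<xi>. \<Phi> s \<xi> - \<Phi> t \<xi>) + M * \<bar>s - t\<bar> * B' * l2 (\<Phi> t)) \<longlongrightarrow> 0) (at t within {0..T})" if t: "t \<in> {0..T}" for t
      proof -
        have "((\<lambda>s. B * l2 (\<lambda>\<xi>. \<Phi> s \<xi> - \<Phi> t \<xi>) + M * \<bar>s - t\<bar> * B' * l2 (\<Phi> t)) \<longlongrightarrow> B * 0 + M * \<bar>t - t\<bar> * B' * l2 (\<Phi> t)) (at t within {0..T})"
          by (intro tendsto_intros L2cont_lim[OF \<Phi>cont t])
        then show ?thesis by simp
      qed
      fix s t assume st: "s \<in> {0..T}" "t \<in> {0..T}"
      have e: "(\<lambda>\<xi>. complex_of_real (\<rho> s \<xi>) * \<Phi> s \<xi> - complex_of_real (\<rho> t \<xi>) * \<Phi> t \<xi>)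
          = (\<lambda>\<xi>. complex_of_real (\<rho> s \<xi>) * (\<Phi> s \<xi> - \<Phi> t \<xi>) + complex_of_real (\<rho> s \<xi> - \<rho> t \<xi>) * \<Phi> t \<xi>)"
        by (simp add: algebra_simps)
      have dsq: "square_integrable (\<lambda>\<xi>. \<Phi> s \<xi> - \<Phi> t \<xi>)" using st by (intro sqint_diff \<Phi>sq)
      have "l2 (\<lambda>\<xi>. complex_of_real (\<rho> s \<xi>) * (\<Phi> s \<xi> - \<Phi> t \<xi>) + complex_of_real (\<rho> s \<xi> - \<rho> t \<xi>) * \<Phi> t \<xi>)
          \<le> l2 (\<lambda>\<xi>. complex_of_real (\<rho> s \<xi>) * (\<Phi> s \<xi> - \<Phi> t \<xi>)) + l2 (\<lambda>\<xi>. complex_of_real (\<rho> s \<xi> - \<rho> t \<xi>) * \<Phi> t \<xi>)"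
        by (intro l2_triangle sqint_mult_bounded[OF dsq _ \<rho>B[OF st(1)]] sqint_mult_bounded[OF \<Phi>sq[OF st(2)] _ \<rho>L[OF st]]) auto
      also have "\<dots> \<le> B * l2 (\<lambda>\<xi>. \<Phi> s \<xi> - \<Phi> t \<xi>) + M * \<bar>s - t\<bar> * B' * l2 (\<Phi> t)"
        by (intro add_mono l2_mult_bounded[OF dsq _ \<rho>B[OF st(1)]] l2_mult_bounded[OF \<Phi>sq[OF st(2)] _ \<rho>L[OF st]]) auto
      finally show "l2 (\<lambda>\<xi>. complex_of_real (\<rho> s \<xi>) * \<Phi> s \<xi> - complex_of_real (\<rho> t \<xi>) * \<Phi> t \<xi>)
          \<le> B * l2 (\<lambda>\<xi>. \<Phi> s \<xi> - \<Phi> t \<xi>) + M * \<bar>s - t\<bar> * B' * l2 (\<Phi> t)" unfolding e .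
    qed
  qed
  then show ?thesis
    unfolding apath_def \<Psi>_def using hspaceD(1)[OF hsp0] cont by blast
qed

lemma apath_diff:
  assumes f: "apath f" and g: "apath g"
  shows "apath (\<lambda>t x. f t x - g t x)"
  unfolding apath_def
proof (intro conjI ballI allI impI)
  fix t assume t: "t \<in> {0..T}"
  show "square_integrable (\<lambda>x. f t x - g t x)" "continuous_on UNIV (\<lambda>x. f t x - g t x)"
    using apathD(1,2)[OF f t] apathD(1,2)[OF g t] by (auto intro!: sqint_diff continuous_intros)
next
  fix k c :: real assume c: "0 \<le> c \<and> c \<le> 1 / 2"
  show "L2cont T (\<lambda>t. wmul (c * W t) k (fourier (\<lambda>x. f t x - g t x)))"
  proof (rule L2cont_cong_AE)
    show "L2cont T (\<lambda>t \<xi>. wmul (c * W t) k (fourier (f t)) \<xi> - wmul (c * W t) k (fourier (g t)) \<xi>)"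
      using c by (intro L2cont_diff apathD(3) f g) auto
    fix t assume t: "t \<in> {0..T}"
    note sq = apathD(1)[OF f t] apathD(1)[OF g t]
    show "wmul (c * W t) k (fourier (\<lambda>x. f t x - g t x)) \<in> borel_measurable borel"
      by (intro wmul_measurable sqint_measurable sqint_fourier sqint_diff sq)
    show "AE \<xi> in lborel. wmul (c * W t) k (fourier (f t)) \<xi> - wmul (c * W t) k (fourier (g t)) \<xi>
        = wmul (c * W t) k (fourier (\<lambda>x. f t x - g t x)) \<xi>"
      using wmul_AE_diff[OF fourier_diff[OF sq], of "c * W t" k] by eventually_elim simp
  qed
qed

lemma apath_zero: "apath (\<lambda>t x. 0)"
  unfolding apath_def
proof (intro conjI ballI allI impI)
  fix k c :: real
  have "wmul (c * W t) k (\<lambda>\<xi>. 0) = (\<lambda>\<xi>. 0)" for t by (auto simp: wmul_def)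
  then have "L2cont T (\<lambda>t. wmul (c * W t) k (\<lambda>\<xi>. 0))" by (simp add: L2cont_def sqint_zero)
  then show "L2cont T (\<lambda>t. wmul (c * W t) k (fourier (\<lambda>x. 0)))"
  proof (rule L2cont_cong_AE)
    fix t
    have "AE \<xi> in lborel. fourier (\<lambda>x. 0) \<xi> = 0" using fourier_scale[OF sqint_zero, of 0] by simp
    then show "AE \<xi> in lborel. wmul (c * W t) k (\<lambda>\<xi>. 0) \<xi> = wmul (c * W t) k (fourier (\<lambda>x. 0)) \<xi>"
      by eventually_elim (simp add: wmul_def)
    show "wmul (c * W t) k (fourier (\<lambda>x. 0)) \<in> borel_measurable borel"
      by (intro wmul_measurable sqint_measurable sqint_fourier sqint_zero)
  qed
qed (auto intro: sqint_zero)

lemma apath_dx: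
  assumes f: "apath f"
  shows "apath (\<lambda>t. dx (f t))"
proof -
  have W0: "0 \<le> 0 * W t" for t by simp
  have R: "dx (f t) \<in> hc (0 * W t) 1" "AE \<xi> in lborel. fourier (dx (f t)) \<xi> = \<i> * complex_of_real \<xi> * fourier (f t) \<xi>"
    if t: "t \<in> {0..T}" for t
    using hc_deriv(2,4)[OF apath_hc[OF f t, of 0 "1 + 1"] order_refl W0] by simp_all
  show ?thesis
    unfolding apath_def
  proof (intro conjI ballI allI impI)
    fix t assume t: "t \<in> {0..T}"
    show "square_integrable (dx (f t))" "continuous_on UNIV (dx (f t))"
      using R(1)[OF t] by (auto simp: hc_def dest: hspaceD)
  next
    fix k c :: real assume c: "0 \<le> c \<and> c \<le> 1 / 2"
    \<comment> \<open>One order is traded for the bounded multiplier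
      \<open>\<i> * \<xi> / bracket \<xi>\<close>, which does not depend on time.\<close>
    define b where "b \<xi> = \<i> * complex_of_real (\<xi> / bracket \<xi>)" for \<xi>
    show "L2cont T (\<lambda>t. wmul (c * W t) k (fourier (dx (f t))))"
    proof (rule L2cont_cong_AE)
      show "L2cont T (\<lambda>t \<xi>. b \<xi> * wmul (c * W t) (k + 1) (fourier (f t)) \<xi>)"
      proof (rule L2cont_mult[where B=1])
        show "cmod (b \<xi>) \<le> 1" for \<xi>
          using abs_le_bracket[of \<xi>] bracket_pos[of \<xi>] by (simp add: b_def norm_mult norm_divide)
        show "b \<in> borel_measurable borel" unfolding b_def by measurable
      qed (use c in \<open>auto intro: apathD(3)[OF f]\<close>)
      fix t assume t: "t \<in> {0..T}"
      show "wmul (c * W t) k (fourier (dx (f t))) \<in> borel_measurable borel"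
        using R(1)[OF t] by (intro wmul_measurable) (auto simp: hc_def dest: hspaceD)
      show "AE \<xi> in lborel. b \<xi> * wmul (c * W t) (k + 1) (fourier (f t)) \<xi> = wmul (c * W t) k (fourier (dx (f t))) \<xi>"
        using R(2)[OF t]
      proof eventually_elim
        case (elim \<xi>)
        show ?case unfolding wmul_def wt_Suc elim b_def using bracket_pos[of \<xi>] by simp
      qed
    qed
  qed
qed

end

section \<open>Paths continuous in L^2 and uniformly in space\<close>

definition qpath :: "real \<Rightarrow> (real \<Rightarrow> real \<Rightarrow> complex) \<Rightarrow> bool" where
  "qpath T q \<longleftrightarrow> L2cont T q \<and>
     (\<forall>t\<in>{0..T}. continuous_on UNIV (q t) \<and> bounded (range (q t)) \<and> uniform_limit UNIV q (q t) (at t within {0..T}))"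

lemma qpathD:
  assumes "qpath T q" "t \<in> {0..T}"
  shows "continuous_on UNIV (q t)" "bounded (range (q t))" "uniform_limit UNIV q (q t) (at t within {0..T})"
    "square_integrable (q t)"
  using assms by (auto simp: qpath_def L2cont_def)

lemma qpath_L2cont: "qpath T q \<Longrightarrow> L2cont T q"
  by (simp add: qpath_def)

lemma L2cont_add: "L2cont T F \<Longrightarrow> L2cont T G \<Longrightarrow> L2cont T (\<lambda>t x. F t x + G t x)"
  using L2cont_diff[of T F "\<lambda>t x. - 1 * G t x"] L2cont_mult[of T G "\<lambda>x. - 1" 1] by simp

lemma qpath_add:
  assumes "qpath T p" "qpath T q"
  shows "qpath T (\<lambda>t x. p t x + q t x)"
  unfolding qpath_def
proof (intro conjI ballI)
  show "L2cont T (\<lambda>t x. p t x + q t x)" by (intro L2cont_add qpath_L2cont assms)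
  fix t assume t: "t \<in> {0..T}"
  note P = qpathD[OF assms(1) t] and Q = qpathD[OF assms(2) t]
  show "continuous_on UNIV (\<lambda>x. p t x + q t x)" by (intro continuous_intros P Q)
  show "bounded (range (\<lambda>x. p t x + q t x))" by (rule bounded_plus_comp[OF P(2) Q(2)])
  show "uniform_limit UNIV (\<lambda>t x. p t x + q t x) (\<lambda>x. p t x + q t x) (at t within {0..T})"
    by (intro uniform_limit_add P Q)
qed

lemma bounded_range_mult:
  fixes f g :: "real \<Rightarrow> complex"
  assumes "bounded (range f)" "bounded (range g)"
  shows "bounded (range (\<lambda>x. f x * g x))"
proof -
  obtain A B where "\<And>x. cmod (f x) \<le> A" "\<And>x. cmod (g x) \<le> B"
    using assms by (auto simp: bounded_iff)
  then have "cmod (f x * g x) \<le> A * B" for x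
    unfolding norm_mult by (intro mult_mono) (auto intro: order_trans[OF norm_ge_zero])
  then show ?thesis by (auto simp: bounded_iff)
qed

text \<open>L^2 continuity alone does not pass to products; one factor must be bounded and converge
  uniformly. This is why \<open>qpath\<close> records both kinds of continuity.\<close>

lemma qpath_mult:
  assumes "qpath T p" "qpath T q"
  shows "qpath T (\<lambda>t x. p t x * q t x)"
  unfolding qpath_def
proof (intro conjI ballI)
  fix t assume t: "t \<in> {0..T}"
  note P = qpathD[OF assms(1) t] and Q = qpathD[OF assms(2) t]
  show "continuous_on UNIV (\<lambda>x. p t x * q t x)" by (intro continuous_intros P Q)
  show "bounded (range (\<lambda>x. p t x * q t x))" by (rule bounded_range_mult[OF P(2) Q(2)])
  show "uniform_limit UNIV (\<lambda>t x. p t x * q t x) (\<lambda>x. p t x * q t x) (at t within {0..T})"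
    by (intro bounded_bilinear.bounded_uniform_limit[OF bounded_bilinear_mult] P Q)
next
  have bnd: "\<exists>B. \<forall>x. cmod (r t x) \<le> B" if "qpath T r" "t \<in> {0..T}" for r t
    using qpathD(2)[OF that] by (auto simp: bounded_iff)
  have sq: "square_integrable (\<lambda>x. p t x * q t x)" if t: "t \<in> {0..T}" for t
  proof -
    obtain B where "\<And>x. cmod (p t x) \<le> B" using bnd[OF assms(1) t] by blast
    then show ?thesis
      using qpathD(4)[OF assms(1) t] qpathD(4)[OF assms(2) t] by (intro sqint_mult_bounded) auto
  qed
  show "L2cont T (\<lambda>t x. p t x * q t x)"
    unfolding L2cont_def
  proof (intro ballI conjI sq)
    fix t assume t: "t \<in> {0..T}"
    note P = qpathD[OF assms(1) t] and Q = qpathD[OF assms(2) t]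
    obtain B where B: "\<And>x. cmod (q t x) \<le> B" using bnd[OF assms(2) t] by blast
    obtain A where A: "\<And>x. cmod (p t x) \<le> A" using bnd[OF assms(1) t] by blast
    have A0: "0 \<le> A" and B0: "0 \<le> B" using A[of 0] B[of 0] norm_ge_zero order_trans by blast+
    \<comment> \<open>Uniform convergence bounds \<open>p s\<close> by \<open>A + 1\<close> for all
      \<open>s\<close> near \<open>t\<close>.\<close>
    have ev: "\<forall>\<^sub>F s in at t within {0..T}. \<forall>x\<in>UNIV. dist (p s x) (p t x) < 1"
      using P(3) unfolding uniform_limit_iff by (meson zero_less_one)
    show "((\<lambda>s. l2 (\<lambda>x. p s x * q s x - p t x * q t x)) \<longlongrightarrow> 0) (at t within {0..T})"
    proof (rule Lim_null_comparison)
      show "((\<lambda>s. (A + 1) * l2 (\<lambda>x. q s x - q t x) + B * l2 (\<lambda>x. p s x - p t x)) \<longlongrightarrow> 0) (at t within {0..T})"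
        using tendsto_add[OF tendsto_mult_left[OF L2cont_lim[OF qpath_L2cont[OF assms(2)] t], of "A + 1"]
            tendsto_mult_left[OF L2cont_lim[OF qpath_L2cont[OF assms(1)] t], of B]] by simp
      have "\<forall>\<^sub>F s in at t within {0..T}. s \<in> {0..T}" by (rule eventually_at_within_mem)
      with ev show "\<forall>\<^sub>F s in at t within {0..T}. norm (l2 (\<lambda>x. p s x * q s x - p t x * q t x))
          \<le> (A + 1) * l2 (\<lambda>x. q s x - q t x) + B * l2 (\<lambda>x. p s x - p t x)"
      proof eventually_elim
        case (elim s)
        note P' = qpathD[OF assms(1) elim(2)] and Q' = qpathD[OF assms(2) elim(2)]
        have ps: "cmod (p s x) \<le> A + 1" for x
          using elim(1) A[of x] norm_triangle_sub[of "p s x" "p t x"] by (auto simp: dist_norm intro: less_imp_le order_trans)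
            (smt (verit) UNIV_I)
        have e: "(\<lambda>x. p s x * q s x - p t x * q t x) = (\<lambda>x. p s x * (q s x - q t x) + q t x * (p s x - p t x))"
          by (simp add: algebra_simps)
        have d: "square_integrable (\<lambda>x. q s x - q t x)" "square_integrable (\<lambda>x. p s x - p t x)"
          by (intro sqint_diff P P' Q Q')+
        have m: "p s \<in> borel_measurable borel" "q t \<in> borel_measurable borel" using P'(4) Q(4) by auto
        have "l2 (\<lambda>x. p s x * (q s x - q t x) + q t x * (p s x - p t x))
            \<le> l2 (\<lambda>x. p s x * (q s x - q t x)) + l2 (\<lambda>x. q t x * (p s x - p t x))"
          by (intro l2_triangle sqint_mult_bounded[OF d(1) m(1) ps] sqint_mult_bounded[OF d(2) m(2) B])
        also have "\<dots> \<le> (A + 1) * l2 (\<lambda>x. q s x - q t x) + B * l2 (\<lambda>x. p s x - p t x)"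
          by (intro add_mono l2_mult_bounded[OF d(1) m(1) ps] l2_mult_bounded[OF d(2) m(2) B])
        finally show ?case unfolding e by simp
      qed
    qed
  qed
qed

lemma qpath_scale:
  assumes "qpath T q"
  shows "qpath T (\<lambda>t x. c * q t x)"
  unfolding qpath_def
proof (intro conjI ballI)
  show "L2cont T (\<lambda>t x. c * q t x)"
    by (rule L2cont_mult[OF qpath_L2cont[OF assms], of "\<lambda>x. c" "cmod c"]) auto
  fix t assume t: "t \<in> {0..T}"
  note Q = qpathD[OF assms t]
  show "continuous_on UNIV (\<lambda>x. c * q t x)" by (intro continuous_intros Q)
  show "bounded (range (\<lambda>x. c * q t x))"
    by (rule bounded_range_mult[OF _ Q(2)]) (auto simp: bounded_iff)
  show "uniform_limit UNIV (\<lambda>t x. c * q t x) (\<lambda>x. c * q t x) (at t within {0..T})"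
    using bounded_linear.uniform_limit[OF bounded_linear_mult_right Q(3)] by simp
qed

lemma qpath_cnj:
  assumes "qpath T q"
  shows "qpath T (\<lambda>t x. cnj (q t x))"
  unfolding qpath_def
proof (intro conjI ballI)
  have "l2 (\<lambda>x. cnj (f x) - cnj (g x)) = l2 (\<lambda>x. f x - g x)" for f g
    unfolding l2_def complex_cnj_diff[symmetric] complex_mod_cnj ..
  then show "L2cont T (\<lambda>t x. cnj (q t x))"
    using qpath_L2cont[OF assms] by (simp add: L2cont_def sqint_cnj)
  fix t assume t: "t \<in> {0..T}"
  note Q = qpathD[OF assms t]
  show "continuous_on UNIV (\<lambda>x. cnj (q t x))" by (intro continuous_intros Q)
  show "bounded (range (\<lambda>x. cnj (q t x)))"
    using Q(2) by (auto simp: bounded_iff)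
  show "uniform_limit UNIV (\<lambda>t x. cnj (q t x)) (\<lambda>x. cnj (q t x)) (at t within {0..T})"
    by (rule bounded_linear.uniform_limit[OF bounded_linear_cnj Q(3)])
qed

lemma qpath_diff: "qpath T p \<Longrightarrow> qpath T q \<Longrightarrow> qpath T (\<lambda>t x. p t x - q t x)"
  using qpath_add[of T p "\<lambda>t x. - 1 * q t x"] qpath_scale[of T q "- 1"] by simp

section \<open>From pointwise to L^2 differentiability in time\<close>

lemma qpath_continuous:
  assumes q: "qpath T q"
  shows "continuous_on ({0..T} \<times> UNIV) (\<lambda>p. q (fst p) (snd p))"
  unfolding continuous_on_def
proof (intro ballI)
  fix p assume "p \<in> {0..T} \<times> (UNIV :: real set)"
  then obtain t x where p: "p = (t, x)" "t \<in> {0..T}" by auto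
  show "((\<lambda>p. q (fst p) (snd p)) \<longlongrightarrow> q (fst p) (snd p)) (at p within {0..T} \<times> UNIV)"
    unfolding tendsto_iff
  proof (intro allI impI)
    fix e :: real assume e: "e > 0"
    have "\<forall>\<^sub>F s in at t within {0..T}. \<forall>y\<in>UNIV. dist (q s y) (q t y) < e / 2"
      using qpathD(3)[OF q p(2)] e unfolding uniform_limit_iff by (meson half_gt_zero)
    then obtain d where d: "d > 0" "\<And>s y. s \<in> {0..T} \<Longrightarrow> dist s t < d \<Longrightarrow> dist (q s y) (q t y) < e / 2"
      unfolding eventually_at using e by (metis UNIV_I dist_self half_gt_zero)
    have "isCont (q t) x" using qpathD(1)[OF q p(2)] by (simp add: continuous_on_eq_continuous_at)
    then obtain d' where d': "d' > 0" "\<And>y. dist y x < d' \<Longrightarrow> dist (q t y) (q t x) < e / 2"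
      using e unfolding continuous_at_eps_delta by (metis half_gt_zero)
    show "\<forall>\<^sub>F r in at p within {0..T} \<times> UNIV. dist (q (fst r) (snd r)) (q (fst p) (snd p)) < e"
      unfolding eventually_at
    proof (intro exI[of _ "min d d'"] conjI ballI impI)
      show "0 < min d d'" using d d' by simp
      fix r assume r: "r \<in> {0..T} \<times> (UNIV :: real set)" "r \<noteq> p \<and> dist r p < min d d'"
      have "dist (fst r) t \<le> dist r p" "dist (snd r) x \<le> dist r p"
        using dist_fst_le[of r p] dist_snd_le[of r p] by (simp_all add: p)
      then have "dist (fst r) t < d" "dist (snd r) x < d'" using r(2) by auto
      then have "dist (q (fst r) (snd r)) (q t (snd r)) < e / 2" "dist (q t (snd r)) (q t x) < e / 2"
        using r(1) d(2) d'(2) by (auto simp: mem_Times_iff)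
      then show "dist (q (fst r) (snd r)) (q (fst p) (snd p)) < e"
        using dist_triangle[of "q (fst r) (snd r)" "q t x" "q t (snd r)"] by (simp add: p)
    qed
  qed
qed

lemma qpath_time_continuous:
  assumes q: "qpath T q"
  shows "continuous_on {0..T} (\<lambda>t. q t x)"
proof -
  have "continuous_on {0..T} ((\<lambda>p. q (fst p) (snd p)) \<circ> (\<lambda>t. (t, x)))"
    by (intro continuous_on_compose continuous_intros continuous_on_subset[OF qpath_continuous[OF q]]) auto
  then show ?thesis by (simp add: o_def)
qed

lemma qpath_measurable:
  assumes q: "qpath T q"
  shows "(\<lambda>p. indicator {0..T} (fst p) *\<^sub>R q (fst p) (snd p)) \<in> borel_measurable (borel \<Otimes>\<^sub>M borel)"
proof -
  have "(\<lambda>p. indicator ({0..T} \<times> UNIV) p *\<^sub>R q (fst p) (snd p)) \<in> borel_measurable (borel :: (real \<times> real) measure)"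
    by (intro borel_measurable_continuous_on_indicator qpath_continuous q) (auto intro!: borel_closed closed_Times)
  moreover have "indicator ({0..T} \<times> UNIV) p = (indicator {0..T} (fst p) :: real)" for p :: "real \<times> real"
    by (auto simp: indicator_def mem_Times_iff)
  ultimately show ?thesis by (simp add: borel_prod)
qed

text \<open>By the fundamental theorem of calculus in time, the function measured is the integral of
  \<open>h t - h r\<close> over \<open>{a..b}\<close>. Cauchy-Schwarz in time and an exchange of
  integrals bound its L^2 norm.\<close>

lemma L2_mean_value:
  assumes h: "qpath T h" and st: "0 \<le> a" "a < b" "b \<le> T" and r: "r \<in> {a..b}"
    and der: "\<And>t x. t \<in> {0..T} \<Longrightarrow> ((\<lambda>s. \<psi> s x) has_vector_derivative h t x) (at t within {0..T})"
    and sq: "square_integrable (\<psi> a)" "square_integrable (\<psi> b)"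
    and e: "0 \<le> e" "\<And>t. t \<in> {a..b} \<Longrightarrow> l2 (\<lambda>x. h t x - h r x) \<le> e"
  shows "l2 (\<lambda>x. \<psi> b x - \<psi> a x - complex_of_real (b - a) * h r x) \<le> (b - a) * e"
proof -
  have sub: "{a..b} \<subseteq> {0..T}" using st by auto
  have rT: "r \<in> {0..T}" using r sub by auto
  define D where "D = (\<lambda>x. \<psi> b x - \<psi> a x - complex_of_real (b - a) * h r x)"
  have hm: "h t \<in> borel_measurable borel" if "t \<in> {0..T}" for t using qpathD(4)[OF h that] by auto
  note [measurable] = hm[OF rT] sqint_measurable[OF sq(1)] sqint_measurable[OF sq(2)]
  have [measurable]: "D \<in> borel_measurable borel" unfolding D_def by measurable
  have Deq: "D x = (LINT t|lborel. indicator {a..b} t *\<^sub>R (h t x - h r x))" for x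
  proof -
    have 1: "(LINT t|lborel. indicator {a..b} t *\<^sub>R (h t x - h r x))
        = (\<psi> b x - complex_of_real b * h r x) - (\<psi> a x - complex_of_real a * h r x)"
    proof (rule integral_FTC_atLeastAtMost)
      show "a \<le> b" using st by simp
      show "continuous_on {a..b} (\<lambda>t. h t x - h r x)"
        by (intro continuous_intros continuous_on_subset[OF qpath_time_continuous[OF h] sub])
      fix t assume "a \<le> t" "t \<le> b"
      then have "((\<lambda>s. \<psi> s x) has_vector_derivative h t x) (at t within {a..b})"
        using der[of t x] sub has_vector_derivative_within_subset by (metis atLeastAtMost_iff subsetD)
      moreover have "((\<lambda>s. complex_of_real s * h r x) has_vector_derivative h r x) (at t within {a..b})"
        by (auto intro!: derivative_eq_intros has_vector_derivative_real_field)
      ultimately show "((\<lambda>s. \<psi> s x - complex_of_real s * h r x) has_vector_derivative h t x - h r x) (at t within {a..b})"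
        by (rule has_vector_derivative_diff)
    qed
    show ?thesis unfolding 1 by (simp add: D_def algebra_simps)
  qed
  \<comment> \<open>Cutting off outside \<open>{0..T}\<close>, where nothing is known about
    \<open>h\<close>, makes the integrand Borel on the whole plane, as the exchange of integrals
    requires.\<close>
  define v where "v t x = cmod (indicator {0..T} t *\<^sub>R h t x - h r x)" for t x
  have hM: "(\<lambda>p. indicator {0..T} (fst p) *\<^sub>R h (fst p) (snd p)) \<in> borel_measurable (borel \<Otimes>\<^sub>M borel)"
    by (rule qpath_measurable[OF h])
  have vM: "(\<lambda>p. v (fst p) (snd p)) \<in> borel_measurable (borel \<Otimes>\<^sub>M borel)"
    unfolding v_def using hM by measurable
  have [measurable]: "(\<lambda>p. v (fst p) (snd p)) \<in> borel_measurable (lborel \<Otimes>\<^sub>M lborel)"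
    using vM by simp
  have "(\<lambda>p. (snd p, fst p)) \<in> (borel :: real measure) \<Otimes>\<^sub>M borel \<rightarrow>\<^sub>M borel \<Otimes>\<^sub>M (borel :: real measure)"
    by measurable
  from measurable_compose[OF this vM]
  have [measurable]: "(\<lambda>p. v (snd p) (fst p)) \<in> borel_measurable (borel \<Otimes>\<^sub>M borel)" by simp
  have vt [measurable]: "(\<lambda>t. v t x) \<in> borel_measurable borel" for x
    using measurable_compose_rev[OF vM, of "\<lambda>t. (t, x)" borel] by simp
  have vx [measurable]: "(\<lambda>x. v t x) \<in> borel_measurable borel" for t
    using measurable_compose_rev[OF vM, of "\<lambda>x. (t, x)" borel] by simp
  have "(\<integral>\<^sup>+x. ennreal ((cmod (D x))\<^sup>2) \<partial>lborel)
      \<le> (\<integral>\<^sup>+x. ennreal (b - a) * (\<integral>\<^sup>+t. ennreal (indicator {a..b} t * (v t x)\<^sup>2) \<partial>lborel) \<partial>lborel)"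
  proof (rule nn_integral_mono)
    fix x
    have "ennreal (cmod (D x)) \<le> (\<integral>\<^sup>+t. ennreal (cmod (indicator {a..b} t *\<^sub>R (h t x - h r x))) \<partial>lborel)"
      unfolding Deq by (rule norm_integral_le_nn)
    also have "\<dots> = (\<integral>\<^sup>+t. ennreal (indicator {a..b} t * v t x) \<partial>lborel)"
      using sub by (intro nn_integral_cong) (auto simp: v_def indicator_def)
    finally have "(ennreal (cmod (D x)))\<^sup>2 \<le> (\<integral>\<^sup>+t. ennreal (indicator {a..b} t * v t x) \<partial>lborel)\<^sup>2"
      by (intro power_mono) auto
    also have "\<dots> \<le> ennreal (b - a) * (\<integral>\<^sup>+t. ennreal (indicator {a..b} t * (v t x)\<^sup>2) \<partial>lborel)"
    proof (rule nn_cauchy_schwarz_weighted)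
      show "(\<integral>\<^sup>+t. ennreal (indicator {a..b} t) \<partial>lborel) \<le> ennreal (b - a)"
        using st by (simp add: ennreal_indicator)
      show "(\<lambda>t. v t x) \<in> borel_measurable borel" by (rule vt)
    qed (use st in \<open>simp_all add: v_def\<close>)
    finally show "ennreal ((cmod (D x))\<^sup>2) \<le> ennreal (b - a) * (\<integral>\<^sup>+t. ennreal (indicator {a..b} t * (v t x)\<^sup>2) \<partial>lborel)"
      by (simp add: ennreal_power)
  qed
  also have "\<dots> = ennreal (b - a) * (\<integral>\<^sup>+x. (\<integral>\<^sup>+t. ennreal (indicator {a..b} t * (v t x)\<^sup>2) \<partial>lborel) \<partial>lborel)"
    by (rule nn_integral_cmult) measurable
  also have "\<dots> \<le> ennreal (b - a) * (ennreal (e\<^sup>2) * ennreal (b - a))"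
  proof (rule mult_left_mono)
    have "(\<integral>\<^sup>+x. (\<integral>\<^sup>+t. ennreal (indicator {a..b} t * (v t x)\<^sup>2) \<partial>lborel) \<partial>lborel)
        = (\<integral>\<^sup>+t. (\<integral>\<^sup>+x. ennreal (indicator {a..b} t * (v t x)\<^sup>2) \<partial>lborel) \<partial>lborel)"
      by (rule lborel_pair.Fubini'[where f="\<lambda>t x. ennreal (indicator {a..b} t * (v t x)\<^sup>2)"]) measurable
    also have "\<dots> \<le> (\<integral>\<^sup>+t. ennreal (e\<^sup>2) * indicator {a..b} t \<partial>lborel)"
    proof (rule nn_integral_mono)
      fix t
      show "(\<integral>\<^sup>+x. ennreal (indicator {a..b} t * (v t x)\<^sup>2) \<partial>lborel) \<le> ennreal (e\<^sup>2) * indicator {a..b} t"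
      proof (cases "t \<in> {a..b}")
        case True
        then have t: "t \<in> {0..T}" using sub by auto
        have "(\<integral>\<^sup>+x. ennreal (indicator {a..b} t * (v t x)\<^sup>2) \<partial>lborel) = (\<integral>\<^sup>+x. ennreal ((cmod (h t x - h r x))\<^sup>2) \<partial>lborel)"
          using True t by (simp add: v_def)
        also have "\<dots> = ennreal ((l2 (\<lambda>x. h t x - h r x))\<^sup>2)"
          by (intro nn_l2 sqint_diff qpathD(4)[OF h] t rT)
        also have "\<dots> \<le> ennreal (e\<^sup>2)" using e(2)[OF True] by (intro ennreal_leI power_mono) auto
        finally show ?thesis using True by simp
      qed simp
    qed
    also have "\<dots> = ennreal (e\<^sup>2) * ennreal (b - a)"
      using st by (subst nn_integral_cmult) auto
    finally show "(\<integral>\<^sup>+x. (\<integral>\<^sup>+t. ennreal (indicator {a..b} t * (v t x)\<^sup>2) \<partial>lborel) \<partial>lborel)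
        \<le> ennreal (e\<^sup>2) * ennreal (b - a)" .
  qed simp
  also have "\<dots> = ennreal (((b - a) * e)\<^sup>2)"
  proof -
    have "((b - a) * e)\<^sup>2 = (b - a) * (e\<^sup>2 * (b - a))" by (simp add: power2_eq_square)
    then show ?thesis using st by (simp add: ennreal_mult)
  qed
  finally have le: "(\<integral>\<^sup>+x. ennreal ((cmod (D x))\<^sup>2) \<partial>lborel) \<le> ennreal (((b - a) * e)\<^sup>2)" .
  have "square_integrable D"
    unfolding D_def by (intro sqint_diff sqint_scale sq qpathD(4)[OF h rT])
  then have "(l2 D)\<^sup>2 \<le> ((b - a) * e)\<^sup>2" using le by (simp add: nn_l2)
  moreover have "0 \<le> (b - a) * e" using st e(1) by simp
  ultimately have "l2 D \<le> (b - a) * e" by (rule power2_le_imp_le)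
  then show ?thesis unfolding D_def .
qed

text \<open>The equations give a time derivative only for each fixed \<open>x\<close>. The mean
  value estimate with \<open>r = s\<close> upgrades this to convergence of the difference quotients
  in L^2.\<close>

lemma L2_differentiable:
  assumes h: "qpath T h" and s: "s \<in> {0..T}"
    and der: "\<And>t x. t \<in> {0..T} \<Longrightarrow> ((\<lambda>s. \<psi> s x) has_vector_derivative h t x) (at t within {0..T})"
    and sq: "\<And>t. t \<in> {0..T} \<Longrightarrow> square_integrable (\<psi> t)"
  shows "((\<lambda>t. l2 (\<lambda>x. \<psi> t x - \<psi> s x - complex_of_real (t - s) * h s x) / \<bar>t - s\<bar>) \<longlongrightarrow> 0) (at s within {0..T})"
proof (rule tendstoI)
  fix e :: real assume e: "e > 0"
  have "\<forall>\<^sub>F t in at s within {0..T}. l2 (\<lambda>x. h t x - h s x) < e / 2"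
    using L2cont_lim[OF qpath_L2cont[OF h] s] e by (intro order_tendstoD) auto
  then obtain d where d: "d > 0" "\<And>t. t \<in> {0..T} \<Longrightarrow> t \<noteq> s \<Longrightarrow> dist t s < d \<Longrightarrow> l2 (\<lambda>x. h t x - h s x) < e / 2"
    unfolding eventually_at by blast
  have d': "l2 (\<lambda>x. h t x - h s x) \<le> e / 2" if "t \<in> {0..T}" "dist t s < d" for t
    using d(2)[OF that(1) _ that(2)] e by (cases "t = s") auto
  have key: "l2 (\<lambda>x. \<psi> t x - \<psi> s x - complex_of_real (t - s) * h s x) \<le> \<bar>t - s\<bar> * (e / 2)"
    if t: "t \<in> {0..T}" "t \<noteq> s" "dist t s < d" for t
  proof (cases "s < t")
    case True
    then have "l2 (\<lambda>x. \<psi> t x - \<psi> s x - complex_of_real (t - s) * h s x) \<le> (t - s) * (e / 2)"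
      using s t e by (intro L2_mean_value[OF h _ _ _ _ der] sq d') (auto simp: dist_real_def)
    then show ?thesis using True by simp
  next
    case False
    then have ts: "t < s" using t by simp
    then have "l2 (\<lambda>x. \<psi> s x - \<psi> t x - complex_of_real (s - t) * h s x) \<le> (s - t) * (e / 2)"
      using s t e by (intro L2_mean_value[OF h _ _ _ _ der] sq d') (auto simp: dist_real_def)
    moreover have "l2 (\<lambda>x. \<psi> t x - \<psi> s x - complex_of_real (t - s) * h s x)
        = l2 (\<lambda>x. \<psi> s x - \<psi> t x - complex_of_real (s - t) * h s x)"
      unfolding l2_def by (intro arg_cong[where f=sqrt] Bochner_Integration.integral_cong refl arg_cong[where f="\<lambda>x. x\<^sup>2"])
        (subst norm_minus_cancel[symmetric], rule arg_cong[where f=norm], simp add: algebra_simps)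
    ultimately show ?thesis using ts by simp
  qed
  show "\<forall>\<^sub>F t in at s within {0..T}. dist (l2 (\<lambda>x. \<psi> t x - \<psi> s x - complex_of_real (t - s) * h s x) / \<bar>t - s\<bar>) 0 < e"
    unfolding eventually_at
  proof (intro exI[of _ d] conjI ballI impI d(1))
    fix t assume "t \<in> {0..T}" "t \<noteq> s \<and> dist t s < d"
    with key[of t] have "l2 (\<lambda>x. \<psi> t x - \<psi> s x - complex_of_real (t - s) * h s x) / \<bar>t - s\<bar> \<le> e / 2"
      by (simp add: divide_le_eq mult.commute)
    moreover have "0 \<le> l2 (\<lambda>x. \<psi> t x - \<psi> s x - complex_of_real (t - s) * h s x) / \<bar>t - s\<bar>" by simp
    ultimately show "dist (l2 (\<lambda>x. \<psi> t x - \<psi> s x - complex_of_real (t - s) * h s x) / \<bar>t - s\<bar>) 0 < e"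
      using e unfolding dist_real_def by linarith
  qed
qed

section \<open>The time derivative of a squared weighted norm\<close>

lemma wmul_0_0 [simp]: "wmul 0 0 F = F"
  using bracket_pos by (auto simp: wmul_def wt_def less_imp_neq[THEN not_sym])

lemma Re_of_real_mult: "Re (complex_of_real r * z) = r * Re z"
  by simp

lemma ip_wmul: "ip (wmul (w + w') (k + k') F) G = ip (wmul w k F) (wmul w' k' G)"
  unfolding ip_def wmul_def wt_mult[symmetric]
  by (intro Bochner_Integration.integral_cong refl) simp

text \<open>The orders may be split unevenly. Later \<open>5 / 2 + 5 / 2\<close> is read as
  \<open>3 + 2\<close> and \<open>3 / 2 + 3 / 2\<close> as \<open>2 + 1\<close>, so that the half
  derivative gained by the decay relieves the nonlinear term.\<close>

lemma ip_wmul_bound: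
  assumes "f \<in> hspace w k" "g \<in> hspace w k'"
  shows "cmod (ip (wmul (w + w) (k + k') (fourier f)) (fourier g)) \<le> hnorm w k f * hnorm w k' g"
  unfolding ip_wmul hnorm_eq[OF assms(1)] hnorm_eq[OF assms(2)]
  by (intro ip_cauchy_schwarz hspaceD(2) assms)

text \<open>The factor \<open>1 + exp d\<close> covers both signs of \<open>d\<close>; in
  \<open>weight_difference\<close> its two summands become the weights at the two times.\<close>

lemma exp_taylor_bound: "\<bar>exp d - 1 - d\<bar> \<le> d\<^sup>2 * (1 + exp d)" for d :: real
proof -
  have nn: "0 \<le> exp d - 1 - d" using exp_ge_add_one_self[of d] by linarith
  have "(1 - d) * exp d \<le> exp (- d) * exp d" using exp_ge_add_one_self[of "- d"] by (intro mult_right_mono) auto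
  then have le: "exp d - 1 \<le> d * exp d" by (simp add: exp_add[symmetric] algebra_simps)
  have "exp d - 1 - d \<le> d\<^sup>2 * (1 + exp d)"
  proof (cases "0 \<le> d")
    case True
    have "exp d - 1 - d \<le> d * (exp d - 1)" using le by (simp add: algebra_simps)
    also have "\<dots> \<le> d * (d * exp d)" by (intro mult_left_mono le True)
    also have "\<dots> = d\<^sup>2 * exp d" by (simp add: power2_eq_square)
    also have "\<dots> \<le> d\<^sup>2 * (1 + exp d)" by (intro mult_left_mono) auto
    finally show ?thesis .
  next
    case False
    have "exp d - 1 - d \<le> d * (exp d - 1)" using le by (simp add: algebra_simps)
    also have "\<dots> = - d * (1 - exp d)" by (simp add: algebra_simps)
    also have "\<dots> \<le> - d * - d" using False nn by (intro mult_left_mono) linarith+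
    also have "\<dots> = d\<^sup>2 * 1" by (simp add: power2_eq_square)
    also have "\<dots> \<le> d\<^sup>2 * (1 + exp d)" by (intro mult_left_mono) auto
    finally show ?thesis .
  qed
  then show ?thesis using nn by simp
qed

context weight_decay
begin

lemma apath_hnorm_diff:
  assumes f: "apath \<psi>" and st: "s \<in> {0..T}" "t \<in> {0..T}"
  shows "(\<lambda>x. \<psi> s x - \<psi> t x) \<in> hc 0 k"
    "hnorm 0 k (\<lambda>x. \<psi> s x - \<psi> t x) = l2 (\<lambda>\<xi>. wmul (0 * W s) k (fourier (\<psi> s)) \<xi> - wmul (0 * W t) k (fourier (\<psi> t)) \<xi>)"
proof -
  have h: "\<psi> s \<in> hc 0 k" "\<psi> t \<in> hc 0 k"
    using apath_hc[OF f st(1), of 0 k] apath_hc[OF f st(2), of 0 k] by simp_all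
  then show d: "(\<lambda>x. \<psi> s x - \<psi> t x) \<in> hc 0 k" by (rule hc_diff)
  then have dh: "(\<lambda>x. \<psi> s x - \<psi> t x) \<in> hspace 0 k" by (simp add: hc_def)
  note sq = apathD(1)[OF f st(1)] apathD(1)[OF f st(2)]
  have hh: "\<psi> s \<in> hspace 0 k" "\<psi> t \<in> hspace 0 k" using h by (auto simp: hc_def)
  have m: "wmul 0 k (fourier (\<lambda>x. \<psi> s x - \<psi> t x)) \<in> borel_measurable borel"
    "(\<lambda>\<xi>. wmul 0 k (fourier (\<psi> s)) \<xi> - wmul 0 k (fourier (\<psi> t)) \<xi>) \<in> borel_measurable borel"
    by (intro wmul_measurable hspaceD(3)[OF dh], intro sqint_measurable sqint_diff hspaceD(2) hh)
  show "hnorm 0 k (\<lambda>x. \<psi> s x - \<psi> t x) = l2 (\<lambda>\<xi>. wmul (0 * W s) k (fourier (\<psi> s)) \<xi> - wmul (0 * W t) k (fourier (\<psi> t)) \<xi>)"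
    unfolding hnorm_eq[OF dh] mult_zero_left
    by (rule l2_cong_AE[OF wmul_AE_diff[OF fourier_diff[OF sq]] m])
qed

lemma apath_qpath:
  assumes f: "apath \<psi>"
  shows "qpath T \<psi>"
proof -
  have L: "L2cont T (\<lambda>t. wmul (0 * W t) k (fourier (\<psi> t)))" for k
    by (rule apathD(3)[OF f]) auto
  note lim = L2cont_lim[OF L]
  show ?thesis
    unfolding qpath_def
  proof (intro conjI ballI)
    show "L2cont T \<psi>"
    proof (rule L2cont_bounded_by[OF apathD(1)[OF f]])
      fix t assume t: "t \<in> {0..T}"
      show "((\<lambda>s. hnorm 0 1 (\<lambda>x. \<psi> s x - \<psi> t x)) \<longlongrightarrow> 0) (at t within {0..T})"
      proof (rule Lim_null_comparison[OF eventually_at_within_mem lim[OF t, of 1]])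
        fix s assume "s \<in> {0..T}"
        then show "norm (hnorm 0 1 (\<lambda>x. \<psi> s x - \<psi> t x))
            \<le> l2 (\<lambda>x. wmul (0 * W s) 1 (fourier (\<psi> s)) x - wmul (0 * W t) 1 (fourier (\<psi> t)) x)"
          using apath_hnorm_diff(2)[OF f _ t, of s 1] by simp
      qed
    next
      fix s t assume "s \<in> {0..T}" "t \<in> {0..T}"
      then show "l2 (\<lambda>x. \<psi> s x - \<psi> t x) \<le> hnorm 0 1 (\<lambda>x. \<psi> s x - \<psi> t x)"
        by (intro hc_rep(5)[OF apath_hnorm_diff(1)[OF f]]) auto
    qed
    fix t assume t: "t \<in> {0..T}"
    show "continuous_on UNIV (\<psi> t)" by (rule apathD(2)[OF f t])
    have "\<psi> t \<in> hc 0 1" using apath_hc[OF f t, of 0 1] by simp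
    then show "bounded (range (\<psi> t))"
      using hc_sup[of "\<psi> t" 0 1] by (auto simp: bounded_iff)
    show "uniform_limit UNIV \<psi> (\<psi> t) (at t within {0..T})"
      unfolding uniform_limit_iff
    proof (intro allI impI)
      fix e :: real assume e: "e > 0"
      have "((\<lambda>s. Cb * l2 (\<lambda>x. wmul (0 * W s) 1 (fourier (\<psi> s)) x - wmul (0 * W t) 1 (fourier (\<psi> t)) x)) \<longlongrightarrow> 0) (at t within {0..T})"
        using tendsto_mult_left[OF lim[OF t, of 1], of Cb] by simp
      then have "\<forall>\<^sub>F s in at t within {0..T}. Cb * l2 (\<lambda>x. wmul (0 * W s) 1 (fourier (\<psi> s)) x - wmul (0 * W t) 1 (fourier (\<psi> t)) x) < e"
        using e by (rule order_tendstoD)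
      moreover have "\<forall>\<^sub>F s in at t within {0..T}. s \<in> {0..T}" by (rule eventually_at_within_mem)
      ultimately show "\<forall>\<^sub>F s in at t within {0..T}. \<forall>x\<in>UNIV. dist (\<psi> s x) (\<psi> t x) < e"
      proof eventually_elim
        case (elim s)
        show ?case
        proof
          fix x
          have "cmod (\<psi> s x - \<psi> t x) \<le> Cb * hnorm 0 1 (\<lambda>x. \<psi> s x - \<psi> t x)"
            by (rule hc_sup[OF apath_hnorm_diff(1)[OF f elim(2) t, of 1]]) auto
          then show "dist (\<psi> s x) (\<psi> t x) < e"
            using elim(1) unfolding apath_hnorm_diff(2)[OF f elim(2) t] dist_norm by linarith
        qed
      qed
    qed
  qed
qed

lemma apath_hnorm_continuous:
  assumes f: "apath \<psi>" and c: "0 \<le> c" "c \<le> 1 / 2"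
  shows "continuous_on {0..T} (\<lambda>t. hnorm (c * W t) k (\<psi> t))"
proof -
  have "continuous_on {0..T} (\<lambda>t. l2 (wmul (c * W t) k (fourier (\<psi> t))))"
    by (rule L2cont_norm[OF apathD(3)[OF f c]])
  moreover have "hnorm (c * W t) k (\<psi> t) = l2 (wmul (c * W t) k (fourier (\<psi> t)))" if "t \<in> {0..T}" for t
    using apath_hc[OF f that c] by (intro hnorm_eq) (auto simp: hc_def)
  ultimately show ?thesis by (auto intro: continuous_on_eq)
qed

text \<open>Between \<open>s\<close> and \<open>t\<close> the exponent drops by
  \<open>a * bracket \<xi>\<close>. Each power of \<open>a\<close> therefore costs one order: the
  linear term has order \<open>k + 1\<close>, the remainder order \<open>k + 2\<close>.\<close>

lemma weight_difference:
  fixes s t c k :: real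
  assumes c: "0 \<le> c"
  defines "a \<equiv> 2 * c * M * (t - s)"
  shows "\<bar>wt (2 * c * W t) k \<xi> - wt (2 * c * W s) k \<xi> + a * wt (2 * c * W s) (k + 1) \<xi>\<bar>
    \<le> a\<^sup>2 * (wt (2 * c * W t) (k + 2) \<xi> + wt (2 * c * W s) (k + 2) \<xi>)"
proof -
  define b where "b = bracket \<xi>"
  have b: "0 < b" unfolding b_def by (rule bracket_pos)
  define p e where "p = b powr k" and "e = exp (2 * c * W s * b)"
  have p: "0 \<le> p" "0 \<le> e" by (auto simp: p_def e_def)
  have t: "exp (2 * c * W t * b) = exp (- (a * b)) * e"
    unfolding e_def exp_add[symmetric] by (simp add: a_def W_def algebra_simps)
  have pk: "b powr (k + 1) = p * b" "b powr (k + 2) = p * b\<^sup>2"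
    using b powr_realpow[OF b, of 2] by (auto simp: p_def powr_add)
  have "wt (2 * c * W t) k \<xi> - wt (2 * c * W s) k \<xi> + a * wt (2 * c * W s) (k + 1) \<xi>
      = p * e * (exp (- (a * b)) - 1 - (- (a * b)))"
    unfolding wt_def b_def[symmetric] t pk e_def[symmetric] p_def[symmetric] by (simp add: algebra_simps)
  then have "\<bar>wt (2 * c * W t) k \<xi> - wt (2 * c * W s) k \<xi> + a * wt (2 * c * W s) (k + 1) \<xi>\<bar>
      = p * e * \<bar>exp (- (a * b)) - 1 - (- (a * b))\<bar>"
    using p by (simp only: abs_mult abs_of_nonneg)
  also have "\<dots> \<le> p * e * ((- (a * b))\<^sup>2 * (1 + exp (- (a * b))))"
    using p by (intro mult_left_mono exp_taylor_bound) auto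
  also have "\<dots> = a\<^sup>2 * (wt (2 * c * W t) (k + 2) \<xi> + wt (2 * c * W s) (k + 2) \<xi>)"
    unfolding wt_def b_def[symmetric] t pk e_def[symmetric] by (simp add: power2_eq_square algebra_simps)
  finally show ?thesis .
qed

text \<open>The decay of the weight produces the negative term, which gains half a derivative.\<close>

lemma energy_derivative:
  assumes \<psi>: "apath \<psi>" and h: "qpath T h" and s: "s \<in> {0..T}" and c: "0 \<le> c" "c \<le> 1 / 4"
    and der: "\<And>t x. t \<in> {0..T} \<Longrightarrow> ((\<lambda>s. \<psi> s x) has_vector_derivative h t x) (at t within {0..T})"
  shows "((\<lambda>t. (hnorm (c * W t) k (\<psi> t))\<^sup>2) has_real_derivative
      - (2 * c * M) * (hnorm (c * W s) (k + 1 / 2) (\<psi> s))\<^sup>2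
      + 2 * Re (ip (wmul (c * W s + c * W s) (k + k) (fourier (\<psi> s))) (fourier (h s)))) (at s within {0..T})"
proof -
  define F where "F t = fourier (\<psi> t)" for t
  define G where "G = fourier (h s)"
  \<comment> \<open>The whole squared weight is put on one factor, so that the time derivative
    \<open>h\<close> need only be taken in L^2. This is where paths must be controlled at the weight
    \<open>2 * c\<close>.\<close>
  define Z where "Z t = wmul (2 * c * W t) (2 * k) (F t)" for t
  define Y where "Y = wmul (2 * c * W s) (2 * k + 1) (F s)"
  define X where "X t = wmul (2 * c * W t) (2 * k + 2) (F t)" for t
  have c2: "0 \<le> 2 * c" "2 * c \<le> 1 / 2" and c1: "c \<le> 1 / 2" using c by auto
  have LZ: "L2cont T Z" and LX: "L2cont T X" and LY: "L2cont T (\<lambda>t. wmul (2 * c * W t) (2 * k + 1) (F t))"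
    unfolding Z_def X_def F_def using apathD(3)[OF \<psi> c2] by auto
  have LF: "L2cont T F" using apathD(3)[OF \<psi>, of 0 0] by (simp add: F_def[abs_def])
  note sqZ = L2cont_sqint[OF LZ] and sqX = L2cont_sqint[OF LX] and sqF = L2cont_sqint[OF LF]
  have sqY: "square_integrable Y" unfolding Y_def by (rule L2cont_sqint[OF LY s])
  have sqG: "square_integrable G" unfolding G_def by (intro sqint_fourier qpathD(4)[OF h s])
  have hspc: "\<psi> t \<in> hspace (c * W t) j" if "t \<in> {0..T}" for t j
    using apath_hc[OF \<psi> that c(1) c1, of j] by (simp add: hc_def)
  have En: "(hnorm (c * W t) j (\<psi> t))\<^sup>2 = Re (ip (wmul (2 * c * W t) (2 * j) (F t)) (F t))" if "t \<in> {0..T}" for t j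
  proof -
    have "ip (wmul (2 * c * W t) (2 * j) (F t)) (F t) = ip (wmul (c * W t) j (F t)) (wmul (c * W t) j (F t))"
      using ip_wmul[of "c * W t" "c * W t" j j "F t" "F t"] by (simp add: mult_2[symmetric] mult.assoc)
    then show ?thesis by (simp add: ip_self hnorm_eq[OF hspc[OF that]] F_def)
  qed
  define Q where "Q t \<xi> = complex_of_real (1 / (t - s)) * (F t \<xi> - F s \<xi>)" for t \<xi>
  \<comment> \<open>The increment of the energy is \<open>Z t + Z s\<close> paired with
    \<open>F t - F s\<close>, plus these cross terms. Their real part sees only the change of the
    weight, since the real part of \<open>F t * cnj (F s)\<close> is symmetric in \<open>s\<close>
    and \<open>t\<close>.\<close>
  define R where "R t = Re (ip (Z t) (F s) - ip (Z s) (F t)) / (t - s)" for t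
  have sqQ: "square_integrable (Q t)" if "t \<in> {0..T}" for t
    unfolding Q_def using that s by (intro sqint_scale sqint_diff sqF)
  have quot: "((hnorm (c * W t) k (\<psi> t))\<^sup>2 - (hnorm (c * W s) k (\<psi> s))\<^sup>2) / (t - s)
      = Re (ip (\<lambda>\<xi>. Z t \<xi> + Z s \<xi>) (Q t)) + R t" if t: "t \<in> {0..T}" for t
  proof -
    have "ip (\<lambda>\<xi>. Z t \<xi> + Z s \<xi>) (Q t) = complex_of_real (1 / (t - s)) *
        ((ip (Z t) (F t) - ip (Z t) (F s)) + (ip (Z s) (F t) - ip (Z s) (F s)))"
      unfolding Q_def ip_scale_right
      using ip_add_left[OF sqZ[OF t] sqZ[OF s] sqint_diff[OF sqF[OF t] sqF[OF s]]]
        ip_diff_right[OF sqF[OF t] sqF[OF s] sqZ[OF t]] ip_diff_right[OF sqF[OF t] sqF[OF s] sqZ[OF s]]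
      by simp
    then have "Re (ip (\<lambda>\<xi>. Z t \<xi> + Z s \<xi>) (Q t)) = (1 / (t - s)) *
        Re ((ip (Z t) (F t) - ip (Z t) (F s)) + (ip (Z s) (F t) - ip (Z s) (F s)))"
      by (simp only: Re_of_real_mult)
    then show ?thesis
      unfolding En[OF t] En[OF s] Z_def[symmetric] R_def
      by (simp add: diff_divide_distrib add_divide_distrib)
  qed
  \<comment> \<open>Plancherel's identity carries \<open>L2_differentiable\<close> over to the
    transforms.\<close>
  have Qlim: "((\<lambda>t. l2 (\<lambda>\<xi>. Q t \<xi> - G \<xi>)) \<longlongrightarrow> 0) (at s within {0..T})"
  proof (rule Lim_transform_eventually[OF L2_differentiable[OF h s der apathD(1)[OF \<psi>]]])
    have "l2 (\<lambda>\<xi>. Q t \<xi> - G \<xi>) = l2 (\<lambda>x. \<psi> t x - \<psi> s x - complex_of_real (t - s) * h s x) / \<bar>t - s\<bar>"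
      if t: "t \<in> {0..T}" "t \<noteq> s" for t
    proof -
      note sq = apathD(1)[OF \<psi> t(1)] apathD(1)[OF \<psi> s] sqint_scale[OF qpathD(4)[OF h s]]
      note sqd = sqint_diff[OF sqint_diff[OF sq(1,2)] sq(3)]
      have ae: "AE \<xi> in lborel. fourier (\<lambda>x. \<psi> t x - \<psi> s x - complex_of_real (t - s) * h s x) \<xi>
          = F t \<xi> - F s \<xi> - complex_of_real (t - s) * G \<xi>"
        using fourier_diff[OF sqint_diff[OF sq(1,2)] sq(3), of "complex_of_real (t - s)"] fourier_diff[OF sq(1,2)]
          fourier_scale[OF qpathD(4)[OF h s], of "complex_of_real (t - s)"]
        unfolding F_def G_def by eventually_elim simp
      have m: "(\<lambda>\<xi>. F t \<xi> - F s \<xi> - complex_of_real (t - s) * G \<xi>) \<in> borel_measurable borel"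
        by (intro sqint_measurable sqint_diff sqint_scale sqF s t sqG)
      have "(\<lambda>\<xi>. Q t \<xi> - G \<xi>) = (\<lambda>\<xi>. complex_of_real (1 / (t - s)) * (F t \<xi> - F s \<xi> - complex_of_real (t - s) * G \<xi>))"
      proof
        fix \<xi>
        have "complex_of_real (1 / (t - s)) * (complex_of_real (t - s) * G \<xi>) = G \<xi>"
          using t(2) unfolding mult.assoc[symmetric] of_real_mult[symmetric] by simp
        then show "Q t \<xi> - G \<xi> = complex_of_real (1 / (t - s)) * (F t \<xi> - F s \<xi> - complex_of_real (t - s) * G \<xi>)"
          by (simp only: Q_def right_diff_distrib)
      qed
      then have "l2 (\<lambda>\<xi>. Q t \<xi> - G \<xi>) = (1 / \<bar>t - s\<bar>) * l2 (\<lambda>\<xi>. F t \<xi> - F s \<xi> - complex_of_real (t - s) * G \<xi>)"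
        by (simp only: l2_scale norm_of_real abs_divide abs_one)
      also have "l2 (\<lambda>\<xi>. F t \<xi> - F s \<xi> - complex_of_real (t - s) * G \<xi>)
          = l2 (fourier (\<lambda>x. \<psi> t x - \<psi> s x - complex_of_real (t - s) * h s x))"
        by (rule l2_cong_AE[symmetric, OF ae sqint_measurable[OF sqint_fourier[OF sqd]] m])
      also have "\<dots> = l2 (\<lambda>x. \<psi> t x - \<psi> s x - complex_of_real (t - s) * h s x)"
        by (rule l2_fourier[OF sqd])
      finally show ?thesis by simp
    qed
    then show "\<forall>\<^sub>F t in at s within {0..T}. l2 (\<lambda>x. \<psi> t x - \<psi> s x - complex_of_real (t - s) * h s x) / \<bar>t - s\<bar> = l2 (\<lambda>\<xi>. Q t \<xi> - G \<xi>)"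
      by (auto simp: eventually_at_filter)
  qed
  note Zlim = L2cont_lim[OF LZ s]
  have mem: "\<forall>\<^sub>F t in at s within {0..T}. t \<in> {0..T}" by (rule eventually_at_within_mem)
  have A: "((\<lambda>t. ip (\<lambda>\<xi>. Z t \<xi> + Z s \<xi>) (Q t)) \<longlongrightarrow> ip (\<lambda>\<xi>. Z s \<xi> + Z s \<xi>) G) (at s within {0..T})"
  proof (rule LIM_zero_cancel, rule Lim_null_comparison)
    show "((\<lambda>t. l2 (\<lambda>\<xi>. Z t \<xi> - Z s \<xi>) * (l2 (\<lambda>\<xi>. Q t \<xi> - G \<xi>) + l2 G) + l2 (\<lambda>\<xi>. Z s \<xi> + Z s \<xi>) * l2 (\<lambda>\<xi>. Q t \<xi> - G \<xi>)) \<longlongrightarrow> 0) (at s within {0..T})"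
      using tendsto_add[OF tendsto_mult[OF Zlim tendsto_add[OF Qlim tendsto_const[of "l2 G"]]] tendsto_mult_left[OF Qlim, of "l2 (\<lambda>\<xi>. Z s \<xi> + Z s \<xi>)"]]
      by simp
    show "\<forall>\<^sub>F t in at s within {0..T}. norm (ip (\<lambda>\<xi>. Z t \<xi> + Z s \<xi>) (Q t) - ip (\<lambda>\<xi>. Z s \<xi> + Z s \<xi>) G)
        \<le> l2 (\<lambda>\<xi>. Z t \<xi> - Z s \<xi>) * (l2 (\<lambda>\<xi>. Q t \<xi> - G \<xi>) + l2 G) + l2 (\<lambda>\<xi>. Z s \<xi> + Z s \<xi>) * l2 (\<lambda>\<xi>. Q t \<xi> - G \<xi>)"
      using mem
    proof eventually_elim
      case (elim t)
      note sZ = sqZ[OF elim] sqZ[OF s]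
      have dZ: "square_integrable (\<lambda>\<xi>. Z t \<xi> - Z s \<xi>)" and pZ: "square_integrable (\<lambda>\<xi>. Z s \<xi> + Z s \<xi>)"
        and dQ: "square_integrable (\<lambda>\<xi>. Q t \<xi> - G \<xi>)"
        by (intro sqint_diff sqint_add sZ sqQ elim sqG)+
      have eq: "ip (\<lambda>\<xi>. Z t \<xi> + Z s \<xi>) (Q t) - ip (\<lambda>\<xi>. Z s \<xi> + Z s \<xi>) G
          = ip (\<lambda>\<xi>. Z t \<xi> - Z s \<xi>) (Q t) + ip (\<lambda>\<xi>. Z s \<xi> + Z s \<xi>) (\<lambda>\<xi>. Q t \<xi> - G \<xi>)"
        unfolding ip_diff_right[OF sqQ[OF elim] sqG pZ] ip_diff_left[OF sZ sqQ[OF elim]] ip_add_left[OF sZ sqQ[OF elim]]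
          ip_add_left[OF sZ(2) sZ(2) sqQ[OF elim]] by (simp only: algebra_simps)
      have "norm (ip (\<lambda>\<xi>. Z t \<xi> + Z s \<xi>) (Q t) - ip (\<lambda>\<xi>. Z s \<xi> + Z s \<xi>) G)
          \<le> norm (ip (\<lambda>\<xi>. Z t \<xi> - Z s \<xi>) (Q t)) + norm (ip (\<lambda>\<xi>. Z s \<xi> + Z s \<xi>) (\<lambda>\<xi>. Q t \<xi> - G \<xi>))"
        unfolding eq by (rule norm_triangle_ineq)
      also have "\<dots> \<le> l2 (\<lambda>\<xi>. Z t \<xi> - Z s \<xi>) * l2 (Q t) + l2 (\<lambda>\<xi>. Z s \<xi> + Z s \<xi>) * l2 (\<lambda>\<xi>. Q t \<xi> - G \<xi>)"
        by (rule add_mono[OF ip_cauchy_schwarz[OF dZ sqQ[OF elim]] ip_cauchy_schwarz[OF pZ dQ]])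
      also have "\<dots> \<le> l2 (\<lambda>\<xi>. Z t \<xi> - Z s \<xi>) * (l2 (\<lambda>\<xi>. Q t \<xi> - G \<xi>) + l2 G) + l2 (\<lambda>\<xi>. Z s \<xi> + Z s \<xi>) * l2 (\<lambda>\<xi>. Q t \<xi> - G \<xi>)"
        using l2_triangle[OF dQ sqG] by (intro add_right_mono mult_left_mono) auto
      finally show ?case .
    qed
  qed
  have Fip: "((\<lambda>t. ip Y (F t)) \<longlongrightarrow> ip Y (F s)) (at s within {0..T})"
  proof (rule LIM_zero_cancel, rule Lim_null_comparison)
    show "((\<lambda>t. l2 Y * l2 (\<lambda>\<xi>. F t \<xi> - F s \<xi>)) \<longlongrightarrow> 0) (at s within {0..T})"
      using tendsto_mult_left[OF L2cont_lim[OF LF s], of "l2 Y"] by simp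
    show "\<forall>\<^sub>F t in at s within {0..T}. norm (ip Y (F t) - ip Y (F s)) \<le> l2 Y * l2 (\<lambda>\<xi>. F t \<xi> - F s \<xi>)"
      using mem
    proof eventually_elim
      case (elim t)
      then show ?case using ip_cauchy_schwarz[OF sqY sqint_diff[OF sqF[OF elim] sqF[OF s]]]
        ip_diff_right[OF sqF[OF elim] sqF[OF s] sqY] by simp
    qed
  qed
  have Xc: "((\<lambda>t. l2 (X t)) \<longlongrightarrow> l2 (X s)) (at s within {0..T})" "((\<lambda>t. l2 (F t)) \<longlongrightarrow> l2 (F s)) (at s within {0..T})"
    using L2cont_norm[OF LX] L2cont_norm[OF LF] s by (auto simp: continuous_on_def)
  have B: "(R \<longlongrightarrow> - (2 * c * M) * Re (ip Y (F s))) (at s within {0..T})"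
  proof -
    \<comment> \<open>\<open>weight_difference\<close>, integrated against \<open>F t\<close> and
      \<open>F s\<close>, gives an error quadratic in \<open>t - s\<close>, of which one factor is
      lost in the division.\<close>
    have err: "\<bar>R t - - (2 * c * M) * Re (ip Y (F t))\<bar> \<le> \<bar>t - s\<bar> * ((2 * c * M)\<^sup>2 * (l2 (X t) * l2 (F s) + l2 (X s) * l2 (F t)))"
      if t: "t \<in> {0..T}" "t \<noteq> s" for t
    proof -
      define a where "a = 2 * c * M * (t - s)"
      note sq = sqZ[OF t(1)] sqZ[OF s] sqF[OF t(1)] sqF[OF s] sqX[OF t(1)] sqX[OF s]
      have i: "integrable lborel (\<lambda>\<xi>. Z t \<xi> * cnj (F s \<xi>))" "integrable lborel (\<lambda>\<xi>. Z s \<xi> * cnj (F t \<xi>))"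
        "integrable lborel (\<lambda>\<xi>. Y \<xi> * cnj (F t \<xi>))"
        by (intro ip_integrable sq sqY)+
      have iN: "integrable lborel (\<lambda>\<xi>. cmod (X t \<xi>) * cmod (F s \<xi>))" "integrable lborel (\<lambda>\<xi>. cmod (X s \<xi>) * cmod (F t \<xi>))"
        using integrable_norm[OF sqint_prod_integrable[OF sq(5,4)]] integrable_norm[OF sqint_prod_integrable[OF sq(6,3)]]
        by (simp_all add: norm_mult)
      have pw: "\<bar>Re (Z t \<xi> * cnj (F s \<xi>) - Z s \<xi> * cnj (F t \<xi>) + complex_of_real a * (Y \<xi> * cnj (F t \<xi>)))\<bar>
          \<le> a\<^sup>2 * (cmod (X t \<xi>) * cmod (F s \<xi>) + cmod (X s \<xi>) * cmod (F t \<xi>))" for \<xi>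
      proof -
        define u where "u = wt (2 * c * W t) (2 * k) \<xi>"
        define v where "v = wt (2 * c * W s) (2 * k) \<xi>"
        define v1 where "v1 = wt (2 * c * W s) (2 * k + 1) \<xi>"
        define r where "r = Re (F t \<xi> * cnj (F s \<xi>))"
        have r2: "Re (F s \<xi> * cnj (F t \<xi>)) = r" by (simp add: r_def)
        have "Z t \<xi> * cnj (F s \<xi>) - Z s \<xi> * cnj (F t \<xi>) + complex_of_real a * (Y \<xi> * cnj (F t \<xi>))
           = complex_of_real u * (F t \<xi> * cnj (F s \<xi>)) - complex_of_real v * (F s \<xi> * cnj (F t \<xi>)) + complex_of_real (a * v1) * (F s \<xi> * cnj (F t \<xi>))"
          by (simp add: Z_def Y_def wmul_def u_def v_def v1_def)
        then have "Re (Z t \<xi> * cnj (F s \<xi>) - Z s \<xi> * cnj (F t \<xi>) + complex_of_real a * (Y \<xi> * cnj (F t \<xi>)))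
            = u * r - v * r + a * v1 * r"
          by (simp only: minus_complex.sel plus_complex.sel Re_of_real_mult r2 r_def[symmetric])
        also have "\<dots> = (u - v + a * v1) * r" by (simp add: algebra_simps)
        finally have "\<bar>Re (Z t \<xi> * cnj (F s \<xi>) - Z s \<xi> * cnj (F t \<xi>) + complex_of_real a * (Y \<xi> * cnj (F t \<xi>)))\<bar> = \<bar>u - v + a * v1\<bar> * \<bar>r\<bar>"
          by (simp add: abs_mult)
        also have "\<dots> \<le> (a\<^sup>2 * (wt (2 * c * W t) (2 * k + 2) \<xi> + wt (2 * c * W s) (2 * k + 2) \<xi>)) * (cmod (F t \<xi>) * cmod (F s \<xi>))"
        proof (rule mult_mono)
          show "\<bar>u - v + a * v1\<bar> \<le> a\<^sup>2 * (wt (2 * c * W t) (2 * k + 2) \<xi> + wt (2 * c * W s) (2 * k + 2) \<xi>)"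
            unfolding u_def v_def v1_def a_def by (rule weight_difference[OF c(1)])
          show "\<bar>r\<bar> \<le> cmod (F t \<xi>) * cmod (F s \<xi>)"
            using abs_Re_le_cmod[of "F t \<xi> * cnj (F s \<xi>)"] by (simp add: r_def norm_mult)
        qed (auto simp: wt_nonneg)
        also have "\<dots> = a\<^sup>2 * (cmod (X t \<xi>) * cmod (F s \<xi>) + cmod (X s \<xi>) * cmod (F t \<xi>))"
          by (simp add: X_def cmod_wmul algebra_simps)
        finally show ?thesis .
      qed
      have "Re (ip (Z t) (F s) - ip (Z s) (F t)) + a * Re (ip Y (F t))
          = Re (LINT \<xi>|lborel. Z t \<xi> * cnj (F s \<xi>) - Z s \<xi> * cnj (F t \<xi>) + complex_of_real a * (Y \<xi> * cnj (F t \<xi>)))"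
        unfolding ip_def using i by simp
      also have "\<dots> = (LINT \<xi>|lborel. Re (Z t \<xi> * cnj (F s \<xi>) - Z s \<xi> * cnj (F t \<xi>) + complex_of_real a * (Y \<xi> * cnj (F t \<xi>))))"
        using i by (intro integral_Re[symmetric] Bochner_Integration.integrable_add Bochner_Integration.integrable_diff integrable_mult_right)
      finally have eq: "Re (ip (Z t) (F s) - ip (Z s) (F t)) + a * Re (ip Y (F t)) =
          (LINT \<xi>|lborel. Re (Z t \<xi> * cnj (F s \<xi>) - Z s \<xi> * cnj (F t \<xi>) + complex_of_real a * (Y \<xi> * cnj (F t \<xi>))))" .
      have "\<bar>Re (ip (Z t) (F s) - ip (Z s) (F t)) + a * Re (ip Y (F t))\<bar>
          \<le> (LINT \<xi>|lborel. \<bar>Re (Z t \<xi> * cnj (F s \<xi>) - Z s \<xi> * cnj (F t \<xi>) + complex_of_real a * (Y \<xi> * cnj (F t \<xi>)))\<bar>)"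
        unfolding eq by (rule integral_abs_bound)
      also have "\<dots> \<le> (LINT \<xi>|lborel. a\<^sup>2 * (cmod (X t \<xi>) * cmod (F s \<xi>) + cmod (X s \<xi>) * cmod (F t \<xi>)))"
        using i iN pw by (intro integral_mono integrable_abs integrable_Re Bochner_Integration.integrable_add Bochner_Integration.integrable_diff integrable_mult_right)
      also have "\<dots> = a\<^sup>2 * ((LINT \<xi>|lborel. cmod (X t \<xi>) * cmod (F s \<xi>)) + (LINT \<xi>|lborel. cmod (X s \<xi>) * cmod (F t \<xi>)))"
        using iN by simp
      also have "\<dots> \<le> a\<^sup>2 * (l2 (X t) * l2 (F s) + l2 (X s) * l2 (F t))"
        by (intro mult_left_mono add_mono l2_cauchy_schwarz_abs sq) simp
      finally have le: "\<bar>Re (ip (Z t) (F s) - ip (Z s) (F t)) + a * Re (ip Y (F t))\<bar> \<le> a\<^sup>2 * (l2 (X t) * l2 (F s) + l2 (X s) * l2 (F t))" .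
      have "R t - - (2 * c * M) * Re (ip Y (F t)) = (Re (ip (Z t) (F s) - ip (Z s) (F t)) + a * Re (ip Y (F t))) / (t - s)"
        using t(2) by (simp add: R_def a_def add_divide_distrib)
      then have "\<bar>R t - - (2 * c * M) * Re (ip Y (F t))\<bar> \<le> a\<^sup>2 * (l2 (X t) * l2 (F s) + l2 (X s) * l2 (F t)) / \<bar>t - s\<bar>"
        using le by (simp only: abs_divide) (rule divide_right_mono, auto)
      also have "\<dots> = \<bar>t - s\<bar> * ((2 * c * M)\<^sup>2 * (l2 (X t) * l2 (F s) + l2 (X s) * l2 (F t)))"
      proof -
        have "a\<^sup>2 = \<bar>t - s\<bar> * \<bar>t - s\<bar> * (2 * c * M)\<^sup>2" by (simp add: a_def power2_eq_square)
        moreover have "d * d * y * z / d = d * (y * z)" if "d \<noteq> 0" for d y z :: real using that by simp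
        ultimately show ?thesis using t(2) by (simp only: abs_eq_0 right_minus_eq not_False_eq_True)
      qed
      finally show ?thesis .
    qed
    have "((\<lambda>t. R t - - (2 * c * M) * Re (ip Y (F t))) \<longlongrightarrow> 0) (at s within {0..T})"
    proof (rule Lim_null_comparison)
      have "((\<lambda>t. \<bar>t - s\<bar> * ((2 * c * M)\<^sup>2 * (l2 (X t) * l2 (F s) + l2 (X s) * l2 (F t)))) \<longlongrightarrow>
          \<bar>s - s\<bar> * ((2 * c * M)\<^sup>2 * (l2 (X s) * l2 (F s) + l2 (X s) * l2 (F s)))) (at s within {0..T})"
        by (intro tendsto_intros Xc)
      then show "((\<lambda>t. \<bar>t - s\<bar> * ((2 * c * M)\<^sup>2 * (l2 (X t) * l2 (F s) + l2 (X s) * l2 (F t)))) \<longlongrightarrow> 0) (at s within {0..T})"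
        by simp
      show "\<forall>\<^sub>F t in at s within {0..T}. norm (R t - - (2 * c * M) * Re (ip Y (F t))) \<le> \<bar>t - s\<bar> * ((2 * c * M)\<^sup>2 * (l2 (X t) * l2 (F s) + l2 (X s) * l2 (F t)))"
        using err by (auto simp: eventually_at_filter)
    qed
    moreover have "((\<lambda>t. - (2 * c * M) * Re (ip Y (F t))) \<longlongrightarrow> - (2 * c * M) * Re (ip Y (F s))) (at s within {0..T})"
      by (intro tendsto_intros Fip)
    ultimately have "((\<lambda>t. (R t - - (2 * c * M) * Re (ip Y (F t))) + - (2 * c * M) * Re (ip Y (F t))) \<longlongrightarrow>
        0 + - (2 * c * M) * Re (ip Y (F s))) (at s within {0..T})" by (rule tendsto_add)
    then show ?thesis by simp
  qed
  have Yeq: "Re (ip Y (F s)) = (hnorm (c * W s) (k + 1 / 2) (\<psi> s))\<^sup>2"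
    unfolding En[OF s] Y_def by (simp add: distrib_left)
  have Geq: "Re (ip (\<lambda>\<xi>. Z s \<xi> + Z s \<xi>) G) = 2 * Re (ip (wmul (c * W s + c * W s) (k + k) (fourier (\<psi> s))) (fourier (h s)))"
    unfolding ip_add_left[OF sqZ[OF s] sqZ[OF s] sqG] by (simp add: Z_def F_def G_def mult_2[symmetric] mult.assoc)
  have "((\<lambda>t. Re (ip (\<lambda>\<xi>. Z t \<xi> + Z s \<xi>) (Q t)) + R t) \<longlongrightarrow>
      Re (ip (\<lambda>\<xi>. Z s \<xi> + Z s \<xi>) G) + - (2 * c * M) * Re (ip Y (F s))) (at s within {0..T})"
    by (intro tendsto_add tendsto_Re A B)
  then have "((\<lambda>t. ((hnorm (c * W t) k (\<psi> t))\<^sup>2 - (hnorm (c * W s) k (\<psi> s))\<^sup>2) / (t - s)) \<longlongrightarrow>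
      Re (ip (\<lambda>\<xi>. Z s \<xi> + Z s \<xi>) G) + - (2 * c * M) * Re (ip Y (F s))) (at s within {0..T})"
    by (rule Lim_transform_eventually) (use mem in \<open>eventually_elim, simp add: quot\<close>)
  then show ?thesis
    unfolding has_field_derivative_iff Yeq Geq by (simp only: add.commute)
qed

end

section \<open>Nonlinear terms\<close>

text \<open>All orders at one weight: products and derivatives of the unknowns stay inside, so that
  orders are counted only when norms are taken.\<close>

definition hinf :: "real \<Rightarrow> (real \<Rightarrow> complex) set" where
  "hinf w = {f. \<forall>k. f \<in> hc w k}"

lemma hinfD: "f \<in> hinf w \<Longrightarrow> f \<in> hc w k"
  by (simp add: hinf_def)

lemma hinf_hspace: "f \<in> hinf w \<Longrightarrow> f \<in> hspace w k"
  by (simp add: hinf_def hc_def)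

lemma hinf_add: "f \<in> hinf w \<Longrightarrow> g \<in> hinf w \<Longrightarrow> (\<lambda>x. f x + g x) \<in> hinf w"
  by (simp add: hinf_def hc_add)

lemma hinf_diff: "f \<in> hinf w \<Longrightarrow> g \<in> hinf w \<Longrightarrow> (\<lambda>x. f x - g x) \<in> hinf w"
  by (simp add: hinf_def hc_diff)

lemma hinf_scale: "f \<in> hinf w \<Longrightarrow> (\<lambda>x. c * f x) \<in> hinf w"
  by (simp add: hinf_def hc_scale)

lemma hinfI: "(\<And>k. 1 \<le> k \<Longrightarrow> f \<in> hc w k) \<Longrightarrow> f \<in> hinf w"
  unfolding hinf_def
proof (intro CollectI allI)
  fix k assume "\<And>k. 1 \<le> k \<Longrightarrow> f \<in> hc w k"
  from this[of "max 1 k"] show "f \<in> hc w k" by (rule hc_mono[of f w "max 1 k"]) auto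
qed

lemma hinf_mult: "0 \<le> w \<Longrightarrow> f \<in> hinf w \<Longrightarrow> g \<in> hinf w \<Longrightarrow> (\<lambda>x. f x * g x) \<in> hinf w"
  by (rule hinfI, rule hc_product(1)) (simp_all add: hinfD)

lemma hinf_cnj: "0 \<le> w \<Longrightarrow> f \<in> hinf w \<Longrightarrow> (\<lambda>x. cnj (f x)) \<in> hinf w"
  by (rule hinfI, rule hc_cnj(1)) (simp_all add: hinfD)

lemma hinf_dx: "0 \<le> w \<Longrightarrow> f \<in> hinf w \<Longrightarrow> dx f \<in> hinf w"
  by (rule hinfI, rule hc_deriv(2)) (simp_all add: hinfD)

lemma hinf_has_dx: "0 \<le> w \<Longrightarrow> f \<in> hinf w \<Longrightarrow> (f has_vector_derivative dx f x) (at x)"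
  by (rule hc_deriv(1)[of f w 1]) (auto intro: hinfD)

lemma dx_add: "0 \<le> w \<Longrightarrow> f \<in> hinf w \<Longrightarrow> g \<in> hinf w \<Longrightarrow> dx (\<lambda>x. f x + g x) = (\<lambda>x. dx f x + dx g x)"
  by (intro ext vector_derivative_at has_vector_derivative_add hinf_has_dx)

lemma dx_diff: "0 \<le> w \<Longrightarrow> f \<in> hinf w \<Longrightarrow> g \<in> hinf w \<Longrightarrow> dx (\<lambda>x. f x - g x) = (\<lambda>x. dx f x - dx g x)"
  by (intro ext vector_derivative_at has_vector_derivative_diff hinf_has_dx)

lemma dx_mult: "0 \<le> w \<Longrightarrow> f \<in> hinf w \<Longrightarrow> g \<in> hinf w \<Longrightarrow> dx (\<lambda>x. f x * g x) = (\<lambda>x. f x * dx g x + dx f x * g x)"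
  by (intro ext vector_derivative_at has_vector_derivative_mult hinf_has_dx)

lemma dx_scale: "0 \<le> w \<Longrightarrow> f \<in> hinf w \<Longrightarrow> dx (\<lambda>x. c * f x) = (\<lambda>x. c * dx f x)"
  by (intro ext vector_derivative_at has_vector_derivative_mult_right hinf_has_dx)

lemma dx_cnj: "0 \<le> w \<Longrightarrow> f \<in> hinf w \<Longrightarrow> dx (\<lambda>x. cnj (f x)) = (\<lambda>x. cnj (dx f x))"
  by (intro ext vector_derivative_at bounded_linear.has_vector_derivative[OF bounded_linear_cnj] hinf_has_dx)

text \<open>The factor \<open>Calg 1\<close> makes the order 1 norm submultiplicative with constant
  1, so that products introduce no further constants.\<close>

definition anorm :: "real \<Rightarrow> (real \<Rightarrow> complex) \<Rightarrow> real" where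
  "anorm w f = Calg 1 * hnorm w 1 f"

lemma anorm_nonneg: "0 \<le> anorm w f"
  using Calg_ge_1[of 1] by (simp add: anorm_def)

lemma anorm_mult: "0 \<le> w \<Longrightarrow> f \<in> hinf w \<Longrightarrow> g \<in> hinf w \<Longrightarrow> anorm w (\<lambda>x. f x * g x) \<le> anorm w f * anorm w g"
  unfolding anorm_def using mult_left_mono[OF hc_product(2)[OF hinfD[of f w] hinfD[of g w], of 1], of "Calg 1"] Calg_ge_1[of 1]
  by (simp add: mult_ac)

lemma anorm_add: "f \<in> hinf w \<Longrightarrow> g \<in> hinf w \<Longrightarrow> anorm w (\<lambda>x. f x + g x) \<le> anorm w f + anorm w g"
  unfolding anorm_def distrib_left[symmetric] using Calg_ge_1[of 1]
  by (intro mult_left_mono hspace_add hinf_hspace) auto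

lemma anorm_scale: "f \<in> hinf w \<Longrightarrow> anorm w (\<lambda>x. c * f x) = cmod c * anorm w f"
  unfolding anorm_def by (simp add: hspace_scale(2)[OF hinf_hspace])

lemma anorm_cnj: "0 \<le> w \<Longrightarrow> f \<in> hinf w \<Longrightarrow> anorm w (\<lambda>x. cnj (f x)) = anorm w f"
  unfolding anorm_def by (simp add: hc_cnj(2)[OF hinfD])

text \<open>A pair of values of the same expression at two solutions. Here \<open>d\<close> measures the difference of the
  solutions, \<open>e\<close> the difference of their derivatives and \<open>D\<close> the derivatives of the second solution.
  The bounds are stable under products, so they pass from the unknowns to all nonlinear terms.\<close>

definition opair where
  "opair w c d e D r1 r2 \<longleftrightarrow> r1 \<in> hinf w \<and> r2 \<in> hinf w \<and>
     anorm w r2 \<le> c * D \<and> anorm w (\<lambda>x. r1 x - r2 x) \<le> c * (e + d * D)"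

definition pair where
  "pair w c d e D q1 q2 \<longleftrightarrow> q1 \<in> hinf w \<and> q2 \<in> hinf w \<and> anorm w q1 \<le> c \<and> anorm w q2 \<le> c \<and>
     anorm w (\<lambda>x. q1 x - q2 x) \<le> c * d \<and> opair w c d e D (dx q1) (dx q2)"

context
  fixes w d e D :: real
  assumes w: "0 \<le> w" and d: "0 \<le> d" and e: "0 \<le> e" and D: "0 \<le> D"
begin

lemma opair_mono: "opair w c d e D r1 r2 \<Longrightarrow> c \<le> c' \<Longrightarrow> opair w c' d e D r1 r2"
proof -
  assume r: "opair w c d e D r1 r2" and le: "c \<le> c'"
  have "0 \<le> e + d * D" using d e D by simp
  then have "c * (e + d * D) \<le> c' * (e + d * D)" "c * D \<le> c' * D"
    using D le by (auto intro: mult_right_mono)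
  then show "opair w c' d e D r1 r2" using r unfolding opair_def by linarith
qed

lemma pair_mono: "pair w c d e D q1 q2 \<Longrightarrow> c \<le> c' \<Longrightarrow> pair w c' d e D q1 q2"
  unfolding pair_def using d opair_mono by (auto elim!: order_trans intro: mult_right_mono)

lemma anorm_sum_le:
  assumes "f \<in> hinf w" "g \<in> hinf w" "anorm w f \<le> A" "anorm w g \<le> B"
  shows "anorm w (\<lambda>x. f x + g x) \<le> A + B"
  using anorm_add[OF assms(1,2)] assms(3,4) by simp

lemma anorm_mult_le:
  assumes "f \<in> hinf w" "g \<in> hinf w" "anorm w f \<le> A" "anorm w g \<le> B"
  shows "anorm w (\<lambda>x. f x * g x) \<le> A * B"
  using anorm_mult[OF w assms(1,2)] mult_mono[OF assms(3,4) _ anorm_nonneg] anorm_nonneg[of w f] assms(3) by linarith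

lemma opair_add:
  assumes "opair w c d e D q1 q2" "opair w c' d e D r1 r2"
  shows "opair w (c + c') d e D (\<lambda>x. q1 x + r1 x) (\<lambda>x. q2 x + r2 x)"
proof -
  note q = assms(1)[unfolded opair_def] and r = assms(2)[unfolded opair_def]
  have "(\<lambda>x. (q1 x + r1 x) - (q2 x + r2 x)) = (\<lambda>x. (q1 x - q2 x) + (r1 x - r2 x))" by (simp add: algebra_simps)
  moreover have "anorm w (\<lambda>x. (q1 x - q2 x) + (r1 x - r2 x)) \<le> c * (e + d * D) + c' * (e + d * D)"
    using q r by (intro anorm_sum_le hinf_diff) auto
  moreover have "anorm w (\<lambda>x. q2 x + r2 x) \<le> c * D + c' * D"
    using q r by (intro anorm_sum_le) auto
  ultimately show ?thesis using q r by (simp add: opair_def hinf_add distrib_right)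
qed

lemma opair_scale:
  assumes "opair w c d e D q1 q2"
  shows "opair w (cmod z * c) d e D (\<lambda>x. z * q1 x) (\<lambda>x. z * q2 x)"
proof -
  note q = assms[unfolded opair_def]
  show ?thesis
    unfolding opair_def right_diff_distrib[symmetric]
    using q by (auto simp: hinf_scale anorm_scale hinf_diff mult.assoc intro: mult_left_mono)
qed

text \<open>The difference is split as \<open>q1 * (r1 - r2) + (q1 - q2) * r2\<close>. In this way a
  derivative that is not differenced belongs to the second solution and meets only the low-order
  difference \<open>d\<close>.\<close>

lemma pair_opair_mult:
  assumes "pair w c d e D q1 q2" "opair w c' d e D r1 r2" "0 \<le> c" "0 \<le> c'"
  shows "opair w (2 * (c * c')) d e D (\<lambda>x. q1 x * r1 x) (\<lambda>x. q2 x * r2 x)"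
proof -
  note q = assms(1)[unfolded pair_def] and r = assms(2)[unfolded opair_def]
  have "anorm w (\<lambda>x. q2 x * r2 x) \<le> c * (c' * D)" using q r by (intro anorm_mult_le) auto
  also have "\<dots> \<le> 2 * (c * c') * D" using D assms(3,4) by simp
  finally have 1: "anorm w (\<lambda>x. q2 x * r2 x) \<le> 2 * (c * c') * D" .
  have "(\<lambda>x. q1 x * r1 x - q2 x * r2 x) = (\<lambda>x. q1 x * (r1 x - r2 x) + (q1 x - q2 x) * r2 x)" by (simp add: algebra_simps)
  moreover have "anorm w (\<lambda>x. q1 x * (r1 x - r2 x) + (q1 x - q2 x) * r2 x) \<le> c * (c' * (e + d * D)) + (c * d) * (c' * D)"
    using q r by (intro anorm_sum_le anorm_mult_le hinf_diff hinf_mult w) auto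
  moreover have "c * (c' * (e + d * D)) + (c * d) * (c' * D) \<le> 2 * (c * c') * (e + d * D)"
    using assms(3,4) e by (simp add: algebra_simps)
  ultimately have 2: "anorm w (\<lambda>x. q1 x * r1 x - q2 x * r2 x) \<le> 2 * (c * c') * (e + d * D)" by simp
  show ?thesis using q r 1 2 by (simp add: opair_def hinf_mult w)
qed

lemma pair_add:
  assumes "pair w c d e D q1 q2" "pair w c' d e D r1 r2"
  shows "pair w (c + c') d e D (\<lambda>x. q1 x + r1 x) (\<lambda>x. q2 x + r2 x)"
proof -
  note q = assms(1)[unfolded pair_def] and r = assms(2)[unfolded pair_def]
  have "(\<lambda>x. (q1 x + r1 x) - (q2 x + r2 x)) = (\<lambda>x. (q1 x - q2 x) + (r1 x - r2 x))" by (simp add: algebra_simps)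
  moreover have "anorm w (\<lambda>x. (q1 x - q2 x) + (r1 x - r2 x)) \<le> c * d + c' * d"
    using q r by (intro anorm_sum_le hinf_diff) auto
  moreover have "anorm w (\<lambda>x. q2 x + r2 x) \<le> c + c'" "anorm w (\<lambda>x. q1 x + r1 x) \<le> c + c'"
    using q r by (auto intro!: anorm_sum_le)
  moreover have "opair w (c + c') d e D (\<lambda>x. dx q1 x + dx r1 x) (\<lambda>x. dx q2 x + dx r2 x)"
    using q r by (intro opair_add) auto
  ultimately show ?thesis using q r by (simp add: pair_def hinf_add distrib_right dx_add[OF w])
qed

lemma pair_scale:
  assumes "pair w c d e D q1 q2"
  shows "pair w (cmod z * c) d e D (\<lambda>x. z * q1 x) (\<lambda>x. z * q2 x)"
proof -
  note q = assms[unfolded pair_def]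
  have "opair w (cmod z * c) d e D (\<lambda>x. z * dx q1 x) (\<lambda>x. z * dx q2 x)" using q by (intro opair_scale) auto
  then show ?thesis
    unfolding pair_def right_diff_distrib[symmetric]
    using q by (auto simp: hinf_scale anorm_scale hinf_diff mult.assoc dx_scale[OF w] intro: mult_left_mono)
qed

text \<open>The constant 4 comes from the product rule: two terms, each contributing 2 by
  \<open>pair_opair_mult\<close>.\<close>

lemma pair_mult:
  assumes qq: "pair w c d e D q1 q2" and rr: "pair w c' d e D r1 r2" and c: "0 \<le> c" "0 \<le> c'"
  shows "pair w (4 * (c * c')) d e D (\<lambda>x. q1 x * r1 x) (\<lambda>x. q2 x * r2 x)"
proof -
  note q = qq[unfolded pair_def] and r = rr[unfolded pair_def]
  have cc: "0 \<le> c * c'" using c by simp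
  have "(\<lambda>x. q1 x * r1 x - q2 x * r2 x) = (\<lambda>x. q1 x * (r1 x - r2 x) + (q1 x - q2 x) * r2 x)" by (simp add: algebra_simps)
  moreover have "anorm w (\<lambda>x. q1 x * (r1 x - r2 x) + (q1 x - q2 x) * r2 x) \<le> c * (c' * d) + (c * d) * c'"
    using q r by (intro anorm_sum_le anorm_mult_le hinf_diff hinf_mult w) auto
  moreover have "c * (c' * d) + (c * d) * c' \<le> 4 * (c * c') * d"
    using mult_nonneg_nonneg[OF cc d] by (simp add: mult_ac)
  ultimately have 1: "anorm w (\<lambda>x. q1 x * r1 x - q2 x * r2 x) \<le> 4 * (c * c') * d" by simp
  have "anorm w (\<lambda>x. q1 x * r1 x) \<le> c * c'" "anorm w (\<lambda>x. q2 x * r2 x) \<le> c * c'" using q r by (auto intro!: anorm_mult_le)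
  then have 2: "anorm w (\<lambda>x. q1 x * r1 x) \<le> 4 * (c * c')" "anorm w (\<lambda>x. q2 x * r2 x) \<le> 4 * (c * c')" using cc by auto
  have "opair w (2 * (c * c') + 2 * (c' * c)) d e D (\<lambda>x. q1 x * dx r1 x + r1 x * dx q1 x) (\<lambda>x. q2 x * dx r2 x + r2 x * dx q2 x)"
    using q r by (intro opair_add pair_opair_mult[OF qq] pair_opair_mult[OF rr] c) auto
  moreover have "2 * (c * c') + 2 * (c' * c) = 4 * (c * c')" by simp
  ultimately have 3: "opair w (4 * (c * c')) d e D (\<lambda>x. q1 x * dx r1 x + dx q1 x * r1 x) (\<lambda>x. q2 x * dx r2 x + dx q2 x * r2 x)"
    by (simp only: mult.commute)
  show ?thesis using q r 1 2 3 by (simp add: pair_def hinf_mult w dx_mult[OF w])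
qed

lemma pair_power:
  assumes q: "pair w c d e D q1 q2" and c: "0 \<le> c" and n: "0 < n"
  shows "pair w ((4 * c) ^ n) d e D (\<lambda>x. q1 x ^ n) (\<lambda>x. q2 x ^ n)"
  using n
proof (induction n rule: nat_induct_non_zero)
  case 1
  show ?case using pair_mono[OF q, of "4 * c"] c by simp
next
  case (Suc n)
  have "0 \<le> (4 * c) ^ n" using c by simp
  from pair_mult[OF q Suc.IH c this] show ?case by (simp only: power_Suc mult.assoc)
qed

end

text \<open>The time derivative of the phase as prescribed by the equation, with
  \<open>a * cnj a\<close> for the squared modulus so that complex algebra applies. The sums are
  nested as the constants in \<open>nonlinear_pair\<close> are. \<open>nla\<close> does the same for
  the amplitude, leaving out the dispersive term.\<close>

definition nlphi :: "real \<Rightarrow> real \<Rightarrow> nat \<Rightarrow> nat \<Rightarrow> (real \<Rightarrow> complex) \<Rightarrow> (real \<Rightarrow> complex) \<Rightarrow> real \<Rightarrow> complex" where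
  "nlphi \<alpha> lam \<gamma> \<sigma> \<phi> a x = (- 1 / 2) * (dx \<phi> x * dx \<phi> x)
     + ((- complex_of_real \<alpha> / 2) * ((a x * cnj (a x)) ^ \<gamma> * dx \<phi> x) + (- complex_of_real lam) * (a x * cnj (a x)) ^ \<sigma>)"

definition nla :: "real \<Rightarrow> nat \<Rightarrow> (real \<Rightarrow> complex) \<Rightarrow> (real \<Rightarrow> complex) \<Rightarrow> real \<Rightarrow> complex" where
  "nla \<alpha> \<gamma> \<phi> a x = (- 1) * (dx \<phi> x * dx a x)
     + ((- 1 / 2) * (a x * dx (dx \<phi>) x) + (- complex_of_real \<alpha> / 2) * dx (\<lambda>y. (a y * cnj (a y)) ^ \<gamma> * a y) x)"

text \<open>\<open>K\<close> is chosen before \<open>w\<close>, \<open>d\<close>, \<open>e\<close>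
  and \<open>D\<close> and depends on the solutions only through the low-order bound
  \<open>R\<close>. Hence a threshold for \<open>M\<close> can be fixed before the solutions are
  known.\<close>

lemma nonlinear_pair:
  assumes "0 < \<gamma>" "0 < \<sigma>" "1 \<le> R"
  obtains K where "0 \<le> K"
    "\<And>w \<phi>1 a1 \<phi>2 a2 d e D. 0 \<le> w \<Longrightarrow> \<phi>1 \<in> hinf w \<Longrightarrow> a1 \<in> hinf w \<Longrightarrow> \<phi>2 \<in> hinf w \<Longrightarrow> a2 \<in> hinf w \<Longrightarrow>
      anorm w (dx \<phi>1) \<le> R \<Longrightarrow> anorm w a1 \<le> R \<Longrightarrow> anorm w (dx \<phi>2) \<le> R \<Longrightarrow> anorm w a2 \<le> R \<Longrightarrow>
      d = anorm w (\<lambda>x. dx \<phi>1 x - dx \<phi>2 x) + anorm w (\<lambda>x. a1 x - a2 x) \<Longrightarrow>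
      e = anorm w (\<lambda>x. dx (dx \<phi>1) x - dx (dx \<phi>2) x) + anorm w (\<lambda>x. dx a1 x - dx a2 x) \<Longrightarrow>
      D = anorm w (dx (dx \<phi>2)) + anorm w (dx a2) \<Longrightarrow>
      pair w K d e D (nlphi \<alpha> lam \<gamma> \<sigma> \<phi>1 a1) (nlphi \<alpha> lam \<gamma> \<sigma> \<phi>2 a2) \<and>
      opair w K d e D (nla \<alpha> \<gamma> \<phi>1 a1) (nla \<alpha> \<gamma> \<phi>2 a2)"
proof -
  \<comment> \<open>\<open>pair_mult\<close> gives \<open>4 * (R * R)\<close> for
    \<open>a * cnj a\<close>, and \<open>pair_power\<close> multiplies this by 4 before raising it
    to the power.\<close>
  define G where "G = (4 * (4 * (R * R))) ^ \<gamma>"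
  define S where "S = (4 * (4 * (R * R))) ^ \<sigma>"
  have GS: "0 \<le> G" "0 \<le> S" using assms by (auto simp: G_def S_def)
  define K1 where "K1 = cmod (- 1 / 2) * (4 * (R * R)) + (cmod (- complex_of_real \<alpha> / 2) * (4 * (G * R)) + cmod (- complex_of_real lam) * S)"
  define K2 where "K2 = cmod (- 1) * (2 * (R * R)) + (cmod (- 1 / 2) * (2 * (R * R)) + cmod (- complex_of_real \<alpha> / 2) * (4 * (G * R)))"
  have R: "0 \<le> R" using assms by simp
  have K: "0 \<le> K1" "0 \<le> K2" unfolding K1_def K2_def using GS R by (auto intro!: add_nonneg_nonneg mult_nonneg_nonneg)
  show ?thesis
  proof (rule that[of "max K1 K2"])
    show "0 \<le> max K1 K2" using K by simp
    fix w \<phi>1 a1 \<phi>2 a2 d e D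
    assume w: "0 \<le> w" and h: "\<phi>1 \<in> hinf w" "a1 \<in> hinf w" "\<phi>2 \<in> hinf w" "a2 \<in> hinf w"
      and n: "anorm w (dx \<phi>1) \<le> R" "anorm w a1 \<le> R" "anorm w (dx \<phi>2) \<le> R" "anorm w a2 \<le> R"
      and d: "d = anorm w (\<lambda>x. dx \<phi>1 x - dx \<phi>2 x) + anorm w (\<lambda>x. a1 x - a2 x)"
      and e: "e = anorm w (\<lambda>x. dx (dx \<phi>1) x - dx (dx \<phi>2) x) + anorm w (\<lambda>x. dx a1 x - dx a2 x)"
      and D: "D = anorm w (dx (dx \<phi>2)) + anorm w (dx a2)"
    have pos: "0 \<le> d" "0 \<le> e" "0 \<le> D" by (auto simp: d e D anorm_nonneg intro!: add_nonneg_nonneg)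
    note C = w pos
    \<comment> \<open>The unknowns satisfy the difference bounds with constant 1;
      \<open>1 \<le> R\<close> lets them share the constant \<open>R\<close> of their norms.\<close>
    have Rle: "x \<le> R * y" if "x \<le> y" "0 \<le> y" for x y
      using mult_right_mono[OF assms(3) that(2)] that(1) by simp
    have pu: "pair w R d e D (dx \<phi>1) (dx \<phi>2)"
      unfolding pair_def opair_def using w h n pos anorm_nonneg
      by (auto intro!: hinf_dx Rle simp: d e D intro: add_nonneg_nonneg mult_nonneg_nonneg)
    have pa: "pair w R d e D a1 a2"
      unfolding pair_def opair_def using w h n pos anorm_nonneg
      by (auto intro!: hinf_dx Rle simp: d e D intro: add_nonneg_nonneg mult_nonneg_nonneg)
    have cd: "anorm w (\<lambda>x. cnj (f x) - cnj (g x)) = anorm w (\<lambda>x. f x - g x)" if "f \<in> hinf w" "g \<in> hinf w" for f g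
      using anorm_cnj[OF w hinf_diff[OF that]] by simp
    have pc: "pair w R d e D (\<lambda>x. cnj (a1 x)) (\<lambda>x. cnj (a2 x))"
      using pa w h unfolding pair_def opair_def dx_cnj[OF w h(2)] dx_cnj[OF w h(4)]
      by (simp add: anorm_cnj hinf_cnj hinf_dx cd)
    have A: "pair w (4 * (R * R)) d e D (\<lambda>x. a1 x * cnj (a1 x)) (\<lambda>x. a2 x * cnj (a2 x))"
      by (rule pair_mult[OF C pa pc R R])
    have A0: "0 \<le> 4 * (R * R)" using R by simp
    have PG: "pair w G d e D (\<lambda>x. (a1 x * cnj (a1 x)) ^ \<gamma>) (\<lambda>x. (a2 x * cnj (a2 x)) ^ \<gamma>)"
      unfolding G_def by (rule pair_power[OF C A A0 assms(1)])
    have PS: "pair w S d e D (\<lambda>x. (a1 x * cnj (a1 x)) ^ \<sigma>) (\<lambda>x. (a2 x * cnj (a2 x)) ^ \<sigma>)"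
      unfolding S_def by (rule pair_power[OF C A A0 assms(2)])
    have "pair w K1 d e D (nlphi \<alpha> lam \<gamma> \<sigma> \<phi>1 a1) (nlphi \<alpha> lam \<gamma> \<sigma> \<phi>2 a2)"
      unfolding K1_def nlphi_def[abs_def]
      by (rule pair_add[OF C pair_scale[OF C pair_mult[OF C pu pu R R], of "- 1 / 2"]
            pair_add[OF C pair_scale[OF C pair_mult[OF C PG pu GS(1) R], of "- complex_of_real \<alpha> / 2"]
              pair_scale[OF C PS, of "- complex_of_real lam"]]])
    then have 1: "pair w (max K1 K2) d e D (nlphi \<alpha> lam \<gamma> \<sigma> \<phi>1 a1) (nlphi \<alpha> lam \<gamma> \<sigma> \<phi>2 a2)"
      by (rule pair_mono[OF C]) simp
    have od: "opair w c d e D (dx q1) (dx q2)" if "pair w c d e D q1 q2" for c q1 q2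
      using that by (simp add: pair_def)
    have "opair w K2 d e D (nla \<alpha> \<gamma> \<phi>1 a1) (nla \<alpha> \<gamma> \<phi>2 a2)"
      unfolding K2_def nla_def[abs_def]
      by (rule opair_add[OF C opair_scale[OF C pair_opair_mult[OF C pu od[OF pa] R R], of "- 1"]
            opair_add[OF C opair_scale[OF C pair_opair_mult[OF C pa od[OF pu] R R], of "- 1 / 2"]
              opair_scale[OF C od[OF pair_mult[OF C PG pa GS(1) R]], of "- complex_of_real \<alpha> / 2"]]])
    then have 2: "opair w (max K1 K2) d e D (nla \<alpha> \<gamma> \<phi>1 a1) (nla \<alpha> \<gamma> \<phi>2 a2)"
      by (rule opair_mono[OF C]) simp
    show "pair w (max K1 K2) d e D (nlphi \<alpha> lam \<gamma> \<sigma> \<phi>1 a1) (nlphi \<alpha> lam \<gamma> \<sigma> \<phi>2 a2) \<and>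
      opair w (max K1 K2) d e D (nla \<alpha> \<gamma> \<phi>1 a1) (nla \<alpha> \<gamma> \<phi>2 a2)"
      using 1 2 ..
  qed
qed

section \<open>Energy estimates\<close>

lemma ip_cong_AE_right:
  assumes "AE \<xi> in lborel. G \<xi> = H \<xi>" "F \<in> borel_measurable borel" "G \<in> borel_measurable borel" "H \<in> borel_measurable borel"
  shows "ip F G = ip F H"
proof -
  have [measurable]: "F \<in> borel_measurable borel" "G \<in> borel_measurable borel" "H \<in> borel_measurable borel" by fact+
  show ?thesis unfolding ip_def using assms(1) by (intro integral_cong_AE) (auto elim!: AE_mp)
qed

text \<open>The dispersive term is skew-adjoint, so it does not contribute to the energy, uniformly in \<open>\<epsilon>\<close>.\<close>

lemma schroedinger_skew:
  assumes w: "0 \<le> w" and f: "f \<in> hinf w"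
  shows "Re (ip (wmul (w + w) (k + k) (fourier f)) (fourier (\<lambda>x. (\<i> * complex_of_real r) * dx (dx f) x))) = 0"
proof -
  have f1: "dx f \<in> hinf w" and f2: "dx (dx f) \<in> hinf w" using f w by (auto intro: hinf_dx)
  note [measurable] = hspaceD(3)[OF hinf_hspace[OF f]] hspaceD(3)[OF hinf_hspace[OF f2]]
  have [measurable]: "fourier (\<lambda>x. (\<i> * complex_of_real r) * dx (dx f) x) \<in> borel_measurable borel"
    by (rule hspaceD(3)[OF hinf_hspace[OF hinf_scale[OF f2]]])
  have ae: "AE \<xi> in lborel. fourier (\<lambda>x. (\<i> * complex_of_real r) * dx (dx f) x) \<xi> = (\<i> * complex_of_real (- r * \<xi>\<^sup>2)) * fourier f \<xi>"
    using fourier_scale[OF hspaceD(1)[OF hinf_hspace[OF f2]], of "\<i> * complex_of_real r"]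
      hc_deriv(4)[OF hinfD[OF f1] order_refl w] hc_deriv(4)[OF hinfD[OF f] order_refl w]
  proof eventually_elim
    case (elim \<xi>)
    have "(\<i> * u) * (\<i> * z * (\<i> * z * v)) = (\<i> * - (u * (z * z))) * v" for u z v
    proof -
      have "(\<i> * u) * (\<i> * z * (\<i> * z * v)) = (\<i> * \<i>) * (\<i> * (u * (z * z)) * v)" by (simp only: mult_ac)
      then show ?thesis by simp
    qed
    then show ?case unfolding elim by (simp add: power2_eq_square)
  qed
  have "ip (wmul (w + w) (k + k) (fourier f)) (fourier (\<lambda>x. (\<i> * complex_of_real r) * dx (dx f) x))
      = ip (wmul (w + w) (k + k) (fourier f)) (\<lambda>\<xi>. (\<i> * complex_of_real (- r * \<xi>\<^sup>2)) * fourier f \<xi>)"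
    by (rule ip_cong_AE_right[OF ae]) measurable
  \<comment> \<open>The multiplier of the dispersive term is imaginary and the weight is real, so
    the integrand is \<open>\<i>\<close> times a real function.\<close>
  also have "\<dots> = (LINT \<xi>|lborel. \<i> * complex_of_real (wt (w + w) (k + k) \<xi> * (r * \<xi>\<^sup>2) * (cmod (fourier f \<xi>))\<^sup>2))"
    unfolding ip_def
  proof (intro Bochner_Integration.integral_cong refl)
    fix \<xi>
    have "wmul (w + w) (k + k) (fourier f) \<xi> * cnj ((\<i> * complex_of_real (- r * \<xi>\<^sup>2)) * fourier f \<xi>)
        = \<i> * complex_of_real (wt (w + w) (k + k) \<xi> * (r * \<xi>\<^sup>2)) * (fourier f \<xi> * cnj (fourier f \<xi>))"
      by (simp add: wmul_def)
    then show "wmul (w + w) (k + k) (fourier f) \<xi> * cnj ((\<i> * complex_of_real (- r * \<xi>\<^sup>2)) * fourier f \<xi>)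
        = \<i> * complex_of_real (wt (w + w) (k + k) \<xi> * (r * \<xi>\<^sup>2) * (cmod (fourier f \<xi>))\<^sup>2)"
      unfolding complex_norm_square[symmetric] by simp
  qed
  also have "\<dots> = \<i> * complex_of_real (LINT \<xi>|lborel. wt (w + w) (k + k) \<xi> * (r * \<xi>\<^sup>2) * (cmod (fourier f \<xi>))\<^sup>2)"
    by (simp only: integral_mult_right_zero integral_complex_of_real)
  finally show ?thesis by simp
qed

lemma le_sqrt_sum: "0 \<le> x \<Longrightarrow> x \<le> sqrt (x\<^sup>2 + y\<^sup>2)" "0 \<le> y \<Longrightarrow> y \<le> sqrt (x\<^sup>2 + y\<^sup>2)" for x y :: real
  by (auto intro: real_le_rsqrt)

text \<open>\<open>sE\<close> and \<open>sD\<close> stand for the roots of the energy and of the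
  dissipated norms. The terms with \<open>e\<close> or with \<open>d\<close> alone contribute 12
  times \<open>K * C * sD^2\<close>. The mixed terms with \<open>D\<close> are split by 2xy <= x^2 +
  y^2, which adds 4 more and leaves the term for Gronwall's inequality.\<close>

lemma energy_arithmetic:
  fixes C K D :: real
  assumes "0 \<le> C" "0 \<le> K" "0 \<le> D" "0 \<le> f" "0 \<le> g" and d: "d \<le> 2 * C * sE" "d \<le> 2 * C * sD" and e: "e \<le> 2 * C * sD"
    and s: "0 \<le> sE" "0 \<le> sD" "f \<le> sD" "g \<le> sD"
    and P: "P \<le> K * d + K * (e + d * D)" "Q \<le> K * (e + d * D)"
  shows "2 * (f * P) + 2 * (g * Q) \<le> 16 * (K * C) * sD\<^sup>2 + 4 * (K * C) * D\<^sup>2 * sE\<^sup>2"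
proof -
  have "e + d * D \<le> 2 * C * sD + 2 * C * sE * D" using d(1) e assms(3) by (intro add_mono mult_right_mono)
  then have "K * (e + d * D) \<le> K * (2 * C * sD + 2 * C * sE * D)" using assms(2) by (rule mult_left_mono)
  moreover have "K * d \<le> K * (2 * C * sD)" using d(2) assms(2) by (rule mult_left_mono)
  ultimately have PQ: "P \<le> K * (2 * C * sD) + K * (2 * C * sD + 2 * C * sE * D)" "Q \<le> K * (2 * C * sD + 2 * C * sE * D)"
    using P by linarith+
  have nn: "0 \<le> K * (2 * C * sD)" "0 \<le> K * (2 * C * sD + 2 * C * sE * D)"
    using assms by (auto intro!: mult_nonneg_nonneg add_nonneg_nonneg)
  have "f * P \<le> f * (K * (2 * C * sD) + K * (2 * C * sD + 2 * C * sE * D))"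
    by (rule mult_left_mono[OF PQ(1) assms(4)])
  also have "\<dots> \<le> sD * (K * (2 * C * sD) + K * (2 * C * sD + 2 * C * sE * D))"
    using s(3) nn by (intro mult_right_mono) auto
  finally have 1: "f * P \<le> sD * (K * (2 * C * sD) + K * (2 * C * sD + 2 * C * sE * D))" .
  have "g * Q \<le> g * (K * (2 * C * sD + 2 * C * sE * D))" by (rule mult_left_mono[OF PQ(2) assms(5)])
  also have "\<dots> \<le> sD * (K * (2 * C * sD + 2 * C * sE * D))" using s(4) nn by (intro mult_right_mono) auto
  finally have 2: "g * Q \<le> sD * (K * (2 * C * sD + 2 * C * sE * D))" .
  have "2 * sD * (D * sE) \<le> sD\<^sup>2 + (D * sE)\<^sup>2" by (rule sum_squares_bound)
  then have 3: "4 * (K * C) * (2 * sD * (D * sE)) \<le> 4 * (K * C) * (sD\<^sup>2 + (D * sE)\<^sup>2)"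
    using assms by (intro mult_left_mono) auto
  have "2 * (sD * (K * (2 * C * sD) + K * (2 * C * sD + 2 * C * sE * D))) + 2 * (sD * (K * (2 * C * sD + 2 * C * sE * D)))
      = 12 * (K * C) * sD\<^sup>2 + 4 * (K * C) * (2 * sD * (D * sE))"
    by (simp add: power2_eq_square algebra_simps)
  also have "\<dots> \<le> 12 * (K * C) * sD\<^sup>2 + 4 * (K * C) * (sD\<^sup>2 + (D * sE)\<^sup>2)" using 3 by simp
  also have "\<dots> = 16 * (K * C) * sD\<^sup>2 + 4 * (K * C) * D\<^sup>2 * sE\<^sup>2" by (simp add: power2_eq_square algebra_simps)
  finally show ?thesis using 1 2 by linarith
qed

lemma qpath_cong:
  assumes q: "qpath T q" and eq: "\<And>t. t \<in> {0..T} \<Longrightarrow> q t = p t"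
  shows "qpath T p"
  unfolding qpath_def
proof (intro conjI ballI)
  show "L2cont T p"
    by (rule L2cont_cong_AE[OF qpath_L2cont[OF q]]) (use eq qpathD(4)[OF q] in auto)
  fix t assume t: "t \<in> {0..T}"
  note Q = qpathD[OF q t]
  show "continuous_on UNIV (p t)" "bounded (range (p t))" using Q eq[OF t] by auto
  show "uniform_limit UNIV p (p t) (at t within {0..T})"
    unfolding uniform_limit_iff
  proof (intro allI impI)
    fix e :: real assume "e > 0"
    then have "\<forall>\<^sub>F s in at t within {0..T}. \<forall>x\<in>UNIV. dist (q s x) (q t x) < e"
      using Q(3) by (simp add: uniform_limit_iff)
    moreover have "\<forall>\<^sub>F s in at t within {0..T}. s \<in> {0..T}" by (rule eventually_at_within_mem)
    ultimately show "\<forall>\<^sub>F s in at t within {0..T}. \<forall>x\<in>UNIV. dist (p s x) (p t x) < e"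
    proof eventually_elim
      case (elim s)
      then show ?case using eq[OF elim(2)] eq[OF t] by simp
    qed
  qed
qed

section \<open>The energy inequality for two solutions\<close>

context weight_decay
begin

definition ww :: "real \<Rightarrow> real" where "ww t = 1 / 4 * W t"

lemma ww_nonneg: "t \<in> {0..T} \<Longrightarrow> 0 \<le> ww t"
  using W_pos[of t] by (simp add: ww_def)

lemma apath_hinf: "apath \<psi> \<Longrightarrow> t \<in> {0..T} \<Longrightarrow> \<psi> t \<in> hinf (ww t)"
  unfolding hinf_def ww_def using apath_hc[of \<psi> t "1/4"] by auto

text \<open>\<open>nla\<close> contains the derivative of a product, so the continuity of a product
  is carried along with that of its derivative.\<close>

definition dpath :: "(real \<Rightarrow> real \<Rightarrow> complex) \<Rightarrow> bool" where
  "dpath q \<longleftrightarrow> qpath T q \<and> qpath T (\<lambda>t. dx (q t)) \<and> (\<forall>t\<in>{0..T}. q t \<in> hinf (ww t))"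

lemma dpath_apath: "apath q \<Longrightarrow> dpath q"
  by (simp add: dpath_def apath_qpath apath_dx apath_hinf)

lemma dpath_mult:
  assumes p: "dpath p" and q: "dpath q"
  shows "dpath (\<lambda>t x. p t x * q t x)"
proof -
  have "qpath T (\<lambda>t x. p t x * dx (q t) x + dx (p t) x * q t x)"
    using p q unfolding dpath_def by (intro qpath_add qpath_mult) auto
  then have "qpath T (\<lambda>t. dx (\<lambda>x. p t x * q t x))"
    by (rule qpath_cong) (use p q in \<open>simp add: dpath_def dx_mult[OF ww_nonneg]\<close>)
  then show ?thesis
    using p q unfolding dpath_def by (auto intro!: qpath_mult hinf_mult ww_nonneg)
qed

lemma dpath_cnj:
  assumes p: "dpath p"
  shows "dpath (\<lambda>t x. cnj (p t x))"
proof -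
  have "qpath T (\<lambda>t x. cnj (dx (p t) x))"
    using p unfolding dpath_def by (intro qpath_cnj) auto
  then have "qpath T (\<lambda>t. dx (\<lambda>x. cnj (p t x)))"
    by (rule qpath_cong) (use p in \<open>simp add: dpath_def dx_cnj[OF ww_nonneg]\<close>)
  then show ?thesis
    using p unfolding dpath_def by (auto intro!: qpath_cnj hinf_cnj ww_nonneg)
qed

lemma dpath_power:
  assumes p: "dpath p" and "0 < n"
  shows "dpath (\<lambda>t x. p t x ^ n)"
  using assms(2)
proof (induction n rule: nat_induct_non_zero)
  case 1 show ?case using p by simp
next
  case (Suc n) show ?case using dpath_mult[OF p Suc.IH] by simp
qed

lemma qpath_nlphi:
  assumes "apath \<phi>" "apath a" "0 < \<gamma>" "0 < \<sigma>"
  shows "qpath T (\<lambda>t. nlphi \<alpha> lam \<gamma> \<sigma> (\<phi> t) (a t))"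
proof -
  have "dpath (\<lambda>t x. (a t x * cnj (a t x)) ^ n)" if "0 < n" for n
    using that assms by (intro dpath_power dpath_mult dpath_cnj dpath_apath)
  then have q: "qpath T (\<lambda>t x. (a t x * cnj (a t x)) ^ n)" if "0 < n" for n
    using that by (simp add: dpath_def)
  show ?thesis
    unfolding nlphi_def[abs_def] using assms
    by (intro qpath_add qpath_scale qpath_mult q apath_qpath apath_dx)
qed

lemma qpath_nla:
  assumes "apath \<phi>" "apath a" "0 < \<gamma>"
  shows "qpath T (\<lambda>t. nla \<alpha> \<gamma> (\<phi> t) (a t))"
proof -
  have "dpath (\<lambda>t x. (a t x * cnj (a t x)) ^ \<gamma> * a t x)"
    using assms by (intro dpath_power dpath_mult dpath_cnj dpath_apath)
  then have q: "qpath T (\<lambda>t. dx (\<lambda>x. (a t x * cnj (a t x)) ^ \<gamma> * a t x))"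
    by (simp add: dpath_def)
  show ?thesis
    unfolding nla_def[abs_def] using assms
    by (intro qpath_add qpath_scale qpath_mult q apath_qpath apath_dx)
qed

text \<open>The system for the complexified phase, so that both unknowns are treated alike.\<close>

definition csol where
  "csol \<alpha> lam \<gamma> \<sigma> \<epsilon> \<phi> a \<longleftrightarrow> apath \<phi> \<and> apath a \<and>
     (\<forall>t\<in>{0..T}. \<forall>x.
        ((\<lambda>s. \<phi> s x) has_vector_derivative nlphi \<alpha> lam \<gamma> \<sigma> (\<phi> t) (a t) x) (at t within {0..T}) \<and>
        ((\<lambda>s. a s x) has_vector_derivative
          nla \<alpha> \<gamma> (\<phi> t) (a t) x + (\<i> * complex_of_real (\<epsilon> / 2)) * dx (dx (a t)) x) (at t within {0..T}))"

text \<open>One order more for the phase, because the amplitude equation contains its second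
  derivative while the phase equation contains no derivative of the amplitude.\<close>

definition energy where
  "energy \<phi> a t = (hnorm (ww t) (5 / 2) (\<phi> t))\<^sup>2 + (hnorm (ww t) (3 / 2) (a t))\<^sup>2"

lemma energy_nonneg: "0 \<le> energy \<phi> a t"
  by (simp add: energy_def)

lemma energy_bounds:
  assumes "apath \<phi>" "apath a" "t \<in> {0..T}"
  shows "hnorm (ww t) 1 (a t) \<le> sqrt (energy \<phi> a t)" "hnorm (ww t) 1 (dx (\<phi> t)) \<le> sqrt (energy \<phi> a t)"
proof -
  note h = apath_hinf[OF assms(1,3)] apath_hinf[OF assms(2,3)]
  have "hnorm (ww t) 1 (a t) \<le> hnorm (ww t) (3 / 2) (a t)" by (rule hspace_mono(2)[OF hinf_hspace[OF h(2)]]) auto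
  also have "\<dots> \<le> sqrt (energy \<phi> a t)" unfolding energy_def by (rule le_sqrt_sum(2)) simp
  finally show "hnorm (ww t) 1 (a t) \<le> sqrt (energy \<phi> a t)" .
  have "hnorm (ww t) 1 (dx (\<phi> t)) \<le> hnorm (ww t) (1 + 1) (\<phi> t)"
    by (rule hc_deriv(3)[OF hinfD[OF h(1)] order_refl ww_nonneg[OF assms(3)]])
  also have "\<dots> \<le> hnorm (ww t) (5 / 2) (\<phi> t)" by (rule hspace_mono(2)[OF hinf_hspace[OF h(1)]]) auto
  also have "\<dots> \<le> sqrt (energy \<phi> a t)" unfolding energy_def by (rule le_sqrt_sum(1)) simp
  finally show "hnorm (ww t) 1 (dx (\<phi> t)) \<le> sqrt (energy \<phi> a t)" .
qed

text \<open>The derivatives that the decay does not recover all fall on the second solution: through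
  \<open>D\<close> in the term proportional to the energy, and through order 7/2 in the term with
  \<open>\<epsilon>1 - \<epsilon>2\<close>. The condition on \<open>M\<close> involves
  neither.\<close>

lemma energy_inequality:
  assumes s1: "csol \<alpha> lam \<gamma> \<sigma> \<epsilon>1 \<phi>1 a1" and s2: "csol \<alpha> lam \<gamma> \<sigma> \<epsilon>2 \<phi>2 a2" and t: "t \<in> {0..T}"
    and gs: "0 < \<gamma>" "0 < \<sigma>" and K0: "0 \<le> K"
  defines "d \<equiv> anorm (ww t) (\<lambda>x. dx (\<phi>1 t) x - dx (\<phi>2 t) x) + anorm (ww t) (\<lambda>x. a1 t x - a2 t x)"
    and "e \<equiv> anorm (ww t) (\<lambda>x. dx (dx (\<phi>1 t)) x - dx (dx (\<phi>2 t)) x) + anorm (ww t) (\<lambda>x. dx (a1 t) x - dx (a2 t) x)"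
    and "D \<equiv> anorm (ww t) (dx (dx (\<phi>2 t))) + anorm (ww t) (dx (a2 t))"
    and "En \<equiv> energy (\<lambda>t x. \<phi>1 t x - \<phi>2 t x) (\<lambda>t x. a1 t x - a2 t x)"
  assumes pr: "pair (ww t) K d e D (nlphi \<alpha> lam \<gamma> \<sigma> (\<phi>1 t) (a1 t)) (nlphi \<alpha> lam \<gamma> \<sigma> (\<phi>2 t) (a2 t))"
    and opr: "opair (ww t) K d e D (nla \<alpha> \<gamma> (\<phi>1 t) (a1 t)) (nla \<alpha> \<gamma> (\<phi>2 t) (a2 t))"
    and M: "32 * (K * Calg 1) \<le> M"
  shows "\<exists>E'. (En has_real_derivative E') (at t within {0..T}) \<and>
    E' \<le> 4 * (K * Calg 1) * D\<^sup>2 * En t + \<bar>\<epsilon>1 - \<epsilon>2\<bar> * hnorm (ww t) (7 / 2) (a2 t) * sqrt (En t)"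
proof -
  define w where "w = ww t"
  have w: "0 \<le> w" unfolding w_def by (rule ww_nonneg[OF t])
  define \<delta>\<phi> where "\<delta>\<phi> = (\<lambda>t x. \<phi>1 t x - \<phi>2 t x)"
  define \<delta>a where "\<delta>a = (\<lambda>t x. a1 t x - a2 t x)"
  have ap: "apath \<phi>1" "apath a1" "apath \<phi>2" "apath a2" using s1 s2 by (auto simp: csol_def)
  have apd: "apath \<delta>\<phi>" "apath \<delta>a" unfolding \<delta>\<phi>_def \<delta>a_def using ap by (auto intro: apath_diff)
  note h = ap[THEN apath_hinf, OF t, folded w_def] and hd = apd[THEN apath_hinf, OF t, folded w_def]
  define P where "P = (\<lambda>t x. nlphi \<alpha> lam \<gamma> \<sigma> (\<phi>1 t) (a1 t) x - nlphi \<alpha> lam \<gamma> \<sigma> (\<phi>2 t) (a2 t) x)"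
  define Q where "Q = (\<lambda>t x. nla \<alpha> \<gamma> (\<phi>1 t) (a1 t) x - nla \<alpha> \<gamma> (\<phi>2 t) (a2 t) x)"
  \<comment> \<open>The difference of the dispersive terms is \<open>\<epsilon>1\<close> times that
    of the difference of the amplitudes, which is skew-adjoint, plus a small multiple of a term of
    the second solution alone.\<close>
  define S1 where "S1 = (\<lambda>t x. (\<i> * complex_of_real (\<epsilon>1 / 2)) * dx (dx (\<delta>a t)) x)"
  define S2 where "S2 = (\<lambda>t x. (\<i> * complex_of_real ((\<epsilon>1 - \<epsilon>2) / 2)) * dx (dx (a2 t)) x)"
  have qP: "qpath T P" unfolding P_def using ap gs by (intro qpath_diff qpath_nlphi)
  have qQ: "qpath T Q" unfolding Q_def using ap gs by (intro qpath_diff qpath_nla)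
  have qS: "qpath T S1" "qpath T S2" unfolding S1_def S2_def by (intro qpath_scale apath_qpath apath_dx ap apd)+
  have dP: "((\<lambda>s. \<delta>\<phi> s x) has_vector_derivative P t x) (at t within {0..T})" if "t \<in> {0..T}" for t x
    unfolding \<delta>\<phi>_def P_def using s1 s2 that by (intro has_vector_derivative_diff) (auto simp: csol_def)
  have dQ: "((\<lambda>s. \<delta>a s x) has_vector_derivative Q t x + (S1 t x + S2 t x)) (at t within {0..T})" if u: "t \<in> {0..T}" for t x
  proof -
    have "dx (dx (\<delta>a t)) = (\<lambda>x. dx (dx (a1 t)) x - dx (dx (a2 t)) x)"
      unfolding \<delta>a_def using ap[THEN apath_hinf, OF u] ww_nonneg[OF u]
      by (simp add: dx_diff hinf_dx)
    from fun_cong[OF this, of x]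
    have e: "dx (dx (\<delta>a t)) x = dx (dx (a1 t)) x - dx (dx (a2 t)) x" .
    have "Q t x + (S1 t x + S2 t x) =
        (nla \<alpha> \<gamma> (\<phi>1 t) (a1 t) x + (\<i> * complex_of_real (\<epsilon>1 / 2)) * dx (dx (a1 t)) x)
        - (nla \<alpha> \<gamma> (\<phi>2 t) (a2 t) x + (\<i> * complex_of_real (\<epsilon>2 / 2)) * dx (dx (a2 t)) x)"
      unfolding Q_def S1_def S2_def e by (simp add: field_simps)
    then show ?thesis
      unfolding \<delta>a_def using s1 s2 u by (auto simp: csol_def intro!: has_vector_derivative_diff)
  qed
  define h3 h2 where "h3 = hnorm w 3 (\<delta>\<phi> t)" and "h2 = hnorm w 2 (\<delta>a t)"
  define IP where "IP = Re (ip (wmul (w + w) (5 / 2 + 5 / 2) (fourier (\<delta>\<phi> t))) (fourier (P t)))"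
  define IQ where "IQ = Re (ip (wmul (w + w) (3 / 2 + 3 / 2) (fourier (\<delta>a t))) (fourier (\<lambda>x. Q t x + (S1 t x + S2 t x))))"
  have D1: "((\<lambda>t. (hnorm (ww t) (5 / 2) (\<delta>\<phi> t))\<^sup>2) has_real_derivative - (M / 2) * h3\<^sup>2 + 2 * IP) (at t within {0..T})"
    using energy_derivative[OF apd(1) qP t, of "1/4" "5/2"] dP by (simp add: ww_def w_def h3_def IP_def)
  have D2: "((\<lambda>t. (hnorm (ww t) (3 / 2) (\<delta>a t))\<^sup>2) has_real_derivative - (M / 2) * h2\<^sup>2 + 2 * IQ) (at t within {0..T})"
    using energy_derivative[OF apd(2) qpath_add[OF qQ qpath_add[OF qS]] t, of "1/4" "3/2"] dQ
    by (simp add: ww_def w_def h2_def IQ_def)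
  have En_eq: "En = (\<lambda>t. (hnorm (ww t) (5 / 2) (\<delta>\<phi> t))\<^sup>2 + (hnorm (ww t) (3 / 2) (\<delta>a t))\<^sup>2)"
    by (auto simp: En_def energy_def \<delta>\<phi>_def \<delta>a_def)
  define sD where "sD = sqrt (h3\<^sup>2 + h2\<^sup>2)"
  define sE where "sE = sqrt (En t)"
  have En0: "0 \<le> En t" unfolding En_def by (rule energy_nonneg)
  define C where "C = Calg 1"
  have C: "1 \<le> C" unfolding C_def by (rule Calg_ge_1)
  have hP: "P t \<in> hinf w" and hQ: "Q t \<in> hinf w"
    using pr opr by (auto simp: pair_def opair_def P_def Q_def w_def intro: hinf_diff)
  have hS: "S1 t \<in> hinf w" "S2 t \<in> hinf w" unfolding S1_def S2_def by (intro hinf_scale hinf_dx w h hd)+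
  have h1an: "hnorm w 1 f \<le> anorm w f" for f
    unfolding anorm_def C_def[symmetric] using C mult_right_mono[of 1 C "hnorm w 1 f"] by simp
  \<comment> \<open>\<open>pair\<close> controls the order 1 norms of \<open>P t\<close> and of its
    derivative, and thereby the order 2 norm.\<close>
  have P2: "hnorm w 2 (P t) \<le> K * d + K * (e + d * D)"
  proof -
    have "hnorm w (1 + 1) (P t) \<le> hnorm w 1 (P t) + hnorm w 1 (dx (P t))"
      by (rule hnorm_Suc_le[OF hinfD[OF hP] order_refl w])
    also have "\<dots> \<le> anorm w (P t) + anorm w (dx (P t))" by (intro add_mono h1an)
    also have "\<dots> \<le> K * d + K * (e + d * D)"
      using pr by (intro add_mono) (simp_all add: pair_def opair_def P_def w_def dx_diff[OF ww_nonneg[OF t]])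
    finally show ?thesis by simp
  qed
  have Q1: "hnorm w 1 (Q t) \<le> K * (e + d * D)"
    using h1an[of "Q t"] opr by (simp add: opair_def Q_def w_def)
  have dd: "dx (\<delta>\<phi> t) = (\<lambda>x. dx (\<phi>1 t) x - dx (\<phi>2 t) x)" "dx (\<delta>a t) = (\<lambda>x. dx (a1 t) x - dx (a2 t) x)"
    "dx (dx (\<delta>\<phi> t)) = (\<lambda>x. dx (dx (\<phi>1 t)) x - dx (dx (\<phi>2 t)) x)"
    unfolding \<delta>\<phi>_def \<delta>a_def using h w by (simp_all add: dx_diff[OF w] hinf_dx)
  have hx: "hnorm w 1 (dx f) \<le> hnorm w 2 f" "hnorm w 1 (dx (dx f)) \<le> hnorm w 3 f" if f: "f \<in> hinf w" for f
  proof -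
    show "hnorm w 1 (dx f) \<le> hnorm w 2 f"
      using hc_deriv(3)[OF hinfD[OF f] order_refl w] by simp
    have "hnorm w 1 (dx (dx f)) \<le> hnorm w 2 (dx f)"
      using hc_deriv(3)[OF hinfD[OF hinf_dx[OF w f]] order_refl w] by simp
    also have "\<dots> \<le> hnorm w 3 f"
      using hc_deriv(3)[OF hinfD[OF f], of 2] w by simp
    finally show "hnorm w 1 (dx (dx f)) \<le> hnorm w 3 f" .
  qed
  have mono: "hnorm w k f \<le> hnorm w k' f" if "f \<in> hinf w" "k \<le> k'" for k k' f
    by (rule hspace_mono(2)[OF hinf_hspace[OF that(1)]]) (use that in auto)
  have sD: "h3 \<le> sD" "h2 \<le> sD" unfolding sD_def h3_def h2_def by (auto intro!: le_sqrt_sum)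
  have sE: "hnorm w (5 / 2) (\<delta>\<phi> t) \<le> sE" "hnorm w (3 / 2) (\<delta>a t) \<le> sE"
    unfolding sE_def En_eq w_def by (auto intro!: le_sqrt_sum)
  have d_eq: "d = C * (hnorm w 1 (dx (\<delta>\<phi> t)) + hnorm w 1 (\<delta>a t))"
    unfolding d_def anorm_def C_def dd(1) by (simp add: \<delta>a_def w_def distrib_left)
  have e_eq: "e = C * (hnorm w 1 (dx (dx (\<delta>\<phi> t))) + hnorm w 1 (dx (\<delta>a t)))"
    unfolding e_def anorm_def C_def dd(3) dd(2) by (simp add: w_def distrib_left)
  have C2: "C * (x + y) \<le> 2 * C * z" if "x \<le> z" "y \<le> z" for x y z
    using mult_left_mono[of "x + y" "2 * z" C] that C by simp
  have dE: "d \<le> 2 * C * sE"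
    unfolding d_eq
  proof (rule C2)
    show "hnorm w 1 (dx (\<delta>\<phi> t)) \<le> sE"
      using hx(1)[OF hd(1)] mono[OF hd(1), of 2 "5 / 2"] sE(1) by simp
    show "hnorm w 1 (\<delta>a t) \<le> sE" using mono[OF hd(2), of 1 "3 / 2"] sE(2) by simp
  qed
  have dD: "d \<le> 2 * C * sD"
    unfolding d_eq
  proof (rule C2)
    show "hnorm w 1 (dx (\<delta>\<phi> t)) \<le> sD"
      using hx(1)[OF hd(1)] mono[OF hd(1), of 2 3] sD(1) by (simp add: h3_def)
    show "hnorm w 1 (\<delta>a t) \<le> sD" using mono[OF hd(2), of 1 2] sD(2) by (simp add: h2_def)
  qed
  have eD: "e \<le> 2 * C * sD"
    unfolding e_eq
  proof (rule C2)
    show "hnorm w 1 (dx (dx (\<delta>\<phi> t))) \<le> sD" using hx(2)[OF hd(1)] sD(1) by (simp add: h3_def)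
    show "hnorm w 1 (dx (\<delta>a t)) \<le> sD" using hx(1)[OF hd(2)] sD(2) by (simp add: h2_def)
  qed
  \<comment> \<open>Orders \<open>5 / 2 + 5 / 2\<close> are split as \<open>3 + 2\<close>; the order
    3 factor is the one that the decay dissipates.\<close>
  have IP: "IP \<le> h3 * hnorm w 2 (P t)"
    using order_trans[OF complex_Re_le_cmod ip_wmul_bound[OF hinf_hspace[OF hd(1)] hinf_hspace[OF hP], of 3 2]]
    by (simp add: IP_def h3_def)
  define S where "S = hnorm w (7 / 2) (a2 t)"
  have IQ: "IQ \<le> h2 * hnorm w 1 (Q t) + sE * (\<bar>\<epsilon>1 - \<epsilon>2\<bar> / 2 * S)"
  proof -
    define F where "F = wmul (w + w) (3 / 2 + 3 / 2) (fourier (\<delta>a t))"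
    have sqF: "square_integrable F"
    proof -
      \<comment> \<open>Twice the quarter weight is half of \<open>W t\<close>, the largest weight
        that \<open>apath\<close> admits.\<close>
      have "w + w = 1 / 2 * W t" by (simp add: w_def ww_def)
      then have "\<delta>a t \<in> hspace (w + w) (3 / 2 + 3 / 2)"
        using apath_hc[OF apd(2) t, of "1/2" "3 / 2 + 3 / 2"] by (simp only: hc_def) simp
      then show ?thesis unfolding F_def by (rule hspaceD(2))
    qed
    have sq: "square_integrable (Q t)" "square_integrable (S1 t)" "square_integrable (S2 t)"
      using hspaceD(1)[OF hinf_hspace] hQ hS by auto
    note sf = sq[THEN sqint_fourier]
    have "AE \<xi> in lborel. fourier (\<lambda>x. Q t x + (S1 t x + S2 t x)) \<xi> = fourier (Q t) \<xi> + (fourier (S1 t) \<xi> + fourier (S2 t) \<xi>)"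
      using fourier_add[OF sq(1) sqint_add[OF sq(2,3)]] fourier_add[OF sq(2,3)] by eventually_elim simp
    then have "ip F (fourier (\<lambda>x. Q t x + (S1 t x + S2 t x))) = ip F (\<lambda>\<xi>. fourier (Q t) \<xi> + (fourier (S1 t) \<xi> + fourier (S2 t) \<xi>))"
      by (rule ip_cong_AE_right) (intro sqint_measurable sqF sqint_fourier sqint_add sq sf)+
    also have "\<dots> = ip F (fourier (Q t)) + (ip F (fourier (S1 t)) + ip F (fourier (S2 t)))"
      using ip_add_right[OF sf(1) sqint_add[OF sf(2,3)] sqF] ip_add_right[OF sf(2,3) sqF] by simp
    finally have "IQ = Re (ip F (fourier (Q t))) + (Re (ip F (fourier (S1 t))) + Re (ip F (fourier (S2 t))))"
      by (simp add: IQ_def F_def)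
    moreover have "Re (ip F (fourier (S1 t))) = 0"
      unfolding F_def S1_def by (rule schroedinger_skew[OF w hd(2)])
    moreover have "Re (ip F (fourier (Q t))) \<le> h2 * hnorm w 1 (Q t)"
      using order_trans[OF complex_Re_le_cmod ip_wmul_bound[OF hinf_hspace[OF hd(2)] hinf_hspace[OF hQ], of 2 1]]
      by (simp add: F_def h2_def)
    moreover have "Re (ip F (fourier (S2 t))) \<le> sE * (\<bar>\<epsilon>1 - \<epsilon>2\<bar> / 2 * S)"
    proof -
      \<comment> \<open>Two derivatives on top of order 3/2 account for the order 7/2.\<close>
      have a2: "hnorm w (3 / 2) (dx (dx (a2 t))) \<le> S"
      proof -
        have "hnorm w (3 / 2) (dx (dx (a2 t))) \<le> hnorm w (3 / 2 + 1) (dx (a2 t))"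
          by (rule hc_deriv(3)[OF hinfD[OF hinf_dx[OF w h(4)]] _ w]) simp
        also have "\<dots> \<le> hnorm w (3 / 2 + 1 + 1) (a2 t)"
          by (rule hc_deriv(3)[OF hinfD[OF h(4)] _ w]) simp
        finally show ?thesis by (simp add: S_def)
      qed
      have "hnorm w (3 / 2) (S2 t) = \<bar>\<epsilon>1 - \<epsilon>2\<bar> / 2 * hnorm w (3 / 2) (dx (dx (a2 t)))"
        unfolding S2_def using hspace_scale(2)[OF hinf_hspace[OF hinf_dx[OF w hinf_dx[OF w h(4)]]]]
        by (simp only: norm_mult norm_of_real norm_ii abs_divide mult_1 abs_numeral)
      then have S2le: "hnorm w (3 / 2) (S2 t) \<le> \<bar>\<epsilon>1 - \<epsilon>2\<bar> / 2 * S"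
        using a2 by (simp add: mult_left_mono)
      have "Re (ip F (fourier (S2 t))) \<le> hnorm w (3 / 2) (\<delta>a t) * hnorm w (3 / 2) (S2 t)"
        unfolding F_def
        by (rule order_trans[OF complex_Re_le_cmod ip_wmul_bound[OF hinf_hspace[OF hd(2)] hinf_hspace[OF hS(2)]]])
      also have "\<dots> \<le> sE * (\<bar>\<epsilon>1 - \<epsilon>2\<bar> / 2 * S)"
        by (intro mult_mono sE S2le) (use En0 in \<open>auto simp: sE_def\<close>)
      finally show ?thesis .
    qed
    ultimately show ?thesis by linarith
  qed
  have D0: "0 \<le> D" unfolding D_def by (intro add_nonneg_nonneg anorm_nonneg)
  have main: "2 * (h3 * hnorm w 2 (P t)) + 2 * (h2 * hnorm w 1 (Q t)) \<le> 16 * (K * C) * sD\<^sup>2 + 4 * (K * C) * D\<^sup>2 * sE\<^sup>2"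
    by (rule energy_arithmetic[OF _ K0 D0 _ _ dE dD eD _ _ sD P2 Q1])
       (use C En0 in \<open>auto simp: h3_def h2_def sE_def sD_def\<close>)
  have sq: "sD\<^sup>2 = h3\<^sup>2 + h2\<^sup>2" "sE\<^sup>2 = En t" using En0 by (auto simp: sD_def sE_def)
  \<comment> \<open>\<open>energy_arithmetic\<close> leaves \<open>16 * (K * C)\<close>, while the
    decay at \<open>c = 1 / 4\<close> supplies \<open>M / 2\<close>; this is the origin of the
    32.\<close>
  have "16 * (K * C) * sD\<^sup>2 \<le> (M / 2) * sD\<^sup>2"
    using M by (intro mult_right_mono) (auto simp: C_def)
  then have fin: "(- (M / 2) * h3\<^sup>2 + 2 * IP) + (- (M / 2) * h2\<^sup>2 + 2 * IQ)
      \<le> 4 * (K * C) * D\<^sup>2 * En t + \<bar>\<epsilon>1 - \<epsilon>2\<bar> * S * sE"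
    using main IP IQ unfolding sq by (simp add: algebra_simps)
  show ?thesis
  proof (intro exI conjI)
    show "(En has_real_derivative (- (M / 2) * h3\<^sup>2 + 2 * IP) + (- (M / 2) * h2\<^sup>2 + 2 * IQ)) (at t within {0..T})"
      unfolding En_eq by (rule DERIV_add[OF D1 D2])
    show "(- (M / 2) * h3\<^sup>2 + 2 * IP) + (- (M / 2) * h2\<^sup>2 + 2 * IQ)
        \<le> 4 * (K * Calg 1) * D\<^sup>2 * En t + \<bar>\<epsilon>1 - \<epsilon>2\<bar> * hnorm (ww t) (7 / 2) (a2 t) * sqrt (En t)"
      using fin unfolding C_def S_def sE_def w_def .
  qed
qed

end

section \<open>Continuity argument, Gronwall's inequality and embeddings\<close>

lemma nonincreasing_within:
  fixes f :: "real \<Rightarrow> real"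
  assumes b: "0 \<le> b" "b \<le> T"
    and der: "\<And>t. t \<in> {0..b} \<Longrightarrow> \<exists>D. (f has_real_derivative D) (at t within {0..T}) \<and> D \<le> 0"
  shows "f b \<le> f 0"
proof -
  show ?thesis
  proof (rule DERIV_nonpos_imp_decreasing_open[OF b(1)])
    fix x assume x: "0 < x" "x < b"
    then have "x \<in> interior {0..T}" using b by (simp add: interior_atLeastAtMost_real)
    then have "at x within {0..T} = at x" by (rule at_within_interior)
    then show "\<exists>y. (f has_real_derivative y) (at x) \<and> y \<le> 0" using der[of x] x by simp
  next
    have "f differentiable (at t within {0..b})" if t: "t \<in> {0..b}" for t
    proof -
      obtain D where "(f has_real_derivative D) (at t within {0..T})" using der[OF t] by blast
      then have "(f has_real_derivative D) (at t within {0..b})" by (rule DERIV_subset) (use b in auto)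
      then show ?thesis by (auto simp: real_differentiable_def)
    qed
    then show "continuous_on {0..b} f"
      by (intro differentiable_imp_continuous_on) (simp add: differentiable_on_def)
  qed
qed

text \<open>Until \<open>f\<close> first reaches \<open>r\<close> it stays at or below
  \<open>r\<close> and so does not increase. At that moment it would be at most
  \<open>f 0 < r\<close>, a contradiction.\<close>

lemma bootstrap:
  fixes f :: "real \<Rightarrow> real"
  assumes c: "continuous_on {0..T} f" and f0: "f 0 < r"
    and der: "\<And>t. t \<in> {0..T} \<Longrightarrow> f t \<le> r \<Longrightarrow> \<exists>D. (f has_real_derivative D) (at t within {0..T}) \<and> D \<le> 0"
    and t: "t \<in> {0..T}"
  shows "f t \<le> f 0"
proof -
  have lt: "f s \<le> r" if s: "s \<in> {0..T}" for s
  proof (rule ccontr)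
    assume "\<not> f s \<le> r"
    \<comment> \<open>These times form a compact set, nonempty by the intermediate value theorem, so
      that there is a first one.\<close>
    define A where "A = {u \<in> {0..s}. f u = r}"
    have cs: "continuous_on {0..s} f" by (rule continuous_on_subset[OF c]) (use s in auto)
    have "\<exists>x\<ge>0. x \<le> s \<and> f x = r" by (rule IVT') (use f0 s cs \<open>\<not> f s \<le> r\<close> in auto)
    then have ne: "A \<noteq> {}" by (auto simp: A_def)
    have "closed A"
      unfolding A_def using continuous_closed_preimage_constant[OF cs closed_atLeastAtMost, of r] by simp
    moreover have "bounded A" by (rule bounded_subset[of "{0..s}"]) (auto simp: A_def)
    ultimately have "compact A" by (simp add: compact_eq_bounded_closed)
    then obtain m where m: "m \<in> A" "\<And>u. u \<in> A \<Longrightarrow> m \<le> u" using ne compact_attains_inf by metis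
    have mm: "0 \<le> m" "m \<le> s" "f m = r" using m(1) by (auto simp: A_def)
    have "f u \<le> r" if u: "u \<in> {0..m}" for u
    proof (rule ccontr)
      assume n: "\<not> f u \<le> r"
      have "continuous_on {0..u} f" by (rule continuous_on_subset[OF cs]) (use u mm in auto)
      then have "\<exists>x\<ge>0. x \<le> u \<and> f x = r" by (intro IVT') (use f0 u n in auto)
      then obtain x where x: "0 \<le> x" "x \<le> u" "f x = r" by blast
      then have "x \<in> A" using u mm by (auto simp: A_def)
      then have "m \<le> x" by (rule m(2))
      then have "x = u" using x u by auto
      then show False using x n by simp
    qed
    then have "f m \<le> f 0"
      using mm s by (intro nonincreasing_within[of m T f] der) auto
    then show False using mm f0 by simp
  qed
  show ?thesis using t lt by (intro nonincreasing_within[of t T f] der) auto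
qed

text \<open>The integrating factor turns the differential inequality into a decreasing function
  \<open>g\<close>. Subtracting \<open>B * s\<close> compensates the source, because the factor is
  at most 1.\<close>

lemma gronwall:
  fixes f :: "real \<Rightarrow> real"
  assumes A: "0 \<le> A" and B: "0 \<le> B" and f0: "0 \<le> f 0" and t: "t \<in> {0..T}"
    and der: "\<And>t. t \<in> {0..T} \<Longrightarrow> \<exists>D. (f has_real_derivative D) (at t within {0..T}) \<and> D \<le> A * f t + B"
  shows "f t \<le> exp (A * T) * (f 0 + B * T)"
proof -
  define g where "g = (\<lambda>s. f s * exp (- (A * s)) - B * s)"
  have "g t \<le> g 0"
  proof (rule nonincreasing_within)
    fix s assume s: "s \<in> {0..t}"
    then obtain D where D: "(f has_real_derivative D) (at s within {0..T})" "D \<le> A * f s + B"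
      using der[of s] t by auto
    have "(g has_real_derivative (D - A * f s) * exp (- (A * s)) - B) (at s within {0..T})"
      unfolding g_def by (auto intro!: derivative_eq_intros D(1) simp: algebra_simps)
    moreover have "(D - A * f s) * exp (- (A * s)) \<le> B * 1"
    proof -
      have "(D - A * f s) * exp (- (A * s)) \<le> B * exp (- (A * s))" using D(2) by (intro mult_right_mono) auto
      also have "\<dots> \<le> B * 1" using A B s by (intro mult_left_mono) auto
      finally show ?thesis .
    qed
    ultimately show "\<exists>D. (g has_real_derivative D) (at s within {0..T}) \<and> D \<le> 0" by fastforce
  qed (use t in auto)
  then have "f t * exp (- (A * t)) \<le> f 0 + B * t" by (simp add: g_def)
  then have "f t * exp (- (A * t)) * exp (A * t) \<le> (f 0 + B * t) * exp (A * t)" by (intro mult_right_mono) auto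
  then have "f t \<le> (f 0 + B * t) * exp (A * t)" by (simp add: mult.assoc exp_add[symmetric])
  also have "\<dots> \<le> (f 0 + B * T) * exp (A * T)"
    using A B t f0 by (intro mult_mono add_left_mono mult_left_mono) (auto intro: mult_left_mono)
  finally show ?thesis by (simp add: mult.commute)
qed

text \<open>A gap between exponential weights beats every power of the bracket, whatever the two
  orders are. It brings initial data of orders \<open>l + 1\<close> and \<open>l\<close> to the
  fixed orders of the energy.\<close>

lemma hnorm_embedding:
  assumes "w < w'"
  obtains B where "0 \<le> B" "\<And>f. f \<in> hspace w' k' \<Longrightarrow> hnorm w k f \<le> B * hnorm w' k' f"
proof -
  have "0 < w' - w" using assms by simp
  then obtain B where B: "0 \<le> B" "\<And>b. 1 \<le> b \<Longrightarrow> b powr (k - k') * exp (- (w' - w) * b) \<le> B"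
    using powr_exp_bounded[of "w' - w" "k - k'"] by blast
  have wtB: "wt w k \<xi> \<le> B * wt w' k' \<xi>" for \<xi>
  proof -
    have "wt w k \<xi> = wt (w - w') (k - k') \<xi> * wt w' k' \<xi>" by (simp add: wt_mult)
    also have "\<dots> \<le> B * wt w' k' \<xi>"
      using B(2)[OF bracket_ge_1[of \<xi>]] by (intro mult_right_mono wt_nonneg) (simp add: wt_def)
    finally show ?thesis .
  qed
  show ?thesis
  proof (rule that[OF B(1)])
    fix f assume f: "f \<in> hspace w' k'"
    note F = hspaceD[OF f]
    note [measurable] = F(3)
    have s: "square_integrable (\<lambda>\<xi>. complex_of_real B * wmul w' k' (fourier f) \<xi>)" by (rule sqint_scale[OF F(2)])
    have le: "AE \<xi> in lborel. cmod (wmul w k (fourier f) \<xi>) \<le> cmod (complex_of_real B * wmul w' k' (fourier f) \<xi>)"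
      using mult_right_mono[OF wtB norm_ge_zero] B(1) by (intro AE_I2) (simp add: norm_mult cmod_wmul mult.assoc)
    have m: "wmul w k (fourier f) \<in> borel_measurable borel" by measurable
    have h: "f \<in> hspace w k" using F(1) l2_mono(2)[OF s m le] by (simp add: hspace_iff)
    have "hnorm w k f \<le> l2 (\<lambda>\<xi>. complex_of_real B * wmul w' k' (fourier f) \<xi>)"
      unfolding hnorm_eq[OF h] by (rule l2_mono(1)[OF s m le])
    then show "hnorm w k f \<le> B * hnorm w' k' f"
      unfolding l2_scale hnorm_eq[OF f] using B(1) by simp
  qed
qed

text \<open>\<open>nonlinear_pair\<close> as a predicate, so that \<open>K\<close> can be fixed
  outside the locale, before \<open>M\<close> and \<open>T\<close> are given.\<close>

definition nlbound :: "real \<Rightarrow> real \<Rightarrow> nat \<Rightarrow> nat \<Rightarrow> real \<Rightarrow> real \<Rightarrow> bool" where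
  "nlbound \<alpha> lam \<gamma> \<sigma> R K \<longleftrightarrow> 0 \<le> K \<and> (\<forall>w \<phi>1 a1 \<phi>2 a2 d e D. 0 \<le> w \<longrightarrow>
      \<phi>1 \<in> hinf w \<longrightarrow> a1 \<in> hinf w \<longrightarrow> \<phi>2 \<in> hinf w \<longrightarrow> a2 \<in> hinf w \<longrightarrow>
      anorm w (dx \<phi>1) \<le> R \<longrightarrow> anorm w a1 \<le> R \<longrightarrow> anorm w (dx \<phi>2) \<le> R \<longrightarrow> anorm w a2 \<le> R \<longrightarrow>
      d = anorm w (\<lambda>x. dx \<phi>1 x - dx \<phi>2 x) + anorm w (\<lambda>x. a1 x - a2 x) \<longrightarrow>
      e = anorm w (\<lambda>x. dx (dx \<phi>1) x - dx (dx \<phi>2) x) + anorm w (\<lambda>x. dx a1 x - dx a2 x) \<longrightarrow>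
      D = anorm w (dx (dx \<phi>2)) + anorm w (dx a2) \<longrightarrow>
      pair w K d e D (nlphi \<alpha> lam \<gamma> \<sigma> \<phi>1 a1) (nlphi \<alpha> lam \<gamma> \<sigma> \<phi>2 a2) \<and>
      opair w K d e D (nla \<alpha> \<gamma> \<phi>1 a1) (nla \<alpha> \<gamma> \<phi>2 a2))"

lemma nlbound_exists:
  assumes "0 < \<gamma>" "0 < \<sigma>" "1 \<le> R"
  shows "\<exists>K. nlbound \<alpha> lam \<gamma> \<sigma> R K"
proof -
  obtain K where K: "0 \<le> K" and *: "\<And>w \<phi>1 a1 \<phi>2 a2 d e D. 0 \<le> w \<Longrightarrow> \<phi>1 \<in> hinf w \<Longrightarrow> a1 \<in> hinf w \<Longrightarrow> \<phi>2 \<in> hinf w \<Longrightarrow> a2 \<in> hinf w \<Longrightarrow>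
      anorm w (dx \<phi>1) \<le> R \<Longrightarrow> anorm w a1 \<le> R \<Longrightarrow> anorm w (dx \<phi>2) \<le> R \<Longrightarrow> anorm w a2 \<le> R \<Longrightarrow>
      d = anorm w (\<lambda>x. dx \<phi>1 x - dx \<phi>2 x) + anorm w (\<lambda>x. a1 x - a2 x) \<Longrightarrow>
      e = anorm w (\<lambda>x. dx (dx \<phi>1) x - dx (dx \<phi>2) x) + anorm w (\<lambda>x. dx a1 x - dx a2 x) \<Longrightarrow>
      D = anorm w (dx (dx \<phi>2)) + anorm w (dx a2) \<Longrightarrow>
      pair w K d e D (nlphi \<alpha> lam \<gamma> \<sigma> \<phi>1 a1) (nlphi \<alpha> lam \<gamma> \<sigma> \<phi>2 a2) \<and>
      opair w K d e D (nla \<alpha> \<gamma> \<phi>1 a1) (nla \<alpha> \<gamma> \<phi>2 a2)"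
    using nonlinear_pair[OF assms, of \<alpha> lam] by blast
  show ?thesis unfolding nlbound_def using K by (intro exI[of _ K] conjI allI impI *) auto
qed

section \<open>Uniform bound and difference estimate\<close>

lemma anorm_zero: "anorm w (\<lambda>x. 0) = 0"
  by (simp add: anorm_def hspace_zero)

context weight_decay
begin

lemma csol_zero:
  assumes "0 < \<gamma>" "0 < \<sigma>"
  shows "csol \<alpha> lam \<gamma> \<sigma> \<epsilon> (\<lambda>t x. 0) (\<lambda>t x. 0)"
  unfolding csol_def nlphi_def nla_def using assms by (simp add: apath_zero zero_power)

lemma energy_step:
  assumes s1: "csol \<alpha> lam \<gamma> \<sigma> \<epsilon>1 \<phi>1 a1" and s2: "csol \<alpha> lam \<gamma> \<sigma> \<epsilon>2 \<phi>2 a2" and t: "t \<in> {0..T}"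
    and gs: "0 < \<gamma>" "0 < \<sigma>" and K: "nlbound \<alpha> lam \<gamma> \<sigma> (1 + Calg 1 * \<rho>) K"
    and e: "energy \<phi>1 a1 t \<le> \<rho>\<^sup>2" "energy \<phi>2 a2 t \<le> \<rho>\<^sup>2" and \<rho>: "0 \<le> \<rho>" and M: "32 * (K * Calg 1) \<le> M"
  defines "En \<equiv> energy (\<lambda>t x. \<phi>1 t x - \<phi>2 t x) (\<lambda>t x. a1 t x - a2 t x)"
  shows "\<exists>E'. (En has_real_derivative E') (at t within {0..T}) \<and>
    E' \<le> 4 * (K * Calg 1) * (anorm (ww t) (dx (dx (\<phi>2 t))) + anorm (ww t) (dx (a2 t)))\<^sup>2 * En t
      + \<bar>\<epsilon>1 - \<epsilon>2\<bar> * hnorm (ww t) (7 / 2) (a2 t) * sqrt (En t)"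
proof -
  have ap: "apath \<phi>1" "apath a1" "apath \<phi>2" "apath a2" using s1 s2 by (auto simp: csol_def)
  note h = ap[THEN apath_hinf, OF t]
  have sq: "sqrt (energy \<phi>1 a1 t) \<le> \<rho>" "sqrt (energy \<phi>2 a2 t) \<le> \<rho>"
    using e \<rho> by (auto intro: real_le_lsqrt)
  have C: "1 \<le> Calg 1" by (rule Calg_ge_1)
  \<comment> \<open>An energy of at most \<open>\<rho>^2\<close> bounds the order 1 norms by
    \<open>\<rho>\<close>, hence \<open>anorm\<close> by \<open>Calg 1 * \<rho>\<close>; the summand
    1 secures \<open>1 \<le> R\<close> in the choice of \<open>K\<close>.\<close>
  have R: "anorm (ww t) f \<le> 1 + Calg 1 * \<rho>" if "hnorm (ww t) 1 f \<le> \<rho>" for f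
    using mult_left_mono[OF that, of "Calg 1"] C unfolding anorm_def by linarith
  note b1 = energy_bounds[OF ap(1,2) t] and b2 = energy_bounds[OF ap(3,4) t]
  have r: "anorm (ww t) (dx (\<phi>1 t)) \<le> 1 + Calg 1 * \<rho>" "anorm (ww t) (a1 t) \<le> 1 + Calg 1 * \<rho>"
    "anorm (ww t) (dx (\<phi>2 t)) \<le> 1 + Calg 1 * \<rho>" "anorm (ww t) (a2 t) \<le> 1 + Calg 1 * \<rho>"
    using b1 b2 sq by (auto intro!: R)
  note N = K[unfolded nlbound_def, THEN conjunct2, rule_format, OF ww_nonneg[OF t] h r refl refl refl]
  show ?thesis
    unfolding En_def
    by (rule energy_inequality[OF s1 s2 t gs _ N[THEN conjunct1] N[THEN conjunct2] M])
       (use K in \<open>simp add: nlbound_def\<close>)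
qed

lemma energy_continuous:
  assumes "apath \<phi>" "apath a"
  shows "continuous_on {0..T} (energy \<phi> a)"
  unfolding energy_def[abs_def] ww_def by (intro continuous_intros apath_hnorm_continuous assms) auto

text \<open>Compared with the zero solution at the same \<open>\<epsilon>\<close>, both terms on the
  right of the energy inequality vanish. So the energy does not grow while it is at most
  \<open>\<rho>^2\<close>, and \<open>bootstrap\<close> removes this proviso.\<close>

lemma a_priori:
  assumes s: "csol \<alpha> lam \<gamma> \<sigma> \<epsilon> \<phi> a" and t: "t \<in> {0..T}"
    and gs: "0 < \<gamma>" "0 < \<sigma>" and K: "nlbound \<alpha> lam \<gamma> \<sigma> (1 + Calg 1 * \<rho>) K"
    and e: "energy \<phi> a 0 < \<rho>\<^sup>2" and \<rho>: "0 \<le> \<rho>" and M: "32 * (K * Calg 1) \<le> M"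
  shows "energy \<phi> a t \<le> \<rho>\<^sup>2"
proof -
  have ap: "apath \<phi>" "apath a" using s by (auto simp: csol_def)
  have "energy \<phi> a t \<le> energy \<phi> a 0"
  proof (rule bootstrap[OF energy_continuous[OF ap] e _ t])
    fix u assume u: "u \<in> {0..T}" "energy \<phi> a u \<le> \<rho>\<^sup>2"
    have z: "energy (\<lambda>t x. 0) (\<lambda>t x. 0) u \<le> \<rho>\<^sup>2" by (simp add: energy_def hspace_zero)
    from energy_step[OF s csol_zero[OF gs, of \<alpha> lam \<epsilon>] u(1) gs K u(2) z \<rho> M]
    show "\<exists>D. (energy \<phi> a has_real_derivative D) (at u within {0..T}) \<and> D \<le> 0"
      by (simp add: anorm_zero)
  qed
  then show ?thesis using e by simp
qed

text \<open>On the compact time interval the limit solution has bounded norms of every order at the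
  quarter weight. These bounds may depend on \<open>M\<close> and \<open>T\<close>, which is
  harmless: they enter only \<open>A\<close> and \<open>S\<close>.\<close>

lemma difference_estimate:
  assumes s2: "csol \<alpha> lam \<gamma> \<sigma> 0 \<phi>2 a2"
    and gs: "0 < \<gamma>" "0 < \<sigma>" and K: "nlbound \<alpha> lam \<gamma> \<sigma> (1 + Calg 1 * \<rho>) K"
    and e2: "\<And>t. t \<in> {0..T} \<Longrightarrow> energy \<phi>2 a2 t \<le> \<rho>\<^sup>2" and \<rho>: "0 \<le> \<rho>" and M: "32 * (K * Calg 1) \<le> M"
  obtains A S where "0 \<le> S"
    "\<And>\<epsilon> \<phi>1 a1 t. \<epsilon> \<in> {0<..1} \<Longrightarrow> csol \<alpha> lam \<gamma> \<sigma> \<epsilon> \<phi>1 a1 \<Longrightarrow>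
      (\<And>t. t \<in> {0..T} \<Longrightarrow> energy \<phi>1 a1 t \<le> \<rho>\<^sup>2) \<Longrightarrow> t \<in> {0..T} \<Longrightarrow>
      energy (\<lambda>t x. \<phi>1 t x - \<phi>2 t x) (\<lambda>t x. a1 t x - a2 t x) t
        \<le> exp (A * T) * (energy (\<lambda>t x. \<phi>1 t x - \<phi>2 t x) (\<lambda>t x. a1 t x - a2 t x) 0 + \<epsilon> * S * T)"
proof -
  have ap: "apath \<phi>2" "apath a2" using s2 by (auto simp: csol_def)
  have K0: "0 \<le> K" using K by (simp add: nlbound_def)
  have C: "1 \<le> Calg 1" by (rule Calg_ge_1)
  have bnd: "\<exists>B. \<forall>t\<in>{0..T}. hnorm (ww t) k (q t) \<le> B" if "apath q" for q k
  proof -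
    have "continuous_on {0..T} (\<lambda>t. hnorm (ww t) k (q t))"
      unfolding ww_def by (intro apath_hnorm_continuous that) auto
    then have "bounded ((\<lambda>t. hnorm (ww t) k (q t)) ` {0..T})"
      by (intro compact_imp_bounded compact_continuous_image) auto
    then show ?thesis by (auto simp: bounded_iff)
  qed
  obtain S where S: "\<And>t. t \<in> {0..T} \<Longrightarrow> hnorm (ww t) (7 / 2) (a2 t) \<le> S" using bnd[OF ap(2)] by blast
  obtain B1 where B1: "\<And>t. t \<in> {0..T} \<Longrightarrow> hnorm (ww t) 1 (dx (dx (\<phi>2 t))) \<le> B1"
    using bnd[OF apath_dx[OF apath_dx[OF ap(1)]]] by blast
  obtain B2 where B2: "\<And>t. t \<in> {0..T} \<Longrightarrow> hnorm (ww t) 1 (dx (a2 t)) \<le> B2"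
    using bnd[OF apath_dx[OF ap(2)]] by blast
  have S0: "0 \<le> S" using order_trans[OF hnorm_nonneg S[of 0]] T_pos by simp
  define L where "L = Calg 1 * (B1 + B2)"
  \<comment> \<open>The summand \<open>S\<close> comes from
    \<open>sqrt (En t) \<le> 1 + En t\<close>, which makes the \<open>\<epsilon>\<close> term linear
    in the energy.\<close>
  define A where "A = 4 * (K * Calg 1) * L\<^sup>2 + S"
  have A0: "0 \<le> A" unfolding A_def using K0 C S0 by simp
  show ?thesis
  proof (rule that[of S A, OF S0])
    fix \<epsilon> \<phi>1 a1 t
    assume \<epsilon>: "\<epsilon> \<in> {0<..1::real}" and s1: "csol \<alpha> lam \<gamma> \<sigma> \<epsilon> \<phi>1 a1"
      and e1: "\<And>t. t \<in> {0..T} \<Longrightarrow> energy \<phi>1 a1 t \<le> \<rho>\<^sup>2" and t: "t \<in> {0..T}"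
    define En where "En = energy (\<lambda>t x. \<phi>1 t x - \<phi>2 t x) (\<lambda>t x. a1 t x - a2 t x)"
    have En0: "0 \<le> En t" for t unfolding En_def by (rule energy_nonneg)
    have "En t \<le> exp (A * T) * (En 0 + (\<epsilon> * S) * T)"
    proof (rule gronwall[OF A0 _ En0 t])
      show "0 \<le> \<epsilon> * S" using \<epsilon> S0 by simp
      fix t assume t: "t \<in> {0..T}"
      define D where "D = anorm (ww t) (dx (dx (\<phi>2 t))) + anorm (ww t) (dx (a2 t))"
      obtain E' where E': "(En has_real_derivative E') (at t within {0..T})"
        "E' \<le> 4 * (K * Calg 1) * D\<^sup>2 * En t + \<bar>\<epsilon> - 0\<bar> * hnorm (ww t) (7 / 2) (a2 t) * sqrt (En t)"
        using energy_step[OF s1 s2 t gs K e1[OF t] e2[OF t] \<rho> M] unfolding En_def D_def by blast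
      have DL: "0 \<le> D" "D \<le> L"
        unfolding D_def L_def anorm_def distrib_left[symmetric]
        using C B1[OF t] B2[OF t] by (auto intro!: mult_left_mono add_mono)
      have "4 * (K * Calg 1) * D\<^sup>2 * En t \<le> 4 * (K * Calg 1) * L\<^sup>2 * En t"
        using DL K0 C En0[of t] by (intro mult_right_mono mult_left_mono power_mono) auto
      moreover have "\<bar>\<epsilon> - 0\<bar> * hnorm (ww t) (7 / 2) (a2 t) * sqrt (En t) \<le> \<epsilon> * S + S * En t"
      proof -
        have "sqrt (En t) \<le> 1 + En t"
          using En0[of t] by (intro real_le_lsqrt) (auto simp: power2_eq_square algebra_simps)
        then have "\<bar>\<epsilon> - 0\<bar> * hnorm (ww t) (7 / 2) (a2 t) * sqrt (En t) \<le> \<epsilon> * S * (1 + En t)"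
          using \<epsilon> S[OF t] S0 En0[of t] by (intro mult_mono) auto
        also have "\<dots> = \<epsilon> * S + \<epsilon> * (S * En t)" by (simp add: algebra_simps)
        also have "\<dots> \<le> \<epsilon> * S + 1 * (S * En t)"
          using \<epsilon> S0 En0[of t] by (intro add_left_mono mult_right_mono) auto
        finally show ?thesis by simp
      qed
      ultimately have "E' \<le> A * En t + \<epsilon> * S"
        using E'(2) unfolding A_def by (simp add: distrib_right)
      then show "\<exists>D. (En has_real_derivative D) (at t within {0..T}) \<and> D \<le> A * En t + \<epsilon> * S"
        using E'(1) by blast
    qed
    then show "energy (\<lambda>t x. \<phi>1 t x - \<phi>2 t x) (\<lambda>t x. a1 t x - a2 t x) t
        \<le> exp (A * T) * (energy (\<lambda>t x. \<phi>1 t x - \<phi>2 t x) (\<lambda>t x. a1 t x - a2 t x) 0 + \<epsilon> * S * T)"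
      unfolding En_def .
  qed
qed

end

section \<open>Convergence of the observables\<close>

text \<open>A supremum over countably many points is measurable in a parameter. This is needed
  because the norm in time is again an \<open>esssup\<close>.\<close>

lemma esssup_continuous:
  fixes g :: "real \<Rightarrow> real"
  assumes g: "continuous_on UNIV g"
  shows "esssup lborel (\<lambda>x. ennreal \<bar>g x\<bar>) = (SUP r\<in>\<rat>. ennreal \<bar>g r\<bar>)"
proof (rule antisym)
  have c: "continuous_on UNIV (\<lambda>x. ennreal \<bar>g x\<bar>)"
    by (intro continuous_on_ennreal continuous_intros g)
  have m: "(\<lambda>x. ennreal \<bar>g x\<bar>) \<in> borel_measurable lborel"
    using borel_measurable_continuous_onI[OF c] by simp
  define s where "s = (SUP r\<in>\<rat>. ennreal \<bar>g r\<bar>)"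
  have "closed {x. ennreal \<bar>g x\<bar> \<le> s}" by (intro closed_Collect_le c continuous_on_const)
  moreover have "\<rat> \<subseteq> {x. ennreal \<bar>g x\<bar> \<le> s}" unfolding s_def by (auto intro: SUP_upper)
  ultimately have "closure \<rat> \<subseteq> {x. ennreal \<bar>g x\<bar> \<le> s}" by (intro closure_minimal)
  then show "esssup lborel (\<lambda>x. ennreal \<bar>g x\<bar>) \<le> (SUP r\<in>\<rat>. ennreal \<bar>g r\<bar>)"
    unfolding Rats_closure_real s_def[symmetric] by (intro esssup_I m AE_I2) auto
  define e where "e = esssup lborel (\<lambda>x. ennreal \<bar>g x\<bar>)"
  \<comment> \<open>Capping at the essential supremum changes nothing almost everywhere, hence
    nothing at all by continuity.\<close>
  have "AE x in lborel. min (ennreal \<bar>g x\<bar>) e = ennreal \<bar>g x\<bar>"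
    using esssup_AE[of "\<lambda>x. ennreal \<bar>g x\<bar>" lborel] by eventually_elim (simp add: e_def min_absorb1)
  then have "(\<lambda>x. min (ennreal \<bar>g x\<bar>) e) = (\<lambda>x. ennreal \<bar>g x\<bar>)"
    by (intro continuous_AE_eq continuous_on_min c continuous_on_const)
  then have "ennreal \<bar>g x\<bar> \<le> e" for x by (metis min.cobounded2)
  then show "(SUP r\<in>\<rat>. ennreal \<bar>g r\<bar>) \<le> esssup lborel (\<lambda>x. ennreal \<bar>g x\<bar>)"
    unfolding e_def by (intro SUP_least)
qed

text \<open>One constant for the L^1 norm and for the supremum, since every product of two functions
  of order 1 admits both bounds.\<close>

definition dominated :: "(real \<Rightarrow> complex) \<Rightarrow> real \<Rightarrow> bool" where
  "dominated q B \<longleftrightarrow> q \<in> borel_measurable borel \<and> 0 \<le> B \<and>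
     (\<integral>\<^sup>+x. ennreal (cmod (q x)) \<partial>lborel) \<le> ennreal B \<and> (\<forall>x. cmod (q x) \<le> B)"

lemma dominated_add:
  assumes "dominated p A" "dominated q B"
  shows "dominated (\<lambda>x. p x + q x) (A + B)"
proof -
  have [measurable]: "p \<in> borel_measurable borel" "q \<in> borel_measurable borel" using assms by (auto simp: dominated_def)
  have "(\<integral>\<^sup>+x. ennreal (cmod (p x + q x)) \<partial>lborel) \<le> (\<integral>\<^sup>+x. ennreal (cmod (p x)) + ennreal (cmod (q x)) \<partial>lborel)"
    by (intro nn_integral_mono) (auto simp: ennreal_plus[symmetric] simp del: ennreal_plus intro!: ennreal_leI norm_triangle_ineq)
  also have "\<dots> = (\<integral>\<^sup>+x. ennreal (cmod (p x)) \<partial>lborel) + (\<integral>\<^sup>+x. ennreal (cmod (q x)) \<partial>lborel)"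
    by (rule nn_integral_add) auto
  also have "\<dots> \<le> ennreal (A + B)" using assms by (auto simp: dominated_def ennreal_plus intro: add_mono)
  finally show ?thesis
    using assms by (auto simp: dominated_def intro: norm_triangle_le add_mono)
qed

lemma dominated_scale:
  assumes "dominated q B"
  shows "dominated (\<lambda>x. c * q x) (cmod c * B)"
proof -
  have [measurable]: "q \<in> borel_measurable borel" using assms by (auto simp: dominated_def)
  have "(\<integral>\<^sup>+x. ennreal (cmod (c * q x)) \<partial>lborel) = ennreal (cmod c) * (\<integral>\<^sup>+x. ennreal (cmod (q x)) \<partial>lborel)"
    by (simp add: norm_mult ennreal_mult nn_integral_cmult)
  also have "\<dots> \<le> ennreal (cmod c * B)" using assms by (auto simp: dominated_def ennreal_mult intro: mult_left_mono)
  finally show ?thesis using assms by (auto simp: dominated_def norm_mult intro: mult_left_mono)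
qed

text \<open>The L^1 bound is Cauchy-Schwarz, the supremum bound is \<open>hc_sup\<close> for each
  factor; \<open>(1 + Cb)^2\<close> exceeds both 1 and \<open>Cb * Cb\<close>.\<close>

lemma dominated_mult:
  assumes f: "f \<in> hc w 1" and g: "g \<in> hc w 1" and w: "0 \<le> w" and fg: "hnorm w 1 f \<le> A" "hnorm w 1 g \<le> B"
  shows "dominated (\<lambda>x. f x * g x) ((1 + Cb)\<^sup>2 * (A * B))"
proof -
  have fs: "square_integrable f" and gs: "square_integrable g" using f g by (auto simp: hc_def hspace_def)
  note F = hc_rep(5)[OF f order_refl w] and G = hc_rep(5)[OF g order_refl w]
  have AB: "0 \<le> A" "0 \<le> B" using fg hnorm_nonneg order_trans by blast+
  have one: "1 \<le> (1 + Cb)\<^sup>2" "Cb * Cb \<le> (1 + Cb)\<^sup>2" using Cb_nonneg by (auto simp: power2_eq_square algebra_simps)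
  have hh: "hnorm w 1 f * hnorm w 1 g \<le> A * B" using fg AB by (intro mult_mono) auto
  have "(\<integral>\<^sup>+x. ennreal (cmod (f x * g x)) \<partial>lborel) = ennreal (LINT x|lborel. cmod (f x * g x))"
    by (intro nn_integral_eq_integral integrable_norm sqint_prod_integrable fs gs) auto
  also have "\<dots> \<le> ennreal (l2 f * l2 g)"
    using l2_cauchy_schwarz_abs[OF fs gs] by (simp add: norm_mult ennreal_leI)
  also have "\<dots> \<le> ennreal ((1 + Cb)\<^sup>2 * (A * B))"
  proof (rule ennreal_leI)
    have "l2 f * l2 g \<le> hnorm w 1 f * hnorm w 1 g" using F G by (intro mult_mono) auto
    also have "\<dots> \<le> 1 * (A * B)" using hh by simp
    also have "\<dots> \<le> (1 + Cb)\<^sup>2 * (A * B)" using AB by (intro mult_right_mono one) simp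
    finally show "l2 f * l2 g \<le> (1 + Cb)\<^sup>2 * (A * B)" .
  qed
  finally have 1: "(\<integral>\<^sup>+x. ennreal (cmod (f x * g x)) \<partial>lborel) \<le> ennreal ((1 + Cb)\<^sup>2 * (A * B))" .
  have 2: "cmod (f x * g x) \<le> (1 + Cb)\<^sup>2 * (A * B)" for x
  proof -
    have "cmod (f x * g x) \<le> (Cb * hnorm w 1 f) * (Cb * hnorm w 1 g)"
      unfolding norm_mult by (intro mult_mono hc_sup[OF f order_refl w] hc_sup[OF g order_refl w]) (auto simp: Cb_nonneg)
    also have "\<dots> = (Cb * Cb) * (hnorm w 1 f * hnorm w 1 g)" by (simp only: mult_ac)
    also have "\<dots> \<le> (1 + Cb)\<^sup>2 * (A * B)" by (intro mult_mono one hh) auto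
    finally show ?thesis .
  qed
  show ?thesis unfolding dominated_def using 1 2 AB fs gs by auto
qed

lemma L1_Linf_dom:
  assumes q: "continuous_on UNIV q" and d: "dominated q B"
  shows "L1_Linf_norm (\<lambda>x. Re (q x)) \<le> ennreal (2 * B)"
proof -
  have [measurable]: "q \<in> borel_measurable borel" and B: "0 \<le> B" using d by (auto simp: dominated_def)
  have "(\<integral>\<^sup>+x. ennreal \<bar>Re (q x)\<bar> \<partial>lborel) \<le> (\<integral>\<^sup>+x. ennreal (cmod (q x)) \<partial>lborel)"
    by (intro nn_integral_mono ennreal_leI abs_Re_le_cmod)
  also have "\<dots> \<le> ennreal B" using d by (simp add: dominated_def)
  finally have 1: "(\<integral>\<^sup>+x. ennreal \<bar>Re (q x)\<bar> \<partial>lborel) \<le> ennreal B" .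
  have "\<bar>Re (q x)\<bar> \<le> B" for x
    using order_trans[OF abs_Re_le_cmod] d by (auto simp: dominated_def)
  then have 2: "esssup lborel (\<lambda>x. ennreal \<bar>Re (q x)\<bar>) \<le> ennreal B"
    by (intro esssup_I AE_I2 ennreal_leI) auto
  have "L1_Linf_norm (\<lambda>x. Re (q x)) \<le> ennreal B + ennreal B"
    unfolding L1_Linf_norm_def by (rule add_mono[OF 1 2])
  then show ?thesis using B by (simp add: ennreal_plus[symmetric] del: ennreal_plus)
qed

text \<open>Besides the pointwise bound, measurability of the norm in time has to be shown, because
  \<open>esssup\<close> of a non-measurable function is top. On \<open>{0..T}\<close> the norm
  equals \<open>G\<close>, which is built from a jointly measurable function and suprema over the
  rationals.\<close>

lemma Linf_L1_Linf_dom: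
  assumes q: "qpath T q" and d: "\<And>t. t \<in> {0..T} \<Longrightarrow> dominated (q t) B"
    and F: "\<And>t x. t \<in> {0..T} \<Longrightarrow> F t x = Re (q t x)"
  shows "Linf_L1_Linf_norm T F \<le> ennreal (2 * B)"
  unfolding Linf_L1_Linf_norm_def
proof (rule esssup_I)
  let ?M = "restrict_space lborel {0..T} :: real measure"
  have sp: "space ?M = {0..T}" by (simp add: space_restrict_space)
  have eq: "F t = (\<lambda>x. Re (q t x))" if "t \<in> {0..T}" for t using F[OF that] by auto
  show "AE t in ?M. L1_Linf_norm (F t) \<le> ennreal (2 * B)"
    using eq by (intro AE_I2) (auto simp: sp intro!: L1_Linf_dom qpathD(1)[OF q] d)
  define Q where "Q t x = \<bar>Re (indicator {0..T} t *\<^sub>R q t x)\<bar>" for t x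
  have QM: "(\<lambda>p. Q (fst p) (snd p)) \<in> borel_measurable (borel \<Otimes>\<^sub>M borel)"
    unfolding Q_def using qpath_measurable[OF q] by measurable
  have [measurable]: "(\<lambda>p. Q (fst p) (snd p)) \<in> borel_measurable (borel \<Otimes>\<^sub>M lborel)"
    using QM by simp
  have [measurable]: "(\<lambda>t. Q t x) \<in> borel_measurable borel" for x
    using measurable_compose_rev[OF QM, of "\<lambda>t. (t, x)" borel] by simp
  define G where "G t = (\<integral>\<^sup>+x. ennreal (Q t x) \<partial>lborel) + (SUP r\<in>\<rat>. ennreal (Q t r))" for t
  have "(\<lambda>t. \<integral>\<^sup>+x. ennreal (Q t x) \<partial>lborel) \<in> borel_measurable borel"
    by measurable
  moreover have "(\<lambda>t. SUP r\<in>\<rat>. ennreal (Q t r)) \<in> borel_measurable borel"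
    by (rule borel_measurable_SUP) (auto simp: countable_rat)
  ultimately have "G \<in> borel_measurable borel" unfolding G_def by measurable
  then have "G \<in> borel_measurable ?M" by (intro measurable_restrict_space1) simp
  moreover have "L1_Linf_norm (F t) = G t" if "t \<in> space ?M" for t
  proof -
    have t: "t \<in> {0..T}" using that sp by simp
    have "continuous_on UNIV (\<lambda>x. Re (q t x))" by (intro continuous_intros qpathD(1)[OF q t])
    from esssup_continuous[OF this] show ?thesis
      unfolding eq[OF t] L1_Linf_norm_def G_def Q_def using t by simp
  qed
  ultimately show "(\<lambda>t. L1_Linf_norm (F t)) \<in> borel_measurable ?M"
    using measurable_cong[of ?M "\<lambda>t. L1_Linf_norm (F t)" G borel] by simp
qed

section \<open>The complexified system and the observables in WKB form\<close>

lemma dx_of_real: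
  assumes "((\<lambda>y. complex_of_real (f y)) has_vector_derivative D) (at x)"
  shows "(f has_vector_derivative Re D) (at x)" "complex_of_real (dx f x) = D"
proof -
  show 1: "(f has_vector_derivative Re D) (at x)"
    using bounded_linear.has_vector_derivative[OF bounded_linear_Re assms] by simp
  have "((\<lambda>y. complex_of_real (f y)) has_vector_derivative complex_of_real (Re D)) (at x)"
    by (rule bounded_linear.has_vector_derivative[OF bounded_linear_of_real 1])
  then have "complex_of_real (Re D) = D" using assms by (rule vector_derivative_unique_at)
  then show "complex_of_real (dx f x) = D" by (simp add: vector_derivative_at[OF 1])
qed

lemma dx_complexify:
  assumes w: "0 \<le> w" and f: "(\<lambda>x. complex_of_real (f x)) \<in> hinf w"
  shows "dx (\<lambda>x. complex_of_real (f x)) = (\<lambda>x. complex_of_real (dx f x))"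
    "dx (dx (\<lambda>x. complex_of_real (f x))) = (\<lambda>x. complex_of_real (dx (dx f) x))"
proof -
  show 1: "dx (\<lambda>x. complex_of_real (f x)) = (\<lambda>x. complex_of_real (dx f x))"
    using dx_of_real(2)[OF hinf_has_dx[OF w f]] by simp
  have "(\<lambda>x. complex_of_real (dx f x)) \<in> hinf w" using hinf_dx[OF w f] unfolding 1 .
  from dx_of_real(2)[OF hinf_has_dx[OF w this]]
  show "dx (dx (\<lambda>x. complex_of_real (f x))) = (\<lambda>x. complex_of_real (dx (dx f) x))"
    unfolding 1 by simp
qed

context weight_decay
begin

text \<open>\<open>solves_S\<close> only asserts that time derivatives exist; solving the equations
  for them identifies them with \<open>nlphi\<close> and \<open>nla\<close>. Derivatives in space
  commute with the embedding of the reals by \<open>dx_complexify\<close>.\<close>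

lemma csol_of_solves:
  assumes X: "(\<phi>, a) \<in> Xspace W T l" and l: "0 \<le> l" and gs: "0 < \<gamma>" "0 < \<sigma>"
    and S: "solves_S (\<lambda>s. \<alpha> * s ^ \<gamma>) (\<lambda>s. lam * s ^ \<sigma>) \<epsilon> T \<phi>0 a0 \<phi> a"
  shows "csol \<alpha> lam \<gamma> \<sigma> \<epsilon> (\<lambda>t x. complex_of_real (\<phi> t x)) a"
proof -
  have cont: "continuous_on UNIV (\<phi> t)" "continuous_on UNIV (a t)" if "t \<in> {0..T}" for t
    using S that by (auto simp: solves_S_def)
  have ap: "apath (\<lambda>t x. complex_of_real (\<phi> t x))"
  proof (rule apath_C_hspace)
    show "(\<lambda>t x. complex_of_real (\<phi> t x)) \<in> C_hspace W T (l + 1)" using X by (simp add: Xspace_def Yspace_def)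
  qed (use l cont in \<open>auto intro!: continuous_intros\<close>)
  have aa: "apath a"
    by (rule apath_C_hspace[of _ l]) (use X l cont in \<open>auto simp: Xspace_def Yspace_def\<close>)
  show ?thesis
    unfolding csol_def
  proof (intro conjI ballI allI ap aa)
    fix t x assume t: "t \<in> {0..T}"
    note w = ww_nonneg[OF t]
    note h = apath_hinf[OF ap t] and ha = apath_hinf[OF aa t]
    obtain \<phi>' a' where d: "((\<lambda>s. \<phi> s x) has_vector_derivative \<phi>') (at t within {0..T})"
      "((\<lambda>s. a s x) has_vector_derivative a') (at t within {0..T})"
      and e1: "\<phi>' + 1 / 2 * (dx (\<phi> t) x)\<^sup>2 + 1 / 2 * (\<alpha> * ((cmod (a t x))\<^sup>2) ^ \<gamma>) * dx (\<phi> t) x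
          + lam * ((cmod (a t x))\<^sup>2) ^ \<sigma> = 0"
      and e2: "a' + complex_of_real (dx (\<phi> t) x) * dx (a t) x + 1 / 2 * a t x * complex_of_real (dx (dx (\<phi> t)) x)
          + 1 / 2 * dx (\<lambda>y. complex_of_real (\<alpha> * ((cmod (a t y))\<^sup>2) ^ \<gamma>) * a t y) x
          = \<i> * complex_of_real \<epsilon> / 2 * dx (dx (a t)) x"
      using S t unfolding solves_S_def by blast
    have A: "complex_of_real (((cmod (a t y))\<^sup>2) ^ n) = (a t y * cnj (a t y)) ^ n" for y n
      by (simp only: of_real_power[of "(cmod (a t y))\<^sup>2"] complex_norm_square)
    from fun_cong[OF dx_complexify(1)[OF w h], of x, symmetric]
    have u1: "complex_of_real (dx (\<phi> t) x) = dx (\<lambda>x. complex_of_real (\<phi> t x)) x" .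
    from fun_cong[OF dx_complexify(2)[OF w h], of x, symmetric]
    have u2: "complex_of_real (dx (dx (\<phi> t)) x) = dx (dx (\<lambda>x. complex_of_real (\<phi> t x))) x" .
    note u = u1 u2
    have "\<phi>' = - 1 / 2 * (dx (\<phi> t) x * dx (\<phi> t) x) + (- \<alpha> / 2 * (((cmod (a t x))\<^sup>2) ^ \<gamma> * dx (\<phi> t) x) + - lam * ((cmod (a t x))\<^sup>2) ^ \<sigma>)"
      using e1 by (simp add: power2_eq_square algebra_simps)
    then have pe: "complex_of_real \<phi>' = nlphi \<alpha> lam \<gamma> \<sigma> (\<lambda>x. complex_of_real (\<phi> t x)) (a t) x"
      unfolding nlphi_def u[symmetric] A[symmetric] by simp
    have "((\<lambda>s. complex_of_real (\<phi> s x)) has_vector_derivative complex_of_real \<phi>') (at t within {0..T})"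
      by (rule bounded_linear.has_vector_derivative[OF bounded_linear_of_real d(1)])
    then show "((\<lambda>s. complex_of_real (\<phi> s x)) has_vector_derivative nlphi \<alpha> lam \<gamma> \<sigma> (\<lambda>x. complex_of_real (\<phi> t x)) (a t) x) (at t within {0..T})"
      unfolding pe .
    have hp: "(\<lambda>y. (a t y * cnj (a t y)) ^ \<gamma> * a t y) \<in> hinf (ww t)"
      using dpath_mult[OF dpath_power[OF dpath_mult[OF dpath_apath[OF aa] dpath_cnj[OF dpath_apath[OF aa]]] gs(1)] dpath_apath[OF aa]] t
      by (simp add: dpath_def)
    have fe: "(\<lambda>y. complex_of_real (\<alpha> * ((cmod (a t y))\<^sup>2) ^ \<gamma>) * a t y) = (\<lambda>y. complex_of_real \<alpha> * ((a t y * cnj (a t y)) ^ \<gamma> * a t y))"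
      by (simp only: of_real_mult A mult.assoc)
    from fun_cong[OF dx_scale[OF w hp, of "complex_of_real \<alpha>"], of x]
    have g: "dx (\<lambda>y. complex_of_real (\<alpha> * ((cmod (a t y))\<^sup>2) ^ \<gamma>) * a t y) x = complex_of_real \<alpha> * dx (\<lambda>y. (a t y * cnj (a t y)) ^ \<gamma> * a t y) x"
      unfolding fe .
    have "a' = nla \<alpha> \<gamma> (\<lambda>x. complex_of_real (\<phi> t x)) (a t) x + (\<i> * complex_of_real (\<epsilon> / 2)) * dx (dx (a t)) x"
      using e2 unfolding g nla_def u by (simp add: algebra_simps)
    then show "((\<lambda>s. a s x) has_vector_derivative nla \<alpha> \<gamma> (\<lambda>x. complex_of_real (\<phi> t x)) (a t) x
        + (\<i> * complex_of_real (\<epsilon> / 2)) * dx (dx (a t)) x) (at t within {0..T})"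
      using d(2) by simp
  qed
qed

end

text \<open>The oscillating factor has modulus 1 and cancels against its conjugate, and the factor
  \<open>\<epsilon>\<close> cancels the 1/\<epsilon> in the phase. What remains is free of
  oscillation and is written as a real part, since the imaginary part of z is the real part of
  -iz.\<close>

lemma wkb_current:
  assumes \<epsilon>: "\<epsilon> \<noteq> 0" and a: "(a t has_vector_derivative a') (at x)" and \<phi>: "(\<phi> t has_vector_derivative \<phi>') (at x)"
  shows "Im (complex_of_real \<epsilon> * cnj (wkb \<epsilon> \<phi> a t x) * dx (wkb \<epsilon> \<phi> a t) x)
    = Re ((- \<i> * complex_of_real \<epsilon>) * (cnj (a t x) * a') + (a t x * cnj (a t x)) * complex_of_real \<phi>')"
proof -
  define E where "E y = exp (\<i> * complex_of_real (\<phi> t y / \<epsilon>))" for y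
  have "((\<lambda>y. \<i> * complex_of_real (\<phi> t y / \<epsilon>)) has_vector_derivative \<i> * complex_of_real (\<phi>' / \<epsilon>)) (at x)"
    by (intro has_vector_derivative_mult_right bounded_linear.has_vector_derivative[OF bounded_linear_of_real]
        has_vector_derivative_divide \<phi>)
  from field_vector_diff_chain_at[OF this DERIV_exp]
  have "(E has_vector_derivative \<i> * complex_of_real (\<phi>' / \<epsilon>) * E x) (at x)"
    by (simp add: E_def[abs_def] o_def)
  from has_vector_derivative_mult[OF a this]
  have "(wkb \<epsilon> \<phi> a t has_vector_derivative a t x * (\<i> * complex_of_real (\<phi>' / \<epsilon>) * E x) + a' * E x) (at x)"
    by (simp add: wkb_def[abs_def] E_def[abs_def])
  then have d: "dx (wkb \<epsilon> \<phi> a t) x = a t x * (\<i> * complex_of_real (\<phi>' / \<epsilon>) * E x) + a' * E x"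
    by (rule vector_derivative_at)
  have "cmod (E x) = 1" by (simp add: E_def)
  then have EE: "E x * cnj (E x) = 1" using complex_norm_square[of "E x"] by simp
  have e: "complex_of_real \<epsilon> * complex_of_real (\<phi>' / \<epsilon>) = complex_of_real \<phi>'"
    using \<epsilon> unfolding of_real_mult[symmetric] by simp
  have "complex_of_real \<epsilon> * cnj (wkb \<epsilon> \<phi> a t x) * dx (wkb \<epsilon> \<phi> a t) x
      = (E x * cnj (E x)) * (complex_of_real \<epsilon> * (cnj (a t x) * a') + \<i> * ((a t x * cnj (a t x)) * (complex_of_real \<epsilon> * complex_of_real (\<phi>' / \<epsilon>))))"
    unfolding d by (simp add: wkb_def E_def algebra_simps)
  also have "\<dots> = complex_of_real \<epsilon> * (cnj (a t x) * a') + \<i> * ((a t x * cnj (a t x)) * complex_of_real \<phi>')"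
    unfolding EE e by simp
  finally show ?thesis by simp
qed

lemma wkb_density: "(cmod (wkb \<epsilon> \<phi> a t x))\<^sup>2 = Re (a t x * cnj (a t x))"
  by (simp add: wkb_def norm_mult complex_norm_square[symmetric] del: of_real_power)

section \<open>Estimates for density and current\<close>

context weight_decay
begin

text \<open>Stated for arbitrary paths, so that the zero path in second place yields finiteness and
  the limit solution yields convergence. Products are telescoped until every term without
  \<open>\<epsilon>\<close> has one factor bounded by \<open>\<eta>\<close> and the others by
  \<open>\<rho>\<close>.\<close>

lemma observables:
  obtains B where "0 \<le> B"
    "\<And>\<phi>1 a1 \<phi>2 a2 \<rho> \<eta> F. apath \<phi>1 \<Longrightarrow> apath a1 \<Longrightarrow> apath \<phi>2 \<Longrightarrow> apath a2 \<Longrightarrow> 0 \<le> \<rho> \<Longrightarrow> 0 \<le> \<eta> \<Longrightarrow>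
      (\<And>t. t \<in> {0..T} \<Longrightarrow> energy \<phi>1 a1 t \<le> \<rho>\<^sup>2) \<Longrightarrow> (\<And>t. t \<in> {0..T} \<Longrightarrow> energy \<phi>2 a2 t \<le> \<rho>\<^sup>2) \<Longrightarrow>
      (\<And>t. t \<in> {0..T} \<Longrightarrow> energy (\<lambda>t x. \<phi>1 t x - \<phi>2 t x) (\<lambda>t x. a1 t x - a2 t x) t \<le> \<eta>\<^sup>2) \<Longrightarrow>
      (\<And>t x. t \<in> {0..T} \<Longrightarrow> F t x = Re (a1 t x * cnj (a1 t x)) - Re (a2 t x * cnj (a2 t x))) \<Longrightarrow>
      Linf_L1_Linf_norm T F \<le> ennreal (B * (\<rho> * \<eta>))"
    "\<And>\<phi>1 a1 \<phi>2 a2 \<rho> \<eta> \<epsilon> F. apath \<phi>1 \<Longrightarrow> apath a1 \<Longrightarrow> apath \<phi>2 \<Longrightarrow> apath a2 \<Longrightarrow> 0 \<le> \<rho> \<Longrightarrow> 0 \<le> \<eta> \<Longrightarrow> 0 \<le> \<epsilon> \<Longrightarrow>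
      (\<And>t. t \<in> {0..T} \<Longrightarrow> energy \<phi>1 a1 t \<le> \<rho>\<^sup>2) \<Longrightarrow> (\<And>t. t \<in> {0..T} \<Longrightarrow> energy \<phi>2 a2 t \<le> \<rho>\<^sup>2) \<Longrightarrow>
      (\<And>t. t \<in> {0..T} \<Longrightarrow> energy (\<lambda>t x. \<phi>1 t x - \<phi>2 t x) (\<lambda>t x. a1 t x - a2 t x) t \<le> \<eta>\<^sup>2) \<Longrightarrow>
      (\<And>t x. t \<in> {0..T} \<Longrightarrow> F t x = Re ((- \<i> * complex_of_real \<epsilon>) * (cnj (a1 t x) * dx (a1 t) x) + (a1 t x * cnj (a1 t x)) * dx (\<phi>1 t) x)
          - Re ((a2 t x * cnj (a2 t x)) * dx (\<phi>2 t) x)) \<Longrightarrow>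
      Linf_L1_Linf_norm T F \<le> ennreal (B * (\<epsilon> * \<rho>\<^sup>2 + \<rho>\<^sup>2 * \<eta>))"
proof -
  define \<kappa> where "\<kappa> = 1 / 4 * (w0 - M * T)"
  have \<kappa>: "0 < \<kappa>" using WT_pos by (simp add: \<kappa>_def)
  \<comment> \<open>The energy controls the amplitude only up to order 3/2, but the
    \<open>\<epsilon>\<close> term contains its derivative in order 1. Giving up the exponential
    weight pays for the missing half order; \<open>\<kappa>\<close> bounds \<open>ww t\<close> from
    below, so that \<open>B0\<close> does not depend on time.\<close>
  obtain B0 where B0: "0 \<le> B0" "\<And>f. f \<in> hspace \<kappa> (3 / 2) \<Longrightarrow> hnorm 0 2 f \<le> B0 * hnorm \<kappa> (3 / 2) f"
    using hnorm_embedding[OF \<kappa>] by blast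
  define c where "c = (1 + Cb)\<^sup>2"
  have c: "1 \<le> c" unfolding c_def using Cb_nonneg by (simp add: power2_eq_square algebra_simps)
  define C where "C = Calg 1"
  have C: "1 \<le> C" unfolding C_def by (rule Calg_ge_1)
  \<comment> \<open>The outer 2 stands for the two parts of the norm, \<open>2 * c\<close> for the
    two terms of the density, \<open>c * B0\<close> for the \<open>\<epsilon>\<close> term and
    \<open>3 * (c * C)\<close> for the three terms of the telescoped current.\<close>
  define B where "B = 2 * (2 * c + c * B0 + 3 * (c * C))"
  have B: "0 \<le> B" unfolding B_def using B0 c C by (auto intro!: add_nonneg_nonneg mult_nonneg_nonneg)
  have single: "hnorm (ww t) 1 (a t) \<le> r \<and> hnorm (ww t) 1 (dx (\<phi> t)) \<le> r"
    if "apath \<phi>" "apath a" "t \<in> {0..T}" "energy \<phi> a t \<le> r\<^sup>2" "0 \<le> r" for \<phi> a t r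
  proof -
    have "sqrt (energy \<phi> a t) \<le> r" using that(4,5) by (auto intro: real_le_lsqrt)
    then show ?thesis using energy_bounds[OF that(1,2,3)] by linarith
  qed
  have prod: "f \<in> hinf w \<Longrightarrow> g \<in> hinf w \<Longrightarrow> 0 \<le> w \<Longrightarrow> hnorm w 1 f \<le> X \<Longrightarrow> hnorm w 1 g \<le> Y \<Longrightarrow>
      hnorm w 1 (\<lambda>x. f x * g x) \<le> C * (X * Y)" for f g w X Y
    using hc_product(2)[OF hinfD[of f w 1] hinfD[of g w 1] order_refl] C
      mult_left_mono[OF mult_mono[of "hnorm w 1 f" X "hnorm w 1 g" Y], of C] order_trans[OF hnorm_nonneg, of w 1 f X]
    unfolding C_def by (meson dual_order.trans hnorm_nonneg order.trans zero_le_one)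
  show ?thesis
  proof (rule that[OF B])
    fix \<phi>1 a1 \<phi>2 a2 and \<rho> \<eta> :: real and F
    assume ap: "apath \<phi>1" "apath a1" "apath \<phi>2" "apath a2" and pos: "0 \<le> \<rho>" "0 \<le> \<eta>"
      and e1: "\<And>t. t \<in> {0..T} \<Longrightarrow> energy \<phi>1 a1 t \<le> \<rho>\<^sup>2" and e2: "\<And>t. t \<in> {0..T} \<Longrightarrow> energy \<phi>2 a2 t \<le> \<rho>\<^sup>2"
      and ed: "\<And>t. t \<in> {0..T} \<Longrightarrow> energy (\<lambda>t x. \<phi>1 t x - \<phi>2 t x) (\<lambda>t x. a1 t x - a2 t x) t \<le> \<eta>\<^sup>2"
    note apd = apath_diff[OF ap(1,3)] apath_diff[OF ap(2,4)]
    have h: "a1 t \<in> hinf (ww t)" "a2 t \<in> hinf (ww t)" "(\<lambda>x. a1 t x - a2 t x) \<in> hinf (ww t)"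
      "(\<lambda>x. cnj (a1 t x)) \<in> hinf (ww t)" "(\<lambda>x. cnj (a2 t x)) \<in> hinf (ww t)" "(\<lambda>x. cnj (a1 t x - a2 t x)) \<in> hinf (ww t)"
      "dx (\<phi>1 t) \<in> hinf (ww t)" "(\<lambda>x. dx (\<phi>1 t) x - dx (\<phi>2 t) x) \<in> hinf (ww t)"
      "dx (\<lambda>x. \<phi>1 t x - \<phi>2 t x) = (\<lambda>x. dx (\<phi>1 t) x - dx (\<phi>2 t) x)" if t: "t \<in> {0..T}" for t
      using ap[THEN apath_hinf, OF t] apd[THEN apath_hinf, OF t] ww_nonneg[OF t]
      by (simp_all add: hinf_cnj hinf_dx hinf_diff dx_diff del: complex_cnj_diff)
    have n: "hnorm (ww t) 1 (a1 t) \<le> \<rho>" "hnorm (ww t) 1 (a2 t) \<le> \<rho>" "hnorm (ww t) 1 (\<lambda>x. a1 t x - a2 t x) \<le> \<eta>"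
      "hnorm (ww t) 1 (\<lambda>x. cnj (a1 t x)) \<le> \<rho>" "hnorm (ww t) 1 (\<lambda>x. cnj (a2 t x)) \<le> \<rho>" "hnorm (ww t) 1 (\<lambda>x. cnj (a1 t x - a2 t x)) \<le> \<eta>"
      "hnorm (ww t) 1 (dx (\<phi>1 t)) \<le> \<rho>" "hnorm (ww t) 1 (\<lambda>x. dx (\<phi>1 t) x - dx (\<phi>2 t) x) \<le> \<eta>" if t: "t \<in> {0..T}" for t
      using single[OF ap(1,2) t e1[OF t] pos(1)] single[OF ap(3,4) t e2[OF t] pos(1)] single[OF apd t ed[OF t] pos(2)]
        hc_cnj(2)[OF hinfD[OF h(1)[OF t]] order_refl ww_nonneg[OF t]] hc_cnj(2)[OF hinfD[OF h(2)[OF t]] order_refl ww_nonneg[OF t]]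
        hc_cnj(2)[OF hinfD[OF h(3)[OF t]] order_refl ww_nonneg[OF t]] h(9)[OF t]
      by (simp_all del: complex_cnj_diff)
    have dm: "dominated (\<lambda>x. f x * g x) (c * (X * Y))" if "f \<in> hinf (ww t)" "g \<in> hinf (ww t)" "t \<in> {0..T}"
      "hnorm (ww t) 1 f \<le> X" "hnorm (ww t) 1 g \<le> Y" for f g t X Y
      unfolding c_def using that by (intro dominated_mult[of _ "ww t"] hinfD ww_nonneg)
    have qa: "qpath T a1" "qpath T a2" "qpath T (\<lambda>t. dx (a1 t))" "qpath T (\<lambda>t. dx (\<phi>1 t))" "qpath T (\<lambda>t. dx (\<phi>2 t))"
      using ap by (auto intro: apath_qpath apath_dx)
    {
      assume F: "\<And>t x. t \<in> {0..T} \<Longrightarrow> F t x = Re (a1 t x * cnj (a1 t x)) - Re (a2 t x * cnj (a2 t x))"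
      have "Linf_L1_Linf_norm T F \<le> ennreal (2 * (c * (\<eta> * \<rho>) + c * (\<rho> * \<eta>)))"
      proof (rule Linf_L1_Linf_dom)
        show "qpath T (\<lambda>t x. a1 t x * cnj (a1 t x) - a2 t x * cnj (a2 t x))"
          by (intro qpath_diff qpath_mult qpath_cnj qa)
        show "dominated (\<lambda>x. a1 t x * cnj (a1 t x) - a2 t x * cnj (a2 t x)) (c * (\<eta> * \<rho>) + c * (\<rho> * \<eta>))" if t: "t \<in> {0..T}" for t
        proof -
          have "(\<lambda>x. a1 t x * cnj (a1 t x) - a2 t x * cnj (a2 t x))
              = (\<lambda>x. (a1 t x - a2 t x) * cnj (a1 t x) + a2 t x * cnj (a1 t x - a2 t x))"
            by (simp add: algebra_simps)
          moreover have "dominated (\<lambda>x. (a1 t x - a2 t x) * cnj (a1 t x) + a2 t x * cnj (a1 t x - a2 t x)) (c * (\<eta> * \<rho>) + c * (\<rho> * \<eta>))"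
            by (rule dominated_add[OF dm[OF h(3) h(4) _ n(3) n(4)] dm[OF h(2) h(6) _ n(2) n(6)]]) (rule t)+
          ultimately show ?thesis by simp
        qed
      qed (use F in simp)
      also have "\<dots> \<le> ennreal (B * (\<rho> * \<eta>))"
      proof (rule ennreal_leI)
        have "2 * (c * (\<eta> * \<rho>) + c * (\<rho> * \<eta>)) = (2 * (2 * c)) * (\<rho> * \<eta>)" by (simp add: algebra_simps)
        also have "\<dots> \<le> B * (\<rho> * \<eta>)"
          unfolding B_def using B0 c C pos by (intro mult_right_mono mult_left_mono) (auto intro!: add_nonneg_nonneg)
        finally show "2 * (c * (\<eta> * \<rho>) + c * (\<rho> * \<eta>)) \<le> B * (\<rho> * \<eta>)" .
      qed
      finally show "Linf_L1_Linf_norm T F \<le> ennreal (B * (\<rho> * \<eta>))" .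
    }
    {
      fix \<epsilon> :: real
      assume \<epsilon>: "0 \<le> \<epsilon>"
        and F: "\<And>t x. t \<in> {0..T} \<Longrightarrow> F t x = Re ((- \<i> * complex_of_real \<epsilon>) * (cnj (a1 t x) * dx (a1 t) x) + (a1 t x * cnj (a1 t x)) * dx (\<phi>1 t) x)
          - Re ((a2 t x * cnj (a2 t x)) * dx (\<phi>2 t) x)"
      define b where "b = \<epsilon> * (c * (\<rho> * (B0 * \<rho>))) + (c * (\<eta> * (C * (\<rho> * \<rho>))) + (c * (\<eta> * (C * (\<rho> * \<rho>))) + c * (\<eta> * (C * (\<rho> * \<rho>)))))"
      have "Linf_L1_Linf_norm T F \<le> ennreal (2 * b)"
      proof (rule Linf_L1_Linf_dom)
        show "qpath T (\<lambda>t x. (- \<i> * complex_of_real \<epsilon>) * (cnj (a1 t x) * dx (a1 t) x) + (a1 t x * cnj (a1 t x)) * dx (\<phi>1 t) x - (a2 t x * cnj (a2 t x)) * dx (\<phi>2 t) x)"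
          by (intro qpath_diff qpath_add qpath_scale qpath_mult qpath_cnj qa)
        show "dominated (\<lambda>x. (- \<i> * complex_of_real \<epsilon>) * (cnj (a1 t x) * dx (a1 t) x) + (a1 t x * cnj (a1 t x)) * dx (\<phi>1 t) x - (a2 t x * cnj (a2 t x)) * dx (\<phi>2 t) x) b" if t: "t \<in> {0..T}" for t
        proof -
          note w = ww_nonneg[OF t]
          have k: "\<kappa> \<le> ww t" using W_ge[OF t] by (simp add: \<kappa>_def ww_def)
          \<comment> \<open>The derivative bound is available only at weight 0, so both factors of
            the \<open>\<epsilon>\<close> term are taken there.\<close>
          have z: "a1 t \<in> hc 0 j" for j by (rule hc_mono[OF hinfD[OF h(1)[OF t]] w order_refl])
          have "hnorm 0 1 (dx (a1 t)) \<le> hnorm 0 2 (a1 t)"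
            using hc_deriv(3)[of "a1 t" 0 1] z[of 2] by simp
          also have "\<dots> \<le> B0 * hnorm \<kappa> (3 / 2) (a1 t)"
            by (rule B0(2)[OF hspace_mono(1)[OF hinf_hspace[OF h(1)[OF t]] k order_refl]])
          also have "\<dots> \<le> B0 * hnorm (ww t) (3 / 2) (a1 t)"
            by (rule mult_left_mono[OF hspace_mono(2)[OF hinf_hspace[OF h(1)[OF t]] k order_refl] B0(1)])
          also have "\<dots> \<le> B0 * \<rho>"
          proof (rule mult_left_mono[OF _ B0(1)])
            have "(hnorm (ww t) (3 / 2) (a1 t))\<^sup>2 \<le> energy \<phi>1 a1 t" by (simp add: energy_def)
            also have "\<dots> \<le> \<rho>\<^sup>2" by (rule e1[OF t])
            finally show "hnorm (ww t) (3 / 2) (a1 t) \<le> \<rho>" by (rule power2_le_imp_le[OF _ pos(1)])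
          qed
          finally have a1x: "hnorm 0 1 (dx (a1 t)) \<le> B0 * \<rho>" .
          have a1c: "(\<lambda>x. cnj (a1 t x)) \<in> hc 0 1" "hnorm 0 1 (\<lambda>x. cnj (a1 t x)) \<le> \<rho>"
            using hspace_mono(2)[OF hinf_hspace[OF h(4)[OF t]] w order_refl, of 1] n(4)[OF t]
            by (auto intro: hc_mono[OF hinfD[OF h(4)[OF t]] w order_refl])
          have "dominated (\<lambda>x. cnj (a1 t x) * dx (a1 t) x) (c * (\<rho> * (B0 * \<rho>)))"
            unfolding c_def using z[of "1 + 1"] by (intro dominated_mult[OF a1c(1) _ order_refl a1c(2) a1x] hc_deriv(2)) auto
          from dominated_scale[OF this, of "- \<i> * complex_of_real \<epsilon>"]
          have d1: "dominated (\<lambda>x. (- \<i> * complex_of_real \<epsilon>) * (cnj (a1 t x) * dx (a1 t) x)) (\<epsilon> * (c * (\<rho> * (B0 * \<rho>))))"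
            using \<epsilon> by (simp add: norm_mult)
          have d2: "dominated (\<lambda>x. (a1 t x - a2 t x) * (cnj (a1 t x) * dx (\<phi>1 t) x)) (c * (\<eta> * (C * (\<rho> * \<rho>))))"
            by (intro dm[OF h(3) _ t n(3)] hinf_mult w h t prod n)
          have d3: "dominated (\<lambda>x. cnj (a1 t x - a2 t x) * (a2 t x * dx (\<phi>1 t) x)) (c * (\<eta> * (C * (\<rho> * \<rho>))))"
            by (intro dm[OF h(6) _ t n(6)] hinf_mult w h t prod n)
          have d4: "dominated (\<lambda>x. (dx (\<phi>1 t) x - dx (\<phi>2 t) x) * (a2 t x * cnj (a2 t x))) (c * (\<eta> * (C * (\<rho> * \<rho>))))"
            by (intro dm[OF h(8) _ t n(8)] hinf_mult w h t prod n)
          \<comment> \<open>Telescoping: each of the last three terms contains exactly one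
            difference of the two solutions.\<close>
          have "(\<lambda>x. (- \<i> * complex_of_real \<epsilon>) * (cnj (a1 t x) * dx (a1 t) x) + (a1 t x * cnj (a1 t x)) * dx (\<phi>1 t) x - (a2 t x * cnj (a2 t x)) * dx (\<phi>2 t) x)
              = (\<lambda>x. (- \<i> * complex_of_real \<epsilon>) * (cnj (a1 t x) * dx (a1 t) x) + ((a1 t x - a2 t x) * (cnj (a1 t x) * dx (\<phi>1 t) x)
                + (cnj (a1 t x - a2 t x) * (a2 t x * dx (\<phi>1 t) x) + (dx (\<phi>1 t) x - dx (\<phi>2 t) x) * (a2 t x * cnj (a2 t x)))))"
            by (simp add: algebra_simps)
          with dominated_add[OF d1 dominated_add[OF d2 dominated_add[OF d3 d4]]] show ?thesis unfolding b_def by simp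
        qed
      qed (use F in simp)
      also have "\<dots> \<le> ennreal (B * (\<epsilon> * \<rho>\<^sup>2 + \<rho>\<^sup>2 * \<eta>))"
      proof (rule ennreal_leI)
        have "2 * b = (2 * (c * B0)) * (\<epsilon> * \<rho>\<^sup>2) + (2 * (3 * (c * C))) * (\<rho>\<^sup>2 * \<eta>)"
          by (simp add: b_def power2_eq_square algebra_simps)
        also have "\<dots> \<le> B * (\<epsilon> * \<rho>\<^sup>2) + B * (\<rho>\<^sup>2 * \<eta>)"
          unfolding B_def using B0 c C pos \<epsilon> by (intro add_mono mult_right_mono mult_left_mono) (auto intro!: add_nonneg_nonneg)
        finally show "2 * b \<le> B * (\<epsilon> * \<rho>\<^sup>2 + \<rho>\<^sup>2 * \<eta>)" by (simp add: distrib_left)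
      qed
      finally show "Linf_L1_Linf_norm T F \<le> ennreal (B * (\<epsilon> * \<rho>\<^sup>2 + \<rho>\<^sup>2 * \<eta>))" .
    }
  qed
qed

text \<open>Both parts combine the uniform bound for every solution with the difference estimate;
  the convergence of the data enters only through the initial energy of the difference.\<close>

lemma observables_converge:
  assumes gs: "0 < \<gamma>" "0 < \<sigma>" and K: "nlbound \<alpha> lam \<gamma> \<sigma> (1 + Calg 1 * \<rho>) K"
    and \<rho>: "0 \<le> \<rho>" and M: "32 * (K * Calg 1) \<le> M"
    and se: "\<And>\<epsilon>. \<epsilon> \<in> {0<..1} \<Longrightarrow> csol \<alpha> lam \<gamma> \<sigma> \<epsilon> (\<phi>e \<epsilon>) (ae \<epsilon>)" and s: "csol \<alpha> lam \<gamma> \<sigma> 0 \<phi> a"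
    and ee: "\<And>\<epsilon>. \<epsilon> \<in> {0<..1} \<Longrightarrow> energy (\<phi>e \<epsilon>) (ae \<epsilon>) 0 < \<rho>\<^sup>2" and e: "energy \<phi> a 0 < \<rho>\<^sup>2"
    and lim: "((\<lambda>\<epsilon>. energy (\<lambda>t x. \<phi>e \<epsilon> t x - \<phi> t x) (\<lambda>t x. ae \<epsilon> t x - a t x) 0) \<longlongrightarrow> 0) (at_right 0)"
  shows "(\<And>\<epsilon> t x. \<epsilon> \<in> {0<..1} \<Longrightarrow> t \<in> {0..T} \<Longrightarrow> F \<epsilon> t x = Re (ae \<epsilon> t x * cnj (ae \<epsilon> t x))) \<Longrightarrow>
      (\<And>t x. t \<in> {0..T} \<Longrightarrow> G t x = Re (a t x * cnj (a t x))) \<Longrightarrow> converges_Linf_L1_Linf T F G"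
    and "(\<And>\<epsilon> t x. \<epsilon> \<in> {0<..1} \<Longrightarrow> t \<in> {0..T} \<Longrightarrow> F \<epsilon> t x =
        Re ((- \<i> * complex_of_real \<epsilon>) * (cnj (ae \<epsilon> t x) * dx (ae \<epsilon> t) x) + (ae \<epsilon> t x * cnj (ae \<epsilon> t x)) * dx (\<phi>e \<epsilon> t) x)) \<Longrightarrow>
      (\<And>t x. t \<in> {0..T} \<Longrightarrow> G t x = Re ((a t x * cnj (a t x)) * dx (\<phi> t) x)) \<Longrightarrow> converges_Linf_L1_Linf T F G"
proof -
  have apr: "energy \<phi> a t \<le> \<rho>\<^sup>2" if "t \<in> {0..T}" for t by (rule a_priori[OF s that gs K e \<rho> M])
  have apre: "energy (\<phi>e \<epsilon>) (ae \<epsilon>) t \<le> \<rho>\<^sup>2" if "\<epsilon> \<in> {0<..1}" "t \<in> {0..T}" for \<epsilon> t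
    by (rule a_priori[OF se[OF that(1)] that(2) gs K ee[OF that(1)] \<rho> M])
  have z: "energy (\<lambda>t x. 0) (\<lambda>t x. 0) t \<le> \<rho>\<^sup>2" for t by (simp add: energy_def hspace_zero)
  have ap: "apath \<phi>" "apath a" using s by (auto simp: csol_def)
  have ape: "apath (\<phi>e \<epsilon>)" "apath (ae \<epsilon>)" if "\<epsilon> \<in> {0<..1}" for \<epsilon> using se[OF that] by (auto simp: csol_def)
  define En where "En \<epsilon> = energy (\<lambda>t x. \<phi>e \<epsilon> t x - \<phi> t x) (\<lambda>t x. ae \<epsilon> t x - a t x)" for \<epsilon>
  obtain A S where "0 \<le> S" and AS: "\<And>\<epsilon> t. \<epsilon> \<in> {0<..1} \<Longrightarrow> t \<in> {0..T} \<Longrightarrow> En \<epsilon> t \<le> exp (A * T) * (En \<epsilon> 0 + \<epsilon> * S * T)"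
  proof (rule difference_estimate[OF s gs K apr \<rho> M])
    fix A S
    assume "0 \<le> S" and *: "\<And>\<epsilon> \<phi>1 a1 t. \<epsilon> \<in> {0<..1} \<Longrightarrow> csol \<alpha> lam \<gamma> \<sigma> \<epsilon> \<phi>1 a1 \<Longrightarrow>
      (\<And>t. t \<in> {0..T} \<Longrightarrow> energy \<phi>1 a1 t \<le> \<rho>\<^sup>2) \<Longrightarrow> t \<in> {0..T} \<Longrightarrow>
      energy (\<lambda>t x. \<phi>1 t x - \<phi> t x) (\<lambda>t x. a1 t x - a t x) t
        \<le> exp (A * T) * (energy (\<lambda>t x. \<phi>1 t x - \<phi> t x) (\<lambda>t x. a1 t x - a t x) 0 + \<epsilon> * S * T)"
    show thesis
      by (rule that[OF \<open>0 \<le> S\<close>], unfold En_def) (rule *[OF _ se apre])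
  qed
  \<comment> \<open>The root of the Gronwall bound: independent of \<open>t\<close>, and tending to
    0 with \<open>\<epsilon>\<close>.\<close>
  define \<eta> where "\<eta> \<epsilon> = sqrt (exp (A * T) * (En \<epsilon> 0 + \<epsilon> * S * T))" for \<epsilon>
  have \<eta>0: "0 \<le> \<eta> \<epsilon>" and \<eta>: "t \<in> {0..T} \<Longrightarrow> En \<epsilon> t \<le> (\<eta> \<epsilon>)\<^sup>2" if "\<epsilon> \<in> {0<..1}" for \<epsilon> t
  proof -
    have "0 \<le> exp (A * T) * (En \<epsilon> 0 + \<epsilon> * S * T)"
      using that \<open>0 \<le> S\<close> T_pos energy_nonneg by (simp add: En_def)
    then show "0 \<le> \<eta> \<epsilon>" "t \<in> {0..T} \<Longrightarrow> En \<epsilon> t \<le> (\<eta> \<epsilon>)\<^sup>2" using AS[OF that] by (simp_all add: \<eta>_def)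
  qed
  have "(\<eta> \<longlongrightarrow> sqrt (exp (A * T) * (0 + 0 * S * T))) (at_right 0)"
    unfolding \<eta>_def[abs_def] using lim[folded En_def] by (intro tendsto_intros)
  then have \<eta>lim: "(\<eta> \<longlongrightarrow> 0) (at_right 0)" by simp
  have ev: "eventually (\<lambda>\<epsilon>. \<epsilon> \<in> {0<..1::real}) (at_right 0)"
    unfolding eventually_at_right_field by (intro exI[of _ 1]) auto
  have squeeze: "(N \<longlongrightarrow> 0) (at_right 0)"
    if N: "\<And>\<epsilon>. \<epsilon> \<in> {0<..1} \<Longrightarrow> N \<epsilon> \<le> ennreal (u \<epsilon>)" and u: "(u \<longlongrightarrow> 0) (at_right 0)" for N :: "real \<Rightarrow> ennreal" and u
  proof (rule tendsto_sandwich[OF _ _ tendsto_const])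
    show "((\<lambda>\<epsilon>. ennreal (u \<epsilon>)) \<longlongrightarrow> 0) (at_right 0)" using tendsto_ennrealI[OF u] by simp
  qed (use ev N in \<open>auto elim!: eventually_mono\<close>)
  obtain B where "0 \<le> B" and
    B1: "\<And>\<phi>1 a1 \<phi>2 a2 \<rho> \<eta> F. apath \<phi>1 \<Longrightarrow> apath a1 \<Longrightarrow> apath \<phi>2 \<Longrightarrow> apath a2 \<Longrightarrow> 0 \<le> \<rho> \<Longrightarrow> 0 \<le> \<eta> \<Longrightarrow>
      (\<And>t. t \<in> {0..T} \<Longrightarrow> energy \<phi>1 a1 t \<le> \<rho>\<^sup>2) \<Longrightarrow> (\<And>t. t \<in> {0..T} \<Longrightarrow> energy \<phi>2 a2 t \<le> \<rho>\<^sup>2) \<Longrightarrow>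
      (\<And>t. t \<in> {0..T} \<Longrightarrow> energy (\<lambda>t x. \<phi>1 t x - \<phi>2 t x) (\<lambda>t x. a1 t x - a2 t x) t \<le> \<eta>\<^sup>2) \<Longrightarrow>
      (\<And>t x. t \<in> {0..T} \<Longrightarrow> F t x = Re (a1 t x * cnj (a1 t x)) - Re (a2 t x * cnj (a2 t x))) \<Longrightarrow>
      Linf_L1_Linf_norm T F \<le> ennreal (B * (\<rho> * \<eta>))" and
    B2: "\<And>\<phi>1 a1 \<phi>2 a2 \<rho> \<eta> \<epsilon> F. apath \<phi>1 \<Longrightarrow> apath a1 \<Longrightarrow> apath \<phi>2 \<Longrightarrow> apath a2 \<Longrightarrow> 0 \<le> \<rho> \<Longrightarrow> 0 \<le> \<eta> \<Longrightarrow> 0 \<le> \<epsilon> \<Longrightarrow>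
      (\<And>t. t \<in> {0..T} \<Longrightarrow> energy \<phi>1 a1 t \<le> \<rho>\<^sup>2) \<Longrightarrow> (\<And>t. t \<in> {0..T} \<Longrightarrow> energy \<phi>2 a2 t \<le> \<rho>\<^sup>2) \<Longrightarrow>
      (\<And>t. t \<in> {0..T} \<Longrightarrow> energy (\<lambda>t x. \<phi>1 t x - \<phi>2 t x) (\<lambda>t x. a1 t x - a2 t x) t \<le> \<eta>\<^sup>2) \<Longrightarrow>
      (\<And>t x. t \<in> {0..T} \<Longrightarrow> F t x = Re ((- \<i> * complex_of_real \<epsilon>) * (cnj (a1 t x) * dx (a1 t) x) + (a1 t x * cnj (a1 t x)) * dx (\<phi>1 t) x)
          - Re ((a2 t x * cnj (a2 t x)) * dx (\<phi>2 t) x)) \<Longrightarrow>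
      Linf_L1_Linf_norm T F \<le> ennreal (B * (\<epsilon> * \<rho>\<^sup>2 + \<rho>\<^sup>2 * \<eta>))"
    by (rule observables) blast
  {
    assume F: "\<And>\<epsilon> t x. \<epsilon> \<in> {0<..1} \<Longrightarrow> t \<in> {0..T} \<Longrightarrow> F \<epsilon> t x = Re (ae \<epsilon> t x * cnj (ae \<epsilon> t x))"
      and G: "\<And>t x. t \<in> {0..T} \<Longrightarrow> G t x = Re (a t x * cnj (a t x))"
    \<comment> \<open>Finiteness is the same estimate with zero as the second pair: the difference
      is then the solution itself, and \<open>\<rho>\<close> takes the place of
      \<open>\<eta>\<close>.\<close>
    have "Linf_L1_Linf_norm T (F \<epsilon>) < \<infinity>" if \<epsilon>: "\<epsilon> \<in> {0<..1}" for \<epsilon>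
      by (rule le_less_trans[OF B1[OF ape[OF \<epsilon>] apath_zero apath_zero \<rho> \<rho> apre[OF \<epsilon>] z]]) (use apre[OF \<epsilon>] F[OF \<epsilon>] in auto)
    moreover have "Linf_L1_Linf_norm T G < \<infinity>"
      by (rule le_less_trans[OF B1[OF ap apath_zero apath_zero \<rho> \<rho> apr z]]) (use apr G in auto)
    moreover have "((\<lambda>\<epsilon>. Linf_L1_Linf_norm T (\<lambda>t x. F \<epsilon> t x - G t x)) \<longlongrightarrow> 0) (at_right 0)"
    proof (rule squeeze)
      show "Linf_L1_Linf_norm T (\<lambda>t x. F \<epsilon> t x - G t x) \<le> ennreal (B * (\<rho> * \<eta> \<epsilon>))" if \<epsilon>: "\<epsilon> \<in> {0<..1}" for \<epsilon>
        by (rule B1[OF ape[OF \<epsilon>] ap \<rho> \<eta>0[OF \<epsilon>] apre[OF \<epsilon>] apr \<eta>[OF \<epsilon>, unfolded En_def]]) (use F[OF \<epsilon>] G in auto)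
      show "((\<lambda>\<epsilon>. B * (\<rho> * \<eta> \<epsilon>)) \<longlongrightarrow> 0) (at_right 0)" by (intro tendsto_mult_right_zero \<eta>lim)
    qed
    ultimately show "converges_Linf_L1_Linf T F G"
      unfolding converges_Linf_L1_Linf_def by auto
  }
  {
    assume F: "\<And>\<epsilon> t x. \<epsilon> \<in> {0<..1} \<Longrightarrow> t \<in> {0..T} \<Longrightarrow> F \<epsilon> t x =
        Re ((- \<i> * complex_of_real \<epsilon>) * (cnj (ae \<epsilon> t x) * dx (ae \<epsilon> t) x) + (ae \<epsilon> t x * cnj (ae \<epsilon> t x)) * dx (\<phi>e \<epsilon> t) x)"
      and G: "\<And>t x. t \<in> {0..T} \<Longrightarrow> G t x = Re ((a t x * cnj (a t x)) * dx (\<phi> t) x)"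
    have "Linf_L1_Linf_norm T (F \<epsilon>) < \<infinity>" if \<epsilon>: "\<epsilon> \<in> {0<..1}" for \<epsilon>
      by (rule le_less_trans[OF B2[where \<epsilon> = \<epsilon>, OF ape[OF \<epsilon>] apath_zero apath_zero \<rho> \<rho> _ apre[OF \<epsilon>] z]]) (use apre[OF \<epsilon>] F[OF \<epsilon>] \<epsilon> in auto)
    moreover have "Linf_L1_Linf_norm T G < \<infinity>"
      by (rule le_less_trans[OF B2[where \<epsilon> = 0, OF ap apath_zero apath_zero \<rho> \<rho> order_refl apr z]]) (use apr G in auto)
    moreover have "((\<lambda>\<epsilon>. Linf_L1_Linf_norm T (\<lambda>t x. F \<epsilon> t x - G t x)) \<longlongrightarrow> 0) (at_right 0)"
    proof (rule squeeze)
      show "Linf_L1_Linf_norm T (\<lambda>t x. F \<epsilon> t x - G t x) \<le> ennreal (B * (\<epsilon> * \<rho>\<^sup>2 + \<rho>\<^sup>2 * \<eta> \<epsilon>))" if \<epsilon>: "\<epsilon> \<in> {0<..1}" for \<epsilon>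
        by (rule B2[where \<epsilon> = \<epsilon>, OF ape[OF \<epsilon>] ap \<rho> \<eta>0[OF \<epsilon>] _ apre[OF \<epsilon>] apr \<eta>[OF \<epsilon>, unfolded En_def]]) (use F[OF \<epsilon>] G \<epsilon> in auto)
      have "((\<lambda>\<epsilon>. B * (\<epsilon> * \<rho>\<^sup>2 + \<rho>\<^sup>2 * \<eta> \<epsilon>)) \<longlongrightarrow> B * (0 * \<rho>\<^sup>2 + \<rho>\<^sup>2 * 0)) (at_right 0)"
        by (intro tendsto_intros \<eta>lim)
      then show "((\<lambda>\<epsilon>. B * (\<epsilon> * \<rho>\<^sup>2 + \<rho>\<^sup>2 * \<eta> \<epsilon>)) \<longlongrightarrow> 0) (at_right 0)" by simp
    qed
    ultimately show "converges_Linf_L1_Linf T F G"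
      unfolding converges_Linf_L1_Linf_def by auto
  }
qed

text \<open>The solution matches its data only almost everywhere, which the norms do not see; the
  two embeddings then lead from the data to the orders of the energy.\<close>

lemma energy_0_le:
  assumes "\<forall>f\<in>hspace w0 k. hnorm (w0 / 4) (5 / 2) f \<le> B1 * hnorm w0 k f"
    and "\<forall>f\<in>hspace w0 j. hnorm (w0 / 4) (3 / 2) f \<le> B2 * hnorm w0 j f"
    and "continuous_on UNIV (\<phi> 0)" "continuous_on UNIV (a 0)"
    and "AE x in lborel. \<phi> 0 x = \<phi>0 x" "AE x in lborel. a 0 x = a0 x"
    and \<phi>0: "\<phi>0 \<in> hspace w0 k" and a0: "a0 \<in> hspace w0 j"
  shows "energy \<phi> a 0 \<le> (B1 * hnorm w0 k \<phi>0)\<^sup>2 + (B2 * hnorm w0 j a0)\<^sup>2"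
proof -
  have m: "\<phi> 0 \<in> borel_measurable borel" "a 0 \<in> borel_measurable borel" "\<phi>0 \<in> borel_measurable borel" "a0 \<in> borel_measurable borel"
    using assms(3,4) sqint_measurable[OF hspaceD(1)[OF \<phi>0]] sqint_measurable[OF hspaceD(1)[OF a0]]
    by (auto intro: borel_measurable_continuous_onI)
  have "ww 0 = w0 / 4" by (simp add: ww_def W_def)
  then have "energy \<phi> a 0 = (hnorm (w0 / 4) (5 / 2) \<phi>0)\<^sup>2 + (hnorm (w0 / 4) (3 / 2) a0)\<^sup>2"
    by (simp only: energy_def hspace_cong_AE(2)[OF assms(5) m(1,3)] hspace_cong_AE(2)[OF assms(6) m(2,4)])
  also have "\<dots> \<le> (B1 * hnorm w0 k \<phi>0)\<^sup>2 + (B2 * hnorm w0 j a0)\<^sup>2"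
    using assms(1,2) \<phi>0 a0 by (intro add_mono power_mono) auto
  finally show ?thesis .
qed

end

section \<open>Choice of the constants and conclusion\<close>

theorem corollary1p3:
  fixes \<alpha> lam w0 l :: real and \<gamma> \<sigma> :: nat
    and g f :: "real \<Rightarrow> real"
    and \<phi>0 :: "real \<Rightarrow> real" and a0 :: "real \<Rightarrow> complex"
    and \<phi>0e :: "real \<Rightarrow> real \<Rightarrow> real" and a0e :: "real \<Rightarrow> real \<Rightarrow> complex"
  assumes "\<gamma> > 0" and "\<sigma> > 0"
    and g: "g = (\<lambda>s. \<alpha> * s ^ \<gamma>)" and f: "f = (\<lambda>s. lam * s ^ \<sigma>)"
    and "w0 > 0" and "l > 1"
    and "(\<lambda>x. complex_of_real (\<phi>0 x)) \<in> hspace w0 (l + 2)"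
    and "a0 \<in> hspace w0 (l + 1)"
    and "\<forall>\<epsilon>\<in>{0<..1}. (\<lambda>x. complex_of_real (\<phi>0e \<epsilon> x)) \<in> hspace w0 (l + 1) \<and> a0e \<epsilon> \<in> hspace w0 l"
    and "\<exists>C. \<forall>\<epsilon>\<in>{0<..1}. hnorm w0 (l + 1) (\<lambda>x. complex_of_real (\<phi>0e \<epsilon> x)) \<le> C
                      \<and> hnorm w0 l (a0e \<epsilon>) \<le> C"
    and "((\<lambda>\<epsilon>. hnorm w0 (l + 1) (\<lambda>x. complex_of_real (\<phi>0e \<epsilon> x - \<phi>0 x))
             + hnorm w0 l (\<lambda>x. a0e \<epsilon> x - a0 x)) \<longlongrightarrow> 0) (at_right 0)"
  shows "\<exists>M0>0. \<forall>M\<ge>M0. \<forall>T. 0 < T \<and> T < w0 / M \<longrightarrow>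
    (\<forall>\<phi>e ae \<phi> a.
       (\<forall>\<epsilon>\<in>{0<..1}. (\<phi>e \<epsilon>, ae \<epsilon>) \<in> Xspace (\<lambda>t. w0 - M * t) T l \<and>
            solves_S g f \<epsilon> T (\<phi>0e \<epsilon>) (a0e \<epsilon>) (\<phi>e \<epsilon>) (ae \<epsilon>)) \<and>
       (\<phi>, a) \<in> Xspace (\<lambda>t. w0 - M * t) T (l + 1) \<and>
       solves_S g f 0 T \<phi>0 a0 \<phi> a \<longrightarrow>
       converges_Linf_L1_Linf T
         (\<lambda>\<epsilon> t x. (cmod (wkb \<epsilon> (\<phi>e \<epsilon>) (ae \<epsilon>) t x))\<^sup>2)
         (\<lambda>t x. (cmod (a t x))\<^sup>2) \<and>
       converges_Linf_L1_Linf T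
         (\<lambda>\<epsilon> t x. Im (complex_of_real \<epsilon> * cnj (wkb \<epsilon> (\<phi>e \<epsilon>) (ae \<epsilon>) t x)
                        * dx (wkb \<epsilon> (\<phi>e \<epsilon>) (ae \<epsilon>) t) x))
         (\<lambda>t x. (cmod (a t x))\<^sup>2 * dx (\<phi> t) x))"
proof -
  have "w0 / 4 < w0" using \<open>w0 > 0\<close> by simp
  then obtain B1 where B1: "0 \<le> B1" "\<forall>f\<in>hspace w0 (l + 1). hnorm (w0 / 4) (5 / 2) f \<le> B1 * hnorm w0 (l + 1) f"
    using hnorm_embedding[of "w0 / 4" w0] by metis
  from \<open>w0 / 4 < w0\<close> obtain B2 where B2: "0 \<le> B2" "\<forall>f\<in>hspace w0 l. hnorm (w0 / 4) (3 / 2) f \<le> B2 * hnorm w0 l f"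
    using hnorm_embedding[of "w0 / 4" w0] by metis
  have d0: "(\<lambda>x. complex_of_real (\<phi>0 x)) \<in> hspace w0 (l + 1)" "a0 \<in> hspace w0 l"
    using assms(7,8) by (auto intro: hspace_mono(1))
  have de: "(\<lambda>x. complex_of_real (\<phi>0e \<epsilon> x)) \<in> hspace w0 (l + 1)" "a0e \<epsilon> \<in> hspace w0 l" if "\<epsilon> \<in> {0<..1}" for \<epsilon>
    using assms(9) that by auto
  define \<delta> where "\<delta> \<epsilon> = hnorm w0 (l + 1) (\<lambda>x. complex_of_real (\<phi>0e \<epsilon> x - \<phi>0 x)) + hnorm w0 l (\<lambda>x. a0e \<epsilon> x - a0 x)" for \<epsilon>
  have \<delta>: "(\<delta> \<longlongrightarrow> 0) (at_right 0)" using assms(11) by (simp add: \<delta>_def[abs_def])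
  from assms(10) obtain C where C: "\<And>\<epsilon>. \<epsilon> \<in> {0<..1} \<Longrightarrow> hnorm w0 (l + 1) (\<lambda>x. complex_of_real (\<phi>0e \<epsilon> x)) \<le> C"
    "\<And>\<epsilon>. \<epsilon> \<in> {0<..1} \<Longrightarrow> hnorm w0 l (a0e \<epsilon>) \<le> C" by blast
  \<comment> \<open>Covers the limit data together with the family, so that one
    \<open>\<rho>\<close> serves all solutions.\<close>
  define C' where "C' = \<bar>C\<bar> + hnorm w0 (l + 1) (\<lambda>x. complex_of_real (\<phi>0 x)) + hnorm w0 l a0"
  \<comment> \<open>The summand 1 makes all initial energies strictly smaller than
    \<open>\<rho>^2\<close>, as the continuity argument requires.\<close>
  define \<rho> where "\<rho> = sqrt ((B1 * C')\<^sup>2 + (B2 * C')\<^sup>2 + 1)"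
  have \<rho>: "0 \<le> \<rho>" "\<rho>\<^sup>2 = (B1 * C')\<^sup>2 + (B2 * C')\<^sup>2 + 1" by (simp_all add: \<rho>_def)
  have less: "(B1 * X)\<^sup>2 + (B2 * Y)\<^sup>2 < \<rho>\<^sup>2" if "0 \<le> X" "0 \<le> Y" "X \<le> C'" "Y \<le> C'" for X Y
  proof -
    have "(B1 * X)\<^sup>2 + (B2 * Y)\<^sup>2 \<le> (B1 * C')\<^sup>2 + (B2 * C')\<^sup>2"
      using that B1(1) B2(1) by (intro add_mono power_mono mult_left_mono) auto
    then show ?thesis unfolding \<rho>(2) by simp
  qed
  have "1 \<le> 1 + Calg 1 * \<rho>" using Calg_ge_1[of 1] \<rho>(1) by simp
  from nlbound_exists[OF \<open>\<gamma> > 0\<close> \<open>\<sigma> > 0\<close> this] obtain K where K: "nlbound \<alpha> lam \<gamma> \<sigma> (1 + Calg 1 * \<rho>) K" by blast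
  \<comment> \<open>The threshold of the energy inequality, plus 1 for positivity. Only the data and
    the nonlinearities enter, neither \<open>M\<close> nor \<open>T\<close>.\<close>
  define M0 where "M0 = 32 * (K * Calg 1) + 1"
  have "0 < M0" unfolding M0_def using K Calg_ge_1[of 1] by (auto simp: nlbound_def intro!: add_nonneg_pos)
  show ?thesis
  proof (intro exI[of _ M0] conjI[OF \<open>0 < M0\<close>] allI impI, elim conjE)
    fix M T \<phi>e ae \<phi> a
    assume M: "M0 \<le> M" and T: "0 < T" "T < w0 / M"
      and sole: "\<forall>\<epsilon>\<in>{0<..1}. (\<phi>e \<epsilon>, ae \<epsilon>) \<in> Xspace (\<lambda>t. w0 - M * t) T l \<and>
            solves_S g f \<epsilon> T (\<phi>0e \<epsilon>) (a0e \<epsilon>) (\<phi>e \<epsilon>) (ae \<epsilon>)"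
      and sol: "(\<phi>, a) \<in> Xspace (\<lambda>t. w0 - M * t) T (l + 1)" "solves_S g f 0 T \<phi>0 a0 \<phi> a"
    have Mp: "0 < M" and MK: "32 * (K * Calg 1) \<le> M" using M \<open>0 < M0\<close> by (auto simp: M0_def)
    interpret weight_decay w0 M T
      using T Mp by unfold_locales (auto simp: pos_less_divide_eq mult.commute)
    have W: "(\<lambda>t. w0 - M * t) = W" by (simp add: W_def[abs_def])
    define \<Phi> where "\<Phi> = (\<lambda>t x. complex_of_real (\<phi> t x))"
    define \<Phi>e where "\<Phi>e = (\<lambda>\<epsilon> t x. complex_of_real (\<phi>e \<epsilon> t x))"
    have cs: "csol \<alpha> lam \<gamma> \<sigma> 0 \<Phi> a"
      unfolding \<Phi>_def using assms(6) by (intro csol_of_solves[OF sol(1)[unfolded W] _ assms(1,2) sol(2)[unfolded g f]]) simp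
    have cse: "csol \<alpha> lam \<gamma> \<sigma> \<epsilon> (\<Phi>e \<epsilon>) (ae \<epsilon>)" if "\<epsilon> \<in> {0<..1}" for \<epsilon>
      unfolding \<Phi>e_def using sole[rule_format, OF that, unfolded W g f] assms(6)
      by (intro csol_of_solves[OF conjunct1 _ assms(1,2) conjunct2]) auto
    have z: "0 \<in> {0..T}" using T by simp
    have c: "continuous_on UNIV (\<Phi> 0)" "continuous_on UNIV (a 0)"
      "AE x in lborel. \<Phi> 0 x = complex_of_real (\<phi>0 x)" "AE x in lborel. a 0 x = a0 x"
      using sol(2) z by (auto simp: solves_S_def \<Phi>_def intro: continuous_intros)
    have ce: "continuous_on UNIV (\<Phi>e \<epsilon> 0)" "continuous_on UNIV (ae \<epsilon> 0)"
      "AE x in lborel. \<Phi>e \<epsilon> 0 x = complex_of_real (\<phi>0e \<epsilon> x)" "AE x in lborel. ae \<epsilon> 0 x = a0e \<epsilon> x" if "\<epsilon> \<in> {0<..1}" for \<epsilon>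
      using sole[rule_format, OF that] z by (auto simp: solves_S_def \<Phi>e_def intro: continuous_intros)
    note E0 = energy_0_le[OF B1(2) B2(2)]
    have e0: "energy \<Phi> a 0 < \<rho>\<^sup>2"
      by (rule le_less_trans[OF E0[where \<phi> = \<Phi> and a = a, OF c d0] less]) (auto simp: C'_def)
    have ee0: "energy (\<Phi>e \<epsilon>) (ae \<epsilon>) 0 < \<rho>\<^sup>2" if \<epsilon>: "\<epsilon> \<in> {0<..1}" for \<epsilon>
      by (rule le_less_trans[OF E0[where \<phi> = "\<Phi>e \<epsilon>" and a = "ae \<epsilon>", OF ce[OF \<epsilon>] de[OF \<epsilon>]] less])
         (use C[OF \<epsilon>] in \<open>auto simp: C'_def intro!: add_increasing2\<close>)
    have le: "energy (\<lambda>t x. \<Phi>e \<epsilon> t x - \<Phi> t x) (\<lambda>t x. ae \<epsilon> t x - a t x) 0 \<le> (B1 * \<delta> \<epsilon>)\<^sup>2 + (B2 * \<delta> \<epsilon>)\<^sup>2"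
      if \<epsilon>: "\<epsilon> \<in> {0<..1}" for \<epsilon>
    proof -
      have ae: "AE x in lborel. \<Phi>e \<epsilon> 0 x - \<Phi> 0 x = complex_of_real (\<phi>0e \<epsilon> x) - complex_of_real (\<phi>0 x)"
        "AE x in lborel. ae \<epsilon> 0 x - a 0 x = a0e \<epsilon> x - a0 x"
        using c(3,4) ce(3,4)[OF \<epsilon>] by (auto elim: AE_mp)
      have "energy (\<lambda>t x. \<Phi>e \<epsilon> t x - \<Phi> t x) (\<lambda>t x. ae \<epsilon> t x - a t x) 0
          \<le> (B1 * hnorm w0 (l + 1) (\<lambda>x. complex_of_real (\<phi>0e \<epsilon> x) - complex_of_real (\<phi>0 x)))\<^sup>2
            + (B2 * hnorm w0 l (\<lambda>x. a0e \<epsilon> x - a0 x))\<^sup>2"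
        by (rule E0[where \<phi> = "\<lambda>t x. \<Phi>e \<epsilon> t x - \<Phi> t x" and a = "\<lambda>t x. ae \<epsilon> t x - a t x", OF _ _ ae]) (intro continuous_on_diff c ce[OF \<epsilon>] hspace_diff d0 de[OF \<epsilon>])+
      also have "\<dots> \<le> (B1 * \<delta> \<epsilon>)\<^sup>2 + (B2 * \<delta> \<epsilon>)\<^sup>2"
        using B1(1) B2(1) by (intro add_mono power_mono mult_left_mono) (auto simp: \<delta>_def)
      finally show ?thesis .
    qed
    have lim: "((\<lambda>\<epsilon>. energy (\<lambda>t x. \<Phi>e \<epsilon> t x - \<Phi> t x) (\<lambda>t x. ae \<epsilon> t x - a t x) 0) \<longlongrightarrow> 0) (at_right 0)"
    proof (rule tendsto_sandwich[OF _ _ tendsto_const])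
      have "((\<lambda>\<epsilon>. (B1 * \<delta> \<epsilon>)\<^sup>2 + (B2 * \<delta> \<epsilon>)\<^sup>2) \<longlongrightarrow> (B1 * 0)\<^sup>2 + (B2 * 0)\<^sup>2) (at_right 0)"
        by (intro tendsto_intros \<delta>)
      then show "((\<lambda>\<epsilon>. (B1 * \<delta> \<epsilon>)\<^sup>2 + (B2 * \<delta> \<epsilon>)\<^sup>2) \<longlongrightarrow> 0) (at_right 0)" by simp
      show "eventually (\<lambda>\<epsilon>. energy (\<lambda>t x. \<Phi>e \<epsilon> t x - \<Phi> t x) (\<lambda>t x. ae \<epsilon> t x - a t x) 0 \<le> (B1 * \<delta> \<epsilon>)\<^sup>2 + (B2 * \<delta> \<epsilon>)\<^sup>2) (at_right 0)"
        unfolding eventually_at_right_field by (intro exI[of _ 1]) (auto intro: le)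
    qed (simp add: energy_nonneg)
    note conv = observables_converge[OF assms(1,2) K \<rho>(1) MK cse cs ee0 e0 lim]
    have d: "dx (\<Phi> t) x = complex_of_real (dx (\<phi> t) x)" if t: "t \<in> {0..T}" for t x
      unfolding \<Phi>_def
      by (rule fun_cong[OF dx_complexify(1)[OF ww_nonneg[OF t]]])
         (use cs apath_hinf[OF _ t, of \<Phi>] in \<open>simp add: csol_def \<Phi>_def\<close>)
    have "converges_Linf_L1_Linf T (\<lambda>\<epsilon> t x. (cmod (wkb \<epsilon> (\<phi>e \<epsilon>) (ae \<epsilon>) t x))\<^sup>2) (\<lambda>t x. (cmod (a t x))\<^sup>2)"
      by (rule conv(1)) (simp_all add: wkb_density complex_norm_square[symmetric] del: of_real_power)
    moreover have "converges_Linf_L1_Linf T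
         (\<lambda>\<epsilon> t x. Im (complex_of_real \<epsilon> * cnj (wkb \<epsilon> (\<phi>e \<epsilon>) (ae \<epsilon>) t x) * dx (wkb \<epsilon> (\<phi>e \<epsilon>) (ae \<epsilon>) t) x))
         (\<lambda>t x. (cmod (a t x))\<^sup>2 * dx (\<phi> t) x)"
    proof (rule conv(2))
      fix \<epsilon> t x assume \<epsilon>: "\<epsilon> \<in> {0<..1::real}" and t: "t \<in> {0..T}"
      have h: "ae \<epsilon> t \<in> hinf (ww t)" "\<Phi>e \<epsilon> t \<in> hinf (ww t)"
        using cse[OF \<epsilon>] apath_hinf[OF _ t] by (auto simp: csol_def)
      note r = dx_of_real[OF hinf_has_dx[OF ww_nonneg[OF t] h(2), unfolded \<Phi>e_def]]
      have "\<epsilon> \<noteq> 0" using \<epsilon> by simp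
      from wkb_current[where a = "ae \<epsilon>" and \<phi> = "\<phi>e \<epsilon>" and t = t and x = x, OF this hinf_has_dx[OF ww_nonneg[OF t] h(1)] r(1)]
      show "Im (complex_of_real \<epsilon> * cnj (wkb \<epsilon> (\<phi>e \<epsilon>) (ae \<epsilon>) t x) * dx (wkb \<epsilon> (\<phi>e \<epsilon>) (ae \<epsilon>) t) x) =
        Re ((- \<i> * complex_of_real \<epsilon>) * (cnj (ae \<epsilon> t x) * dx (ae \<epsilon> t) x) + (ae \<epsilon> t x * cnj (ae \<epsilon> t x)) * dx (\<Phi>e \<epsilon> t) x)"
        unfolding \<Phi>e_def r(2)[symmetric] by simp
    next
      fix t x assume t: "t \<in> {0..T}"
      show "(cmod (a t x))\<^sup>2 * dx (\<phi> t) x = Re ((a t x * cnj (a t x)) * dx (\<Phi> t) x)"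
        unfolding d[OF t] complex_norm_square[symmetric] of_real_mult[symmetric] by simp
    qed
    ultimately show "converges_Linf_L1_Linf T (\<lambda>\<epsilon> t x. (cmod (wkb \<epsilon> (\<phi>e \<epsilon>) (ae \<epsilon>) t x))\<^sup>2) (\<lambda>t x. (cmod (a t x))\<^sup>2) \<and>
       converges_Linf_L1_Linf T
         (\<lambda>\<epsilon> t x. Im (complex_of_real \<epsilon> * cnj (wkb \<epsilon> (\<phi>e \<epsilon>) (ae \<epsilon>) t x) * dx (wkb \<epsilon> (\<phi>e \<epsilon>) (ae \<epsilon>) t) x))
         (\<lambda>t x. (cmod (a t x))\<^sup>2 * dx (\<phi> t) x)" by blast
  qed
qed

end
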